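(* Let $w\in L^1(\mathbb{R}^d)\cap L^\infty(\mathbb{R}^d)$ with $w\neq 0$ and $w\ge 0$ almost everywhere, and let $k(x,y):=\widehat{w}(x-y)$ for $x,y\in\mathbb{R}^d$. Assume: (A) for any $a>0$ there exists $c_a>0$ such that $w(\xi)\le c_a e^{-a|\xi|}$ for almost all $\xi\in\mathbb{R}^d$; (B) there exists $B>0$ such that for any $y\in\mathbb{R}^d$, $\limsup_{n\to\infty}\mathcal{E}_n^-(y;w)<B$ and $\limsup_{n\to\infty}\mathcal{E}_n^+(y;w)<B$; (C) $\mathcal{G}(w)$ spans ${\rm M}_d(\mathbb{R})$ as a real vector space. Then for any open set $U\subset\mathbb{R}^d$ and any map $f:U\to\mathbb{R}^d$, the following are equivalent: (i) $f$ is the restriction to $U$ of an affine map $x\mapsto Ax+b$ with $A\in\mathcal{G}(w)$ and $b\in\mathbb{R}^d$; (ii) $\mathcal{D}(C_f)=H_k$ (and thus the composition operator $C_f:H_k\to H_{k|_{U^2}}$ is bounded).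
   Context: Fourier transform: $\widehat{h}(\xi)=\int_{\mathbb{R}^d}h(x)e^{-2\pi i x\cdot\xi}\,dx$. For a positive definite kernel $k$ on a set $E$, $H_k\subset\mathbb{C}^E$ is the reproducing kernel Hilbert space (RKHS) of $k$: $k_x:=k(x,\cdot)\in H_k$ and $\langle h,k_x\rangle_{H_k}=h(x)$ for all $x\in E$, $h\in H_k$. Since $w\ge0$, $k(x,y)=\widehat{w}(x-y)$ is a positive definite kernel on $\mathbb{R}^d$. For $U\subset\mathbb{R}^d$, $k|_{U^2}$ is the restriction of $k$ to $U\times U$ and $H_{k|_{U^2}}\subset\mathbb{C}^U$ is its RKHS. For $f:U\to\mathbb{R}^d$, the composition operator $C_f:H_k\to H_{k|_{U^2}}$ is $C_f h=h\circ f$ with domain $\mathcal{D}(C_f)=\{h\in H_k: h\circ f\in H_{k|_{U^2}}\}$. $L^2(w)$ is the $L^2$-space for the measure $w(\xi)\,d\xi$. $P_n\subset\mathbb{C}[\xi_1,\dots,\xi_d]$ is the space of polynomials of total degree at most $n$, regarded as a subspace of $L^2(w)$. For $y\in\mathbb{R}^d$, $m_y$ is the multiplication operator $(m_yh)(\xi)=e^{y^\top\xi}h(\xi)$. Define $$\mathcal{E}_n^+(y;w)=\Big(\sup_{P\in P_n\setminus\{0\}}\frac{\|m_yP\|_{L^2(w)}}{\|P\|_{L^2(w)}}\Big)^{1/n},\qquad \mathcal{E}_n^-(y;w)=\Big(\sup_{P\in P_n\setminus\{0\}}\frac{\|P\|_{L^2(w)}}{\|m_yP\|_{L^2(w)}}\Big)^{1/n}.$$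 $\mathcal{G}(w)$ is the set of $A\in{\rm GL}_d(\mathbb{R})$ such that for some $\lambda>0$, $w(A^\top\xi)\ge\lambda w(\xi)$ for almost every $\xi\in\mathbb{R}^d$. *)

theory Defs
  imports "HOL-Analysis.Analysis"
begin

text \<open>
  A function in \<open>\<complex>\<^sup>E\<close> is represented by its extension by zero to the ambient type, so that the
  pointwise linear structure and equality of functions are those of the function type.
  A Hilbert space of functions is a carrier set together with an inner product,
  linear in the first argument, whose values outside the carrier are irrelevant.
\<close>

definition zero_ext :: "'a set \<Rightarrow> ('a \<Rightarrow> complex) \<Rightarrow> ('a \<Rightarrow> complex)" where
  "zero_ext E h = (\<lambda>x. if x \<in> E then h x else 0)"

definition fun_subspace :: "'a set \<Rightarrow> ('a \<Rightarrow> complex) set \<Rightarrow> bool" where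
  "fun_subspace E H \<longleftrightarrow>
     (\<forall>h\<in>H. zero_ext E h = h) \<and>
     (\<lambda>x. 0) \<in> H \<and>
     (\<forall>g\<in>H. \<forall>h\<in>H. (\<lambda>x. g x + h x) \<in> H) \<and>
     (\<forall>c. \<forall>h\<in>H. (\<lambda>x. c * h x) \<in> H)"

definition inner_product_on ::
    "('a \<Rightarrow> complex) set \<Rightarrow> (('a \<Rightarrow> complex) \<Rightarrow> ('a \<Rightarrow> complex) \<Rightarrow> complex) \<Rightarrow> bool" where
  "inner_product_on H ip \<longleftrightarrow>
     (\<forall>g\<in>H. \<forall>h\<in>H. \<forall>u\<in>H. ip (\<lambda>x. g x + h x) u = ip g u + ip h u) \<and>
     (\<forall>c. \<forall>h\<in>H. \<forall>u\<in>H. ip (\<lambda>x. c * h x) u = c * ip h u) \<and>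
     (\<forall>h\<in>H. \<forall>u\<in>H. ip u h = cnj (ip h u)) \<and>
     (\<forall>h\<in>H. 0 \<le> Re (ip h h)) \<and>
     (\<forall>h\<in>H. ip h h = 0 \<longrightarrow> h = (\<lambda>x. 0))"

definition ip_norm ::
    "(('a \<Rightarrow> complex) \<Rightarrow> ('a \<Rightarrow> complex) \<Rightarrow> complex) \<Rightarrow> ('a \<Rightarrow> complex) \<Rightarrow> real" where
  "ip_norm ip h = sqrt (Re (ip h h))"

text \<open>
  The locale \<open>Metric_space\<close> is not used for completeness because its axioms \<open>nonneg\<close> and
  \<open>commute\<close> also constrain the distance outside the carrier.
\<close>

definition ip_complete ::
    "('a \<Rightarrow> complex) set \<Rightarrow> (('a \<Rightarrow> complex) \<Rightarrow> ('a \<Rightarrow> complex) \<Rightarrow> complex) \<Rightarrow> bool" where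
  "ip_complete H ip \<longleftrightarrow>
     (\<forall>s :: nat \<Rightarrow> 'a \<Rightarrow> complex.
        range s \<subseteq> H \<longrightarrow>
        (\<forall>e>0. \<exists>N. \<forall>m\<ge>N. \<forall>n\<ge>N. ip_norm ip (\<lambda>x. s m x - s n x) < e) \<longrightarrow>
        (\<exists>h\<in>H. (\<lambda>n. ip_norm ip (\<lambda>x. s n x - h x)) \<longlonglongrightarrow> 0))"

text \<open>
  \<open>is_rkhs E k H ip\<close>: the space \<open>H\<close> with inner product \<open>ip\<close> is the reproducing kernel Hilbert
  space of the kernel \<open>k\<close> on \<open>E\<close>. Only the values of \<open>k\<close> on \<open>E \<times> E\<close> matter, so for \<open>U \<subseteq> E\<close>
  \<open>is_rkhs U k\<close> refers to the restricted kernel.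
\<close>

definition is_rkhs ::
    "'a set \<Rightarrow> ('a \<Rightarrow> 'a \<Rightarrow> complex) \<Rightarrow> ('a \<Rightarrow> complex) set \<Rightarrow>
     (('a \<Rightarrow> complex) \<Rightarrow> ('a \<Rightarrow> complex) \<Rightarrow> complex) \<Rightarrow> bool" where
  "is_rkhs E k H ip \<longleftrightarrow>
     fun_subspace E H \<and> inner_product_on H ip \<and> ip_complete H ip \<and>
     (\<forall>x\<in>E. zero_ext E (k x) \<in> H \<and> (\<forall>h\<in>H. ip h (zero_ext E (k x)) = h x))"

definition comp_op :: "'a set \<Rightarrow> ('a \<Rightarrow> 'b) \<Rightarrow> ('b \<Rightarrow> complex) \<Rightarrow> ('a \<Rightarrow> complex)" where
  "comp_op U f h = zero_ext U (h \<circ> f)"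

definition comp_op_domain ::
    "('b \<Rightarrow> complex) set \<Rightarrow> 'a set \<Rightarrow> ('a \<Rightarrow> complex) set \<Rightarrow> ('a \<Rightarrow> 'b) \<Rightarrow> ('b \<Rightarrow> complex) set" where
  "comp_op_domain H U HU f = {h \<in> H. comp_op U f h \<in> HU}"


definition fourier :: "(real ^ 'd \<Rightarrow> complex) \<Rightarrow> real ^ 'd \<Rightarrow> complex" where
  "fourier h \<xi> =
     (LINT x|lebesgue. h x * exp (- 2 * complex_of_real pi * \<i> * complex_of_real (x \<bullet> \<xi>)))"

definition weight_kernel :: "(real ^ 'd \<Rightarrow> real) \<Rightarrow> real ^ 'd \<Rightarrow> real ^ 'd \<Rightarrow> complex" where
  "weight_kernel w x y = fourier (\<lambda>\<xi>. complex_of_real (w \<xi>)) (x - y)"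


definition poly_le :: "nat \<Rightarrow> (real ^ 'd \<Rightarrow> complex) set" where
  "poly_le n =
     range (\<lambda>(c :: ('d \<Rightarrow> nat) \<Rightarrow> complex) \<xi>.
       \<Sum>\<alpha> | (\<Sum>i\<in>UNIV. \<alpha> i) \<le> n. c \<alpha> * (\<Prod>i\<in>UNIV. complex_of_real (\<xi> $ i) ^ \<alpha> i))"

definition mult_exp :: "real ^ 'd \<Rightarrow> (real ^ 'd \<Rightarrow> complex) \<Rightarrow> (real ^ 'd \<Rightarrow> complex)" where
  "mult_exp y h = (\<lambda>\<xi>. complex_of_real (exp (y \<bullet> \<xi>)) * h \<xi>)"

definition ennroot :: "nat \<Rightarrow> ennreal \<Rightarrow> ennreal" where
  "ennroot n s = (if s = \<infinity> then \<infinity> else ennreal (root n (enn2real s)))"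

text \<open>
  Norms and suprema are taken in \<open>[0, \<infinity>]\<close>, so a function outside \<open>L\<^sup>2(w)\<close> has norm \<open>\<infinity>\<close>
  and an unbounded family of quotients has supremum \<open>\<infinity>\<close>.
\<close>

definition L2_weight_norm :: "(real ^ 'd \<Rightarrow> real) \<Rightarrow> (real ^ 'd \<Rightarrow> complex) \<Rightarrow> ennreal" where
  "L2_weight_norm w h =
     ennroot 2 (\<integral>\<^sup>+ \<xi>. ennreal ((cmod (h \<xi>))\<^sup>2) \<partial>density lebesgue (\<lambda>\<xi>. ennreal (w \<xi>)))"

definition E_plus :: "nat \<Rightarrow> real ^ 'd \<Rightarrow> (real ^ 'd \<Rightarrow> real) \<Rightarrow> ennreal" where
  "E_plus n y w =
     ennroot n (SUP P \<in> poly_le n - {\<lambda>\<xi>. 0}. L2_weight_norm w (mult_exp y P) / L2_weight_norm w P)"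

definition E_minus :: "nat \<Rightarrow> real ^ 'd \<Rightarrow> (real ^ 'd \<Rightarrow> real) \<Rightarrow> ennreal" where
  "E_minus n y w =
     ennroot n (SUP P \<in> poly_le n - {\<lambda>\<xi>. 0}. L2_weight_norm w P / L2_weight_norm w (mult_exp y P))"


definition G_set :: "(real ^ 'd \<Rightarrow> real) \<Rightarrow> (real ^ 'd ^ 'd) set" where
  "G_set w =
     {A. invertible A \<and> (\<exists>l>0. AE \<xi> in lebesgue. w (transpose A *v \<xi>) \<ge> l * w \<xi>)}"

end

theory Submission
  imports Defs "HOL-Complex_Analysis.Complex_Analysis"
    "HOL-Computational_Algebra.Fundamental_Theorem_Algebra"
begin

text \<open>
  Write \<open>e\<^sub>z(\<xi>) = exp (2 \<pi> \<i> z \<cdot> \<xi>)\<close> for \<open>z \<in> \<complex>\<^sup>d\<close>. The space \<open>H\<^sub>k\<close> is an image of \<open>L\<^sup>2(w)\<close> in which the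
  kernel function at \<open>x\<close> comes from the character \<open>e\<^sub>-\<^sub>x\<close>, so norms of finite combinations of kernel functions are
  norms of trigonometric sums (\<open>kernel_norm\<close>). By uniform boundedness an everywhere defined composition
  operator is bounded, and boundedness is an inequality between such combinations
  (\<open>composition_bounded_on_kernels\<close>, \<open>composition_of_bounded_on_kernels\<close>).

  For an affine map with matrix \<open>A \<in> \<G>(w)\<close> this inequality is a change of variables:
  \<open>\<integral> |T(A\<^sup>T \<xi>)|\<^sup>2 w(\<xi>) d\<xi> \<le> c \<integral> |T|\<^sup>2 w\<close> because \<open>w(\<xi>) \<le> w(A\<^sup>T \<xi>) / \<lambda>\<close>
  (\<open>affine_composition_bounded\<close>).

  For the converse a bounded composition operator is turned into a bounded bilinear form \<open>\<Phi>\<close> with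
  \<open>\<Phi>(e\<^sub>x, \<psi>) = \<integral> e\<^sub>f\<^sub>(\<^sub>x\<^sub>) \<psi> w\<close> for \<open>x \<in> U\<close> (\<open>bounded_form_of_composition\<close>). The decay of \<open>w\<close> makes
  \<open>\<Phi>(e\<^sub>z, \<psi>)\<close> entire in \<open>z\<close>. The partial derivatives of \<open>f\<close> solve a linear system with coefficients of this kind, so
  by Cramer's rule they continue to a meromorphic matrix \<open>jac z\<close> for which
  \<open>\<Phi>(\<langle>g,\<xi>\<rangle> e\<^sub>z, \<psi>) = \<Phi>(e\<^sub>z, \<langle>jac z g,\<xi>\<rangle> \<psi>)\<close> (\<open>global_relation\<close>, \<open>jac_relation\<close>). Differentiating again and again,
  the operator behind \<open>\<Phi>\<close> maps \<open>e\<^sub>z P\<close> to \<open>e\<^sub>\<zeta> Q\<close> with \<open>deg Q \<le> deg P\<close>, and it maps the leading part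
  \<open>\<langle>g,\<xi>\<rangle>\<^sup>n\<close> to \<open>\<langle>jac z g,\<xi>\<rangle>\<^sup>n\<close> (\<open>transport_power\<close>, \<open>exponent_exists\<close>).

  On polynomials of large degree \<open>n\<close>, multiplication by \<open>e\<^sub>z\<close> and its inverse cost at most a factor \<open>B\<^sup>n\<close> each. Composing with
  \<open>A\<^sup>T\<close> for \<open>A \<in> \<G>(w)\<close> and comparing distances to the polynomials of lower degree, every eigenvalue \<open>c\<close> of
  \<open>A jac z\<close> satisfies \<open>|c|\<^sup>n \<le> K B\<^sup>2\<^sup>n\<close> for all large \<open>n\<close>, hence \<open>|c| \<le> B\<^sup>2\<close> (\<open>eigenvalue_bound\<close>). So the trace of
  \<open>A jac z\<close> is bounded, and since \<open>\<G>(w)\<close> spans all matrices, every entry of \<open>jac\<close> is bounded; by Liouville's theorem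
  it is constant along complex lines through the base point (\<open>jac_constant\<close>). Therefore \<open>f\<close> is affine, and
  \<open>\<Phi>(e\<^sub>x, \<psi>) = \<integral> e\<^sub>A\<^sub>x\<^sub>+\<^sub>b \<psi> w\<close> holds for all real \<open>x\<close> (\<open>affine\<close>). This gives the inequality
  \<open>\<integral> |T(A\<^sup>T \<xi>)|\<^sup>2 w(\<xi>) d\<xi> \<le> C\<^sup>2 \<integral> |T|\<^sup>2 w\<close> for all trigonometric sums \<open>T\<close>; approximating indicator functions by sums
  of large period yields \<open>A \<in> \<G>(w)\<close> (\<open>membership_from_trigsum_bound\<close>).
\<close>

no_notation fps_nth (infixl "$" 75)

section \<open>Composition operators between reproducing kernel Hilbert spaces\<close>

definition comb :: "'a set \<Rightarrow> ('a \<Rightarrow> 'a \<Rightarrow> complex) \<Rightarrow> (complex \<times> 'a) list \<Rightarrow> 'a \<Rightarrow> complex" where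
  "comb E k xs = (\<lambda>y. \<Sum>(c, x)\<leftarrow>xs. c * zero_ext E (k x) y)"

text \<open>For \<open>q\<close> in the Hilbert space this is the inner product of \<open>q\<close> with the kernel combination; it makes sense for
  every function \<open>q\<close>, and bounds for it decide membership.\<close>

definition antilin :: "('a \<Rightarrow> complex) \<Rightarrow> (complex \<times> 'a) list \<Rightarrow> complex" where
  "antilin q xs = (\<Sum>(c, x)\<leftarrow>xs. cnj c * q x)"

lemma comb_Nil: "comb E k [] = (\<lambda>y. 0)" by (simp add: comb_def)
lemma comb_Cons: "comb E k ((c, x) # xs) = (\<lambda>y. c * zero_ext E (k x) y + comb E k xs y)"
  by (simp add: comb_def)
lemma comb_append: "comb E k (xs @ ys) = (\<lambda>y. comb E k xs y + comb E k ys y)"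
  by (simp add: comb_def)
lemma comb_scale: "comb E k (map (\<lambda>(c, x). (a * c, x)) xs) = (\<lambda>y. a * comb E k xs y)"
  by (induction xs) (auto simp: comb_def algebra_simps fun_eq_iff)
lemma antilin_Nil: "antilin q [] = 0" by (simp add: antilin_def)
lemma antilin_Cons: "antilin q ((c, x) # xs) = cnj c * q x + antilin q xs"
  by (simp add: antilin_def)
lemma antilin_append: "antilin q (xs @ ys) = antilin q xs + antilin q ys"
  by (simp add: antilin_def)
lemma antilin_scale: "antilin q (map (\<lambda>(c, x). (a * c, x)) xs) = cnj a * antilin q xs"
  by (induction xs) (auto simp: antilin_def algebra_simps)

lemma mult_cnj_eq: "z * cnj z = (complex_of_real (cmod z))\<^sup>2" "cnj z * z = (complex_of_real (cmod z))\<^sup>2"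
  using complex_norm_square[of z] by (simp_all add: mult.commute)

locale rkhs =
  fixes E :: "'a set" and k :: "'a \<Rightarrow> 'a \<Rightarrow> complex" and H ip
  assumes is_rkhs: "is_rkhs E k H ip"
begin

abbreviation "nrm \<equiv> ip_norm ip"

lemma H_zero: "(\<lambda>x. 0) \<in> H"
  and H_add: "g \<in> H \<Longrightarrow> h \<in> H \<Longrightarrow> (\<lambda>x. g x + h x) \<in> H"
  and H_scale: "h \<in> H \<Longrightarrow> (\<lambda>x. c * h x) \<in> H"
  and H_ext: "h \<in> H \<Longrightarrow> zero_ext E h = h"
  using is_rkhs unfolding is_rkhs_def fun_subspace_def by auto

lemma H_diff: "g \<in> H \<Longrightarrow> h \<in> H \<Longrightarrow> (\<lambda>x. g x - h x) \<in> H"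
  using H_add[of g "\<lambda>x. (-1) * h x"] H_scale[of h "-1"] by simp

lemma ip_add: "g \<in> H \<Longrightarrow> h \<in> H \<Longrightarrow> u \<in> H \<Longrightarrow> ip (\<lambda>x. g x + h x) u = ip g u + ip h u"
  and ip_scale: "h \<in> H \<Longrightarrow> u \<in> H \<Longrightarrow> ip (\<lambda>x. c * h x) u = c * ip h u"
  and ip_cnj: "h \<in> H \<Longrightarrow> u \<in> H \<Longrightarrow> ip u h = cnj (ip h u)"
  and ip_nonneg: "h \<in> H \<Longrightarrow> 0 \<le> Re (ip h h)"
  and ip_def: "h \<in> H \<Longrightarrow> ip h h = 0 \<Longrightarrow> h = (\<lambda>x. 0)"
  using is_rkhs unfolding is_rkhs_def inner_product_on_def by blast+

lemma H_complete:
  assumes "range s \<subseteq> H" "\<And>e. e > 0 \<Longrightarrow> \<exists>N. \<forall>m\<ge>N. \<forall>n\<ge>N. nrm (\<lambda>x. s m x - s n x) < e"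
  obtains h where "h \<in> H" "(\<lambda>n. nrm (\<lambda>x. s n x - h x)) \<longlonglongrightarrow> 0"
  using is_rkhs assms unfolding is_rkhs_def ip_complete_def by blast

lemma kernel_in: "x \<in> E \<Longrightarrow> zero_ext E (k x) \<in> H"
  and reproducing: "x \<in> E \<Longrightarrow> h \<in> H \<Longrightarrow> ip h (zero_ext E (k x)) = h x"
  using is_rkhs unfolding is_rkhs_def by auto

lemma ip_add_right: "g \<in> H \<Longrightarrow> h \<in> H \<Longrightarrow> u \<in> H \<Longrightarrow> ip u (\<lambda>x. g x + h x) = ip u g + ip u h"
  using ip_cnj[OF H_add[of g h], of u] ip_add[of g h u] ip_cnj[of g u] ip_cnj[of h u] by simp
lemma ip_scale_right: "h \<in> H \<Longrightarrow> u \<in> H \<Longrightarrow> ip u (\<lambda>x. c * h x) = cnj c * ip u h"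
  using ip_cnj[OF H_scale[of h c], of u] ip_scale[of h u c] ip_cnj[of h u] by simp
lemma ip_diff: "g \<in> H \<Longrightarrow> h \<in> H \<Longrightarrow> u \<in> H \<Longrightarrow> ip (\<lambda>x. g x - h x) u = ip g u - ip h u"
  using ip_add[of g "\<lambda>x. (-1) * h x" u] H_scale[of h "-1"] ip_scale[of h u "-1"] by simp

lemma ip_self: "h \<in> H \<Longrightarrow> ip h h = of_real ((nrm h)\<^sup>2)"
proof -
  assume h: "h \<in> H"
  have "ip h h = cnj (ip h h)" using ip_cnj h by blast
  then have "Im (ip h h) = 0" by (metis cnj.simps(2) equal_neg_zero)
  then show ?thesis using ip_nonneg[OF h] by (simp add: ip_norm_def complex_eq_iff)
qed

lemma nrm_nonneg: "h \<in> H \<Longrightarrow> 0 \<le> nrm h"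
  using ip_nonneg by (simp add: ip_norm_def)
lemma nrm_zero: "nrm (\<lambda>x. 0) = 0"
  using ip_scale[OF H_zero H_zero, of 0] by (simp add: ip_norm_def)
lemma nrm_eq_0: "h \<in> H \<Longrightarrow> nrm h = 0 \<Longrightarrow> h = (\<lambda>x. 0)"
  using ip_self ip_def by force

lemma nrm_sq_add: "g \<in> H \<Longrightarrow> h \<in> H \<Longrightarrow>
    (nrm (\<lambda>x. g x + h x))\<^sup>2 = (nrm g)\<^sup>2 + 2 * Re (ip g h) + (nrm h)\<^sup>2"
proof -
  assume g: "g \<in> H" and h: "h \<in> H"
  have "of_real ((nrm (\<lambda>x. g x + h x))\<^sup>2) = ip g g + ip g h + (cnj (ip g h) + ip h h)"
    using ip_self[OF H_add[OF g h]] ip_add[OF g h H_add[OF g h]] ip_add_right[OF g h]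
      ip_cnj[OF g h] g h by simp
  then have "complex_of_real ((nrm (\<lambda>x. g x + h x))\<^sup>2)
      = of_real ((nrm g)\<^sup>2) + ip g h + (cnj (ip g h) + of_real ((nrm h)\<^sup>2))"
    using ip_self g h by simp
  then have "Re (complex_of_real ((nrm (\<lambda>x. g x + h x))\<^sup>2))
      = Re (of_real ((nrm g)\<^sup>2) + ip g h + (cnj (ip g h) + of_real ((nrm h)\<^sup>2)))" by simp
  then show ?thesis by (simp del: of_real_power)
qed

lemma nrm_scale: "h \<in> H \<Longrightarrow> nrm (\<lambda>x. c * h x) = cmod c * nrm h"
proof -
  assume h: "h \<in> H"
  have "complex_of_real ((nrm (\<lambda>x. c * h x))\<^sup>2) = of_real ((cmod c * nrm h)\<^sup>2)"
    using ip_self[OF H_scale[OF h]] ip_scale[OF h H_scale[OF h]] ip_scale_right[OF h h] ip_self[OF h]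
    by (simp add: power_mult_distrib mult.assoc[symmetric] mult_cnj_eq)
  then have "(nrm (\<lambda>x. c * h x))\<^sup>2 = (cmod c * nrm h)\<^sup>2" by (simp only: of_real_eq_iff)
  then show ?thesis using nrm_nonneg h H_scale[OF h]
    by (metis norm_ge_zero power2_eq_imp_eq zero_le_mult_iff)
qed

lemma nrm_sq_diff: "g \<in> H \<Longrightarrow> h \<in> H \<Longrightarrow>
    (nrm (\<lambda>x. g x - h x))\<^sup>2 = (nrm g)\<^sup>2 - 2 * Re (ip g h) + (nrm h)\<^sup>2"
  using nrm_sq_add[of g "\<lambda>x. (-1) * h x"] H_scale[of h "-1"] nrm_scale[of h "-1"]
    ip_scale_right[of h g "-1"] by simp

lemma Cauchy_Schwarz: assumes g: "g \<in> H" and h: "h \<in> H"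
  shows "cmod (ip g h) \<le> nrm g * nrm h"
proof (cases "nrm h = 0")
  case True
  then have "h = (\<lambda>x. 0)" using nrm_eq_0 h by blast
  then show ?thesis using ip_scale_right[OF H_zero g, of 0] nrm_zero by simp
next
  case False
  define t where "t = ip g h / of_real ((nrm h)\<^sup>2)"
  have "0 \<le> (nrm (\<lambda>x. g x - t * h x))\<^sup>2" by simp
  also have "\<dots> = (nrm g)\<^sup>2 - 2 * Re (cnj t * ip g h) + (cmod t * nrm h)\<^sup>2"
    using nrm_sq_diff[OF g H_scale[OF h, of t]] ip_scale_right[OF h g] nrm_scale[OF h] by simp
  also have "cnj t * ip g h = of_real ((cmod (ip g h))\<^sup>2 / (nrm h)\<^sup>2)"
    unfolding t_def using False by (simp add: mult_cnj_eq)
  also have "(cmod t * nrm h)\<^sup>2 = (cmod (ip g h))\<^sup>2 / (nrm h)\<^sup>2"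
  proof -
    have "cmod t = cmod (ip g h) / (nrm h)\<^sup>2"
      unfolding t_def norm_divide norm_of_real using nrm_nonneg[OF h] by simp
    then show ?thesis using False by (simp add: power_divide power_mult_distrib field_simps power2_eq_square)
  qed
  finally have "(cmod (ip g h))\<^sup>2 / (nrm h)\<^sup>2 \<le> (nrm g)\<^sup>2" by simp
  then have "(cmod (ip g h))\<^sup>2 \<le> (nrm g * nrm h)\<^sup>2"
    using False by (simp add: field_simps power_mult_distrib)
  then show ?thesis using nrm_nonneg g h by (meson mult_nonneg_nonneg power2_le_imp_le)
qed

lemma nrm_triangle: assumes g: "g \<in> H" and h: "h \<in> H"
  shows "nrm (\<lambda>x. g x + h x) \<le> nrm g + nrm h"
proof -
  have "Re (ip g h) \<le> nrm g * nrm h" using Cauchy_Schwarz[OF g h] complex_Re_le_cmod order_trans by blast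
  then have "(nrm (\<lambda>x. g x + h x))\<^sup>2 \<le> (nrm g + nrm h)\<^sup>2"
    using nrm_sq_add[OF g h] by (simp add: power2_sum)
  then show ?thesis using nrm_nonneg g h by (meson add_nonneg_nonneg power2_le_imp_le)
qed

lemma ip_limit:
  assumes s: "range s \<subseteq> H" and h: "h \<in> H" and u: "u \<in> H"
    and lim: "(\<lambda>n. nrm (\<lambda>x. s n x - h x)) \<longlonglongrightarrow> 0"
  shows "(\<lambda>n. ip (s n) u) \<longlonglongrightarrow> ip h u"
proof -
  have sn: "s n \<in> H" for n using s by auto
  have "(\<lambda>n. ip (s n) u - ip h u) \<longlonglongrightarrow> 0"
  proof (rule Lim_null_comparison)
    show "\<forall>\<^sub>F n in sequentially. norm (ip (s n) u - ip h u) \<le> nrm (\<lambda>x. s n x - h x) * nrm u"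
      using Cauchy_Schwarz[OF H_diff[OF sn h] u] ip_diff[OF sn h u] by simp
    show "(\<lambda>n. nrm (\<lambda>x. s n x - h x) * nrm u) \<longlonglongrightarrow> 0"
      using tendsto_mult_right[OF lim, of "nrm u"] by simp
  qed
  then show ?thesis by (simp add: LIM_zero_iff)
qed

lemma comb_in: "snd ` set xs \<subseteq> E \<Longrightarrow> comb E k xs \<in> H"
proof (induction xs)
  case Nil then show ?case by (simp add: comb_Nil H_zero)
next
  case (Cons a xs)
  obtain c x where a: "a = (c, x)" by (cases a)
  show ?case unfolding a comb_Cons using Cons a by (intro H_add H_scale kernel_in) auto
qed

lemma ip_comb: "h \<in> H \<Longrightarrow> snd ` set xs \<subseteq> E \<Longrightarrow> ip h (comb E k xs) = antilin h xs"
proof (induction xs)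
  case Nil
  then show ?case using ip_scale_right[OF H_zero, of h 0] by (simp add: comb_Nil antilin_Nil)
next
  case (Cons a xs)
  obtain c x where a: "a = (c, x)" by (cases a)
  have x: "x \<in> E" and xs: "snd ` set xs \<subseteq> E" using Cons a by auto
  show ?case unfolding a comb_Cons antilin_Cons
    using ip_add_right[OF H_scale[OF kernel_in[OF x]] comb_in[OF xs] \<open>h \<in> H\<close>]
      ip_scale_right[OF kernel_in[OF x] \<open>h \<in> H\<close>] reproducing[OF x \<open>h \<in> H\<close>] Cons xs by simp
qed

text \<open>A function belongs to the Hilbert space as soon as pairing with kernel combinations is bounded: this is the Riesz
  representation of that pairing, obtained as the limit of a minimising sequence of kernel combinations.\<close>

lemma membership_criterion:
  assumes C: "C \<ge> 0"
    and bound: "\<And>xs. snd ` set xs \<subseteq> E \<Longrightarrow> cmod (antilin q xs) \<le> C * nrm (comb E k xs)"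
  shows "zero_ext E q \<in> H" "nrm (zero_ext E q) \<le> C"
proof -
  define K :: "(complex \<times> 'a) list set" where "K = {xs. snd ` set xs \<subseteq> E}"
  \<comment> \<open>For \<open>q\<close> in the space, this is \<open>|v - q|\<^sup>2 - |q|\<^sup>2\<close> at the kernel combination \<open>v\<close>.\<close>
  define J where "J xs = (nrm (comb E k xs))\<^sup>2 - 2 * Re (antilin q xs)" for xs
  define m where "m = (INF xs\<in>K. J xs)"
  have Kne: "[] \<in> K" by (simp add: K_def)
  have low: "- C\<^sup>2 \<le> J xs" if "xs \<in> K" for xs
  proof -
    have "2 * Re (antilin q xs) \<le> 2 * (C * nrm (comb E k xs))"
      using bound[of xs] that complex_Re_le_cmod[of "antilin q xs"] unfolding K_def by force
    moreover have "0 \<le> (nrm (comb E k xs) - C)\<^sup>2" by simp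
    ultimately show ?thesis unfolding J_def power2_diff by (simp add: mult_ac)
  qed
  have bdd: "bdd_below (J ` K)" using low by (intro bdd_belowI[of _ "- C\<^sup>2"]) auto
  have mle: "m \<le> J xs" if "xs \<in> K" for xs unfolding m_def using that bdd by (rule cINF_lower[rotated])
  have "\<exists>xs\<in>K. J xs < m + 1 / real (Suc n)" for n
    using cInf_lessD[of "J ` K" "m + 1 / real (Suc n)"] Kne unfolding m_def by auto
  then obtain X where X: "\<And>n. X n \<in> K" and XJ: "\<And>n. J (X n) < m + 1 / real (Suc n)" by metis
  define s where "s n = comb E k (X n)" for n
  have sH: "s n \<in> H" for n unfolding s_def using comb_in X K_def by auto
  have Kapp: "xs @ ys \<in> K" and Kscale: "map (\<lambda>(c, x). (a * c, x)) xs \<in> K"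
    if "xs \<in> K" "ys \<in> K" for xs ys a
    using that unfolding K_def by (auto simp: image_iff; force)+
  \<comment> \<open>The parallelogram identity turns almost-minimality into the Cauchy property.\<close>
  have para: "(nrm (\<lambda>x. s i x - s j x))\<^sup>2 \<le> 2 * (1 / real (Suc i) + 1 / real (Suc j))" for i j
  proof -
    define ms where "ms = map (\<lambda>(c, x). (1/2 * c, x)) (X i @ X j)"
    have "(nrm (comb E k ms))\<^sup>2 = (nrm (\<lambda>x. s i x + s j x))\<^sup>2 / 4"
    proof -
      have "comb E k ms = (\<lambda>x. 1/2 * (s i x + s j x))" unfolding ms_def comb_scale s_def comb_append by simp
      then have half: "nrm (comb E k ms) = nrm (\<lambda>x. s i x + s j x) / 2"
        using nrm_scale[OF H_add[OF sH sH], of "1/2" i j] by simp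
      show ?thesis unfolding half by (simp add: power_divide)
    qed
    moreover have "Re (antilin q ms) = (Re (antilin q (X i)) + Re (antilin q (X j))) / 2"
      unfolding ms_def antilin_scale antilin_append by simp
    ultimately have "J ms = (nrm (\<lambda>x. s i x + s j x))\<^sup>2 / 4 - Re (antilin q (X i)) - Re (antilin q (X j))"
      unfolding J_def by simp
    moreover have "m \<le> J ms" unfolding ms_def using mle Kscale Kapp X by blast
    moreover have "(nrm (\<lambda>x. s i x + s j x))\<^sup>2 + (nrm (\<lambda>x. s i x - s j x))\<^sup>2 = 2 * (nrm (s i))\<^sup>2 + 2 * (nrm (s j))\<^sup>2"
      using nrm_sq_add[OF sH sH, of i j] nrm_sq_diff[OF sH sH, of i j] by simp
    moreover have "J (X i) = (nrm (s i))\<^sup>2 - 2 * Re (antilin q (X i))" "J (X j) = (nrm (s j))\<^sup>2 - 2 * Re (antilin q (X j))"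
      unfolding J_def s_def by auto
    ultimately show ?thesis using XJ[of i] XJ[of j] by argo
  qed
  have Cau: "\<exists>N. \<forall>i\<ge>N. \<forall>j\<ge>N. nrm (\<lambda>x. s i x - s j x) < e" if e: "e > 0" for e
  proof -
    obtain N where N: "1 / real (Suc N) < e\<^sup>2 / 4" using nat_approx_posE[of "e\<^sup>2 / 4"] e
      by (metis zero_less_divide_iff zero_less_numeral zero_less_power)
    show ?thesis
    proof (intro exI[of _ N] allI impI)
      fix i j assume ij: "i \<ge> N" "j \<ge> N"
      have r: "1 / real (Suc i) \<le> 1 / real (Suc N)" "1 / real (Suc j) \<le> 1 / real (Suc N)"
        using ij by (auto simp: field_simps)
      have lin: "t < e\<^sup>2" if "t \<le> 2 * (p + q)" "p \<le> c" "q \<le> c" "c < e\<^sup>2 / 4" for t p q c :: real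
        using that by (simp add: field_simps)
      have "(nrm (\<lambda>x. s i x - s j x))\<^sup>2 < e\<^sup>2" by (rule lin[OF para r N])
      then show "nrm (\<lambda>x. s i x - s j x) < e" using e power2_less_imp_less by fastforce
    qed
  qed
  obtain g where g: "g \<in> H" and lim: "(\<lambda>n. nrm (\<lambda>x. s n x - g x)) \<longlonglongrightarrow> 0"
  proof -
    have "range s \<subseteq> H" using sH by auto
    then show thesis by (rule H_complete[of s, OF _ Cau]) (assumption, rule that)
  qed
  have ran: "range s \<subseteq> H" using sH by auto
  have lin: "cmod (antilin q xs) \<le> C * nrm (comb E k xs)" if "xs \<in> K" for xs using bound[of xs] that unfolding K_def by simp
  \<comment> \<open>First variation at the minimiser, in the direction of one kernel function.\<close>
  have val: "g x = q x" if x: "x \<in> E" for x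
  proof -
    let ?k = "zero_ext E (k x)"
    have kH: "?k \<in> H" using kernel_in x by blast
    have step: "2 * Re (cnj t * (s n x - q x)) + (cmod t * nrm ?k)\<^sup>2 \<ge> - (1 / real (Suc n))" for t n
    proof -
      have in': "[(t, x)] @ X n \<in> K" using Kapp X x unfolding K_def by auto
      have 1: "comb E k ([(t, x)] @ X n) = (\<lambda>y. s n y + t * ?k y)"
        by (simp add: comb_Cons s_def add.commute)
      have 2: "antilin q ([(t, x)] @ X n) = cnj t * q x + antilin q (X n)" by (simp add: antilin_Cons)
      have "(nrm (\<lambda>y. s n y + t * ?k y))\<^sup>2 = (nrm (s n))\<^sup>2 + 2 * Re (cnj t * s n x) + (cmod t * nrm ?k)\<^sup>2"
        using nrm_sq_add[OF sH H_scale[OF kH], of n t] ip_scale_right[OF kH sH, of n t] reproducing[OF x sH]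
          nrm_scale[OF kH, of t] by simp
      then have "J ([(t, x)] @ X n) = J (X n) + 2 * Re (cnj t * (s n x - q x)) + (cmod t * nrm ?k)\<^sup>2"
        unfolding J_def 1 2 s_def[symmetric] by (simp add: algebra_simps)
      then show ?thesis using mle[OF in'] XJ[of n] by linarith
    qed
    have sx: "(\<lambda>n. s n x) \<longlonglongrightarrow> g x"
      using ip_limit[OF ran g kH lim] reproducing[OF x sH] reproducing[OF x g] by simp
    have lim0: "2 * Re (cnj t * (g x - q x)) + (cmod t * nrm ?k)\<^sup>2 \<ge> 0" for t
    proof (rule LIMSEQ_le)
      show "(\<lambda>n. - (1 / real (Suc n))) \<longlonglongrightarrow> 0" using LIMSEQ_Suc[OF lim_1_over_n] tendsto_minus by fastforce
      show "(\<lambda>n. 2 * Re (cnj t * (s n x - q x)) + (cmod t * nrm ?k)\<^sup>2) \<longlonglongrightarrow>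
          2 * Re (cnj t * (g x - q x)) + (cmod t * nrm ?k)\<^sup>2"
        by (intro tendsto_intros sx)
    qed (use step in auto)
    \<comment> \<open>A multiple of \<open>w\<close> as direction makes the quadratic expression negative unless \<open>w = 0\<close>; adding 1 keeps B positive.\<close>
    define B where "B = (nrm ?k)\<^sup>2 + 1"
    define w where "w = g x - q x"
    have B: "B > 0" unfolding B_def by (simp add: add_nonneg_pos)
    have "0 \<le> 2 * Re (cnj (of_real (- 1/B) * w) * w) + (cmod (of_real (- 1/B) * w) * nrm ?k)\<^sup>2"
      using lim0[of "of_real (- 1/B) * w"] unfolding w_def .
    also have "cnj (of_real (- 1/B) * w) * w = of_real (- (cmod w)\<^sup>2 / B)"
      by (simp add: mult_cnj_eq)
    also have "(cmod (of_real (- 1/B) * w) * nrm ?k)\<^sup>2 = (cmod w)\<^sup>2 / B\<^sup>2 * (B - 1)"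
    proof -
      have "cmod (of_real (- 1/B) * w) = cmod w / B" unfolding norm_mult norm_of_real using B by simp
      moreover have "(nrm ?k)\<^sup>2 = B - 1" unfolding B_def by simp
      ultimately show ?thesis by (simp only: power_mult_distrib power_divide)
    qed
    finally have "0 \<le> 2 * (- (cmod w)\<^sup>2 / B) + (cmod w)\<^sup>2 / B\<^sup>2 * (B - 1)" by simp
    also have "\<dots> = - (cmod w)\<^sup>2 * (B + 1) / B\<^sup>2" using B by (simp add: field_simps power2_eq_square)
    finally have "(cmod w)\<^sup>2 * (B + 1) \<le> 0" using B by (simp add: divide_simps)
    then have "(cmod w)\<^sup>2 \<le> 0" using B by (simp add: mult_le_0_iff)
    then show ?thesis unfolding w_def by simp
  qed
  have gq: "zero_ext E q = g"
  proof
    fix x show "zero_ext E q x = g x"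
      using val[of x] fun_cong[OF H_ext[OF g], of x] by (cases "x \<in> E") (auto simp: zero_ext_def)
  qed
  show "zero_ext E q \<in> H" using gq g by simp
  have anti_cong: "antilin q xs = antilin g xs" if "xs \<in> K" for xs
    unfolding antilin_def using that val unfolding K_def
    by (intro arg_cong[of _ _ sum_list] map_cong) auto
  have nn: "nrm (s n) \<le> nrm (\<lambda>x. s n x - g x) + nrm g" for n
    using nrm_triangle[OF H_diff[OF sH g] g, of n] by simp
  have bn: "cmod (ip g (s n)) \<le> C * (nrm (\<lambda>x. s n x - g x) + nrm g)" for n
  proof -
    have "cmod (ip g (s n)) \<le> C * nrm (s n)"
      using ip_comb[OF g, of "X n"] X[of n] lin[OF X] anti_cong[OF X] unfolding K_def s_def by simp
    then show ?thesis using nn[of n] C by (meson mult_left_mono order_trans)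
  qed
  have "cmod (ip g g) \<le> C * (0 + nrm g)"
  proof (rule LIMSEQ_le)
    show "(\<lambda>n. cmod (ip (s n) g)) \<longlonglongrightarrow> cmod (ip g g)" by (intro tendsto_norm ip_limit[OF ran g g lim])
    show "(\<lambda>n. C * (nrm (\<lambda>x. s n x - g x) + nrm g)) \<longlonglongrightarrow> C * (0 + nrm g)" by (intro tendsto_intros lim)
    have "cmod (ip (s n) g) = cmod (ip g (s n))" for n using ip_cnj[OF g sH, of n] by simp
    then show "\<exists>N. \<forall>n\<ge>N. cmod (ip (s n) g) \<le> C * (nrm (\<lambda>x. s n x - g x) + nrm g)" using bn by simp
  qed
  moreover have "cmod (ip g g) = nrm g * nrm g" using ip_self[OF g] by (simp add: power2_eq_square norm_mult)
  ultimately have "nrm g * nrm g \<le> C * nrm g" by simp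
  then have "nrm g \<le> C" using nrm_nonneg[OF g] C by (cases "nrm g = 0") auto
  then show "nrm (zero_ext E q) \<le> C" using gq by simp
qed

text \<open>If \<open>V\<close> were unbounded, a gliding hump would build a vector whose pairings with a sequence in \<open>V\<close> are unbounded.\<close>

lemma uniform_boundedness:
  assumes V: "V \<subseteq> H" and pt: "\<And>h. h \<in> H \<Longrightarrow> \<exists>b. \<forall>v\<in>V. cmod (ip h v) \<le> b"
  shows "\<exists>C. \<forall>v\<in>V. nrm v \<le> C"
proof (rule ccontr)
  assume "\<not> ?thesis"
  then have "\<exists>v\<in>V. nrm v > 4 ^ n" for n :: nat by (meson not_le)
  then obtain v where v: "\<And>n. v n \<in> V" and vbig: "\<And>n :: nat. nrm (v n) > 4 ^ n" by metis
  have vH: "v n \<in> H" for n using v V by auto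
  have vpos: "nrm (v n) > 0" for n using vbig[of n] by (meson less_trans zero_less_numeral zero_less_power)
  \<comment> \<open>Humps of size \<open>3\<^sup>-\<^sup>(\<^sup>n\<^sup>+\<^sup>1\<^sup>)\<close>: all later ones together have at most half of the size of the n-th, and \<open>4\<^sup>n\<close> outgrows \<open>3\<^sup>n\<close>.\<close>
  define d where "d n = (\<lambda>x. of_real ((1/3) ^ Suc n / nrm (v n)) * v n x)" for n
  have dH: "d n \<in> H" for n unfolding d_def using vH H_scale by blast
  have dn: "nrm (d n) = (1/3) ^ Suc n" for n
    unfolding d_def using nrm_scale[OF vH, of "of_real ((1/3) ^ Suc n / nrm (v n))" n] vpos[of n] by (simp add: norm_divide norm_power)
  have dv: "ip (d n) (v n) = of_real ((1/3) ^ Suc n * nrm (v n))" for n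
  proof -
    have "ip (d n) (v n) = of_real ((1/3) ^ Suc n / nrm (v n)) * of_real ((nrm (v n))\<^sup>2)"
      unfolding d_def ip_scale[OF vH vH] ip_self[OF vH] ..
    also have "\<dots> = of_real ((1/3) ^ Suc n / nrm (v n) * (nrm (v n))\<^sup>2)" by (simp only: of_real_mult)
    also have "(1/3) ^ Suc n / nrm (v n) * (nrm (v n))\<^sup>2 = (1/3) ^ Suc n * nrm (v n)"
      using vpos[of n] by (simp add: power2_eq_square)
    finally show ?thesis .
  qed
  \<comment> \<open>Gliding hump: add or subtract the hump, whichever does not cancel the pairing with v n.\<close>
  define stepf where "stepf n h = (if cmod (ip (\<lambda>x. h x + d n x) (v n)) \<ge> (1/3) ^ Suc n * nrm (v n)
      then (\<lambda>x. h x + d n x) else (\<lambda>x. h x - d n x))" for n h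
  define s where "s = rec_nat (\<lambda>x. 0) stepf"
  have s0: "s 0 = (\<lambda>x. 0)" and sS: "s (Suc n) = stepf n (s n)" for n unfolding s_def by auto
  have sH: "s n \<in> H" for n
    by (induction n) (auto simp: s0 sS stepf_def H_zero dH intro: H_add H_diff)
  have sdiff: "nrm (\<lambda>x. s (Suc n) x - s n x) = (1/3) ^ Suc n" for n
    unfolding sS stepf_def using dn nrm_scale[OF dH, of "-1" n] by auto
  have sbig: "cmod (ip (s (Suc n)) (v n)) \<ge> (1/3) ^ Suc n * nrm (v n)" for n
  proof (cases "cmod (ip (\<lambda>x. s n x + d n x) (v n)) \<ge> (1/3) ^ Suc n * nrm (v n)")
    case True then show ?thesis unfolding sS stepf_def by simp
  next
    case False
    let ?p = "ip (\<lambda>x. s n x + d n x) (v n)" and ?m = "ip (\<lambda>x. s n x - d n x) (v n)"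
    have "?p - ?m = of_real (2 * ((1/3) ^ Suc n * nrm (v n)))"
    proof -
      have "?p - ?m = 2 * ip (d n) (v n)" unfolding ip_add[OF sH dH vH] ip_diff[OF sH dH vH] by simp
      then show ?thesis unfolding dv by simp
    qed
    then have "cmod (?p - ?m) = 2 * ((1/3) ^ Suc n * nrm (v n))"
      using vpos[of n] by (simp only: norm_of_real) simp
    then have "2 * ((1/3) ^ Suc n * nrm (v n)) \<le> cmod ?p + cmod ?m" using norm_triangle_ineq4[of ?p ?m] by linarith
    then have "cmod ?m \<ge> (1/3) ^ Suc n * nrm (v n)" using False by linarith
    then show ?thesis unfolding sS stepf_def using False by simp
  qed
  have tail: "nrm (\<lambda>x. s (n + j) x - s n x) \<le> 1/2 * (1/3) ^ n" for n j
  proof -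
    have "nrm (\<lambda>x. s (n + j) x - s n x) \<le> 1/2 * (1/3) ^ n - 1/2 * (1/3) ^ (n + j)"
    proof (induction j)
      case 0 then show ?case using nrm_zero by simp
    next
      case (Suc j)
      have "nrm (\<lambda>x. s (n + Suc j) x - s n x)
          \<le> nrm (\<lambda>x. s (Suc (n + j)) x - s (n + j) x) + nrm (\<lambda>x. s (n + j) x - s n x)"
        using nrm_triangle[OF H_diff[OF sH sH] H_diff[OF sH sH], of "Suc (n + j)" "n + j" "n + j" n] by simp
      then show ?case using Suc sdiff[of "n + j"] by simp
    qed
    then show ?thesis using zero_le_power[of "1/3 :: real" "n + j"] by linarith
  qed
  have sym: "nrm (\<lambda>x. g x - h x) = nrm (\<lambda>x. h x - g x)" if "g \<in> H" "h \<in> H" for g h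
    using nrm_scale[OF H_diff[OF that(2,1)], of "-1"] by simp
  have Cau: "\<exists>N. \<forall>i\<ge>N. \<forall>j\<ge>N. nrm (\<lambda>x. s i x - s j x) < e" if e: "e > 0" for e
  proof -
    obtain N where N: "(1/3 :: real) ^ N < e" using real_arch_pow_inv[of e "1/3"] e by auto
    show ?thesis
    proof (intro exI[of _ N] allI impI)
      fix i j assume ij: "i \<ge> N" "j \<ge> N"
      have "nrm (\<lambda>x. s i x - s j x) \<le> nrm (\<lambda>x. s i x - s N x) + nrm (\<lambda>x. s N x - s j x)"
        using nrm_triangle[OF H_diff[OF sH sH] H_diff[OF sH sH], of i N N j] by simp
      then show "nrm (\<lambda>x. s i x - s j x) < e"
        using tail[of N "i - N"] tail[of N "j - N"] ij N sym[OF sH sH, of N j] by simp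
    qed
  qed
  obtain h where h: "h \<in> H" and lim: "(\<lambda>n. nrm (\<lambda>x. s n x - h x)) \<longlonglongrightarrow> 0"
  proof -
    have "range s \<subseteq> H" using sH by auto
    then show thesis by (rule H_complete[of s, OF _ Cau]) (assumption, rule that)
  qed
  obtain b where b: "\<And>n. cmod (ip h (v n)) \<le> b" using pt[OF h] v by blast
  have low: "1/2 * (1/3) ^ Suc n * nrm (v n) \<le> cmod (ip h (v n))" for n
  proof (rule LIMSEQ_le_const)
    show "(\<lambda>j. cmod (ip (s j) (v n))) \<longlonglongrightarrow> cmod (ip h (v n))"
      using sH by (intro tendsto_norm ip_limit[OF _ h vH lim]) auto
    have "1/2 * (1/3) ^ Suc n * nrm (v n) \<le> cmod (ip (s j) (v n))" if "j \<ge> Suc n" for j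
    proof -
      have "cmod (ip (\<lambda>x. s j x - s (Suc n) x) (v n)) \<le> 1/2 * (1/3) ^ Suc n * nrm (v n)"
      proof -
        have "nrm (\<lambda>x. s j x - s (Suc n) x) \<le> 1/2 * (1/3) ^ Suc n"
          using tail[of "Suc n" "j - Suc n"] that by simp
        then have "nrm (\<lambda>x. s j x - s (Suc n) x) * nrm (v n) \<le> 1/2 * (1/3) ^ Suc n * nrm (v n)"
          using vpos[of n] by (intro mult_right_mono) auto
        then show ?thesis using Cauchy_Schwarz[OF H_diff[OF sH sH] vH, of j "Suc n" n] by linarith
      qed
      moreover have "cmod (ip (s (Suc n)) (v n)) - cmod (ip (s j) (v n)) \<le> cmod (ip (\<lambda>x. s j x - s (Suc n) x) (v n))"
        using ip_diff[OF sH sH vH] norm_triangle_ineq2 norm_minus_commute by metis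
      ultimately show ?thesis using sbig[of n] by linarith
    qed
    then show "\<exists>N. \<forall>j\<ge>N. 1/2 * (1/3) ^ Suc n * nrm (v n) \<le> cmod (ip (s j) (v n))" by blast
  qed
  have "(4/3) ^ n \<le> 6 * b" for n :: nat
  proof -
    have "1/2 * (1/3) ^ Suc n * 4 ^ n \<le> 1/2 * (1/3) ^ Suc n * nrm (v n)"
      using vbig[of n] by (intro mult_left_mono) auto
    then show ?thesis using low[of n] b[of n] by (simp add: power_divide)
  qed
  moreover obtain n where "6 * b < (4/3 :: real) ^ n" using real_arch_pow[of "4/3" "6 * b"] by auto
  ultimately show False by (meson not_le)
qed

end

text \<open>The pairing of \<open>h\<close> with the combination at the points \<open>f x\<close> is the pairing of \<open>h \<circ> f\<close> with the combination at the
  points \<open>x\<close>. If \<open>h \<circ> f\<close> always lies in the second space, then, among the combinations of norm at most one there,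
  this is bounded for each \<open>h\<close>, hence uniformly.\<close>

lemma composition_bounded_on_kernels:
  assumes Hk: "is_rkhs UNIV k H ipH" and HU: "is_rkhs U k' HU ipU"
    and dom: "\<And>h. h \<in> H \<Longrightarrow> comp_op U f h \<in> HU"
  shows "\<exists>C\<ge>0. \<forall>xs. snd ` set xs \<subseteq> U \<longrightarrow>
      ip_norm ipH (comb UNIV k (map (\<lambda>(c, x). (c, f x)) xs)) \<le> C * ip_norm ipU (comb U k' xs)"
proof -
  interpret A: rkhs UNIV k H ipH using Hk by unfold_locales
  interpret B: rkhs U k' HU ipU using HU by unfold_locales
  define v where "v xs = comb UNIV k (map (\<lambda>(c, x). (c, f x)) xs)" for xs
  define V where "V = v ` {xs. snd ` set xs \<subseteq> U \<and> B.nrm (comb U k' xs) \<le> 1}"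
  have vH: "v xs \<in> H" for xs unfolding v_def by (rule A.comb_in) simp
  have pair: "ipH h (v xs) = ipU (comp_op U f h) (comb U k' xs)" if "h \<in> H" "snd ` set xs \<subseteq> U" for h xs
  proof -
    have "ipH h (v xs) = antilin h (map (\<lambda>(c, x). (c, f x)) xs)"
      unfolding v_def by (rule A.ip_comb) (use that in auto)
    also have "\<dots> = antilin (comp_op U f h) xs"
      using that(2) unfolding antilin_def comp_op_def zero_ext_def
      by (simp add: o_def case_prod_beta) (intro arg_cong[of _ _ sum_list] map_cong, auto)
    also have "\<dots> = ipU (comp_op U f h) (comb U k' xs)" using B.ip_comb[OF dom] that by simp
    finally show ?thesis .
  qed
  have "\<exists>C. \<forall>u\<in>V. A.nrm u \<le> C"
  proof (rule A.uniform_boundedness)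
    show "V \<subseteq> H" unfolding V_def using vH by auto
    fix h assume h: "h \<in> H"
    have "cmod (ipH h u) \<le> B.nrm (comp_op U f h)" if u: "u \<in> V" for u
    proof -
      obtain xs where xs: "u = v xs" "snd ` set xs \<subseteq> U" "B.nrm (comb U k' xs) \<le> 1" using u unfolding V_def by blast
      have "cmod (ipH h u) \<le> B.nrm (comp_op U f h) * B.nrm (comb U k' xs)"
        using pair[OF h xs(2)] B.Cauchy_Schwarz[OF dom[OF h] B.comb_in[OF xs(2)]] xs(1) by simp
      also have "\<dots> \<le> B.nrm (comp_op U f h) * 1"
        using xs(3) B.nrm_nonneg[OF dom[OF h]] by (intro mult_left_mono) auto
      finally show ?thesis by simp
    qed
    then show "\<exists>b. \<forall>u\<in>V. cmod (ipH h u) \<le> b" by blast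
  qed
  then obtain C where C: "\<And>u. u \<in> V \<Longrightarrow> A.nrm u \<le> C" by blast
  have scaled: "A.nrm (v xs) \<le> C * r" if xs: "snd ` set xs \<subseteq> U" and r: "r > 0" "B.nrm (comb U k' xs) \<le> r" for xs r
  proof -
    let ?ys = "map (\<lambda>(c, x). (of_real (1/r) * c, x)) xs"
    have ys: "snd ` set ?ys \<subseteq> U" using xs by (auto simp: image_iff)
    have "B.nrm (comb U k' ?ys) = cmod (of_real (1/r)) * B.nrm (comb U k' xs)"
      unfolding comb_scale by (rule B.nrm_scale[OF B.comb_in[OF xs]])
    then have "B.nrm (comb U k' ?ys) \<le> 1" using r by (simp add: norm_divide)
    then have "v ?ys \<in> V" using ys unfolding V_def by blast
    then have le: "A.nrm (v ?ys) \<le> C" by (rule C)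
    have "map (\<lambda>(c, x). (c, f x)) ?ys = map (\<lambda>(c, x). (of_real (1/r) * c, x)) (map (\<lambda>(c, x). (c, f x)) xs)"
      by auto
    then have "A.nrm (v ?ys) = cmod (of_real (1/r)) * A.nrm (v xs)"
      using comb_scale[of UNIV k "of_real (1/r)"] A.nrm_scale[OF vH] unfolding v_def by metis
    then have "A.nrm (v xs) / r \<le> C" using le r by (simp add: norm_divide)
    then show ?thesis using r by (simp add: field_simps)
  qed
  have "v [] \<in> V" unfolding V_def by (auto intro!: image_eqI[of _ _ "[]"] simp: comb_Nil B.nrm_zero)
  then have C0: "C \<ge> 0" using C A.nrm_nonneg[OF vH] order_trans by blast
  have "A.nrm (v xs) \<le> C * B.nrm (comb U k' xs)" if xs: "snd ` set xs \<subseteq> U" for xs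
  proof (rule field_le_epsilon)
    fix e :: real assume e: "e > 0"
    \<comment> \<open>The norm of the combination may vanish, so it is replaced by a slightly larger positive number.\<close>
    define r where "r = B.nrm (comb U k' xs) + e / (C + 1)"
    have r: "r > 0" "B.nrm (comb U k' xs) \<le> r"
      unfolding r_def using e C0 B.nrm_nonneg[OF B.comb_in[OF xs]] by (auto intro: add_nonneg_pos)
    have "A.nrm (v xs) \<le> C * r" by (rule scaled[OF xs r])
    also have "\<dots> = C * B.nrm (comb U k' xs) + C / (C + 1) * e" unfolding r_def by (simp add: algebra_simps)
    also have "\<dots> \<le> C * B.nrm (comb U k' xs) + e"
      using C0 e by (simp add: field_simps)
    finally show "A.nrm (v xs) \<le> C * B.nrm (comb U k' xs) + e" .
  qed
  then show ?thesis using C0 unfolding v_def by blast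
qed

text \<open>The same identity of pairings read backwards: \<open>h \<circ> f\<close> passes the membership criterion.\<close>

lemma composition_of_bounded_on_kernels:
  assumes Hk: "is_rkhs UNIV k H ipH" and HU: "is_rkhs U k' HU ipU" and C: "C \<ge> 0"
    and bd: "\<And>xs. snd ` set xs \<subseteq> U \<Longrightarrow>
      ip_norm ipH (comb UNIV k (map (\<lambda>(c, x). (c, f x)) xs)) \<le> C * ip_norm ipU (comb U k' xs)"
    and h: "h \<in> H"
  shows "comp_op U f h \<in> HU" "ip_norm ipU (comp_op U f h) \<le> C * ip_norm ipH h"
proof -
  interpret A: rkhs UNIV k H ipH using Hk by unfold_locales
  interpret B: rkhs U k' HU ipU using HU by unfold_locales
  have crit: "cmod (antilin (h \<circ> f) xs) \<le> (C * A.nrm h) * B.nrm (comb U k' xs)" if xs: "snd ` set xs \<subseteq> U" for xs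
  proof -
    let ?v = "comb UNIV k (map (\<lambda>(c, x). (c, f x)) xs)"
    have "antilin (h \<circ> f) xs = ipH h ?v"
      using A.ip_comb[OF h, of "map (\<lambda>(c, x). (c, f x)) xs"] 
      by (simp add: antilin_def o_def case_prod_unfold)
    then have "cmod (antilin (h \<circ> f) xs) \<le> A.nrm h * A.nrm ?v"
      using A.Cauchy_Schwarz[OF h A.comb_in] by simp
    also have "\<dots> \<le> A.nrm h * (C * B.nrm (comb U k' xs))"
      using bd[OF xs] A.nrm_nonneg[OF h] by (rule mult_left_mono)
    finally show ?thesis by (simp add: mult_ac)
  qed
  have "C * A.nrm h \<ge> 0" using C A.nrm_nonneg[OF h] by simp
  from B.membership_criterion[OF this crit]
  show "comp_op U f h \<in> HU" "ip_norm ipU (comp_op U f h) \<le> C * ip_norm ipH h" unfolding comp_op_def by auto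
qed

section \<open>Characters and functions of exponential growth\<close>

text \<open>The bilinear pairing with a complex vector, holomorphic in \<open>z\<close>; there is no conjugation.\<close>

definition lin :: "complex ^ 'd \<Rightarrow> real ^ 'd \<Rightarrow> complex" where
  "lin z \<xi> = (\<Sum>i\<in>UNIV. z $ i * of_real (\<xi> $ i))"

text \<open>The character \<open>e\<^sub>z\<close>, continued to complex frequencies.\<close>

definition ch :: "complex ^ 'd \<Rightarrow> real ^ 'd \<Rightarrow> complex" where
  "ch z \<xi> = exp (2 * of_real pi * \<i> * lin z \<xi>)"

definition cx :: "real ^ 'd \<Rightarrow> complex ^ 'd" where
  "cx x = (\<chi> i. of_real (x $ i))"

text \<open>These functions stand in for \<open>L\<^sup>2(\<mu>)\<close>: they are square integrable for every measure with exponential moments and,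
  unlike \<open>L\<^sup>2\<close>, closed under multiplication, so characters and polynomials multiply freely.\<close>

definition exp_type :: "(real ^ 'd \<Rightarrow> complex) set" where
  "exp_type = {\<phi>. \<phi> \<in> borel_measurable lebesgue \<and> (\<exists>c a. \<forall>\<xi>. cmod (\<phi> \<xi>) \<le> c * exp (a * norm \<xi>))}"

lemma lin_add: "lin (z + w) \<xi> = lin z \<xi> + lin w \<xi>"
  by (simp add: lin_def algebra_simps sum.distrib)
lemma lin_diff: "lin (z - w) \<xi> = lin z \<xi> - lin w \<xi>"
  by (simp add: lin_def algebra_simps sum_subtractf)
lemma lin_scale: "lin (s *s z) \<xi> = s * lin z \<xi>"
  by (simp add: lin_def sum_distrib_left mult.assoc)
lemma lin_0: "lin 0 \<xi> = 0"
  by (simp add: lin_def)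
lemma lin_add_right: "lin z (\<xi> + \<eta>) = lin z \<xi> + lin z \<eta>"
  by (simp add: lin_def algebra_simps sum.distrib)
lemma lin_cx: "lin (cx x) \<xi> = of_real (x \<bullet> \<xi>)"
  by (simp add: lin_def cx_def inner_vec_def)
lemma lin_axis: "lin (axis i 1) \<xi> = of_real (\<xi> $ i)"
  by (simp add: lin_def axis_def if_distrib[of "\<lambda>x. x * _"] cong: if_cong)

lemma norm_lin: "cmod (lin z \<xi>) \<le> norm z * norm \<xi>"
proof -
  have "cmod (lin z \<xi>) \<le> (\<Sum>i\<in>UNIV. cmod (z $ i) * \<bar>\<xi> $ i\<bar>)"
    unfolding lin_def by (rule sum_norm_le) (simp add: norm_mult)
  also have "\<dots> = (\<Sum>i\<in>UNIV. \<bar>cmod (z $ i)\<bar> * \<bar>\<xi> $ i\<bar>)" by simp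
  also have "\<dots> \<le> L2_set (\<lambda>i. cmod (z $ i)) UNIV * L2_set (\<lambda>i. \<xi> $ i) UNIV" by (rule L2_set_mult_ineq)
  also have "\<dots> = norm z * norm \<xi>" by (simp add: norm_vec_def L2_set_def)
  finally show ?thesis .
qed

lemma cx_add: "cx (x + y) = cx x + cx y" by (simp add: cx_def vec_eq_iff)
lemma cx_diff: "cx (x - y) = cx x - cx y" by (simp add: cx_def vec_eq_iff)
lemma cx_scale: "cx (s *\<^sub>R x) = of_real s *s cx x" by (simp add: cx_def vec_eq_iff)
lemma norm_cx: "norm (cx x) = norm x"
  by (simp add: cx_def norm_vec_def L2_set_def)

lemma ch_0: "ch 0 \<xi> = 1" by (simp add: ch_def lin_0)
lemma ch_add: "ch (z + w) \<xi> = ch z \<xi> * ch w \<xi>"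
  by (simp add: ch_def lin_add algebra_simps exp_add)
lemma ch_diff: "ch (z - w) \<xi> = ch z \<xi> / ch w \<xi>"
  by (simp add: ch_def lin_diff algebra_simps exp_diff)
lemma ch_nz: "ch z \<xi> \<noteq> 0" by (simp add: ch_def)
lemma ch_cx: "ch (cx x) \<xi> = exp (2 * of_real pi * \<i> * of_real (x \<bullet> \<xi>))"
  by (simp add: ch_def lin_cx)
lemma norm_ch_cx: "cmod (ch (cx x) \<xi>) = 1"
  by (simp add: ch_cx norm_exp_eq_Re)
lemma cnj_ch_cx: "cnj (ch (cx x) \<xi>) = ch (cx (- x)) \<xi>"
  by (simp add: ch_cx exp_cnj)
lemma norm_ch: "cmod (ch z \<xi>) = exp ((\<chi> i. - (2 * pi * Im (z $ i))) \<bullet> \<xi>)"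
  by (simp add: ch_def lin_def norm_exp_eq_Re inner_vec_def sum_distrib_left sum_negf mult_ac)

lemma lin_measurable [measurable]: "lin z \<in> borel_measurable borel"
  unfolding lin_def by (intro borel_measurable_continuous_onI continuous_intros)
lemma ch_measurable [measurable]: "ch z \<in> borel_measurable borel"
  unfolding ch_def by measurable

lemma exp_typeI: "\<phi> \<in> borel_measurable lebesgue \<Longrightarrow> (\<And>\<xi>. cmod (\<phi> \<xi>) \<le> c * exp (a * norm \<xi>)) \<Longrightarrow> \<phi> \<in> exp_type"
  unfolding exp_type_def by blast

lemma exp_typeE:
  assumes "\<phi> \<in> exp_type"
  obtains c a where "c \<ge> 0" "a \<ge> 0" "\<And>\<xi>. cmod (\<phi> \<xi>) \<le> c * exp (a * norm \<xi>)" "\<phi> \<in> borel_measurable lebesgue"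
proof -
  obtain c a where *: "\<And>\<xi>. cmod (\<phi> \<xi>) \<le> c * exp (a * norm \<xi>)" "\<phi> \<in> borel_measurable lebesgue"
    using assms unfolding exp_type_def by blast
  have "cmod (\<phi> \<xi>) \<le> \<bar>c\<bar> * exp (\<bar>a\<bar> * norm \<xi>)" for \<xi>
    using *(1)[of \<xi>] mult_mono[of c "\<bar>c\<bar>" "exp (a * norm \<xi>)" "exp (\<bar>a\<bar> * norm \<xi>)"]
    by (force intro!: mult_right_mono)
  then show thesis using that[of "\<bar>c\<bar>" "\<bar>a\<bar>"] *(2) by auto
qed

lemma exp_type_measurable: "\<phi> \<in> exp_type \<Longrightarrow> \<phi> \<in> borel_measurable lebesgue"
  by (simp add: exp_type_def)

lemma exp_type_const [intro, simp]: "(\<lambda>\<xi>. c) \<in> exp_type"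
  by (rule exp_typeI[of _ "cmod c" 0]) auto

lemma exp_type_add [intro]: assumes "\<phi> \<in> exp_type" "\<psi> \<in> exp_type"
  shows "(\<lambda>\<xi>. \<phi> \<xi> + \<psi> \<xi>) \<in> exp_type"
proof -
  obtain c a where 1: "c \<ge> 0" "a \<ge> 0" "\<And>\<xi>. cmod (\<phi> \<xi>) \<le> c * exp (a * norm \<xi>)" using exp_typeE[OF assms(1)] by metis
  obtain d b where 2: "d \<ge> 0" "b \<ge> 0" "\<And>\<xi>. cmod (\<psi> \<xi>) \<le> d * exp (b * norm \<xi>)" using exp_typeE[OF assms(2)] by metis
  show ?thesis
  proof (rule exp_typeI[of _ "c + d" "a + b"])
    fix \<xi> :: "real ^ 'a"
    have "c * exp (a * norm \<xi>) \<le> c * exp ((a + b) * norm \<xi>)" "d * exp (b * norm \<xi>) \<le> d * exp ((a + b) * norm \<xi>)"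
      using 1 2 by (auto intro!: mult_left_mono mult_right_mono)
    then show "cmod (\<phi> \<xi> + \<psi> \<xi>) \<le> (c + d) * exp ((a + b) * norm \<xi>)"
      using 1(3)[of \<xi>] 2(3)[of \<xi>] norm_triangle_ineq[of "\<phi> \<xi>" "\<psi> \<xi>"] by (simp add: distrib_right)
  qed (use assms exp_type_measurable in \<open>auto intro!: borel_measurable_add\<close>)
qed

lemma exp_type_mult [intro]: assumes "\<phi> \<in> exp_type" "\<psi> \<in> exp_type"
  shows "(\<lambda>\<xi>. \<phi> \<xi> * \<psi> \<xi>) \<in> exp_type"
proof -
  obtain c a where 1: "c \<ge> 0" "a \<ge> 0" "\<And>\<xi>. cmod (\<phi> \<xi>) \<le> c * exp (a * norm \<xi>)" using exp_typeE[OF assms(1)] by metis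
  obtain d b where 2: "d \<ge> 0" "b \<ge> 0" "\<And>\<xi>. cmod (\<psi> \<xi>) \<le> d * exp (b * norm \<xi>)" using exp_typeE[OF assms(2)] by metis
  show ?thesis
  proof (rule exp_typeI[of _ "c * d" "a + b"])
    fix \<xi> :: "real ^ 'a"
    have "cmod (\<phi> \<xi>) * cmod (\<psi> \<xi>) \<le> (c * exp (a * norm \<xi>)) * (d * exp (b * norm \<xi>))"
      using 1 2 by (intro mult_mono) auto
    then show "cmod (\<phi> \<xi> * \<psi> \<xi>) \<le> (c * d) * exp ((a + b) * norm \<xi>)"
      by (simp add: norm_mult exp_add[symmetric] algebra_simps)
  qed (use assms exp_type_measurable in \<open>auto intro!: borel_measurable_times\<close>)
qed

lemma exp_type_scale [intro]: "\<phi> \<in> exp_type \<Longrightarrow> (\<lambda>\<xi>. c * \<phi> \<xi>) \<in> exp_type"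
  by (intro exp_type_mult exp_type_const)
lemma exp_type_uminus [intro]: "\<phi> \<in> exp_type \<Longrightarrow> (\<lambda>\<xi>. - \<phi> \<xi>) \<in> exp_type"
  using exp_type_scale[of \<phi> "-1"] by simp
lemma exp_type_diff [intro]: "\<phi> \<in> exp_type \<Longrightarrow> \<psi> \<in> exp_type \<Longrightarrow> (\<lambda>\<xi>. \<phi> \<xi> - \<psi> \<xi>) \<in> exp_type"
  using exp_type_add[of \<phi> "\<lambda>\<xi>. - \<psi> \<xi>"] exp_type_uminus[of \<psi>] by simp
lemma exp_type_sum [intro]: "(\<And>i. i \<in> I \<Longrightarrow> \<phi> i \<in> exp_type) \<Longrightarrow> (\<lambda>\<xi>. \<Sum>i\<in>I. \<phi> i \<xi>) \<in> exp_type"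
  by (induction I rule: infinite_finite_induct) auto
lemma exp_type_power [intro]: "\<phi> \<in> exp_type \<Longrightarrow> (\<lambda>\<xi>. \<phi> \<xi> ^ n) \<in> exp_type"
  by (induction n) auto

lemma exp_type_cnj [intro]: assumes "\<phi> \<in> exp_type" shows "(\<lambda>\<xi>. cnj (\<phi> \<xi>)) \<in> exp_type"
proof -
  obtain c a where 1: "\<And>\<xi>. cmod (\<phi> \<xi>) \<le> c * exp (a * norm \<xi>)" "\<phi> \<in> borel_measurable lebesgue" using exp_typeE[OF assms] by metis
  have "(\<lambda>\<xi>. cnj (\<phi> \<xi>)) \<in> borel_measurable lebesgue"
    using 1(2) by (intro borel_measurable_continuous_on[of cnj]) (auto intro!: continuous_intros)
  then show ?thesis using 1(1) by (intro exp_typeI[of _ c a]) auto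
qed

lemma borel_measurable_lebesgueI: "f \<in> borel_measurable borel \<Longrightarrow> f \<in> borel_measurable lebesgue"
  by (simp add: measurable_completion)

lemma exp_type_exp_norm [intro]: "(\<lambda>\<xi>. of_real (exp (a * norm \<xi>))) \<in> exp_type"
  by (rule exp_typeI[of _ 1 a]) (auto simp del: of_real_exp intro!: borel_measurable_lebesgueI)

lemma exp_type_norm_id [intro]: "(\<lambda>\<xi>. of_real (norm \<xi>)) \<in> exp_type"
proof (rule exp_typeI[of _ 1 1])
  fix \<xi> :: "real ^ 'a"
  have "norm \<xi> \<le> exp (norm \<xi>)" using exp_ge_add_one_self[of "norm \<xi>"] by linarith
  then show "cmod (of_real (norm \<xi>)) \<le> 1 * exp (1 * norm \<xi>)" by simp
qed (rule borel_measurable_lebesgueI, measurable)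

lemma exp_type_lin [intro]: "lin z \<in> exp_type"
proof (rule exp_typeI[of _ "norm z" 1])
  fix \<xi> :: "real ^ 'a"
  have "norm \<xi> \<le> exp (norm \<xi>)" using exp_ge_add_one_self[of "norm \<xi>"] by linarith
  then have "norm z * norm \<xi> \<le> norm z * exp (norm \<xi>)" by (intro mult_left_mono) auto
  then show "cmod (lin z \<xi>) \<le> norm z * exp (1 * norm \<xi>)" using norm_lin[of z \<xi>] by simp
qed (rule borel_measurable_lebesgueI, measurable)

lemma exp_type_coord [intro]: "(\<lambda>\<xi>. of_real (\<xi> $ i)) \<in> exp_type"
  using exp_type_lin[of "axis i 1"] unfolding lin_axis[abs_def] .

lemma exp_type_ch [intro]: "ch z \<in> exp_type"
proof (rule exp_typeI[of _ 1 "2 * pi * norm z"])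
  fix \<xi> :: "real ^ 'a"
  have "cmod (ch z \<xi>) = exp (Re (2 * of_real pi * \<i> * lin z \<xi>))" by (simp only: ch_def norm_exp_eq_Re)
  also have "Re (2 * of_real pi * \<i> * lin z \<xi>) \<le> cmod (2 * of_real pi * \<i> * lin z \<xi>)" by (rule complex_Re_le_cmod)
  also have "cmod (2 * of_real pi * \<i> * lin z \<xi>) = 2 * pi * cmod (lin z \<xi>)" by (simp add: norm_mult)
  also have "2 * pi * cmod (lin z \<xi>) \<le> 2 * pi * norm z * norm \<xi>"
    using mult_left_mono[OF norm_lin[of z \<xi>], of "2 * pi"] by (simp add: mult_ac)
  finally show "cmod (ch z \<xi>) \<le> 1 * exp (2 * pi * norm z * norm \<xi>)" by simp
qed (rule borel_measurable_lebesgueI, measurable)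

lemmas exp_type_intros = exp_type_add exp_type_diff exp_type_mult exp_type_const exp_type_uminus
  exp_type_sum exp_type_power exp_type_cnj exp_type_exp_norm exp_type_norm_id
  exp_type_lin exp_type_coord exp_type_ch

section \<open>Measures with exponential moments\<close>

locale exp_measure =
  fixes \<mu> :: "(real ^ 'd) measure"
  assumes sets_mu: "sets \<mu> = sets lebesgue"
    and exp_integrable: "\<And>a. integrable \<mu> (\<lambda>\<xi>. exp (a * norm \<xi>))"
begin

text \<open>No conjugation here either, so that pairings with characters are holomorphic in the frequency.\<close>

definition bil :: "(real ^ 'd \<Rightarrow> complex) \<Rightarrow> (real ^ 'd \<Rightarrow> complex) \<Rightarrow> complex" where
  "bil \<phi> \<psi> = (LINT \<xi>|\<mu>. \<phi> \<xi> * \<psi> \<xi>)"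

definition nr :: "(real ^ 'd \<Rightarrow> complex) \<Rightarrow> real" where
  "nr \<phi> = sqrt (LINT \<xi>|\<mu>. (cmod (\<phi> \<xi>))\<^sup>2)"

lemma measurable_mu: "f \<in> measurable \<mu> N \<longleftrightarrow> f \<in> measurable lebesgue N"
  by (rule measurable_cong_sets[OF sets_mu refl, THEN eqset_imp_iff])

lemma integrable_exp_type: assumes "\<phi> \<in> exp_type" shows "integrable \<mu> \<phi>"
proof -
  obtain c a where 1: "c \<ge> 0" "\<And>\<xi>. cmod (\<phi> \<xi>) \<le> c * exp (a * norm \<xi>)" "\<phi> \<in> borel_measurable lebesgue" using exp_typeE[OF assms] by metis
  show ?thesis
    by (rule Bochner_Integration.integrable_bound[of _ "\<lambda>\<xi>. c * exp (a * norm \<xi>)"])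
      (use 1 exp_integrable in \<open>auto simp: measurable_mu\<close>)
qed

lemma integrable_norm_sq: assumes "\<phi> \<in> exp_type" shows "integrable \<mu> (\<lambda>\<xi>. (cmod (\<phi> \<xi>))\<^sup>2)"
  using integrable_norm[OF integrable_exp_type[OF exp_type_power[OF assms, of 2]]] by (simp add: norm_power)

lemma integrable_prod: "\<phi> \<in> exp_type \<Longrightarrow> \<psi> \<in> exp_type \<Longrightarrow> integrable \<mu> (\<lambda>\<xi>. \<phi> \<xi> * \<psi> \<xi>)"
  by (intro integrable_exp_type exp_type_mult)

lemma nr_nonneg: "0 \<le> nr \<phi>" by (simp add: nr_def integral_nonneg)
lemma nr_sq: "(nr \<phi>)\<^sup>2 = (LINT \<xi>|\<mu>. (cmod (\<phi> \<xi>))\<^sup>2)" by (simp add: nr_def integral_nonneg)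

lemma nr_mono: assumes "\<phi> \<in> exp_type" "\<psi> \<in> exp_type" "\<And>\<xi>. cmod (\<phi> \<xi>) \<le> cmod (\<psi> \<xi>)"
  shows "nr \<phi> \<le> nr \<psi>"
  unfolding nr_def using assms by (intro real_sqrt_le_mono integral_mono integrable_norm_sq power_mono) auto

lemma nr_cong_norm: "(\<And>\<xi>. cmod (\<phi> \<xi>) = cmod (\<psi> \<xi>)) \<Longrightarrow> nr \<phi> = nr \<psi>"
  by (simp add: nr_def)

lemma nr_scale: "nr (\<lambda>\<xi>. c * \<phi> \<xi>) = cmod c * nr \<phi>"
  by (simp add: nr_def norm_mult power_mult_distrib real_sqrt_mult)

lemma bil_cnj: "\<phi> \<in> exp_type \<Longrightarrow> bil \<phi> (\<lambda>\<xi>. cnj (\<phi> \<xi>)) = of_real ((nr \<phi>)\<^sup>2)"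
proof -
  have "bil \<phi> (\<lambda>\<xi>. cnj (\<phi> \<xi>)) = (LINT \<xi>|\<mu>. of_real ((cmod (\<phi> \<xi>))\<^sup>2))"
    unfolding bil_def by (intro Bochner_Integration.integral_cong refl) (simp add: complex_norm_square del: of_real_power)
  then show ?thesis unfolding nr_sq by (simp only: integral_complex_of_real)
qed

lemma bil_add_left: "\<phi> \<in> exp_type \<Longrightarrow> \<theta> \<in> exp_type \<Longrightarrow> \<psi> \<in> exp_type \<Longrightarrow> bil (\<lambda>\<xi>. \<phi> \<xi> + \<theta> \<xi>) \<psi> = bil \<phi> \<psi> + bil \<theta> \<psi>"
  unfolding bil_def by (simp add: distrib_right integrable_prod)
lemma bil_scale_left: "bil (\<lambda>\<xi>. c * \<phi> \<xi>) \<psi> = c * bil \<phi> \<psi>"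
  unfolding bil_def by (simp add: mult.assoc)
lemma bil_commute: "bil \<phi> \<psi> = bil \<psi> \<phi>"
  unfolding bil_def by (simp add: mult.commute)

lemma bil_Cauchy_Schwarz: assumes "\<phi> \<in> exp_type" "\<psi> \<in> exp_type" shows "cmod (bil \<phi> \<psi>) \<le> nr \<phi> * nr \<psi>"
proof -
  have bound: "2 * cmod (bil \<phi> \<psi>) \<le> t * (nr \<phi>)\<^sup>2 + (nr \<psi>)\<^sup>2 / t" if t: "t > 0" for t
  proof -
    have "cmod (bil \<phi> \<psi>) \<le> (LINT \<xi>|\<mu>. cmod (\<phi> \<xi> * \<psi> \<xi>))" unfolding bil_def by (rule integral_norm_bound)
    also have "\<dots> \<le> (LINT \<xi>|\<mu>. 1/2 * (t * (cmod (\<phi> \<xi>))\<^sup>2 + 1/t * (cmod (\<psi> \<xi>))\<^sup>2))"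
    proof (rule integral_mono)
      show "integrable \<mu> (\<lambda>\<xi>. cmod (\<phi> \<xi> * \<psi> \<xi>))" using assms by (intro integrable_norm integrable_prod)
      show "integrable \<mu> (\<lambda>\<xi>. 1/2 * (t * (cmod (\<phi> \<xi>))\<^sup>2 + 1/t * (cmod (\<psi> \<xi>))\<^sup>2))"
        using assms by (intro integrable_mult_right Bochner_Integration.integrable_add integrable_norm_sq)
      fix \<xi>
      have "0 \<le> (t * cmod (\<phi> \<xi>) - cmod (\<psi> \<xi>))\<^sup>2 / t" using t by simp
      also have "\<dots> = t * (cmod (\<phi> \<xi>))\<^sup>2 + 1/t * (cmod (\<psi> \<xi>))\<^sup>2 - 2 * (cmod (\<phi> \<xi>) * cmod (\<psi> \<xi>))"
        using t by (simp add: power2_diff field_simps power2_eq_square)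
      finally show "cmod (\<phi> \<xi> * \<psi> \<xi>) \<le> 1/2 * (t * (cmod (\<phi> \<xi>))\<^sup>2 + 1/t * (cmod (\<psi> \<xi>))\<^sup>2)"
        by (simp add: norm_mult)
    qed
    also have "\<dots> = 1/2 * (t * (nr \<phi>)\<^sup>2 + 1/t * (nr \<psi>)\<^sup>2)"
      unfolding nr_sq using assms by (simp add: integrable_norm_sq)
    finally show ?thesis by simp
  qed
  show ?thesis
  proof (cases "nr \<phi> = 0")
    case True
    have "2 * cmod (bil \<phi> \<psi>) \<le> 0 + e" if "e > 0" for e
    proof -
      have "2 * cmod (bil \<phi> \<psi>) \<le> (nr \<psi>)\<^sup>2 / (((nr \<psi>)\<^sup>2 + 1) / e)"
        using bound[of "((nr \<psi>)\<^sup>2 + 1) / e"] that True by (simp add: add_nonneg_pos)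
      also have "\<dots> \<le> e" using that by (simp add: divide_simps add_nonneg_pos)
      finally show ?thesis by simp
    qed
    then have "2 * cmod (bil \<phi> \<psi>) \<le> 0" by (rule field_le_epsilon)
    then show ?thesis using True by simp
  next
    case False
    then have p: "nr \<phi> > 0" using nr_nonneg[of \<phi>] by simp
    show ?thesis
    proof (cases "nr \<psi> = 0")
      case True
      have "2 * cmod (bil \<phi> \<psi>) \<le> 0 + e" if "e > 0" for e
        using bound[of "e / (nr \<phi>)\<^sup>2"] that p True by simp
      then have "2 * cmod (bil \<phi> \<psi>) \<le> 0" by (rule field_le_epsilon)
      then show ?thesis using True by simp
    next
      case False
      then have "nr \<psi> > 0" using nr_nonneg[of \<psi>] by simp
      then show ?thesis using bound[of "nr \<psi> / nr \<phi>"] p by (simp add: power2_eq_square mult_ac)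
    qed
  qed
qed

definition bounded_functional :: "((real ^ 'd \<Rightarrow> complex) \<Rightarrow> complex) \<Rightarrow> bool" where
  "bounded_functional L \<longleftrightarrow>
     (\<forall>\<phi>\<in>exp_type. \<forall>\<psi>\<in>exp_type. L (\<lambda>\<xi>. \<phi> \<xi> + \<psi> \<xi>) = L \<phi> + L \<psi>) \<and>
     (\<forall>\<phi>\<in>exp_type. \<forall>c. L (\<lambda>\<xi>. c * \<phi> \<xi>) = c * L \<phi>) \<and>
     (\<exists>C\<ge>0. \<forall>\<phi>\<in>exp_type. cmod (L \<phi>) \<le> C * nr \<phi>)"

lemma bf_add: "bounded_functional L \<Longrightarrow> \<phi> \<in> exp_type \<Longrightarrow> \<psi> \<in> exp_type \<Longrightarrow> L (\<lambda>\<xi>. \<phi> \<xi> + \<psi> \<xi>) = L \<phi> + L \<psi>"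
  and bf_scale: "bounded_functional L \<Longrightarrow> \<phi> \<in> exp_type \<Longrightarrow> L (\<lambda>\<xi>. c * \<phi> \<xi>) = c * L \<phi>"
  unfolding bounded_functional_def by blast+

lemma bf_zero: "bounded_functional L \<Longrightarrow> L (\<lambda>\<xi>. 0) = 0"
  using bf_scale[of L "\<lambda>\<xi>. 0" 0] by auto
lemma bf_diff: "bounded_functional L \<Longrightarrow> \<phi> \<in> exp_type \<Longrightarrow> \<psi> \<in> exp_type \<Longrightarrow> L (\<lambda>\<xi>. \<phi> \<xi> - \<psi> \<xi>) = L \<phi> - L \<psi>"
  using bf_add[of L \<phi> "\<lambda>\<xi>. (-1) * \<psi> \<xi>"] bf_scale[of L \<psi> "-1"] exp_type_scale[of \<psi> "-1"] by simp
lemma bf_sum: "bounded_functional L \<Longrightarrow> (\<And>i. i \<in> I \<Longrightarrow> \<phi> i \<in> exp_type) \<Longrightarrow> finite I \<Longrightarrow> L (\<lambda>\<xi>. \<Sum>i\<in>I. \<phi> i \<xi>) = (\<Sum>i\<in>I. L (\<phi> i))"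
proof (induction I rule: infinite_finite_induct)
  case (insert x F)
  have "(\<lambda>\<xi>. \<Sum>i\<in>F. \<phi> i \<xi>) \<in> exp_type" using insert by (intro exp_type_sum) auto
  then show ?case using insert bf_add[of L "\<phi> x" "\<lambda>\<xi>. \<Sum>i\<in>F. \<phi> i \<xi>"] by simp
qed (auto simp: bf_zero)

lemma bounded_functional_bil: "\<psi> \<in> exp_type \<Longrightarrow> bounded_functional (\<lambda>\<phi>. bil \<phi> \<psi>)"
  unfolding bounded_functional_def
  using bil_Cauchy_Schwarz[of _ \<psi>] nr_nonneg[of \<psi>] by (auto simp: bil_add_left bil_scale_left mult.commute[of "nr \<psi>"] intro!: exI[of _ "nr \<psi>"])

lemma bf_lin_sum: assumes L: "bounded_functional L" and \<phi>: "\<phi> \<in> exp_type"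
  shows "L (\<lambda>\<xi>. lin z \<xi> * \<phi> \<xi>) = (\<Sum>l\<in>UNIV. z $ l * L (\<lambda>\<xi>. of_real (\<xi> $ l) * \<phi> \<xi>))"
proof -
  have "L (\<lambda>\<xi>. lin z \<xi> * \<phi> \<xi>) = L (\<lambda>\<xi>. \<Sum>l\<in>UNIV. z $ l * (of_real (\<xi> $ l) * \<phi> \<xi>))"
    by (simp add: lin_def sum_distrib_right mult.assoc)
  also have "\<dots> = (\<Sum>l\<in>UNIV. L (\<lambda>\<xi>. z $ l * (of_real (\<xi> $ l) * \<phi> \<xi>)))"
    by (intro bf_sum L) (auto intro!: exp_type_intros \<phi>)
  also have "\<dots> = (\<Sum>l\<in>UNIV. z $ l * L (\<lambda>\<xi>. of_real (\<xi> $ l) * \<phi> \<xi>))"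
    by (intro sum.cong refl bf_scale L exp_type_intros \<phi>)
  finally show ?thesis .
qed

text \<open>Bounded functionals of characters are differentiable in the frequency, with a quadratic error: the Taylor remainder of
  the exponential is dominated by a function of exponential growth.\<close>

lemma bf_expansion:
  assumes L: "bounded_functional L" and \<phi>: "\<phi> \<in> exp_type"
  shows "\<exists>K\<ge>0. \<forall>\<eta>. norm \<eta> \<le> 1 \<longrightarrow>
    cmod (L (\<lambda>\<xi>. ch (z + \<eta>) \<xi> * \<phi> \<xi>) - L (\<lambda>\<xi>. ch z \<xi> * \<phi> \<xi>)
      - 2 * of_real pi * \<i> * L (\<lambda>\<xi>. lin \<eta> \<xi> * (ch z \<xi> * \<phi> \<xi>))) \<le> K * (norm \<eta>)\<^sup>2"
proof -
  obtain C where C: "C \<ge> 0" "\<And>\<phi>. \<phi> \<in> exp_type \<Longrightarrow> cmod (L \<phi>) \<le> C * nr \<phi>"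
    using L unfolding bounded_functional_def by blast
  \<comment> \<open>Times the square of the norm of \<open>\<eta>\<close>, this dominates the second order remainder for all small \<open>\<eta>\<close>.\<close>
  define G where "G \<xi> = of_real ((2 * pi)\<^sup>2) * (of_real (norm \<xi>) ^ 2 * (of_real (exp ((2 * pi) * norm \<xi>)) * (ch z \<xi> * \<phi> \<xi>)))" for \<xi>
  have G: "G \<in> exp_type" unfolding G_def using \<phi>
    by (intro exp_type_scale exp_type_mult exp_type_power exp_type_norm_id exp_type_exp_norm exp_type_ch)
  have *: "cmod (L (\<lambda>\<xi>. ch (z + \<eta>) \<xi> * \<phi> \<xi>) - L (\<lambda>\<xi>. ch z \<xi> * \<phi> \<xi>)
      - 2 * of_real pi * \<i> * L (\<lambda>\<xi>. lin \<eta> \<xi> * (ch z \<xi> * \<phi> \<xi>))) \<le> C * nr G * (norm \<eta>)\<^sup>2" if n: "norm \<eta> \<le> 1" for \<eta>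
  proof -
    define R where "R \<xi> = ch (z + \<eta>) \<xi> * \<phi> \<xi> - ch z \<xi> * \<phi> \<xi> - 2 * of_real pi * \<i> * (lin \<eta> \<xi> * (ch z \<xi> * \<phi> \<xi>))" for \<xi>
    have t: "(\<lambda>\<xi>. ch (z + \<eta>) \<xi> * \<phi> \<xi>) \<in> exp_type" "(\<lambda>\<xi>. ch z \<xi> * \<phi> \<xi>) \<in> exp_type" "(\<lambda>\<xi>. lin \<eta> \<xi> * (ch z \<xi> * \<phi> \<xi>)) \<in> exp_type"
      by (intro exp_type_intros \<phi>)+
    have R: "R \<in> exp_type" unfolding R_def using t by (intro exp_type_diff exp_type_scale)
    have LR: "L R = L (\<lambda>\<xi>. ch (z + \<eta>) \<xi> * \<phi> \<xi>) - L (\<lambda>\<xi>. ch z \<xi> * \<phi> \<xi>)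
      - 2 * of_real pi * \<i> * L (\<lambda>\<xi>. lin \<eta> \<xi> * (ch z \<xi> * \<phi> \<xi>))"
      unfolding R_def using t by (simp add: bf_diff[OF L] bf_scale[OF L] exp_type_diff exp_type_scale)
    have "cmod (R \<xi>) \<le> cmod (of_real ((norm \<eta>)\<^sup>2) * G \<xi>)" for \<xi>
    proof -
      define A where "A = 2 * of_real pi * \<i> * lin \<eta> \<xi>"
      have ch: "ch \<eta> \<xi> = exp A" by (simp add: ch_def A_def)
      have nA: "cmod A \<le> 2 * pi * (norm \<eta> * norm \<xi>)"
        using norm_lin[of \<eta> \<xi>] by (simp add: A_def norm_mult)
      also have "\<dots> \<le> 2 * pi * norm \<xi>" using n by (simp add: mult_left_le_one_le)
      finally have nA': "cmod A \<le> 2 * pi * norm \<xi>" .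
      have "cmod (exp A - (\<Sum>k\<le>1. A ^ k / fact k)) \<le> exp \<bar>Re A\<bar> * cmod A ^ Suc 1 / fact 1" by (rule Taylor_exp)
      then have "cmod (exp A - 1 - A) \<le> exp \<bar>Re A\<bar> * (cmod A)\<^sup>2" by (simp add: algebra_simps numeral_2_eq_2)
      also have "\<dots> \<le> exp (2 * pi * norm \<xi>) * (2 * pi * (norm \<eta> * norm \<xi>))\<^sup>2"
        using nA nA' abs_Re_le_cmod[of A] by (intro mult_mono power_mono) auto
      finally have e: "cmod (exp A - 1 - A) \<le> exp (2 * pi * norm \<xi>) * (2 * pi * (norm \<eta> * norm \<xi>))\<^sup>2" .
      have "R \<xi> = (exp A - 1 - A) * (ch z \<xi> * \<phi> \<xi>)"
        unfolding R_def ch_add ch A_def by (simp add: algebra_simps)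
      then have "cmod (R \<xi>) \<le> (exp (2 * pi * norm \<xi>) * (2 * pi * (norm \<eta> * norm \<xi>))\<^sup>2) * cmod (ch z \<xi> * \<phi> \<xi>)"
        using e by (simp add: norm_mult mult_right_mono)
      also have "\<dots> = cmod (of_real ((norm \<eta>)\<^sup>2) * G \<xi>)"
        unfolding G_def norm_mult norm_of_real norm_power by (simp add: power_mult_distrib mult_ac)
      finally show ?thesis .
    qed
    then have "nr R \<le> nr (\<lambda>\<xi>. of_real ((norm \<eta>)\<^sup>2) * G \<xi>)" using R G by (intro nr_mono) auto
    also have "\<dots> = (norm \<eta>)\<^sup>2 * nr G" unfolding nr_scale by (simp add: norm_power)
    finally have "C * nr R \<le> C * ((norm \<eta>)\<^sup>2 * nr G)" using C(1) by (rule mult_left_mono)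
    then show ?thesis using C(2)[OF R] unfolding LR by (simp add: mult_ac)
  qed
  have "C * nr G \<ge> 0" using C nr_nonneg by simp
  with * show ?thesis by blast
qed

end

section \<open>Leading terms of polynomials\<close>

text \<open>Polynomials of degree less than \<open>n\<close>. The strict bound makes \<open>polyd 0\<close> the zero polynomial, so that statements modulo
  lower degree include \<open>n = 0\<close>. Products of complex linear forms avoid coordinates and are stable under linear
  substitutions.\<close>

inductive polyd :: "nat \<Rightarrow> (real ^ 'd \<Rightarrow> complex) \<Rightarrow> bool" where
  zero: "polyd n (\<lambda>\<xi>. 0)"
| const: "polyd (Suc n) (\<lambda>\<xi>. c)"
| add: "polyd n P \<Longrightarrow> polyd n Q \<Longrightarrow> polyd n (\<lambda>\<xi>. P \<xi> + Q \<xi>)"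
| mult: "polyd n P \<Longrightarrow> polyd (Suc n) (\<lambda>\<xi>. lin z \<xi> * P \<xi>)"

lemma polyd_Suc: "polyd n P \<Longrightarrow> polyd (Suc n) P"
  by (induction rule: polyd.induct) (auto intro: polyd.intros)
lemma polyd_scale: "polyd n P \<Longrightarrow> polyd n (\<lambda>\<xi>. c * P \<xi>)"
proof (induction rule: polyd.induct)
  case (add n P Q) then show ?case using polyd.add by (simp add: distrib_left)
next
  case (mult n P z) then show ?case using polyd.mult[of n "\<lambda>\<xi>. c * P \<xi>" z] by (simp add: mult_ac)
qed (auto intro: polyd.intros)
lemma polyd_0: "polyd 0 P \<Longrightarrow> P = (\<lambda>\<xi>. 0)"
proof (induction "0 :: nat" P rule: polyd.induct)
qed auto
lemma polyd_power: "polyd (Suc n) (\<lambda>\<xi>. lin g \<xi> ^ n)"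
  by (induction n) (auto intro: polyd.intros)
lemma polyd_exp_type: "polyd n P \<Longrightarrow> P \<in> exp_type"
  by (induction rule: polyd.induct) (auto intro!: exp_type_intros)
lemma polyd_continuous: "polyd n P \<Longrightarrow> continuous_on UNIV P"
  by (induction rule: polyd.induct) (auto intro!: continuous_intros simp: lin_def)

lemma lin_transpose: "lin z (transpose A *v \<xi>) = lin ((\<chi> i j. of_real (A $ i $ j)) *v z) \<xi>"
proof -
  have "lin z (transpose A *v \<xi>) = (\<Sum>i\<in>UNIV. \<Sum>j\<in>UNIV. z $ i * (of_real (A $ j $ i) * of_real (\<xi> $ j)))"
    by (simp add: lin_def matrix_vector_mult_def transpose_def sum_distrib_left)
  also have "\<dots> = (\<Sum>j\<in>UNIV. \<Sum>i\<in>UNIV. z $ i * (of_real (A $ j $ i) * of_real (\<xi> $ j)))" by (rule sum.swap)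
  also have "\<dots> = lin ((\<chi> i j. of_real (A $ i $ j)) *v z) \<xi>"
    by (simp add: lin_def matrix_vector_mult_def sum_distrib_left mult_ac)
  finally show ?thesis .
qed

text \<open>Substituting a transposed real matrix moves the matrix to the frequency of each linear form.\<close>

lemma polyd_transpose: "polyd n P \<Longrightarrow> polyd n (\<lambda>\<xi>. P (transpose A *v \<xi>))"
  by (induction rule: polyd.induct) (auto intro: polyd.intros simp: lin_transpose simp del: transpose_matrix_vector)

lemma finite_multiindices: "finite {\<alpha> :: 'd::finite \<Rightarrow> nat. (\<Sum>i\<in>UNIV. \<alpha> i) \<le> n}"
proof (rule finite_subset)
  show "{\<alpha> :: 'd \<Rightarrow> nat. (\<Sum>i\<in>UNIV. \<alpha> i) \<le> n} \<subseteq> PiE UNIV (\<lambda>_. {..n})"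
  proof (clarsimp simp: PiE_def Pi_def)
    fix \<alpha> :: "'d \<Rightarrow> nat" and i assume "sum \<alpha> UNIV \<le> n"
    then show "\<alpha> i \<le> n" using member_le_sum[of i UNIV \<alpha>] by simp
  qed
qed (auto intro: finite_PiE)

lemma poly_le_add: assumes "P \<in> poly_le n" "Q \<in> poly_le n" shows "(\<lambda>\<xi>. P \<xi> + Q \<xi>) \<in> poly_le n"
proof -
  obtain c d where P: "P = (\<lambda>\<xi>. \<Sum>\<alpha> | (\<Sum>i\<in>UNIV. \<alpha> i) \<le> n. c \<alpha> * (\<Prod>i\<in>UNIV. complex_of_real (\<xi> $ i) ^ \<alpha> i))"
    and Q: "Q = (\<lambda>\<xi>. \<Sum>\<alpha> | (\<Sum>i\<in>UNIV. \<alpha> i) \<le> n. d \<alpha> * (\<Prod>i\<in>UNIV. complex_of_real (\<xi> $ i) ^ \<alpha> i))"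
    using assms unfolding poly_le_def by auto
  show ?thesis unfolding poly_le_def P Q
    by (rule image_eqI[of _ _ "\<lambda>\<alpha>. c \<alpha> + d \<alpha>"]) (auto simp: distrib_right sum.distrib)
qed

lemma poly_le_scale: assumes "P \<in> poly_le n" shows "(\<lambda>\<xi>. a * P \<xi>) \<in> poly_le n"
proof -
  obtain c where P: "P = (\<lambda>\<xi>. \<Sum>\<alpha> | (\<Sum>i\<in>UNIV. \<alpha> i) \<le> n. c \<alpha> * (\<Prod>i\<in>UNIV. complex_of_real (\<xi> $ i) ^ \<alpha> i))"
    using assms unfolding poly_le_def by auto
  show ?thesis unfolding poly_le_def P
    by (rule image_eqI[of _ _ "\<lambda>\<alpha>. a * c \<alpha>"]) (auto simp: sum_distrib_left mult.assoc)
qed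

lemma poly_le_const: "(\<lambda>\<xi>. a) \<in> poly_le n"
proof -
  have "(\<Sum>\<alpha> | (\<Sum>i\<in>UNIV. \<alpha> i) \<le> n. (if \<alpha> = (\<lambda>_. 0) then a else 0) * (\<Prod>i\<in>UNIV. complex_of_real (\<xi> $ i) ^ \<alpha> i)) = a"
    for \<xi> :: "real ^ 'a"
    using finite_multiindices[of n, where 'd = 'a] by (simp add: if_distrib[of "\<lambda>x. x * _"] sum.delta cong: if_cong)
  then show ?thesis unfolding poly_le_def
    by (intro image_eqI[of _ _ "\<lambda>\<alpha>. if \<alpha> = (\<lambda>_. 0) then a else 0"]) auto
qed

lemma poly_le_coord: assumes "P \<in> poly_le n" shows "(\<lambda>\<xi>. of_real (\<xi> $ j) * P \<xi>) \<in> poly_le (Suc n)"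
proof -
  obtain c where P: "P = (\<lambda>\<xi>. \<Sum>\<alpha> | (\<Sum>i\<in>UNIV. \<alpha> i) \<le> n. c \<alpha> * (\<Prod>i\<in>UNIV. complex_of_real (\<xi> $ i) ^ \<alpha> i))"
    using assms unfolding poly_le_def by auto
  define up where "up \<alpha> = \<alpha>(j := Suc (\<alpha> j))" for \<alpha> :: "'a \<Rightarrow> nat"
  define c' where "c' \<beta> = (if \<beta> j > 0 then c (\<beta>(j := \<beta> j - 1)) else 0)" for \<beta>
  have upsum: "(\<Sum>i\<in>UNIV. up \<alpha> i) = Suc (\<Sum>i\<in>UNIV. \<alpha> i)" for \<alpha>
    unfolding up_def using sum.remove[of UNIV j "\<alpha>(j := Suc (\<alpha> j))"] sum.remove[of UNIV j \<alpha>] by simp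
  have upprod: "(\<Prod>i\<in>UNIV. complex_of_real (\<xi> $ i) ^ up \<alpha> i) = of_real (\<xi> $ j) * (\<Prod>i\<in>UNIV. complex_of_real (\<xi> $ i) ^ \<alpha> i)" for \<alpha> \<xi>
    unfolding up_def using prod.remove[of UNIV j "\<lambda>i. complex_of_real (\<xi> $ i) ^ (\<alpha>(j := Suc (\<alpha> j))) i"]
      prod.remove[of UNIV j "\<lambda>i. complex_of_real (\<xi> $ i) ^ \<alpha> i"] by simp
  have inj: "inj up" unfolding up_def inj_def by (auto simp: fun_eq_iff split: if_splits)
  have c'up: "c' (up \<alpha>) = c \<alpha>" for \<alpha> unfolding c'_def up_def by simp
  have "of_real (\<xi> $ j) * P \<xi> = (\<Sum>\<beta> | (\<Sum>i\<in>UNIV. \<beta> i) \<le> Suc n. c' \<beta> * (\<Prod>i\<in>UNIV. complex_of_real (\<xi> $ i) ^ \<beta> i))" for \<xi>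
  proof -
    have "(\<Sum>\<beta> | (\<Sum>i\<in>UNIV. \<beta> i) \<le> Suc n. c' \<beta> * (\<Prod>i\<in>UNIV. complex_of_real (\<xi> $ i) ^ \<beta> i))
      = (\<Sum>\<beta>\<in>up ` {\<alpha>. (\<Sum>i\<in>UNIV. \<alpha> i) \<le> n}. c' \<beta> * (\<Prod>i\<in>UNIV. complex_of_real (\<xi> $ i) ^ \<beta> i))"
    proof (rule sum.mono_neutral_right)
      show "up ` {\<alpha>. (\<Sum>i\<in>UNIV. \<alpha> i) \<le> n} \<subseteq> {\<beta>. (\<Sum>i\<in>UNIV. \<beta> i) \<le> Suc n}" using upsum by auto
      show "\<forall>\<beta>\<in>{\<beta>. (\<Sum>i\<in>UNIV. \<beta> i) \<le> Suc n} - up ` {\<alpha>. (\<Sum>i\<in>UNIV. \<alpha> i) \<le> n}.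
          c' \<beta> * (\<Prod>i\<in>UNIV. complex_of_real (\<xi> $ i) ^ \<beta> i) = 0"
      proof
        fix \<beta> assume b: "\<beta> \<in> {\<beta>. (\<Sum>i\<in>UNIV. \<beta> i) \<le> Suc n} - up ` {\<alpha>. (\<Sum>i\<in>UNIV. \<alpha> i) \<le> n}"
        have "\<not> \<beta> j > 0"
        proof
          assume "\<beta> j > 0"
          then have eq: "\<beta> = up (\<beta>(j := \<beta> j - 1))" unfolding up_def by simp
          then have "(\<Sum>i\<in>UNIV. (\<beta>(j := \<beta> j - 1)) i) \<le> n" using b upsum[of "\<beta>(j := \<beta> j - 1)"] by simp
          then have "\<beta> \<in> up ` {\<alpha>. (\<Sum>i\<in>UNIV. \<alpha> i) \<le> n}" using eq by blast
          then show False using b by blast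
        qed
        then show "c' \<beta> * (\<Prod>i\<in>UNIV. complex_of_real (\<xi> $ i) ^ \<beta> i) = 0" unfolding c'_def by simp
      qed
    qed (rule finite_multiindices)
    also have "\<dots> = (\<Sum>\<alpha> | (\<Sum>i\<in>UNIV. \<alpha> i) \<le> n. c \<alpha> * (of_real (\<xi> $ j) * (\<Prod>i\<in>UNIV. complex_of_real (\<xi> $ i) ^ \<alpha> i)))"
      using inj by (subst sum.reindex) (auto simp: inj_on_def inj_def c'up upprod)
    also have "\<dots> = of_real (\<xi> $ j) * P \<xi>" unfolding P by (simp add: sum_distrib_left mult_ac)
    finally show ?thesis by simp
  qed
  then show ?thesis unfolding poly_le_def by (intro image_eqI[of _ _ c']) auto
qed

lemma poly_le_sum: "(\<And>i. i \<in> I \<Longrightarrow> F i \<in> poly_le n) \<Longrightarrow> finite I \<Longrightarrow> (\<lambda>\<xi>. \<Sum>i\<in>I. F i \<xi>) \<in> poly_le n"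
  by (induction I rule: infinite_finite_induct) (auto intro: poly_le_add poly_le_const)

lemma polyd_imp_poly_le: "polyd m P \<Longrightarrow> m = Suc n \<Longrightarrow> P \<in> poly_le n"
proof (induction arbitrary: n rule: polyd.induct)
  case (mult m P z)
  show ?case
  proof (cases n)
    case 0
    then have "P = (\<lambda>\<xi>. 0)" using mult polyd_0 by auto
    then show ?thesis using poly_le_const[of 0 n] by simp
  next
    case (Suc k)
    have "(\<lambda>\<xi>. \<Sum>i\<in>UNIV. z $ i * (of_real (\<xi> $ i) * P \<xi>)) \<in> poly_le n"
      using mult Suc by (intro poly_le_sum poly_le_scale) (auto intro: poly_le_coord)
    then show ?thesis by (simp add: lin_def sum_distrib_right mult.assoc)
  qed
qed (auto intro: poly_le_const poly_le_add)

definition fdiff :: "real ^ 'd \<Rightarrow> (real ^ 'd \<Rightarrow> complex) \<Rightarrow> real ^ 'd \<Rightarrow> complex" where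
  "fdiff h P = (\<lambda>\<xi>. P (\<xi> + h) - P \<xi>)"

lemma polyd_fdiff: "polyd n P \<Longrightarrow> polyd (n - 1) (fdiff h P)"
proof (induction rule: polyd.induct)
  case (add n P Q)
  have "fdiff h (\<lambda>\<xi>. P \<xi> + Q \<xi>) = (\<lambda>\<xi>. fdiff h P \<xi> + fdiff h Q \<xi>)" by (auto simp: fdiff_def)
  then show ?case using add polyd.add by metis
next
  case (mult n P z)
  show ?case
  proof (cases n)
    case 0
    then have "P = (\<lambda>\<xi>. 0)" using mult polyd_0 by auto
    then show ?thesis by (simp add: fdiff_def polyd.zero)
  next
    case (Suc k)
    have eq: "fdiff h (\<lambda>\<xi>. lin z \<xi> * P \<xi>) = (\<lambda>\<xi>. lin z \<xi> * fdiff h P \<xi> + lin z h * (fdiff h P \<xi> + P \<xi>))"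
      by (auto simp: fdiff_def lin_add_right algebra_simps)
    have 1: "polyd (Suc k) (\<lambda>\<xi>. lin z \<xi> * fdiff h P \<xi>)" using mult Suc by (intro polyd.mult) auto
    have 2: "polyd (Suc k) (\<lambda>\<xi>. fdiff h P \<xi> + P \<xi>)" using mult Suc by (intro polyd.add) (auto intro: polyd_Suc)
    show ?thesis unfolding eq using polyd.add[OF 1 polyd_scale[OF 2]] Suc by simp
  qed
qed (auto simp: fdiff_def intro: polyd.zero)

text \<open>The first two terms of the binomial expansion; what is left is two degrees below the top.\<close>

lemma power_shift: "\<exists>R. polyd n R \<and> (\<forall>\<xi>. lin g (\<xi> + h) ^ Suc n = lin g \<xi> ^ Suc n + of_nat (Suc n) * lin g h * lin g \<xi> ^ n + R \<xi>)"
proof (induction n)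
  case 0 show ?case by (rule exI[of _ "\<lambda>\<xi>. 0"]) (simp add: polyd.zero lin_add_right)
next
  case (Suc n)
  then obtain R where R: "polyd n R" "\<And>\<xi>. lin g (\<xi> + h) ^ Suc n = lin g \<xi> ^ Suc n + of_nat (Suc n) * lin g h * lin g \<xi> ^ n + R \<xi>" by blast
  let ?c = "lin g h"
  define R' where "R' \<xi> = lin g \<xi> * R \<xi> + (?c * R \<xi> + (of_nat (Suc n) * ?c * ?c) * lin g \<xi> ^ n)" for \<xi>
  have "polyd (Suc n) R'" unfolding R'_def
    using R(1) by (intro polyd.add polyd.mult polyd_scale polyd_power polyd_Suc)
  moreover have "lin g (\<xi> + h) ^ Suc (Suc n) = lin g \<xi> ^ Suc (Suc n) + of_nat (Suc (Suc n)) * ?c * lin g \<xi> ^ Suc n + R' \<xi>" for \<xi>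
  proof -
    have "lin g (\<xi> + h) ^ Suc (Suc n) = (lin g \<xi> + ?c) * (lin g \<xi> ^ Suc n + of_nat (Suc n) * ?c * lin g \<xi> ^ n + R \<xi>)"
      unfolding power_Suc[of _ "Suc n"] R(2) by (simp add: lin_add_right)
    then show ?thesis unfolding R'_def by (simp add: algebra_simps)
  qed
  ultimately show ?case by blast
qed

text \<open>Differences lower the degree, so \<open>n\<close> of them remove everything below degree \<open>n\<close> and see only the leading term.\<close>

lemma fdiff_iterate: "polyd n q \<Longrightarrow> (fdiff h ^^ n) (\<lambda>\<xi>. a * lin g \<xi> ^ n + q \<xi>) = (\<lambda>\<xi>. a * fact n * lin g h ^ n)"
proof (induction n arbitrary: a q)
  case 0 then show ?case using polyd_0 by fastforce
next
  case (Suc n)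
  obtain R where R: "polyd n R" "\<And>\<xi>. lin g (\<xi> + h) ^ Suc n = lin g \<xi> ^ Suc n + of_nat (Suc n) * lin g h * lin g \<xi> ^ n + R \<xi>" using power_shift by blast
  have "fdiff h (\<lambda>\<xi>. a * lin g \<xi> ^ Suc n + q \<xi>) = (\<lambda>\<xi>. (a * of_nat (Suc n) * lin g h) * lin g \<xi> ^ n + (a * R \<xi> + fdiff h q \<xi>))"
    unfolding fdiff_def R(2) by (simp add: algebra_simps)
  moreover have "polyd n (\<lambda>\<xi>. a * R \<xi> + fdiff h q \<xi>)"
    using R(1) polyd_fdiff[OF Suc.prems, of h] by (intro polyd.add polyd_scale) auto
  ultimately have "(fdiff h ^^ Suc n) (\<lambda>\<xi>. a * lin g \<xi> ^ Suc n + q \<xi>) = (\<lambda>\<xi>. (a * of_nat (Suc n) * lin g h) * fact n * lin g h ^ n)"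
    unfolding funpow_Suc_right o_apply using Suc.IH by simp
  then show ?case by (simp add: fact_Suc mult_ac)
qed

text \<open>On this set \<open>n\<close> differences with step \<open>h\<close> of a function only involve its values on \<open>K\<close>.\<close>

definition stay :: "(real ^ 'd) set \<Rightarrow> nat \<Rightarrow> real ^ 'd \<Rightarrow> (real ^ 'd) set" where
  "stay K n h = {\<xi>. \<forall>j\<le>n. \<xi> + real j *\<^sub>R h \<in> K}"

lemma stay_Suc: "\<xi> \<in> stay K (Suc n) h \<Longrightarrow> \<xi> \<in> stay K n h \<and> \<xi> + h \<in> stay K n h"
proof -
  assume *: "\<xi> \<in> stay K (Suc n) h"
  have "\<xi> + h + real j *\<^sub>R h \<in> K" if "j \<le> n" for j
    using * that unfolding stay_def by (auto dest!: spec[of _ "Suc j"] simp: algebra_simps)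
  with * show ?thesis unfolding stay_def by auto
qed

lemma stay_0: "stay K 0 h = K" by (simp add: stay_def)

lemma stay_Int: "stay K n h = (\<Inter>j\<in>{..n}. (+) (- (real j *\<^sub>R h)) ` K)"
proof -
  have "\<xi> \<in> (+) (- (real j *\<^sub>R h)) ` K \<longleftrightarrow> \<xi> + real j *\<^sub>R h \<in> K" for \<xi> j
    by (auto simp: image_iff algebra_simps)
  then show ?thesis unfolding stay_def by auto
qed

lemma compact_stay: "compact K \<Longrightarrow> compact (stay K n h)"
  using compact_translation[of K] unfolding stay_Int by (intro compact_Inter) (blast, simp)

text \<open>Take an open neighbourhood of \<open>K\<close> of almost the same measure. For small steps each of the \<open>n + 1\<close> translates of \<open>K\<close> lies
  in it and misses less than the fraction \<open>1 / (2(n + 1))\<close> of the measure of \<open>K\<close>, so their intersection keeps half of it.\<close>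

lemma measure_stay:
  fixes K :: "(real ^ 'd) set"
  assumes K: "compact K" and pos: "measure lebesgue K > 0"
  shows "\<exists>r>0. \<forall>h. norm h \<le> r \<longrightarrow> measure lebesgue (stay K n h) \<ge> measure lebesgue K / 2"
proof -
  define m where "m = measure lebesgue K"
  define e where "e = m / (2 * real (Suc n))"
  have e: "e > 0" using pos unfolding e_def m_def by simp
  have Kl: "K \<in> lmeasurable" using K by (rule lmeasurable_compact)
  then have Ks: "K \<in> sets lebesgue" by blast
  obtain V where V: "open V" "K \<subseteq> V" "V - K \<in> lmeasurable" "emeasure lebesgue (V - K) < ennreal e"
    using sets_lebesgue_outer_open[OF Ks e] by blast
  have VK: "measure lebesgue (V - K) < e"
    using V(4) e emeasure_eq_measure2[OF V(3)] by (simp add: ennreal_less_iff)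
  have Vl: "V \<in> lmeasurable" using fmeasurable.Un[OF V(3) Kl] V(2) by (simp add: Un_absorb1 Un_commute)
  have mV: "measure lebesgue V = m + measure lebesgue (V - K)"
    unfolding m_def using measurable_measure_Diff[OF Vl Ks V(2)] by simp
  obtain \<rho> where \<rho>: "\<rho> > 0" "(\<Union>x\<in>K. ball x \<rho>) \<subseteq> V"
    using compact_subset_open_imp_ball_epsilon_subset[OF K V(1,2)] by blast
  define r where "r = \<rho> / (2 * real (Suc n))"
  have r: "r > 0" unfolding r_def using \<rho> by simp
  show ?thesis
  proof (intro exI[of _ r] conjI r allI impI)
    fix h :: "real ^ 'd" assume h: "norm h \<le> r"
    define Kj where "Kj j = (+) (- (real j *\<^sub>R h)) ` K" for j :: nat
    have Kjl: "Kj j \<in> lmeasurable" for j unfolding Kj_def using Kl by (rule measurable_translation)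
    have Kjm: "measure lebesgue (Kj j) = m" for j unfolding Kj_def m_def by (rule measure_translation)
    have KjV: "Kj j \<subseteq> V" if "j \<le> n" for j
    proof
      fix y assume "y \<in> Kj j"
      then obtain x where x: "x \<in> K" "y = x - real j *\<^sub>R h" unfolding Kj_def by auto
      have "norm (real j *\<^sub>R h) \<le> real n * r" using that h by (simp add: mult_mono)
      also have "\<dots> < \<rho>" unfolding r_def using \<rho> by (simp add: field_simps) (simp add: add_nonneg_pos)
      finally have "y \<in> ball x \<rho>" using x by (simp add: dist_norm)
      then show "y \<in> V" using \<rho> x by blast
    qed
    have st: "stay K n h = (\<Inter>j\<in>{..n}. Kj j)" unfolding stay_Int Kj_def ..
    have stl: "stay K n h \<in> lmeasurable" using compact_stay[OF K] by (rule lmeasurable_compact)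
    have stV: "stay K n h \<subseteq> V" using KjV[of 0] unfolding st by auto
    have Un: "V - stay K n h = (\<Union>j\<in>{..n}. V - Kj j)" unfolding st by auto
    have "measure lebesgue (V - stay K n h) \<le> (\<Sum>j\<le>n. measure lebesgue (V - Kj j))"
      unfolding Un using Vl Kjl by (intro measure_UNION_le) (auto intro: fmeasurable.Diff)
    also have "\<dots> = (\<Sum>j\<le>n. measure lebesgue (V - K))"
    proof (rule sum.cong)
      fix j assume "j \<in> {..n}"
      then have "measure lebesgue (V - Kj j) = measure lebesgue V - m"
        using measurable_measure_Diff[OF Vl fmeasurableD[OF Kjl] KjV] Kjm by simp
      then show "measure lebesgue (V - Kj j) = measure lebesgue (V - K)" using mV by simp
    qed simp
    also have "\<dots> \<le> real (Suc n) * e" using VK by simp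
    also have "\<dots> = m / 2" unfolding e_def by (simp add: field_simps)
    finally have "measure lebesgue (V - stay K n h) \<le> m / 2" .
    moreover have "measure lebesgue (V - stay K n h) = measure lebesgue V - measure lebesgue (stay K n h)"
      using measurable_measure_Diff[OF Vl fmeasurableD[OF stl] stV] by simp
    moreover have "measure lebesgue V \<ge> m" unfolding mV by simp
    ultimately show "measure lebesgue K / 2 \<le> measure lebesgue (stay K n h)" unfolding m_def by linarith
  qed
qed

definition mass :: "(real ^ 'd) set \<Rightarrow> (real ^ 'd \<Rightarrow> complex) \<Rightarrow> ennreal" where
  "mass X P = (\<integral>\<^sup>+\<xi>. ennreal ((cmod (P \<xi>))\<^sup>2) * indicator X \<xi> \<partial>lborel)"

lemma mass_translate:
  assumes [measurable]: "P \<in> borel_measurable borel" "X \<in> sets borel"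
  shows "(\<integral>\<^sup>+\<xi>. ennreal ((cmod (P (\<xi> + h)))\<^sup>2) * indicator X (\<xi> + h) \<partial>lborel) = mass X P"
proof -
  have "mass X P = (\<integral>\<^sup>+\<xi>. ennreal ((cmod (P \<xi>))\<^sup>2) * indicator X \<xi> \<partial>distr lborel borel ((+) h))"
    unfolding mass_def lborel_distr_plus ..
  also have "\<dots> = (\<integral>\<^sup>+\<xi>. ennreal ((cmod (P (h + \<xi>)))\<^sup>2) * indicator X (h + \<xi>) \<partial>lborel)"
    by (rule nn_integral_distr) measurable
  finally show ?thesis by (simp add: add.commute)
qed

lemma mass_fdiff:
  assumes P: "continuous_on UNIV P" and K: "compact K"
  shows "mass (stay K (Suc n) h) (fdiff h P) \<le> 4 * mass (stay K n h) P"
proof -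
  have [measurable]: "P \<in> borel_measurable borel" using P by (rule borel_measurable_continuous_onI)
  have [measurable]: "stay K n h \<in> sets borel" using compact_stay[OF K] by (simp add: compact_imp_closed borel_closed)
  have "mass (stay K (Suc n) h) (fdiff h P) \<le> (\<integral>\<^sup>+\<xi>. 2 * (ennreal ((cmod (P (\<xi> + h)))\<^sup>2) * indicator (stay K n h) (\<xi> + h)) + 2 * (ennreal ((cmod (P \<xi>))\<^sup>2) * indicator (stay K n h) \<xi>) \<partial>lborel)"
    unfolding mass_def
  proof (rule nn_integral_mono)
    fix \<xi>
    have "(cmod (P (\<xi> + h) - P \<xi>))\<^sup>2 \<le> (cmod (P (\<xi> + h)) + cmod (P \<xi>))\<^sup>2"
      by (intro power_mono norm_triangle_ineq4) auto
    also have "\<dots> \<le> 2 * (cmod (P (\<xi> + h)))\<^sup>2 + 2 * (cmod (P \<xi>))\<^sup>2"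
      using sum_squares_bound[of "cmod (P (\<xi> + h))" "cmod (P \<xi>)"] by (simp add: power2_sum)
    finally have "ennreal ((cmod (P (\<xi> + h) - P \<xi>))\<^sup>2) \<le> 2 * ennreal ((cmod (P (\<xi> + h)))\<^sup>2) + 2 * ennreal ((cmod (P \<xi>))\<^sup>2)"
      by (simp add: ennreal_plus[symmetric] ennreal_mult''[symmetric] ennreal_numeral[symmetric] del: ennreal_plus ennreal_numeral)
    then show "ennreal ((cmod (fdiff h P \<xi>))\<^sup>2) * indicator (stay K (Suc n) h) \<xi> \<le> 2 * (ennreal ((cmod (P (\<xi> + h)))\<^sup>2) * indicator (stay K n h) (\<xi> + h)) + 2 * (ennreal ((cmod (P \<xi>))\<^sup>2) * indicator (stay K n h) \<xi>)"
      using stay_Suc[of \<xi> K n h] unfolding fdiff_def by (auto simp: indicator_def)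
  qed
  also have "\<dots> = 2 * mass (stay K n h) P + 2 * mass (stay K n h) P"
    by (subst nn_integral_add) (auto simp: nn_integral_cmult mass_translate mass_def[symmetric])
  also have "\<dots> = 4 * mass (stay K n h) P"
    by (simp add: distrib_right[symmetric])
  finally show ?thesis .
qed

lemma fdiff_continuous: "continuous_on UNIV P \<Longrightarrow> continuous_on UNIV (fdiff h P)"
  unfolding fdiff_def
  by (intro continuous_intros) (auto intro!: continuous_on_compose2[of UNIV P] continuous_intros)

lemma mass_fdiff_iterate:
  assumes K: "compact K"
  shows "continuous_on UNIV P \<Longrightarrow> mass (stay K n h) ((fdiff h ^^ n) P) \<le> 4 ^ n * mass K P \<and> continuous_on UNIV ((fdiff h ^^ n) P)"
proof (induction n)
  case 0 then show ?case by (simp add: stay_0)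
next
  case (Suc n)
  then have IH: "mass (stay K n h) ((fdiff h ^^ n) P) \<le> 4 ^ n * mass K P" "continuous_on UNIV ((fdiff h ^^ n) P)" by auto
  have "mass (stay K (Suc n) h) (fdiff h ((fdiff h ^^ n) P)) \<le> 4 * mass (stay K n h) ((fdiff h ^^ n) P)"
    using IH(2) K by (rule mass_fdiff)
  also have "\<dots> \<le> 4 * (4 ^ n * mass K P)" using IH(1) by (rule mult_left_mono) simp
  finally show ?case using fdiff_continuous[OF IH(2)] by (simp add: mult.assoc)
qed

lemma mass_const: "X \<in> sets borel \<Longrightarrow> mass X (\<lambda>\<xi>. c) = ennreal ((cmod c)\<^sup>2) * emeasure lborel X"
  by (simp add: mass_def nn_integral_cmult_indicator)

text \<open>Nondegeneracy: without some mass of positive Lebesgue measure, polynomials and differences of characters could vanish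
  in \<open>L\<^sup>2(\<mu>)\<close>.\<close>

locale ac_measure = exp_measure \<mu> for \<mu> :: "(real ^ 'd) measure" +
  assumes lower: "\<exists>K \<delta>. compact K \<and> measure lebesgue K > 0 \<and> \<delta> > 0 \<and>
     (\<forall>g\<in>borel_measurable borel. ennreal \<delta> * (\<integral>\<^sup>+\<xi>. g \<xi> * indicator K \<xi> \<partial>lborel) \<le> (\<integral>\<^sup>+\<xi>. g \<xi> \<partial>\<mu>))"
begin

text \<open>Each difference at most doubles the \<open>L\<^sup>2\<close> norm on a set that shrinks a little, and the final set still has half of the
  measure of \<open>K\<close>. Hence if \<open>n\<close> differences give a function of constant modulus \<open>c\<close>, the original function is not small.\<close>

lemma difference_bound:
  obtains r M where "r > 0" "M > 0" "\<And>h P c. norm h \<le> r \<Longrightarrow> P \<in> exp_type \<Longrightarrow> continuous_on UNIV P \<Longrightarrow>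
     (\<And>\<xi>. cmod ((fdiff h ^^ n) P \<xi>) = c) \<Longrightarrow> c \<le> M * nr P"
proof -
  obtain K \<delta> where K: "compact K" "measure lebesgue K > 0" "\<delta> > 0"
    and low: "\<And>g. g \<in> borel_measurable borel \<Longrightarrow> ennreal \<delta> * (\<integral>\<^sup>+\<xi>. g \<xi> * indicator K \<xi> \<partial>lborel) \<le> (\<integral>\<^sup>+\<xi>. g \<xi> \<partial>\<mu>)"
    using lower by blast
  obtain r where r: "r > 0" "\<And>h. norm h \<le> r \<Longrightarrow> measure lebesgue (stay K n h) \<ge> measure lebesgue K / 2"
    using measure_stay[OF K(1,2)] by blast
  define m where "m = measure lebesgue K / 2"
  define M where "M = sqrt (4 ^ n / (\<delta> * m))"
  have m: "m > 0" unfolding m_def using K by simp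
  have M: "M > 0" unfolding M_def using m K by simp
  have "c \<le> M * nr P" if h: "norm h \<le> r" and P: "P \<in> exp_type" "continuous_on UNIV P"
    and c: "\<And>\<xi>. cmod ((fdiff h ^^ n) P \<xi>) = c" for h P c
  proof -
    let ?T = "stay K n h"
    have c0: "c \<ge> 0" using c[of 0] by (metis norm_ge_zero)
    have Tb: "?T \<in> sets borel" using compact_stay[OF K(1)] by (simp add: compact_imp_closed borel_closed)
    have Tl: "emeasure lborel ?T = ennreal (measure lebesgue ?T)"
      using emeasure_eq_measure2[OF lmeasurable_compact[OF compact_stay[OF K(1)]], of n h] Tb by simp
    have mass1: "mass ?T ((fdiff h ^^ n) P) = ennreal (c\<^sup>2) * ennreal (measure lebesgue ?T)"
      using mass_const[OF Tb, of "of_real c"] c c0 unfolding mass_def Tl by simp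
    have Pm [measurable]: "P \<in> borel_measurable borel" using P(2) by (rule borel_measurable_continuous_onI)
    have "(\<integral>\<^sup>+\<xi>. ennreal ((cmod (P \<xi>))\<^sup>2) \<partial>\<mu>) = ennreal ((nr P)\<^sup>2)"
      unfolding nr_sq by (rule nn_integral_eq_integral) (auto intro: integrable_norm_sq P)
    then have 2: "ennreal \<delta> * mass K P \<le> ennreal ((nr P)\<^sup>2)"
      using low[of "\<lambda>\<xi>. ennreal ((cmod (P \<xi>))\<^sup>2)"] unfolding mass_def by simp
    have "ennreal (\<delta> * (c\<^sup>2 * m)) \<le> ennreal \<delta> * (ennreal (c\<^sup>2) * ennreal (measure lebesgue ?T))"
      using r(2)[OF h] K m unfolding m_def[symmetric]
      by (simp add: ennreal_mult[symmetric] ennreal_leI mult_left_mono)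
    also have "\<dots> \<le> ennreal \<delta> * (4 ^ n * mass K P)"
      unfolding mass1[symmetric] using mass_fdiff_iterate[OF K(1) P(2)] by (intro mult_left_mono) auto
    also have "\<dots> = 4 ^ n * (ennreal \<delta> * mass K P)" by (simp add: mult_ac)
    also have "\<dots> \<le> 4 ^ n * ennreal ((nr P)\<^sup>2)" using 2 by (rule mult_left_mono) simp
    also have "\<dots> = ennreal (4 ^ n * (nr P)\<^sup>2)" by (simp add: ennreal_mult ennreal_power[symmetric])
    finally have "\<delta> * (c\<^sup>2 * m) \<le> 4 ^ n * (nr P)\<^sup>2" by (simp add: ennreal_le_iff)
    then have "c\<^sup>2 \<le> 4 ^ n / (\<delta> * m) * (nr P)\<^sup>2" using K m by (simp add: field_simps)
    also have "\<dots> = (M * nr P)\<^sup>2" unfolding M_def power_mult_distrib using K m by simp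
    finally show ?thesis using M nr_nonneg[of P] by (meson less_imp_le mult_nonneg_nonneg power2_le_imp_le)
  qed
  with r(1) M show thesis by (rule that)
qed

text \<open>The \<open>n\<close>-th difference of the polynomial is the constant \<open>n! \<langle>g,h\<rangle>\<^sup>n\<close> whatever \<open>q\<close> is; so the leading power
  keeps a positive distance from the polynomials of lower degree.\<close>

lemma leading_power_bounded_below:
  assumes g: "g \<noteq> 0"
  shows "\<exists>\<epsilon>>0. \<forall>q. polyd n q \<longrightarrow> nr (\<lambda>\<xi>. lin g \<xi> ^ n + q \<xi>) \<ge> \<epsilon>"
proof -
  obtain r M where rM: "r > 0" "M > 0" "\<And>h P c. norm h \<le> r \<Longrightarrow> P \<in> exp_type \<Longrightarrow> continuous_on UNIV P \<Longrightarrow>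
     (\<And>\<xi>. cmod ((fdiff h ^^ n) P \<xi>) = c) \<Longrightarrow> c \<le> M * nr P" using difference_bound by blast
  obtain i where i: "g $ i \<noteq> 0" using g by (auto simp: vec_eq_iff)
  define h :: "real ^ 'd" where "h = r *\<^sub>R axis i 1"
  have h: "norm h \<le> r" using rM(1) by (simp add: h_def)
  have "lin g h = g $ i * of_real r"
    unfolding lin_def h_def axis_def by (simp add: if_distrib[of "\<lambda>x. _ * x"] if_distrib[of of_real] cong: if_cong)
  then have nz: "lin g h \<noteq> 0" using i rM(1) by simp
  let ?c = "cmod (fact n * lin g h ^ n)"
  have "?c \<le> M * nr (\<lambda>\<xi>. lin g \<xi> ^ n + q \<xi>)" if q: "polyd n q" for q
  proof (rule rM(3)[OF h])
    have P: "polyd (Suc n) (\<lambda>\<xi>. lin g \<xi> ^ n + q \<xi>)" by (intro polyd.add polyd_power polyd_Suc q)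
    show "(\<lambda>\<xi>. lin g \<xi> ^ n + q \<xi>) \<in> exp_type" "continuous_on UNIV (\<lambda>\<xi>. lin g \<xi> ^ n + q \<xi>)"
      using P polyd_exp_type polyd_continuous by auto
    show "cmod ((fdiff h ^^ n) (\<lambda>\<xi>. lin g \<xi> ^ n + q \<xi>) \<xi>) = ?c" for \<xi>
      using fdiff_iterate[OF q, of h 1 g] by simp
  qed
  then have "?c / M \<le> nr (\<lambda>\<xi>. lin g \<xi> ^ n + q \<xi>)" if "polyd n q" for q
    using that rM(2) by (simp add: field_simps)
  moreover have "?c / M > 0" using nz rM(2) by simp
  ultimately show ?thesis by blast
qed

lemma lin_norm_pos: "g \<noteq> 0 \<Longrightarrow> nr (lin g) > 0"
  using leading_power_bounded_below[of g 1] polyd.zero[of 1] by fastforce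

text \<open>Characters that are close in \<open>L\<^sup>2\<close> have close frequencies, at least linearly: one difference of \<open>e\<^sub>y - 1\<close> with step
  \<open>h\<close> has the constant modulus \<open>|e\<^sub>y(h) - 1|\<close>.\<close>

lemma character_separation:
  "\<exists>C>0. \<exists>\<epsilon>>0. \<forall>y. nr (\<lambda>\<xi>. ch (cx y) \<xi> - 1) < \<epsilon> \<longrightarrow> norm y \<le> C * nr (\<lambda>\<xi>. ch (cx y) \<xi> - 1)"
proof -
  obtain r M where rM: "r > 0" "M > 0" "\<And>h P c. norm h \<le> r \<Longrightarrow> P \<in> exp_type \<Longrightarrow> continuous_on UNIV P \<Longrightarrow>
     (\<And>\<xi>. cmod ((fdiff h ^^ 1) P \<xi>) = c) \<Longrightarrow> c \<le> M * nr P" using difference_bound by blast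
  have *: "cmod (exp (\<i> * of_real (2 * pi * (y \<bullet> h))) - 1) \<le> M * nr (\<lambda>\<xi>. ch (cx y) \<xi> - 1)" if h: "norm h \<le> r" for y h
  proof (rule rM(3)[OF h])
    show "(\<lambda>\<xi>. ch (cx y) \<xi> - 1) \<in> exp_type" by (intro exp_type_intros)
    show "continuous_on UNIV (\<lambda>\<xi>. ch (cx y) \<xi> - 1)" unfolding ch_cx by (intro continuous_intros)
    fix \<xi>
    have "(fdiff h ^^ 1) (\<lambda>\<xi>. ch (cx y) \<xi> - 1) \<xi> = ch (cx y) \<xi> * (exp (\<i> * of_real (2 * pi * (y \<bullet> h))) - 1)"
      by (simp add: fdiff_def ch_cx inner_add_right algebra_simps exp_add)
    then show "cmod ((fdiff h ^^ 1) (\<lambda>\<xi>. ch (cx y) \<xi> - 1) \<xi>) = cmod (exp (\<i> * of_real (2 * pi * (y \<bullet> h))) - 1)"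
      by (simp only: norm_mult norm_ch_cx mult_1_left)
  qed
  define C where "C = 8 * M / r"
  have "norm y \<le> C * nr (\<lambda>\<xi>. ch (cx y) \<xi> - 1)" if small: "nr (\<lambda>\<xi>. ch (cx y) \<xi> - 1) < 1 / M" for y
  proof (cases "y = 0")
    case True then show ?thesis using rM nr_nonneg by (simp add: C_def)
  next
    case False
    define N where "N = nr (\<lambda>\<xi>. ch (cx y) \<xi> - 1)"
    have yp: "norm y > 0" using False by simp
    \<comment> \<open>Otherwise some admissible step h has \<open>y \<bullet> h = 1/2\<close>, where the character takes the value -1.\<close>
    have yr: "norm y * r < 1/2"
    proof (rule ccontr)
      assume "\<not> norm y * r < 1/2"
      then have n: "norm ((1 / (2 * (norm y)\<^sup>2)) *\<^sub>R y) \<le> r" using yp by (simp add: field_simps power2_eq_square)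
      have "y \<bullet> ((1 / (2 * (norm y)\<^sup>2)) *\<^sub>R y) = 1/2" using yp by (simp add: power2_norm_eq_inner[symmetric])
      then have "cmod (exp (\<i> * of_real pi) - 1) \<le> M * N" using *[OF n, of y] unfolding N_def by simp
      moreover have "exp (\<i> * of_real pi) = - 1" using exp_pi_i by (simp add: mult.commute)
      ultimately have "2 \<le> M * N" by simp
      moreover have "M * N < 1" using small rM(2) unfolding N_def by (simp add: field_simps)
      ultimately show False by simp
    qed
    \<comment> \<open>The step of length r/8 along y gives a phase so small that its character differs from 1 by about the phase itself.\<close>
    define s where "s = 2 * pi * (r / 8 * norm y)"
    have s: "s \<ge> 0" "s \<le> 1/2"
    proof -
      have "s = pi / 4 * (norm y * r)" by (simp add: s_def)
      also have "\<dots> \<le> 1 * (1/2)" using yr rM pi_less_4 by (intro mult_mono) auto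
      finally show "s \<le> 1/2" by simp
    qed (use rM in \<open>simp add: s_def\<close>)
    have n: "norm ((r / 8 / norm y) *\<^sub>R y) \<le> r" using yp rM by simp
    have "y \<bullet> ((r / 8 / norm y) *\<^sub>R y) = r / 8 * norm y"
      using yp by (simp add: power2_norm_eq_inner[symmetric] power2_eq_square)
    then have "2 * pi * (y \<bullet> ((r / 8 / norm y) *\<^sub>R y)) = s" by (simp only: s_def)
    then have b: "cmod (exp (\<i> * of_real s) - 1) \<le> M * N" using *[OF n, of y] unfolding N_def by simp
    have "cmod (exp (\<i> * of_real s) - (\<Sum>k\<le>1. (\<i> * of_real s) ^ k / fact k)) \<le> exp \<bar>Re (\<i> * of_real s)\<bar> * cmod (\<i> * of_real s) ^ Suc 1 / fact 1" by (rule Taylor_exp)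
    then have t: "cmod (exp (\<i> * of_real s) - 1 - \<i> * of_real s) \<le> s\<^sup>2"
      using s by (simp add: algebra_simps norm_mult power2_eq_square)
    have "s = cmod (\<i> * of_real s)" using s by (simp add: norm_mult)
    also have "\<dots> \<le> cmod (exp (\<i> * of_real s) - 1) + cmod (exp (\<i> * of_real s) - 1 - \<i> * of_real s)"
      using norm_triangle_ineq4[of "exp (\<i> * of_real s) - 1" "exp (\<i> * of_real s) - 1 - \<i> * of_real s"] by simp
    also have "\<dots> \<le> M * N + s\<^sup>2" using b t by simp
    also have "s\<^sup>2 \<le> 1/2 * s" unfolding power2_eq_square using s by (intro mult_right_mono)
    finally have "s \<le> 2 * (M * N)" by simp
    then have "pi / 2 * (r * norm y) \<le> 4 * (M * N)" unfolding s_def by simp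
    moreover have "1 * (r * norm y) \<le> pi / 2 * (r * norm y)" using pi_ge_two rM by (intro mult_right_mono) auto
    ultimately have "r * norm y \<le> 8 * (M * N)" using rM nr_nonneg by (smt (verit) N_def mult_nonneg_nonneg)
    then show ?thesis unfolding C_def N_def using rM by (simp add: field_simps)
  qed
  moreover have "C > 0" "1 / M > 0" unfolding C_def using rM by auto
  ultimately show ?thesis by blast
qed

end

context exp_measure begin

lemma bf_has_derivative:
  assumes L: "bounded_functional L" and \<phi>: "\<phi> \<in> exp_type"
  shows "((\<lambda>z. L (\<lambda>\<xi>. ch z \<xi> * \<phi> \<xi>)) has_derivative
      (\<lambda>\<eta>. 2 * of_real pi * \<i> * L (\<lambda>\<xi>. lin \<eta> \<xi> * (ch z \<xi> * \<phi> \<xi>)))) (at z)"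
proof -
  obtain K where K: "K \<ge> 0" "\<And>\<eta>. norm \<eta> \<le> 1 \<Longrightarrow>
    cmod (L (\<lambda>\<xi>. ch (z + \<eta>) \<xi> * \<phi> \<xi>) - L (\<lambda>\<xi>. ch z \<xi> * \<phi> \<xi>)
      - 2 * of_real pi * \<i> * L (\<lambda>\<xi>. lin \<eta> \<xi> * (ch z \<xi> * \<phi> \<xi>))) \<le> K * (norm \<eta>)\<^sup>2"
    using bf_expansion[OF L \<phi>, of z] by blast
  have m: "(\<lambda>\<xi>. ch z \<xi> * \<phi> \<xi>) \<in> exp_type" by (intro exp_type_intros \<phi>)
  show ?thesis
  proof (rule has_derivativeI_sandwich[of 1])
    have "linear (\<lambda>\<eta>. 2 * of_real pi * \<i> * L (\<lambda>\<xi>. lin \<eta> \<xi> * (ch z \<xi> * \<phi> \<xi>)))"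
      unfolding bf_lin_sum[OF L m]
      by (rule linearI) (auto simp: algebra_simps sum.distrib sum_distrib_left scaleR_sum_right)
    then show "bounded_linear (\<lambda>\<eta>. 2 * of_real pi * \<i> * L (\<lambda>\<xi>. lin \<eta> \<xi> * (ch z \<xi> * \<phi> \<xi>)))"
      by (simp add: linear_conv_bounded_linear)
    show "((\<lambda>y. K * norm (y - z)) \<longlongrightarrow> 0) (at z)"
      by (auto intro!: tendsto_eq_intros)
    fix y assume y: "y \<noteq> z" "dist y z < 1"
    then have "cmod (L (\<lambda>\<xi>. ch (z + (y - z)) \<xi> * \<phi> \<xi>) - L (\<lambda>\<xi>. ch z \<xi> * \<phi> \<xi>)
      - 2 * of_real pi * \<i> * L (\<lambda>\<xi>. lin (y - z) \<xi> * (ch z \<xi> * \<phi> \<xi>))) \<le> K * (norm (y - z))\<^sup>2"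
      by (intro K(2)) (simp add: dist_norm)
    then show "norm (L (\<lambda>\<xi>. ch y \<xi> * \<phi> \<xi>) - L (\<lambda>\<xi>. ch z \<xi> * \<phi> \<xi>)
      - 2 * of_real pi * \<i> * L (\<lambda>\<xi>. lin (y - z) \<xi> * (ch z \<xi> * \<phi> \<xi>))) / norm (y - z) \<le> K * norm (y - z)"
      using y by (simp add: divide_le_eq power2_eq_square mult.assoc)
  qed simp
qed

lemma bf_curve:
  fixes F :: "complex \<Rightarrow> complex ^ 'd"
  assumes L: "bounded_functional L" and \<phi>: "\<phi> \<in> exp_type"
    and F: "\<And>i. ((\<lambda>t. F t $ i) has_field_derivative D $ i) (at t)"
  shows "((\<lambda>t. L (\<lambda>\<xi>. ch (F t) \<xi> * \<phi> \<xi>)) has_field_derivative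
     2 * of_real pi * \<i> * L (\<lambda>\<xi>. lin D \<xi> * (ch (F t) \<xi> * \<phi> \<xi>))) (at t)"
proof -
  have m: "(\<lambda>\<xi>. ch (F t) \<xi> * \<phi> \<xi>) \<in> exp_type" by (intro exp_type_intros \<phi>)
  have Fd: "(F has_derivative (\<lambda>h. h *s D)) (at t)"
  proof (subst has_derivative_componentwise_within, rule ballI)
    fix b :: "complex ^ 'd" assume "b \<in> Basis"
    then obtain i c where b: "b = axis i c" unfolding Basis_vec_def by auto
    have "(*) (D $ i) = (\<lambda>h. h * D $ i)" by (simp add: fun_eq_iff)
    then have "((\<lambda>t. F t $ i) has_derivative (\<lambda>h. h * D $ i)) (at t)"
      using F[of i] unfolding has_field_derivative_def by simp
    then show "((\<lambda>x. F x \<bullet> b) has_derivative (\<lambda>x. (x *s D) \<bullet> b)) (at t)"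
      unfolding b inner_axis by (auto intro!: derivative_eq_intros)
  qed
  have "((\<lambda>z. L (\<lambda>\<xi>. ch z \<xi> * \<phi> \<xi>)) \<circ> F has_derivative
      (\<lambda>\<eta>. 2 * of_real pi * \<i> * L (\<lambda>\<xi>. lin \<eta> \<xi> * (ch (F t) \<xi> * \<phi> \<xi>))) \<circ> (\<lambda>h. h *s D)) (at t)"
    by (rule diff_chain_at[OF Fd bf_has_derivative[OF L \<phi>]])
  moreover have "L (\<lambda>\<xi>. lin (h *s D) \<xi> * (ch (F t) \<xi> * \<phi> \<xi>)) = h * L (\<lambda>\<xi>. lin D \<xi> * (ch (F t) \<xi> * \<phi> \<xi>))" for h
    using bf_scale[OF L, of "\<lambda>\<xi>. lin D \<xi> * (ch (F t) \<xi> * \<phi> \<xi>)" h] m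
    by (simp add: lin_scale mult.assoc exp_type_mult[OF exp_type_lin m])
  ultimately have "((\<lambda>x. L (\<lambda>\<xi>. ch (F x) \<xi> * \<phi> \<xi>)) has_derivative
      (\<lambda>h. 2 * of_real pi * \<i> * (h * L (\<lambda>\<xi>. lin D \<xi> * (ch (F t) \<xi> * \<phi> \<xi>))))) (at t)" unfolding o_def by simp
  moreover have "(\<lambda>h. 2 * of_real pi * \<i> * (h * L (\<lambda>\<xi>. lin D \<xi> * (ch (F t) \<xi> * \<phi> \<xi>))))
      = (*) (2 * of_real pi * \<i> * L (\<lambda>\<xi>. lin D \<xi> * (ch (F t) \<xi> * \<phi> \<xi>)))"
    by (simp add: fun_eq_iff mult_ac)
  ultimately show ?thesis unfolding has_field_derivative_def by simp
qed

lemma bf_line: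
  assumes L: "bounded_functional L" and \<phi>: "\<phi> \<in> exp_type"
  shows "((\<lambda>t. L (\<lambda>\<xi>. ch (z + t *s v) \<xi> * \<phi> \<xi>)) has_field_derivative
     2 * of_real pi * \<i> * L (\<lambda>\<xi>. ch (z + t *s v) \<xi> * (lin v \<xi> * \<phi> \<xi>))) (at t)"
proof -
  have "((\<lambda>t. (z + t *s v) $ i) has_field_derivative v $ i) (at t)" for i
    by (auto intro!: derivative_eq_intros)
  from bf_curve[OF L \<phi>, of "\<lambda>t. z + t *s v", OF this] show ?thesis
    by (simp add: mult.left_commute)
qed

end

section \<open>Functions that are holomorphic on complex lines\<close>

text \<open>Holomorphy on all complex lines suffices for the identity theorem below, and needs only functions of one variable.\<close>

definition line_holo :: "(complex ^ 'd \<Rightarrow> complex) \<Rightarrow> bool" where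
  "line_holo G \<longleftrightarrow> (\<forall>z v. (\<lambda>s. G (z + s *s v)) holomorphic_on UNIV)"

lemma line_holo_const: "line_holo (\<lambda>z. c)" by (simp add: line_holo_def)
lemma line_holo_add: "line_holo F \<Longrightarrow> line_holo G \<Longrightarrow> line_holo (\<lambda>z. F z + G z)"
  by (simp add: line_holo_def holomorphic_on_add)
lemma line_holo_diff: "line_holo F \<Longrightarrow> line_holo G \<Longrightarrow> line_holo (\<lambda>z. F z - G z)"
  by (simp add: line_holo_def holomorphic_on_diff)
lemma line_holo_mult: "line_holo F \<Longrightarrow> line_holo G \<Longrightarrow> line_holo (\<lambda>z. F z * G z)"
  by (simp add: line_holo_def holomorphic_on_mult)
lemma line_holo_sum: "(\<And>i. i \<in> I \<Longrightarrow> line_holo (F i)) \<Longrightarrow> line_holo (\<lambda>z. \<Sum>i\<in>I. F i z)"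
  by (induction I rule: infinite_finite_induct) (auto intro: line_holo_add line_holo_const)
lemma line_holo_prod: "(\<And>i. i \<in> I \<Longrightarrow> line_holo (F i)) \<Longrightarrow> line_holo (\<lambda>z. \<Prod>i\<in>I. F i z)"
  by (induction I rule: infinite_finite_induct) (auto intro: line_holo_mult line_holo_const)
lemma line_holo_det: "(\<And>i j. line_holo (\<lambda>z. M z $ i $ j)) \<Longrightarrow> line_holo (\<lambda>z. det (M z))"
  unfolding det_def by (intro line_holo_sum line_holo_mult line_holo_prod line_holo_const)

lemma entire_real_zero:
  fixes h :: "complex \<Rightarrow> complex"
  assumes h: "h holomorphic_on UNIV" and e: "e > 0" and z: "\<And>s. \<bar>s\<bar> < e \<Longrightarrow> h (of_real s) = 0"
  shows "h w = 0"
proof (rule analytic_continuation[OF h, of "of_real ` {s. \<bar>s\<bar> < e}" 0])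
  show "0 islimpt (complex_of_real ` {s. \<bar>s\<bar> < e})"
    unfolding islimpt_approachable
  proof (intro allI impI)
    fix d :: real assume d: "d > 0"
    then show "\<exists>x'\<in>complex_of_real ` {s. \<bar>s\<bar> < e}. x' \<noteq> 0 \<and> dist x' 0 < d"
      using e by (intro bexI[of _ "of_real (min d e / 2)"] imageI) (auto simp del: of_real_divide)
  qed
qed (use z in auto)

text \<open>The real points of \<open>U\<close> are a set of uniqueness: by the identity theorem on the lines \<open>x + \<complex> y\<close> the function
  vanishes at \<open>x + \<i> y\<close> for \<open>x \<in> U\<close> and real \<open>y\<close>, and then on the lines in a real direction through \<open>p + \<i> y\<close>.\<close>

lemma line_holo_real_zero:
  assumes G: "line_holo G" and U: "open U" "p \<in> U" and z: "\<And>x. x \<in> U \<Longrightarrow> G (cx x) = 0"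
  shows "G w = 0"
proof -
  have small: "\<exists>e>0. \<forall>s. \<bar>s\<bar> < e \<longrightarrow> x + s *\<^sub>R y \<in> U" if x: "x \<in> U" for x y
  proof -
    obtain r where r: "r > 0" "ball x r \<subseteq> U" using openE[OF U(1) x] by blast
    show ?thesis
    proof (intro exI[of _ "r / (norm y + 1)"] conjI allI impI)
      show "r / (norm y + 1) > 0" using r by (simp add: add_nonneg_pos)
      fix s :: real assume "\<bar>s\<bar> < r / (norm y + 1)"
      then have "\<bar>s\<bar> * (norm y + 1) < r" by (simp add: pos_less_divide_eq add_nonneg_pos)
      then have "norm (s *\<^sub>R y) < r" by (simp add: distrib_left)
      then show "x + s *\<^sub>R y \<in> U" using r by (auto simp: dist_norm subset_iff)
    qed
  qed
  have 1: "G (cx x + \<i> *s cx y) = 0" if x: "x \<in> U" for x y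
  proof -
    obtain e where e: "e > 0" "\<And>s. \<bar>s\<bar> < e \<Longrightarrow> x + s *\<^sub>R y \<in> U" using small[OF x] by blast
    show ?thesis
    proof (rule entire_real_zero[of "\<lambda>s. G (cx x + s *s cx y)" e])
      show "(\<lambda>s. G (cx x + s *s cx y)) holomorphic_on UNIV" using G unfolding line_holo_def by blast
      show "G (cx x + of_real s *s cx y) = 0" if "\<bar>s\<bar> < e" for s
        using z[OF e(2)[OF that]] by (simp add: cx_add cx_scale)
    qed (rule e(1))
  qed
  define x where "x = (\<chi> i. Re (w $ i)) - p"
  define y where "y = (\<chi> i. Im (w $ i))"
  obtain e where e: "e > 0" "\<And>s. \<bar>s\<bar> < e \<Longrightarrow> p + s *\<^sub>R x \<in> U" using small[OF U(2)] by blast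
  have "G ((cx p + \<i> *s cx y) + 1 *s cx x) = 0"
  proof (rule entire_real_zero[of "\<lambda>s. G ((cx p + \<i> *s cx y) + s *s cx x)" e])
    show "(\<lambda>s. G ((cx p + \<i> *s cx y) + s *s cx x)) holomorphic_on UNIV" using G unfolding line_holo_def by blast
    show "G ((cx p + \<i> *s cx y) + of_real s *s cx x) = 0" if "\<bar>s\<bar> < e" for s
      using 1[OF e(2)[OF that], of y] by (simp add: cx_add cx_scale add_ac)
  qed (rule e(1))
  moreover have "(cx p + \<i> *s cx y) + 1 *s cx x = w"
    by (simp add: vec_eq_iff cx_def x_def y_def complex_eq_iff)
  ultimately show ?thesis by simp
qed

section \<open>Bounded forms that map characters to characters\<close>

text \<open>\<open>\<Phi>\<close> plays the role of a bounded operator on \<open>L\<^sup>2(\<mu>)\<close> that sends the character \<open>e\<^sub>x\<close> to \<open>e\<^sub>f\<^sub>(\<^sub>x\<^sub>)\<close> for \<open>x \<in> U\<close>,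
  paired with a second function.\<close>

locale bounded_form = ac_measure \<mu> for \<mu> :: "(real ^ 'd) measure" +
  fixes \<Phi> :: "(real ^ 'd \<Rightarrow> complex) \<Rightarrow> (real ^ 'd \<Rightarrow> complex) \<Rightarrow> complex" and C\<^sub>0 :: real
    and U :: "(real ^ 'd) set" and f :: "real ^ 'd \<Rightarrow> real ^ 'd"
  assumes bf_left: "\<And>\<psi>. \<psi> \<in> exp_type \<Longrightarrow> bounded_functional (\<lambda>\<phi>. \<Phi> \<phi> \<psi>)"
    and bf_right: "\<And>\<phi>. \<phi> \<in> exp_type \<Longrightarrow> bounded_functional (\<lambda>\<psi>. \<Phi> \<phi> \<psi>)"
    and C0: "C\<^sub>0 \<ge> 0"
    and Phi_bound: "\<And>\<phi> \<psi>. \<phi> \<in> exp_type \<Longrightarrow> \<psi> \<in> exp_type \<Longrightarrow> cmod (\<Phi> \<phi> \<psi>) \<le> C\<^sub>0 * nr \<phi> * nr \<psi>"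
    and open_U: "open U"
    and Phi_ch: "\<And>x \<psi>. x \<in> U \<Longrightarrow> \<psi> \<in> exp_type \<Longrightarrow> \<Phi> (ch (cx x)) \<psi> = bil (ch (cx (f x))) \<psi>"
begin

text \<open>The operator behind \<open>\<Phi>\<close> applied to \<open>e\<^sub>z P\<close> and paired with \<open>\<psi>\<close>; as a function of \<open>z\<close> it is entire on lines.\<close>

definition u :: "complex ^ 'd \<Rightarrow> (real ^ 'd \<Rightarrow> complex) \<Rightarrow> (real ^ 'd \<Rightarrow> complex) \<Rightarrow> complex" where
  "u z P \<psi> = \<Phi> (\<lambda>\<xi>. ch z \<xi> * P \<xi>) \<psi>"

abbreviation one :: "real ^ 'd \<Rightarrow> complex" where "one \<equiv> (\<lambda>\<xi>. 1)"

lemma u_real: "x \<in> U \<Longrightarrow> \<psi> \<in> exp_type \<Longrightarrow> u (cx x) one \<psi> = bil (ch (cx (f x))) \<psi>"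
  by (simp add: u_def Phi_ch)

text \<open>If the operator behind \<open>\<Phi>\<close> maps \<open>\<phi>\<close> to \<open>\<theta>\<close>, its bound applies; test with the conjugate of \<open>\<theta>\<close>.\<close>

lemma norm_le_of_dual:
  assumes \<phi>: "\<phi> \<in> exp_type" and \<theta>: "\<theta> \<in> exp_type" and eq: "\<And>\<psi>. \<psi> \<in> exp_type \<Longrightarrow> \<Phi> \<phi> \<psi> = bil \<theta> \<psi>"
  shows "nr \<theta> \<le> C\<^sub>0 * nr \<phi>"
proof (cases "nr \<theta> = 0")
  case True then show ?thesis using C0 nr_nonneg by simp
next
  case False
  have "(nr \<theta>)\<^sup>2 = cmod (bil \<theta> (\<lambda>\<xi>. cnj (\<theta> \<xi>)))" unfolding bil_cnj[OF \<theta>] norm_of_real by simp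
  also have "\<dots> \<le> C\<^sub>0 * nr \<phi> * nr (\<lambda>\<xi>. cnj (\<theta> \<xi>))" using Phi_bound[OF \<phi>, of "\<lambda>\<xi>. cnj (\<theta> \<xi>)"] eq \<theta> by auto
  also have "nr (\<lambda>\<xi>. cnj (\<theta> \<xi>)) = nr \<theta>" by (rule nr_cong_norm) simp
  finally show ?thesis using False nr_nonneg[of \<theta>] by (simp add: power2_eq_square)
qed

lemma difference_of_characters:
  assumes "x \<in> U" "x' \<in> U"
  shows "nr (\<lambda>\<xi>. ch (cx (f x' - f x)) \<xi> - 1) \<le> C\<^sub>0 * nr (\<lambda>\<xi>. ch (cx (x' - x)) \<xi> - 1)"
proof -
  have eq: "nr (\<lambda>\<xi>. ch (cx (b - a)) \<xi> - 1) = nr (\<lambda>\<xi>. ch (cx b) \<xi> - ch (cx a) \<xi>)" for a b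
  proof (rule nr_cong_norm)
    fix \<xi>
    have "ch (cx b) \<xi> - ch (cx a) \<xi> = ch (cx a) \<xi> * (ch (cx (b - a)) \<xi> - 1)"
      using ch_nz[of "cx a" \<xi>] by (simp add: cx_diff ch_diff field_simps)
    then show "cmod (ch (cx (b - a)) \<xi> - 1) = cmod (ch (cx b) \<xi> - ch (cx a) \<xi>)"
      by (simp only: norm_mult norm_ch_cx mult_1_left)
  qed
  have t: "ch z \<in> exp_type" for z by (intro exp_type_intros)
  show ?thesis unfolding eq
  proof (rule norm_le_of_dual)
    fix \<psi> :: "real ^ 'd \<Rightarrow> complex" assume \<psi>: "\<psi> \<in> exp_type"
    show "\<Phi> (\<lambda>\<xi>. ch (cx x') \<xi> - ch (cx x) \<xi>) \<psi> = bil (\<lambda>\<xi>. ch (cx (f x')) \<xi> - ch (cx (f x)) \<xi>) \<psi>"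
      using bf_diff[OF bf_left[OF \<psi>] t t] bf_diff[OF bounded_functional_bil[OF \<psi>] t t] Phi_ch assms \<psi> by simp
  qed (intro exp_type_intros)+
qed

lemma small_character: "nr (\<lambda>\<xi>. ch (cx (t *\<^sub>R v)) \<xi> - 1) \<le> \<bar>t\<bar> * nr (\<lambda>\<xi>. 2 * of_real pi * lin (cx v) \<xi>)"
proof -
  have "cmod (ch (cx (t *\<^sub>R v)) \<xi> - 1) \<le> cmod (of_real t * (2 * of_real pi * lin (cx v) \<xi>))" for \<xi>
  proof -
    define A where "A = \<i> * of_real (2 * pi * (t * (v \<bullet> \<xi>)))"
    have "cmod (exp A - (\<Sum>k\<le>0. A ^ k / fact k)) \<le> exp \<bar>Re A\<bar> * cmod A ^ Suc 0 / fact 0" by (rule Taylor_exp)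
    then have "cmod (exp A - 1) \<le> cmod A" by (simp add: A_def)
    moreover have "ch (cx (t *\<^sub>R v)) \<xi> = exp A" by (simp add: ch_cx A_def mult_ac)
    moreover have "cmod A = cmod (of_real t * (2 * of_real pi * lin (cx v) \<xi>))" by (simp add: A_def lin_cx norm_mult abs_mult)
    ultimately show ?thesis by simp
  qed
  then have "nr (\<lambda>\<xi>. ch (cx (t *\<^sub>R v)) \<xi> - 1) \<le> nr (\<lambda>\<xi>. of_real t * (2 * of_real pi * lin (cx v) \<xi>))"
    by (intro nr_mono exp_type_intros)
  then show ?thesis by (simp add: nr_scale)
qed

text \<open>Boundedness of \<open>\<Phi>\<close> and the separation of characters make \<open>f\<close> Lipschitz near \<open>x\<close>, so the difference quotients along \<open>v\<close>
  have an accumulation point \<open>c\<close>; comparing the expansions of \<open>\<Phi>(e\<^sub>x\<^sub>+\<^sub>t\<^sub>v, \<psi>)\<close> and of the pairing of \<open>e\<^sub>f\<^sub>(\<^sub>x\<^sub>+\<^sub>t\<^sub>v\<^sub>)\<close> with \<open>\<psi>\<close> to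
  first order gives the relation.\<close>

lemma directional_derivative:
  assumes x: "x \<in> U"
  shows "\<exists>c. \<forall>\<psi>\<in>exp_type. u (cx x) (lin (cx v)) \<psi> = (\<Sum>l\<in>UNIV. of_real (c $ l) * u (cx x) one (\<lambda>\<xi>. of_real (\<xi> $ l) * \<psi> \<xi>))"
proof -
  obtain C' \<epsilon> where sep: "C' > 0" "\<epsilon> > 0" "\<And>y. nr (\<lambda>\<xi>. ch (cx y) \<xi> - 1) < \<epsilon> \<Longrightarrow> norm y \<le> C' * nr (\<lambda>\<xi>. ch (cx y) \<xi> - 1)"
    using character_separation by blast
  define K where "K = nr (\<lambda>\<xi>. 2 * of_real pi * lin (cx v) \<xi>)"
  have K: "K \<ge> 0" unfolding K_def by (rule nr_nonneg)
  obtain r where r: "r > 0" "ball x r \<subseteq> U" using openE[OF open_U x] by blast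
  \<comment> \<open>Up to this size \<open>x + t v\<close> stays in U and the separation of characters applies to the increments of f.\<close>
  define t0 where "t0 = min 1 (min (r / (norm v + 1)) (\<epsilon> / (C\<^sub>0 * K + 1)))"
  have t0: "t0 > 0" unfolding t0_def using r sep C0 K by (simp add: add_nonneg_pos)
  define t where "t m = t0 * (1 / real (Suc (Suc m)))" for m :: nat
  have tpos: "t m > 0" for m unfolding t_def using t0 by simp
  have tt0: "t m < t0" for m
    unfolding t_def using t0 by (simp add: divide_less_eq)
  have tlim: "t \<longlonglongrightarrow> 0"
    unfolding t_def using tendsto_mult_left[OF LIMSEQ_Suc[OF LIMSEQ_Suc[OF lim_1_over_n]], of t0] by simp
  have inU: "x + t m *\<^sub>R v \<in> U" for m
  proof -
    have "t m < r / (norm v + 1)" using tt0[of m] unfolding t0_def by simp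
    then have "t m * (norm v + 1) < r" by (simp add: pos_less_divide_eq add_nonneg_pos)
    then have "norm (t m *\<^sub>R v) < r" using tpos[of m] by (simp add: distrib_left)
    then show ?thesis using r by (auto simp: dist_norm subset_iff)
  qed
  define y where "y m = (1 / t m) *\<^sub>R (f (x + t m *\<^sub>R v) - f x)" for m
  have ty: "f (x + t m *\<^sub>R v) = f x + t m *\<^sub>R y m" for m unfolding y_def using tpos[of m] by simp
  have yb: "norm (y m) \<le> C' * C\<^sub>0 * K" for m
  proof -
    let ?N = "nr (\<lambda>\<xi>. ch (cx (f (x + t m *\<^sub>R v) - f x)) \<xi> - 1)"
    have N: "?N \<le> C\<^sub>0 * (t m * K)"
    proof -
      have "?N \<le> C\<^sub>0 * nr (\<lambda>\<xi>. ch (cx (t m *\<^sub>R v)) \<xi> - 1)"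
        using difference_of_characters[OF x inU[of m]] by simp
      also have "\<dots> \<le> C\<^sub>0 * (t m * K)"
        using small_character[of "t m" v] C0 tpos[of m] unfolding K_def by (intro mult_left_mono) auto
      finally show ?thesis .
    qed
    have "t m < \<epsilon> / (C\<^sub>0 * K + 1)" using tt0[of m] unfolding t0_def by simp
    then have "t m * (C\<^sub>0 * K + 1) < \<epsilon>" using C0 K by (simp add: pos_less_divide_eq add_nonneg_pos)
    then have "C\<^sub>0 * (t m * K) < \<epsilon>" using tpos[of m] by (simp add: algebra_simps)
    then have "norm (f (x + t m *\<^sub>R v) - f x) \<le> C' * ?N" using N by (intro sep(3)) simp
    also have "\<dots> \<le> C' * (C\<^sub>0 * (t m * K))" using N sep(1) by simp
    finally show ?thesis unfolding ty using tpos[of m] by (simp add: field_simps)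
  qed
  define M where "M = C' * C\<^sub>0 * K"
  have yM: "norm (y m) \<le> M" for m using yb unfolding M_def .
  have M0: "M \<ge> 0" using order_trans[OF norm_ge_zero yM[of 0]] .
  have "seq_compact (cball (0 :: real ^ 'd) M)" by (intro compact_imp_seq_compact compact_cball)
  then obtain c \<sigma> where \<sigma>: "strict_mono (\<sigma> :: nat \<Rightarrow> nat)" and lim: "(y \<circ> \<sigma>) \<longlonglongrightarrow> c"
    by (rule seq_compactE[of _ y]) (use yM in auto)
  have "u (cx x) (lin (cx v)) \<psi> = (\<Sum>l\<in>UNIV. of_real (c $ l) * u (cx x) one (\<lambda>\<xi>. of_real (\<xi> $ l) * \<psi> \<xi>))"
    if \<psi>: "\<psi> \<in> exp_type" for \<psi>
  proof -
    let ?L = "\<lambda>\<phi>. \<Phi> \<phi> \<psi>" and ?B = "\<lambda>\<phi>. bil \<phi> \<psi>"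
    have L: "bounded_functional ?L" and B: "bounded_functional ?B" using bf_left bounded_functional_bil \<psi> by auto
    obtain K1 where K1: "K1 \<ge> 0" "\<And>\<eta>. norm \<eta> \<le> 1 \<Longrightarrow> cmod (?L (\<lambda>\<xi>. ch (cx x + \<eta>) \<xi> * 1) - ?L (\<lambda>\<xi>. ch (cx x) \<xi> * 1)
      - 2 * of_real pi * \<i> * ?L (\<lambda>\<xi>. lin \<eta> \<xi> * (ch (cx x) \<xi> * 1))) \<le> K1 * (norm \<eta>)\<^sup>2"
      using bf_expansion[OF L exp_type_const[of 1], of "cx x"] by blast
    obtain K2 where K2: "K2 \<ge> 0" "\<And>\<eta>. norm \<eta> \<le> 1 \<Longrightarrow> cmod (?B (\<lambda>\<xi>. ch (cx (f x) + \<eta>) \<xi> * 1) - ?B (\<lambda>\<xi>. ch (cx (f x)) \<xi> * 1)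
      - 2 * of_real pi * \<i> * ?B (\<lambda>\<xi>. lin \<eta> \<xi> * (ch (cx (f x)) \<xi> * 1))) \<le> K2 * (norm \<eta>)\<^sup>2"
      using bf_expansion[OF B exp_type_const[of 1], of "cx (f x)"] by blast
    let ?P = "?L (\<lambda>\<xi>. lin (cx v) \<xi> * ch (cx x) \<xi>)" and ?Q = "\<lambda>y. ?B (\<lambda>\<xi>. lin (cx y) \<xi> * ch (cx (f x)) \<xi>)"
    have ev: "\<forall>\<^sub>F m in sequentially. t m * (norm v + M + 1) < 1"
    proof -
      have "(\<lambda>m. t m * (norm v + M + 1)) \<longlonglongrightarrow> 0" using tendsto_mult_right[OF tlim] by simp
      then show ?thesis by (rule order_tendstoD) simp
    qed
    have est: "cmod (?P - ?Q (y m)) \<le> t m * (K1 * (norm v)\<^sup>2 + K2 * M\<^sup>2)" if m: "t m * (norm v + M + 1) < 1" for m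
    proof -
      let ?\<tau> = "2 * of_real pi * \<i> :: complex"
      have tm: "t m > 0" by (rule tpos)
      have tv: "norm (of_real (t m) *s cx v) = t m * norm v" "norm (of_real (t m) *s cx (y m)) = t m * norm (y m)"
        using tm unfolding cx_scale[symmetric] norm_cx by auto
      have e: "0 \<le> t m * norm v" "0 \<le> t m * M" using tm M0 by auto
      have s1: "t m * norm v \<le> 1" using m e tm unfolding distrib_left by linarith
      have yy: "t m * norm (y m) \<le> t m * M" using yM[of m] tm by simp
      have "t m * M \<le> 1" using m e tm unfolding distrib_left by linarith
      with yy have s2: "t m * norm (y m) \<le> 1" by (rule order_trans)
      have lc: "(\<lambda>\<xi>. lin a \<xi> * ch b \<xi>) \<in> exp_type" for a b by (intro exp_type_intros)
      have ls: "?L (\<lambda>\<xi>. lin (of_real (t m) *s cx v) \<xi> * ch (cx x) \<xi>) = of_real (t m) * ?P"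
        using bf_scale[OF L lc, of "of_real (t m)" "cx v" "cx x"] by (simp add: lin_scale mult.assoc)
      have bs: "?B (\<lambda>\<xi>. lin (of_real (t m) *s cx (y m)) \<xi> * ch (cx (f x)) \<xi>) = of_real (t m) * ?Q (y m)"
        using bf_scale[OF B lc, of "of_real (t m)" "cx (y m)" "cx (f x)"] by (simp add: lin_scale mult.assoc)
      define a0 a1 where "a0 = ?L (ch (cx x))" and "a1 = ?L (ch (cx (x + t m *\<^sub>R v)))"
      have a: "a0 = ?B (ch (cx (f x)))" "a1 = ?B (ch (cx (f x) + of_real (t m) *s cx (y m)))"
        unfolding a0_def a1_def Phi_ch[OF x \<psi>] Phi_ch[OF inU \<psi>] ty by (auto simp: cx_add cx_scale)
      have "cmod (a1 - a0 - ?\<tau> * (of_real (t m) * ?P)) \<le> K1 * (t m * norm v)\<^sup>2"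
        using K1(2)[of "of_real (t m) *s cx v"] s1 unfolding tv a0_def a1_def by (simp add: ls cx_add cx_scale)
      moreover have "cmod (a1 - a0 - ?\<tau> * (of_real (t m) * ?Q (y m))) \<le> K2 * (t m * norm (y m))\<^sup>2"
        using K2(2)[of "of_real (t m) *s cx (y m)"] s2 unfolding tv a by (simp add: bs)
      moreover have "K2 * (t m * norm (y m))\<^sup>2 \<le> K2 * (t m * M)\<^sup>2"
        using yy K2(1) tm by (intro mult_left_mono power_mono) auto
      ultimately have "cmod ((a1 - a0 - ?\<tau> * (of_real (t m) * ?Q (y m))) - (a1 - a0 - ?\<tau> * (of_real (t m) * ?P))) \<le> K1 * (t m * norm v)\<^sup>2 + K2 * (t m * M)\<^sup>2"
        using norm_triangle_ineq4[of "a1 - a0 - ?\<tau> * (of_real (t m) * ?Q (y m))" "a1 - a0 - ?\<tau> * (of_real (t m) * ?P)"] by linarith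
      moreover have "(a1 - a0 - ?\<tau> * (of_real (t m) * ?Q (y m))) - (a1 - a0 - ?\<tau> * (of_real (t m) * ?P)) = of_real (2 * pi * t m) * (\<i> * (?P - ?Q (y m)))"
        by (simp add: algebra_simps)
      ultimately have "2 * pi * t m * cmod (?P - ?Q (y m)) \<le> K1 * (t m * norm v)\<^sup>2 + K2 * (t m * M)\<^sup>2"
        using tm by (simp add: norm_mult)
      moreover have "1 * (t m * cmod (?P - ?Q (y m))) \<le> 2 * pi * (t m * cmod (?P - ?Q (y m)))"
        using pi_ge_two tm by (intro mult_right_mono) auto
      ultimately have "t m * cmod (?P - ?Q (y m)) \<le> t m * (t m * (K1 * (norm v)\<^sup>2 + K2 * M\<^sup>2))"
        by (simp add: power2_eq_square algebra_simps)
      then show ?thesis using tm by simp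
    qed
    have Qsum: "?Q w = (\<Sum>l\<in>UNIV. of_real (w $ l) * ?B (\<lambda>\<xi>. of_real (\<xi> $ l) * ch (cx (f x)) \<xi>))" for w
      using bf_lin_sum[OF B exp_type_ch, of "cx w"] by (simp add: cx_def)
    have Qlim: "(\<lambda>m. ?P - ?Q ((y \<circ> \<sigma>) m)) \<longlonglongrightarrow> ?P - ?Q c"
      unfolding Qsum by (intro tendsto_intros tendsto_vec_nth lim)
    have Qnull: "(\<lambda>m. ?P - ?Q ((y \<circ> \<sigma>) m)) \<longlonglongrightarrow> 0"
    proof (rule Lim_null_comparison)
      show "\<forall>\<^sub>F m in sequentially. norm (?P - ?Q ((y \<circ> \<sigma>) m)) \<le> t (\<sigma> m) * (K1 * (norm v)\<^sup>2 + K2 * M\<^sup>2)"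
        using eventually_subseq[OF \<sigma> ev] by (rule eventually_mono) (use est in auto)
      have "(t \<circ> \<sigma>) \<longlonglongrightarrow> 0" using tlim \<sigma> by (rule LIMSEQ_subseq_LIMSEQ)
      then show "(\<lambda>m. t (\<sigma> m) * (K1 * (norm v)\<^sup>2 + K2 * M\<^sup>2)) \<longlonglongrightarrow> 0"
        using tendsto_mult_right[of "t \<circ> \<sigma>" 0 _ "K1 * (norm v)\<^sup>2 + K2 * M\<^sup>2"] by (simp add: o_def)
    qed
    have "?P = ?Q c" using LIMSEQ_unique[OF Qlim Qnull] by simp
    moreover have "u (cx x) one (\<lambda>\<xi>. of_real (\<xi> $ l) * \<psi> \<xi>) = ?B (\<lambda>\<xi>. of_real (\<xi> $ l) * ch (cx (f x)) \<xi>)" for l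
    proof -
      have "(\<lambda>\<xi>. of_real (\<xi> $ l) * \<psi> \<xi>) \<in> exp_type" by (intro exp_type_intros \<psi>)
      from u_real[OF x this] show ?thesis unfolding bil_def by (simp only: mult_ac)
    qed
    moreover have "u (cx x) (lin (cx v)) \<psi> = ?P" unfolding u_def by (simp only: mult.commute)
    ultimately show ?thesis unfolding Qsum by simp
  qed
  then show ?thesis by (intro exI[of _ c] ballI)
qed

end

section \<open>The trace of a matrix with bounded eigenvalues\<close>

text \<open>The quotient of the first two coefficients is minus the sum of the reciprocals of the roots.\<close>

lemma poly_linear_coeff_bound:
  fixes P :: "complex poly"
  assumes R: "R > 0" and roots: "\<And>x. poly P x = 0 \<Longrightarrow> cmod x \<ge> R"
  shows "cmod (coeff P 1) \<le> real (degree P) / R * cmod (coeff P 0)"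
  using roots
proof (induction "degree P" arbitrary: P)
  case 0
  then show ?case by (simp add: coeff_eq_0)
next
  case (Suc n)
  then have "\<not> constant (poly P)" by (simp add: constant_degree)
  then obtain r where r: "poly P r = 0" using fundamental_theorem_of_algebra by blast
  then obtain Q where Q: "P = [:- r, 1:] * Q" using poly_eq_0_iff_dvd by (metis dvdE)
  have P0: "P \<noteq> 0" using Suc.hyps(2) by auto
  have dQ: "degree Q = n"
  proof -
    have "Q \<noteq> 0" using Q P0 by auto
    then have "degree P = degree [:- r, 1:] + degree Q" unfolding Q by (intro degree_mult_eq) auto
    then show ?thesis using Suc.hyps(2) by simp
  qed
  have rR: "cmod r \<ge> R" using Suc.prems r by blast
  have IH: "cmod (coeff Q 1) \<le> real n / R * cmod (coeff Q 0)"
    using Suc.hyps(1)[of Q] Suc.prems dQ Q by auto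
  have c: "coeff P 1 = - r * coeff Q 1 + coeff Q 0" "coeff P 0 = - r * coeff Q 0"
    unfolding Q by (auto simp: coeff_pCons)
  have "cmod (coeff P 1) \<le> cmod r * cmod (coeff Q 1) + cmod (coeff Q 0)"
    unfolding c using norm_triangle_ineq[of "- r * coeff Q 1" "coeff Q 0"] by (simp add: norm_mult)
  also have "\<dots> \<le> cmod r * (real n / R * cmod (coeff Q 0)) + cmod r / R * cmod (coeff Q 0)"
  proof (rule add_mono)
    show "cmod r * cmod (coeff Q 1) \<le> cmod r * (real n / R * cmod (coeff Q 0))" using IH by (rule mult_left_mono) simp
    have "1 * cmod (coeff Q 0) \<le> cmod r / R * cmod (coeff Q 0)" using rR R by (intro mult_right_mono) auto
    then show "cmod (coeff Q 0) \<le> cmod r / R * cmod (coeff Q 0)" by simp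
  qed
  also have "\<dots> = real (Suc n) / R * cmod (coeff P 0)"
    unfolding c using R by (simp add: norm_mult field_simps)
  finally show ?case using Suc.hyps(2) by simp
qed

text \<open>The trace is minus the linear coefficient of \<open>det (1 - x M)\<close>, a polynomial with constant term one whose roots are
  reciprocals of eigenvalues.\<close>

lemma trace_le_eigenvalue_bound:
  fixes M :: "complex ^ 'n ^ 'n"
  assumes B: "B > 0" and ev: "\<And>c g. g \<noteq> 0 \<Longrightarrow> M *v g = c *s g \<Longrightarrow> cmod c \<le> B"
  shows "cmod (trace M) \<le> real CARD('n) * B"
proof -
  define l where "l i j = [: mat 1 $ i $ j, - M $ i $ j :]" for i j
  define P where "P = (\<Sum>\<pi> | \<pi> permutes (UNIV :: 'n set). smult (of_int (sign \<pi>)) (\<Prod>i\<in>UNIV. l i (\<pi> i)))"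
  have polyP: "poly P x = det (mat 1 - (\<chi> i j. x * M $ i $ j))" for x
    unfolding P_def det_def l_def by (simp add: poly_sum poly_prod)
  have deg: "degree P \<le> CARD('n)"
    unfolding P_def
  proof (rule degree_sum_le)
    fix \<pi> assume "\<pi> \<in> {\<pi>. \<pi> permutes (UNIV :: 'n set)}"
    have "degree (\<Prod>i\<in>UNIV. l i (\<pi> i)) \<le> (\<Sum>i\<in>(UNIV :: 'n set). degree (l i (\<pi> i)))"
      using degree_prod_sum_le[of UNIV "\<lambda>i. l i (\<pi> i)"] by (simp add: o_def)
    also have "\<dots> \<le> (\<Sum>i\<in>(UNIV :: 'n set). 1)" by (intro sum_mono) (simp add: l_def)
    finally have le: "degree (\<Prod>i\<in>UNIV. l i (\<pi> i)) \<le> CARD('n)" by simp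
    show "degree (smult (of_int (sign \<pi>)) (\<Prod>i\<in>UNIV. l i (\<pi> i))) \<le> CARD('n)"
      by (rule order_trans[OF degree_smult_le le])
  qed (simp add: finite_permutations)
  have c0: "coeff P 0 = 1"
    using polyP[of 0] by (simp add: poly_0_coeff_0 mat_def[symmetric] zero_vec_def[symmetric])
  have c1: "coeff P 1 = - trace M"
  proof -
    have "coeff P 1 = poly (pderiv P) 0" by (simp add: poly_0_coeff_0 coeff_pderiv)
    also have "\<dots> = (\<Sum>\<pi> | \<pi> permutes (UNIV :: 'n set). of_int (sign \<pi>) * (\<Sum>i\<in>UNIV. (\<Prod>j\<in>UNIV - {i}. mat 1 $ j $ \<pi> j) * (- M $ i $ \<pi> i)))"
    proof -
      have "poly (pderiv (smult (of_int (sign \<pi>)) (\<Prod>i\<in>UNIV. l i (\<pi> i)))) 0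
         = of_int (sign \<pi>) * (\<Sum>i\<in>UNIV. (\<Prod>j\<in>UNIV - {i}. mat 1 $ j $ \<pi> j) * (- M $ i $ \<pi> i))" for \<pi> :: "'n \<Rightarrow> 'n"
        by (simp add: pderiv_smult pderiv_prod poly_sum poly_prod l_def pderiv_pCons mult.commute)
      moreover have "pderiv P = (\<Sum>\<pi> | \<pi> permutes (UNIV :: 'n set). pderiv (smult (of_int (sign \<pi>)) (\<Prod>i\<in>UNIV. l i (\<pi> i))))"
      proof -
        have "pderiv (sum F A) = (\<Sum>x\<in>A. pderiv (F x))" for F :: "('n \<Rightarrow> 'n) \<Rightarrow> complex poly" and A
          by (induction A rule: infinite_finite_induct) (auto simp: pderiv_add)
        then show ?thesis unfolding P_def by blast
      qed
      ultimately show ?thesis by (simp add: poly_sum)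
    qed
    also have "\<dots> = (\<Sum>\<pi>\<in>{id}. of_int (sign \<pi>) * (\<Sum>i\<in>UNIV. (\<Prod>j\<in>UNIV - {i}. mat 1 $ j $ \<pi> j) * (- M $ i $ \<pi> i)))"
    proof (rule sum.mono_neutral_right)
      show "\<forall>\<pi>\<in>{\<pi>. \<pi> permutes (UNIV :: 'n set)} - {id}. of_int (sign \<pi>) * (\<Sum>i\<in>UNIV. (\<Prod>j\<in>UNIV - {i}. mat 1 $ j $ \<pi> j) * (- M $ i $ \<pi> i)) = 0"
      proof
        fix \<pi> assume "\<pi> \<in> {\<pi>. \<pi> permutes (UNIV :: 'n set)} - {id}"
        then have \<pi>: "\<pi> permutes UNIV" "\<pi> \<noteq> id" by auto
        have moved: "\<exists>j. j \<noteq> i \<and> \<pi> j \<noteq> j" for i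
        proof (rule ccontr)
          assume "\<not> ?thesis"
          then have fix': "\<And>j. j \<noteq> i \<Longrightarrow> \<pi> j = j" by blast
          have "\<pi> i = i"
          proof (rule ccontr)
            assume ne: "\<pi> i \<noteq> i"
            then have "\<pi> (\<pi> i) = \<pi> i" by (rule fix')
            then have "\<pi> i = i" using permutes_inj[OF \<pi>(1)] by (simp add: inj_eq)
            then show False using ne by simp
          qed
          then have "\<pi> j = id j" for j using fix' by (cases "j = i") auto
          then have "\<pi> = id" by (rule ext)
          then show False using \<pi> by simp
        qed
        have "(\<Prod>j\<in>UNIV - {i}. (mat 1 :: complex ^ 'n ^ 'n) $ j $ \<pi> j) = 0" for i
        proof -
          obtain j where "j \<noteq> i" "\<pi> j \<noteq> j" using moved[of i] by blast
          then have "j \<in> UNIV - {i}" "(mat 1 :: complex ^ 'n ^ 'n) $ j $ \<pi> j = 0" by (auto simp: mat_def)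
          then show ?thesis by (intro prod_zero) auto
        qed
        then show "of_int (sign \<pi>) * (\<Sum>i\<in>UNIV. (\<Prod>j\<in>UNIV - {i}. mat 1 $ j $ \<pi> j) * (- M $ i $ \<pi> i)) = 0"
          by (simp only: mult_zero_left mult_zero_right sum.neutral_const)
      qed
    qed (auto simp: finite_permutations permutes_id)
    also have "\<dots> = - trace M" by (simp add: mat_def trace_def sign_id sum_negf)
    finally show ?thesis .
  qed
  have "cmod (coeff P 1) \<le> real (degree P) / (1 / B) * cmod (coeff P 0)"
  proof (rule poly_linear_coeff_bound)
    show "1 / B > 0" using B by simp
    fix x assume "poly P x = 0"
    then have "\<not> invertible (mat 1 - (\<chi> i j. x * M $ i $ j))" unfolding polyP invertible_det_nz by simp
    then obtain g where g: "g \<noteq> 0" "(mat 1 - (\<chi> i j. x * M $ i $ j)) *v g = 0"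
      using matrix_left_invertible_ker invertible_left_inverse by blast
    have "(\<chi> i j. x * M $ i $ j) *v g = x *s (M *v g)"
      by (simp add: matrix_vector_mult_def vec_eq_iff sum_distrib_left mult.assoc)
    then have e: "x *s (M *v g) = g" using g(2) by (simp add: matrix_vector_mult_diff_rdistrib)
    then have x: "x \<noteq> 0" using g(1) by auto
    have "M *v g = (1 / x) *s (x *s (M *v g))" using x by (simp add: vector_smult_assoc)
    then have "M *v g = (1 / x) *s g" unfolding e .
    then have "cmod (1 / x) \<le> B" using ev g(1) by blast
    then show "1 / B \<le> cmod x" using x B by (simp add: norm_divide field_simps)
  qed
  also have "\<dots> = real (degree P) * B" using c0 by simp
  also have "\<dots> \<le> real CARD('n) * B" using deg B by simp
  finally show ?thesis unfolding c1 by simp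
qed

section \<open>Meromorphic continuation of the derivative\<close>

lemma cnj_lin: "cnj (lin c \<xi>) = lin (\<chi> i. cnj (c $ i)) \<xi>"
  by (simp add: lin_def)

text \<open>The base point normalises the linear system that determines the derivative.\<close>

locale based_form = bounded_form +
  fixes p assumes p: "p \<in> U"
begin

abbreviation coord :: "'a \<Rightarrow> real ^ 'a \<Rightarrow> complex" where "coord l \<equiv> (\<lambda>\<xi>. of_real (\<xi> $ l))"

text \<open>At a point \<open>x \<in> U\<close> the \<open>k\<close>-th partial derivative \<open>c\<close> of \<open>f\<close> satisfies
  \<open>u x \<xi>\<^sub>k \<psi> = (\<Sum>l. c\<^sub>l u x 1 (\<xi>\<^sub>l \<psi>))\<close> for every \<open>\<psi>\<close>. Taking \<open>\<psi> = test j\<close> for all \<open>j\<close> gives a square system with the matrix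
  \<open>\<Delta> x\<close> and the \<open>k\<close>-th column of \<open>\<Gamma> x\<close> as right hand side. Both make sense at complex points, and Cramer's rule
  turns the solution into the quotients \<open>cof z l k / D z\<close>. The factor in \<open>test\<close> makes \<open>\<Delta> p\<close> the Gram matrix of
  the coordinate functions.\<close>

definition test :: "'a \<Rightarrow> real ^ 'a \<Rightarrow> complex" where
  "test j = (\<lambda>\<xi>. cnj (ch (cx (f p)) \<xi>) * coord j \<xi>)"
definition \<Delta> :: "complex ^ 'a \<Rightarrow> complex ^ 'a ^ 'a" where
  "\<Delta> z = (\<chi> j l. u z one (\<lambda>\<xi>. coord l \<xi> * test j \<xi>))"
definition \<Gamma> :: "complex ^ 'a \<Rightarrow> complex ^ 'a ^ 'a" where
  "\<Gamma> z = (\<chi> j k. u z (coord k) (test j))"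
definition D :: "complex ^ 'a \<Rightarrow> complex" where "D z = det (\<Delta> z)"
definition cof :: "complex ^ 'a \<Rightarrow> 'a \<Rightarrow> 'a \<Rightarrow> complex" where
  "cof z l k = det (\<chi> i j. if j = l then \<Gamma> z $ i $ k else \<Delta> z $ i $ j)"
definition jac :: "complex ^ 'a \<Rightarrow> complex ^ 'a ^ 'a" where
  "jac z = (\<chi> l k. cof z l k / D z)"

lemma test_exp_type [intro]: "test j \<in> exp_type"
  unfolding test_def by (intro exp_type_intros)

lemma u_line: "P \<in> exp_type \<Longrightarrow> \<psi> \<in> exp_type \<Longrightarrow>
  ((\<lambda>t. u (z + t *s v) P \<psi>) has_field_derivative 2 * of_real pi * \<i> * u (z + t *s v) (\<lambda>\<xi>. lin v \<xi> * P \<xi>) \<psi>) (at t)"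
  unfolding u_def by (rule bf_line[OF bf_left])

lemma u_line_holo: "P \<in> exp_type \<Longrightarrow> \<psi> \<in> exp_type \<Longrightarrow> line_holo (\<lambda>z. u z P \<psi>)"
  unfolding line_holo_def holomorphic_on_open[OF open_UNIV] by (intro allI ballI exI) (rule u_line)

lemma u_bf_right: "P \<in> exp_type \<Longrightarrow> bounded_functional (\<lambda>\<psi>. u z P \<psi>)"
  unfolding u_def by (intro bf_right exp_type_intros)

lemma u_add_left: "P \<in> exp_type \<Longrightarrow> Q \<in> exp_type \<Longrightarrow> \<psi> \<in> exp_type \<Longrightarrow> u z (\<lambda>\<xi>. P \<xi> + Q \<xi>) \<psi> = u z P \<psi> + u z Q \<psi>"
  unfolding u_def distrib_left
  by (rule bf_add[OF bf_left exp_type_mult[OF exp_type_ch] exp_type_mult[OF exp_type_ch]])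
lemma u_scale_left: "P \<in> exp_type \<Longrightarrow> \<psi> \<in> exp_type \<Longrightarrow> u z (\<lambda>\<xi>. c * P \<xi>) \<psi> = c * u z P \<psi>"
  unfolding u_def using bf_scale[OF bf_left, of \<psi> "\<lambda>\<xi>. ch z \<xi> * P \<xi>" c] by (simp add: mult.left_commute exp_type_mult[OF exp_type_ch])

lemma u_lin_left: "\<psi> \<in> exp_type \<Longrightarrow> u z (lin v) \<psi> = (\<Sum>k\<in>UNIV. v $ k * u z (coord k) \<psi>)"
  unfolding u_def using bf_lin_sum[OF bf_left exp_type_ch, of \<psi> v z] by (simp add: mult.commute)

lemma u_lin_right: "\<psi> \<in> exp_type \<Longrightarrow> u z P (\<lambda>\<xi>. lin v \<xi> * \<psi> \<xi>) = (\<Sum>k\<in>UNIV. v $ k * u z P (\<lambda>\<xi>. coord k \<xi> * \<psi> \<xi>))"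
  if "P \<in> exp_type"
  using bf_lin_sum[OF u_bf_right[OF that]] by blast

text \<open>A kernel vector of the Gram matrix would be a linear form of norm zero.\<close>

lemma Gram_nonsingular: "D (cx p) \<noteq> 0"
proof
  assume "D (cx p) = 0"
  then have "\<not> invertible (\<Delta> (cx p))" unfolding D_def invertible_det_nz by simp
  then obtain c where c: "c \<noteq> 0" "\<Delta> (cx p) *v c = 0"
    using matrix_left_invertible_ker invertible_left_inverse by blast
  have ent: "\<Delta> (cx p) $ j $ l = bil (coord l) (coord j)" for j l
  proof -
    have "\<Delta> (cx p) $ j $ l = bil (ch (cx (f p))) (\<lambda>\<xi>. coord l \<xi> * test j \<xi>)"
      unfolding \<Delta>_def using u_real[OF p, of "\<lambda>\<xi>. coord l \<xi> * test j \<xi>"] exp_type_mult[OF exp_type_coord test_exp_type] by simp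
    also have "\<dots> = bil (coord l) (coord j)"
      unfolding bil_def
    proof (intro Bochner_Integration.integral_cong refl)
      fix \<xi>
      have "ch (cx (f p)) \<xi> * cnj (ch (cx (f p)) \<xi>) = 1"
        using complex_norm_square[of "ch (cx (f p)) \<xi>"] norm_ch_cx[of "f p" \<xi>] by simp
      then have "(ch (cx (f p)) \<xi> * cnj (ch (cx (f p)) \<xi>)) * (coord l \<xi> * coord j \<xi>) = coord l \<xi> * coord j \<xi>" by simp
      then show "ch (cx (f p)) \<xi> * (coord l \<xi> * test j \<xi>) = coord l \<xi> * coord j \<xi>" unfolding test_def by (simp only: mult_ac)
    qed
    finally show ?thesis .
  qed
  have e: "coord j \<in> exp_type" for j by (rule exp_type_coord)
  have b1: "bil (lin c) \<psi> = (\<Sum>l\<in>UNIV. c $ l * bil (coord l) \<psi>)" if "\<psi> \<in> exp_type" for \<psi> and c :: "complex ^ 'a"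
    using bf_lin_sum[OF bounded_functional_bil[OF that] exp_type_const[of 1]] by simp
  have row: "bil (lin c) (coord j) = 0" for j
  proof -
    have "bil (lin c) (coord j) = (\<Delta> (cx p) *v c) $ j"
      unfolding b1[OF e] matrix_vector_mult_def by (simp add: ent mult.commute)
    then show ?thesis using c(2) by simp
  qed
  have "bil (lin c) (\<lambda>\<xi>. cnj (lin c \<xi>)) = bil (lin (\<chi> i. cnj (c $ i))) (lin c)"
    unfolding cnj_lin by (rule bil_commute)
  also have "\<dots> = (\<Sum>l\<in>UNIV. cnj (c $ l) * bil (lin c) (coord l))"
    unfolding b1[OF exp_type_lin] by (simp add: bil_commute)
  also have "\<dots> = 0" unfolding row by simp
  finally have "nr (lin c) = 0" unfolding bil_cnj[OF exp_type_lin] by simp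
  then show False using lin_norm_pos[OF c(1)] by simp
qed

lemma \<Delta>_line_holo: "line_holo (\<lambda>z. \<Delta> z $ i $ j)" and \<Gamma>_line_holo: "line_holo (\<lambda>z. \<Gamma> z $ i $ j)"
  unfolding \<Delta>_def \<Gamma>_def by (simp_all add: u_line_holo exp_type_mult[OF exp_type_coord test_exp_type] test_exp_type exp_type_coord)
lemma D_line_holo: "line_holo D"
  using line_holo_det[OF \<Delta>_line_holo] unfolding D_def[abs_def] .
lemma cof_line_holo: "line_holo (\<lambda>z. cof z l k)"
  unfolding cof_def
proof (rule line_holo_det)
  fix i j show "line_holo (\<lambda>z. (\<chi> i j. if j = l then \<Gamma> z $ i $ k else \<Delta> z $ i $ j) $ i $ j)"
    by (cases "j = l") (auto simp: \<Gamma>_line_holo \<Delta>_line_holo)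
qed

text \<open>At real points of \<open>U\<close> Cramer's rule recovers the weak derivative.\<close>

lemma cof_real:
  assumes x: "x \<in> U"
  obtains c where "\<And>\<psi>. \<psi> \<in> exp_type \<Longrightarrow> u (cx x) (coord k) \<psi> = (\<Sum>l\<in>UNIV. of_real (c $ l) * u (cx x) one (\<lambda>\<xi>. coord l \<xi> * \<psi> \<xi>))"
    "\<And>l. cof (cx x) l k = of_real (c $ l) * D (cx x)"
proof -
  have ax: "lin (cx (axis k 1)) = coord k" by (simp add: lin_cx inner_axis' fun_eq_iff)
  obtain c where c: "\<And>\<psi>. \<psi> \<in> exp_type \<Longrightarrow> u (cx x) (coord k) \<psi> = (\<Sum>l\<in>UNIV. of_real (c $ l) * u (cx x) one (\<lambda>\<xi>. coord l \<xi> * \<psi> \<xi>))"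
    using directional_derivative[OF x, of "axis k 1"] unfolding ax by blast
  have G: "\<Gamma> (cx x) $ i $ k = (\<Delta> (cx x) *v cx c) $ i" for i
    unfolding \<Gamma>_def \<Delta>_def matrix_vector_mult_def using c[OF test_exp_type, of i] by (simp add: cx_def mult.commute)
  have "cof (cx x) l k = of_real (c $ l) * D (cx x)" for l
    unfolding cof_def G D_def using cramer_lemma[of l "\<Delta> (cx x)" "cx c"] by (simp add: cx_def)
  with c show thesis by (rule that)
qed

text \<open>Both sides are entire on lines and agree at the real points of \<open>U\<close>.\<close>

lemma global_relation:
  assumes \<psi>: "\<psi> \<in> exp_type"
  shows "D z * u z (coord k) \<psi> = (\<Sum>l\<in>UNIV. cof z l k * u z one (\<lambda>\<xi>. coord l \<xi> * \<psi> \<xi>))"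
proof -
  define G where "G z = D z * u z (coord k) \<psi> - (\<Sum>l\<in>UNIV. cof z l k * u z one (\<lambda>\<xi>. coord l \<xi> * \<psi> \<xi>))" for z
  have "G z = 0"
  proof (rule line_holo_real_zero[OF _ open_U p])
    show "line_holo G" unfolding G_def
      by (intro line_holo_diff line_holo_mult line_holo_sum D_line_holo cof_line_holo u_line_holo exp_type_intros \<psi>)
    fix x assume x: "x \<in> U"
    show "G (cx x) = 0"
    proof (rule cof_real[OF x, of k])
      fix c
      assume c1: "\<And>\<psi>. \<psi> \<in> exp_type \<Longrightarrow> u (cx x) (coord k) \<psi> = (\<Sum>l\<in>UNIV. of_real (c $ l) * u (cx x) one (\<lambda>\<xi>. coord l \<xi> * \<psi> \<xi>))"
        and c2: "\<And>l. cof (cx x) l k = of_real (c $ l) * D (cx x)"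
      show "G (cx x) = 0" unfolding G_def c1[OF \<psi>] c2 by (simp add: sum_distrib_left mult_ac)
    qed
  qed
  then show ?thesis unfolding G_def by simp
qed

lemma jac_relation:
  assumes z: "D z \<noteq> 0" and \<psi>: "\<psi> \<in> exp_type"
  shows "u z (lin g) \<psi> = u z one (\<lambda>\<xi>. lin (jac z *v g) \<xi> * \<psi> \<xi>)"
proof -
  have k: "u z (coord k) \<psi> = (\<Sum>l\<in>UNIV. jac z $ l $ k * u z one (\<lambda>\<xi>. coord l \<xi> * \<psi> \<xi>))" for k
  proof -
    have "u z (coord k) \<psi> = (\<Sum>l\<in>UNIV. cof z l k * u z one (\<lambda>\<xi>. coord l \<xi> * \<psi> \<xi>)) / D z"
      using global_relation[OF \<psi>, of z k] z by (simp add: field_simps)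
    then show ?thesis unfolding jac_def by (simp add: sum_divide_distrib)
  qed
  have "u z (lin g) \<psi> = (\<Sum>k\<in>UNIV. \<Sum>l\<in>UNIV. g $ k * (jac z $ l $ k * u z one (\<lambda>\<xi>. coord l \<xi> * \<psi> \<xi>)))"
    unfolding u_lin_left[OF \<psi>] k sum_distrib_left ..
  also have "\<dots> = (\<Sum>l\<in>UNIV. \<Sum>k\<in>UNIV. g $ k * (jac z $ l $ k * u z one (\<lambda>\<xi>. coord l \<xi> * \<psi> \<xi>)))" by (rule sum.swap)
  also have "\<dots> = (\<Sum>l\<in>UNIV. (jac z *v g) $ l * u z one (\<lambda>\<xi>. coord l \<xi> * \<psi> \<xi>))"
    by (simp only: matrix_vector_mult_def vec_lambda_beta sum_distrib_right) (simp add: mult_ac)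
  also have "\<dots> = u z one (\<lambda>\<xi>. lin (jac z *v g) \<xi> * \<psi> \<xi>)" using u_lin_right[OF exp_type_const \<psi>] by simp
  finally show ?thesis .
qed

end

section \<open>Uniqueness for linear holomorphic systems\<close>

text \<open>Combinations of the unknowns \<open>Y s \<psi>\<close> with holomorphic coefficients.\<close>

inductive jets :: "complex set \<Rightarrow> (complex \<Rightarrow> 'b \<Rightarrow> complex) \<Rightarrow> 'b set \<Rightarrow> (complex \<Rightarrow> complex) \<Rightarrow> bool"
  for S Y E where
  zero: "jets S Y E (\<lambda>s. 0)"
| step: "c holomorphic_on S \<Longrightarrow> \<psi> \<in> E \<Longrightarrow> jets S Y E h \<Longrightarrow> jets S Y E (\<lambda>s. c s * Y s \<psi> + h s)"

lemma jets_add: "jets S Y E g \<Longrightarrow> jets S Y E h \<Longrightarrow> jets S Y E (\<lambda>s. g s + h s)"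
proof (induction rule: jets.induct)
  case (step c \<psi> g)
  then have "jets S Y E (\<lambda>s. c s * Y s \<psi> + (g s + h s))" by (intro jets.step) auto
  then show ?case by (simp add: add.assoc)
qed simp

lemma jets_scale: "jets S Y E g \<Longrightarrow> c holomorphic_on S \<Longrightarrow> jets S Y E (\<lambda>s. c s * g s)"
proof (induction rule: jets.induct)
  case (step d \<psi> g)
  then have "jets S Y E (\<lambda>s. (c s * d s) * Y s \<psi> + c s * g s)" by (intro jets.step holomorphic_on_mult) auto
  then show ?case by (simp add: algebra_simps)
qed (simp add: jets.zero)

lemma jets_sum: "finite I \<Longrightarrow> (\<And>i. i \<in> I \<Longrightarrow> jets S Y E (g i)) \<Longrightarrow> jets S Y E (\<lambda>s. \<Sum>i\<in>I. g i s)"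
  by (induction I rule: finite_induct) (auto intro: jets.zero jets_add)

lemma jets_vanish: "jets S Y E h \<Longrightarrow> (\<And>\<psi>. \<psi> \<in> E \<Longrightarrow> Y s \<psi> = 0) \<Longrightarrow> h s = 0"
  by (induction rule: jets.induct) auto

text \<open>The derivatives of the unknowns are combinations of the unknowns, hence so are all higher derivatives, and all
  of these vanish at \<open>s1\<close>. The system may be infinite, so estimates of Gronwall type are not available; the identity
  theorem for holomorphic functions replaces them.\<close>

lemma linear_system_zero:
  assumes S: "open S" "connected S" "s1 \<in> S"
    and der: "\<And>\<psi>. \<psi> \<in> E \<Longrightarrow> jets S Y E (Y' \<psi>)"
      "\<And>\<psi> s. \<psi> \<in> E \<Longrightarrow> s \<in> S \<Longrightarrow> ((\<lambda>s. Y s \<psi>) has_field_derivative Y' \<psi> s) (at s)"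
    and init: "\<And>\<psi>. \<psi> \<in> E \<Longrightarrow> Y s1 \<psi> = 0"
    and \<psi>: "\<psi> \<in> E" and s: "s \<in> S"
  shows "Y s \<psi> = 0"
proof -
  have closed: "\<exists>h'. jets S Y E h' \<and> (\<forall>s\<in>S. (h has_field_derivative h' s) (at s))" if "jets S Y E h" for h
    using that
  proof (induction rule: jets.induct)
    case zero
    show ?case by (rule exI[of _ "\<lambda>s. 0"]) (simp add: jets.zero)
  next
    case (step c \<psi> h)
    then obtain h' where h': "jets S Y E h'" "\<And>s. s \<in> S \<Longrightarrow> (h has_field_derivative h' s) (at s)" by auto
    let ?n = "\<lambda>s. deriv c s * Y s \<psi> + (c s * Y' \<psi> s + h' s)"
    have "jets S Y E ?n"
      using step S h'(1) by (intro jets.step jets_add jets_scale der holomorphic_deriv)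
    moreover have "((\<lambda>s. c s * Y s \<psi> + h s) has_field_derivative ?n s) (at s)" if s: "s \<in> S" for s
    proof -
      have "(c has_field_derivative deriv c s) (at s)" using step(1) S(1) s by (rule holomorphic_derivI)
      from DERIV_add[OF DERIV_mult[OF this der(2)[OF step(2) s]] h'(2)[OF s]] show ?thesis
        by (simp add: algebra_simps)
    qed
    ultimately show ?case by (intro exI[of _ ?n] conjI ballI)
  qed
  have holo: "h holomorphic_on S" if h: "jets S Y E h" for h
  proof -
    obtain h' where "\<And>s. s \<in> S \<Longrightarrow> (h has_field_derivative h' s) (at s)" using closed[OF h] by auto
    then show ?thesis unfolding holomorphic_on_open[OF S(1)] by (intro ballI exI)
  qed
  have all: "(deriv ^^ n) h s1 = 0" if "jets S Y E h" for n h
    using that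
  proof (induction n arbitrary: h)
    case 0 then show ?case using jets_vanish[of S Y E h s1] init by simp
  next
    case (Suc n)
    obtain h' where h': "jets S Y E h'" "\<And>s. s \<in> S \<Longrightarrow> (h has_field_derivative h' s) (at s)" using closed[OF Suc.prems] by auto
    have "(deriv ^^ n) (deriv h) s1 = (deriv ^^ n) h' s1"
    proof (rule higher_deriv_transform_within_open[OF _ _ S(1,3)])
      show "deriv h holomorphic_on S" using holo[OF Suc.prems] S(1) by (rule holomorphic_deriv)
      show "h' holomorphic_on S" by (rule holo[OF h'(1)])
      show "deriv h w = h' w" if "w \<in> S" for w using DERIV_imp_deriv[OF h'(2)[OF that]] .
    qed
    then show ?case using Suc.IH[OF h'(1)] by (simp add: funpow_Suc_right del: funpow.simps)
  qed
  have "jets S Y E (\<lambda>s. 1 * Y s \<psi> + 0)" using \<psi> by (intro jets.step jets.zero holomorphic_on_const)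
  then have j: "jets S Y E (\<lambda>s. Y s \<psi>)" by simp
  show ?thesis by (rule holomorphic_fun_eq_0_on_connected[OF holo[OF j] S(1,2) all[OF j] S(3) s])
qed

section \<open>Transport of polynomials\<close>

context based_form begin

text \<open>A ring of functions that contains the entries of \<open>jac\<close> and is closed under directional derivatives at the points
  where \<open>D\<close> does not vanish. Inverses are only formed of functions without zeros at these points.\<close>

inductive coef :: "(complex ^ 'a \<Rightarrow> complex) \<Rightarrow> bool" where
  gen: "P \<in> exp_type \<Longrightarrow> \<psi> \<in> exp_type \<Longrightarrow> coef (\<lambda>z. u z P \<psi>)"
| const: "coef (\<lambda>z. a)"
| add: "coef b \<Longrightarrow> coef c \<Longrightarrow> coef (\<lambda>z. b z + c z)"
| mult: "coef b \<Longrightarrow> coef c \<Longrightarrow> coef (\<lambda>z. b z * c z)"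
| inv: "coef c \<Longrightarrow> (\<And>z. D z \<noteq> 0 \<Longrightarrow> c z \<noteq> 0) \<Longrightarrow> coef (\<lambda>z. inverse (c z))"

lemma coef_sum: "(\<And>i. i \<in> I \<Longrightarrow> coef (c i)) \<Longrightarrow> coef (\<lambda>z. \<Sum>i\<in>I. c i z)"
  by (induction I rule: infinite_finite_induct) (auto intro: coef.intros)
lemma coef_prod: "(\<And>i. i \<in> I \<Longrightarrow> coef (c i)) \<Longrightarrow> coef (\<lambda>z. \<Prod>i\<in>I. c i z)"
  by (induction I rule: infinite_finite_induct) (auto intro: coef.intros)
lemma coef_det: "(\<And>i j. coef (\<lambda>z. M z $ i $ j)) \<Longrightarrow> coef (\<lambda>z. det (M z :: complex ^ 'a ^ 'a))"
  unfolding det_def by (intro coef_sum coef.mult coef_prod coef.const)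
lemma coef_Delta: "coef (\<lambda>z. \<Delta> z $ i $ j)" and coef_Gamma: "coef (\<lambda>z. \<Gamma> z $ i $ j)"
  unfolding \<Delta>_def \<Gamma>_def by (simp_all add: coef.gen exp_type_mult[OF exp_type_coord test_exp_type] test_exp_type exp_type_coord)
lemma coef_D: "coef D" using coef_det[OF coef_Delta] unfolding D_def[abs_def] .
lemma coef_cof: "coef (\<lambda>z. cof z l k)"
  unfolding cof_def
proof (rule coef_det)
  fix i j show "coef (\<lambda>z. (\<chi> i j. if j = l then \<Gamma> z $ i $ k else \<Delta> z $ i $ j) $ i $ j)"
    by (cases "j = l") (auto simp: coef_Gamma coef_Delta)
qed
lemma coef_jac: "coef (\<lambda>z. (jac z *v g) $ l)"
  unfolding matrix_vector_mult_def jac_def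
  by (simp add: divide_inverse) (intro coef_sum coef.mult coef.const coef_cof coef.inv coef_D)

lemma coef_deriv:
  assumes "coef c"
  shows "\<exists>c'. coef c' \<and> (\<forall>z. D z \<noteq> 0 \<longrightarrow> ((\<lambda>t. c (z + t *s g)) has_field_derivative c' z) (at 0))"
  using assms
proof (induction rule: coef.induct)
  case (gen P \<psi>)
  have "coef (\<lambda>z. 2 * of_real pi * \<i> * u z (\<lambda>\<xi>. lin g \<xi> * P \<xi>) \<psi>)"
    using gen by (intro coef.mult coef.const coef.gen exp_type_intros)
  moreover have "((\<lambda>t. u (z + t *s g) P \<psi>) has_field_derivative 2 * of_real pi * \<i> * u z (\<lambda>\<xi>. lin g \<xi> * P \<xi>) \<psi>) (at 0)" for z
    using u_line[OF gen, of z g 0] by simp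
  ultimately show ?case by (intro exI[of _ "\<lambda>z. 2 * of_real pi * \<i> * u z (\<lambda>\<xi>. lin g \<xi> * P \<xi>) \<psi>"] conjI allI impI)
next
  case (const a)
  show ?case by (intro exI[of _ "\<lambda>z. 0"]) (simp add: coef.const)
next
  case (add b c)
  then obtain b' c' where bc: "coef b'" "coef c'"
    "\<And>z. D z \<noteq> 0 \<Longrightarrow> ((\<lambda>t. b (z + t *s g)) has_field_derivative b' z) (at 0)"
    "\<And>z. D z \<noteq> 0 \<Longrightarrow> ((\<lambda>t. c (z + t *s g)) has_field_derivative c' z) (at 0)" by auto
  show ?case
    by (intro exI[of _ "\<lambda>z. b' z + c' z"] conjI allI impI coef.add DERIV_add bc)
next
  case (mult b c)
  then obtain b' c' where bc: "coef b'" "coef c'"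
    "\<And>z. D z \<noteq> 0 \<Longrightarrow> ((\<lambda>t. b (z + t *s g)) has_field_derivative b' z) (at 0)"
    "\<And>z. D z \<noteq> 0 \<Longrightarrow> ((\<lambda>t. c (z + t *s g)) has_field_derivative c' z) (at 0)" by auto
  have "((\<lambda>t. b (z + t *s g) * c (z + t *s g)) has_field_derivative b' z * c z + c' z * b z) (at 0)" if "D z \<noteq> 0" for z
    using DERIV_mult[OF bc(3)[OF that] bc(4)[OF that]] by simp
  then show ?case
    using mult bc(1,2) by (intro exI[of _ "\<lambda>z. b' z * c z + c' z * b z"] conjI allI impI coef.add coef.mult)
next
  case (inv c)
  then obtain c' where c: "coef c'"
    "\<And>z. D z \<noteq> 0 \<Longrightarrow> ((\<lambda>t. c (z + t *s g)) has_field_derivative c' z) (at 0)" by auto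
  have "((\<lambda>t. inverse (c (z + t *s g))) has_field_derivative (-1) * (inverse (c z) * c' z * inverse (c z))) (at 0)" if z: "D z \<noteq> 0" for z
    using DERIV_inverse'[OF c(2)[OF z]] inv(2)[OF z] by simp
  moreover have "coef (\<lambda>z. (-1) * (inverse (c z) * c' z * inverse (c z)))"
    using inv c(1) by (intro coef.mult coef.const coef.inv)
  ultimately show ?case by (intro exI[of _ "\<lambda>z. (-1) * (inverse (c z) * c' z * inverse (c z))"] conjI allI impI)
qed

text \<open>Polynomials of degree less than \<open>n\<close> in \<open>\<xi>\<close> with coefficients in this ring.\<close>

inductive cpoly :: "nat \<Rightarrow> (complex ^ 'a \<Rightarrow> real ^ 'a \<Rightarrow> complex) \<Rightarrow> bool" where
  zero: "cpoly n (\<lambda>z \<xi>. 0)"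
| step: "coef c \<Longrightarrow> polyd n P \<Longrightarrow> cpoly n Q \<Longrightarrow> cpoly n (\<lambda>z \<xi>. c z * P \<xi> + Q z \<xi>)"

lemma cpoly_term: "coef c \<Longrightarrow> polyd n P \<Longrightarrow> cpoly n (\<lambda>z \<xi>. c z * P \<xi>)"
  using cpoly.step[OF _ _ cpoly.zero, of c n P] by simp
lemma cpoly_add: "cpoly n P \<Longrightarrow> cpoly n Q \<Longrightarrow> cpoly n (\<lambda>z \<xi>. P z \<xi> + Q z \<xi>)"
proof (induction rule: cpoly.induct)
  case (step c n P R)
  then have "cpoly n (\<lambda>z \<xi>. c z * P \<xi> + (R z \<xi> + Q z \<xi>))" by (intro cpoly.step) auto
  then show ?case by (simp add: add.assoc)
qed simp
lemma cpoly_Suc: "cpoly n Q \<Longrightarrow> cpoly (Suc n) Q"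
  by (induction rule: cpoly.induct) (auto intro: cpoly.intros polyd_Suc)
lemma cpoly_scale: "cpoly n Q \<Longrightarrow> coef b \<Longrightarrow> cpoly n (\<lambda>z \<xi>. b z * Q z \<xi>)"
proof (induction rule: cpoly.induct)
  case (step c n P Q)
  then have "cpoly n (\<lambda>z \<xi>. (b z * c z) * P \<xi> + b z * Q z \<xi>)" by (intro cpoly.step coef.mult) auto
  then show ?case by (simp add: algebra_simps)
qed (simp add: cpoly.zero)
lemma cpoly_lin: "cpoly n Q \<Longrightarrow> cpoly (Suc n) (\<lambda>z \<xi>. lin g \<xi> * Q z \<xi>)"
proof (induction rule: cpoly.induct)
  case (step c n P Q)
  then have "cpoly (Suc n) (\<lambda>z \<xi>. c z * (lin g \<xi> * P \<xi>) + lin g \<xi> * Q z \<xi>)" by (intro cpoly.step polyd.mult) auto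
  then show ?case by (simp add: algebra_simps)
qed (simp add: cpoly.zero)
lemma cpoly_sum: "(\<And>i. i \<in> I \<Longrightarrow> cpoly n (Q i)) \<Longrightarrow> cpoly n (\<lambda>z \<xi>. \<Sum>i\<in>I. Q i z \<xi>)"
  by (induction I rule: infinite_finite_induct) (auto intro: cpoly.zero cpoly_add)
lemma cpoly_jac: assumes "cpoly n Q" shows "cpoly (Suc n) (\<lambda>z \<xi>. lin (jac z *v g) \<xi> * Q z \<xi>)"
proof -
  have "cpoly (Suc n) (\<lambda>z \<xi>. \<Sum>l\<in>UNIV. (jac z *v g) $ l * (lin (axis l 1) \<xi> * Q z \<xi>))"
    using assms by (intro cpoly_sum cpoly_scale coef_jac cpoly_lin)
  then show ?thesis unfolding lin_axis by (simp add: lin_def sum_distrib_right mult.assoc)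
qed
lemma cpoly_polyd: "cpoly n Q \<Longrightarrow> polyd n (Q z)"
  by (induction rule: cpoly.induct) (auto intro: polyd.zero polyd.add polyd_scale)
lemma cpoly_one: "cpoly (Suc n) (\<lambda>z \<xi>. a)"
  using cpoly_term[OF coef.const[of a] polyd.const[of n 1]] by simp
lemma cpoly_power: "cpoly (Suc n) (\<lambda>z \<xi>. lin (jac z *v g) \<xi> ^ n)"
  by (induction n) (auto intro: cpoly_one cpoly_jac)
lemma cpoly_exp_type: "cpoly n Q \<Longrightarrow> Q z \<in> exp_type"
  using cpoly_polyd polyd_exp_type by blast

lemma u_combine: "cpoly n Q \<Longrightarrow> P \<in> exp_type \<Longrightarrow> \<psi> \<in> exp_type \<Longrightarrow>
  u z one (\<lambda>\<xi>. (c * P \<xi> + Q z' \<xi>) * \<psi> \<xi>) = c * u z one (\<lambda>\<xi>. P \<xi> * \<psi> \<xi>) + u z one (\<lambda>\<xi>. Q z' \<xi> * \<psi> \<xi>)"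
  using bf_add[OF u_bf_right[OF exp_type_const] exp_type_scale[OF exp_type_mult] exp_type_mult[OF cpoly_exp_type], of P \<psi> n Q \<psi> z 1 c z']
    bf_scale[OF u_bf_right[OF exp_type_const] exp_type_mult, of P \<psi> z 1 c]
  by (simp add: distrib_right mult.assoc)

text \<open>Product rule: the derivative of the character produces the factor \<open>\<langle>jac z g,\<xi>\<rangle>\<close> by \<open>jac_relation\<close>, the
  derivative of the coefficients stays within the degree.\<close>

lemma cpoly_deriv:
  assumes "cpoly n Q"
  shows "\<exists>Q'. cpoly n Q' \<and> (\<forall>\<psi>\<in>exp_type. \<forall>z. D z \<noteq> 0 \<longrightarrow>
    ((\<lambda>t. u (z + t *s g) one (\<lambda>\<xi>. Q (z + t *s g) \<xi> * \<psi> \<xi>)) has_field_derivative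
      2 * of_real pi * \<i> * u z one (\<lambda>\<xi>. lin (jac z *v g) \<xi> * (Q z \<xi> * \<psi> \<xi>)) + u z one (\<lambda>\<xi>. Q' z \<xi> * \<psi> \<xi>)) (at 0))"
  using assms
proof (induction rule: cpoly.induct)
  case (zero n)
  have "u z one (\<lambda>\<xi>. 0) = 0" for z by (rule bf_zero[OF u_bf_right[OF exp_type_const]])
  then show ?case by (intro exI[of _ "\<lambda>z \<xi>. 0"]) (simp add: cpoly.zero)
next
  case (step c n P Q)
  obtain c' where c': "coef c'" "\<And>z. D z \<noteq> 0 \<Longrightarrow> ((\<lambda>t. c (z + t *s g)) has_field_derivative c' z) (at 0)"
    using coef_deriv[OF step(1), of g] by auto
  obtain Q' where Q': "cpoly n Q'" "\<And>\<psi> z. \<psi> \<in> exp_type \<Longrightarrow> D z \<noteq> 0 \<Longrightarrow>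
    ((\<lambda>t. u (z + t *s g) one (\<lambda>\<xi>. Q (z + t *s g) \<xi> * \<psi> \<xi>)) has_field_derivative
      2 * of_real pi * \<i> * u z one (\<lambda>\<xi>. lin (jac z *v g) \<xi> * (Q z \<xi> * \<psi> \<xi>)) + u z one (\<lambda>\<xi>. Q' z \<xi> * \<psi> \<xi>)) (at 0)"
    using step(4) by auto
  have P: "P \<in> exp_type" using step(2) by (rule polyd_exp_type)
  have der: "((\<lambda>t. u (z + t *s g) one (\<lambda>\<xi>. (c (z + t *s g) * P \<xi> + Q (z + t *s g) \<xi>) * \<psi> \<xi>)) has_field_derivative
      2 * of_real pi * \<i> * u z one (\<lambda>\<xi>. lin (jac z *v g) \<xi> * ((c z * P \<xi> + Q z \<xi>) * \<psi> \<xi>)) + u z one (\<lambda>\<xi>. (c' z * P \<xi> + Q' z \<xi>) * \<psi> \<xi>)) (at 0)"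
    if \<psi>: "\<psi> \<in> exp_type" and z: "D z \<noteq> 0" for \<psi> z
  proof -
    have P\<psi>: "(\<lambda>\<xi>. P \<xi> * \<psi> \<xi>) \<in> exp_type" by (intro exp_type_intros P \<psi>)
    have l\<psi>: "(\<lambda>\<xi>. lin (jac z *v g) \<xi> * \<psi> \<xi>) \<in> exp_type" by (intro exp_type_intros \<psi>)
    have d1: "((\<lambda>t. u (z + t *s g) one (\<lambda>\<xi>. P \<xi> * \<psi> \<xi>)) has_field_derivative
       2 * of_real pi * \<i> * u z one (\<lambda>\<xi>. lin (jac z *v g) \<xi> * (P \<xi> * \<psi> \<xi>))) (at 0)"
      using u_line[OF exp_type_const[of 1] P\<psi>, of z g 0] jac_relation[OF z P\<psi>, of g] by simp
    have e1: "u z one (\<lambda>\<xi>. lin (jac z *v g) \<xi> * ((c z * P \<xi> + Q z \<xi>) * \<psi> \<xi>))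
       = c z * u z one (\<lambda>\<xi>. lin (jac z *v g) \<xi> * (P \<xi> * \<psi> \<xi>)) + u z one (\<lambda>\<xi>. lin (jac z *v g) \<xi> * (Q z \<xi> * \<psi> \<xi>))"
      using u_combine[OF step(3) P l\<psi>, of z "c z" z] by (simp add: mult.left_commute)
    show ?thesis
      unfolding u_combine[OF step(3) P \<psi>] u_combine[OF Q'(1) P \<psi>] e1
      using DERIV_add[OF DERIV_mult[OF c'(2)[OF z] d1] Q'(2)[OF \<psi> z]] by (simp add: algebra_simps)
  qed
  have "cpoly n (\<lambda>z \<xi>. c' z * P \<xi> + Q' z \<xi>)" using c'(1) step(2) Q'(1) by (rule cpoly.step)
  with der show ?case by (intro exI[of _ "\<lambda>z \<xi>. c' z * P \<xi> + Q' z \<xi>"] conjI ballI allI impI)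
qed

lemma D_near: assumes "D z \<noteq> 0" shows "\<forall>\<^sub>F t in nhds 0. D (z + t *s g) \<noteq> 0"
proof -
  have h: "(\<lambda>t. D (z + t *s g)) holomorphic_on UNIV" using D_line_holo unfolding line_holo_def by auto
  then have "continuous_on UNIV (\<lambda>t. D (z + t *s g))" by (rule holomorphic_on_imp_continuous_on)
  then have "open {t. D (z + t *s g) \<noteq> 0}" by (intro open_Collect_neq continuous_intros)
  then show ?thesis unfolding eventually_nhds using assms by (intro exI[of _ "{t. D (z + t *s g) \<noteq> 0}"]) simp
qed

text \<open>Differentiate the relation for \<open>P\<close> in the direction \<open>g\<close>. The left side acquires the factor \<open>\<langle>g,\<xi>\<rangle>\<close>, the right side
  the factor \<open>\<langle>jac z g,\<xi>\<rangle>\<close> up to a term that does not raise the degree.\<close>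

lemma transport_step:
  assumes Q: "cpoly m Q" and P: "P \<in> exp_type"
    and eq: "\<And>z \<psi>. D z \<noteq> 0 \<Longrightarrow> \<psi> \<in> exp_type \<Longrightarrow> u z P \<psi> = u z one (\<lambda>\<xi>. Q z \<xi> * \<psi> \<xi>)"
  shows "\<exists>Q'. cpoly m Q' \<and> (\<forall>z \<psi>. D z \<noteq> 0 \<longrightarrow> \<psi> \<in> exp_type \<longrightarrow>
     u z (\<lambda>\<xi>. lin g \<xi> * P \<xi>) \<psi> = u z one (\<lambda>\<xi>. (lin (jac z *v g) \<xi> * Q z \<xi> + Q' z \<xi>) * \<psi> \<xi>))"
proof -
  obtain Q' where Q': "cpoly m Q'" "\<And>\<psi> z. \<psi> \<in> exp_type \<Longrightarrow> D z \<noteq> 0 \<Longrightarrow>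
    ((\<lambda>t. u (z + t *s g) one (\<lambda>\<xi>. Q (z + t *s g) \<xi> * \<psi> \<xi>)) has_field_derivative
      2 * of_real pi * \<i> * u z one (\<lambda>\<xi>. lin (jac z *v g) \<xi> * (Q z \<xi> * \<psi> \<xi>)) + u z one (\<lambda>\<xi>. Q' z \<xi> * \<psi> \<xi>)) (at 0)"
    using cpoly_deriv[OF Q, of g] by auto
  let ?\<tau> = "2 * of_real pi * \<i> :: complex"
  define R where "R = (\<lambda>z \<xi>. inverse ?\<tau> * Q' z \<xi>)"
  have R: "cpoly m R" unfolding R_def using Q'(1) by (rule cpoly_scale[OF _ coef.const])
  have "u z (\<lambda>\<xi>. lin g \<xi> * P \<xi>) \<psi> = u z one (\<lambda>\<xi>. (lin (jac z *v g) \<xi> * Q z \<xi> + R z \<xi>) * \<psi> \<xi>)"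
    if z: "D z \<noteq> 0" and \<psi>: "\<psi> \<in> exp_type" for z \<psi>
  proof -
    have "((\<lambda>t. u (z + t *s g) P \<psi>) has_field_derivative ?\<tau> * u z (\<lambda>\<xi>. lin g \<xi> * P \<xi>) \<psi>) (at 0)"
      using u_line[OF P \<psi>, of z g 0] by simp
    moreover have "\<forall>\<^sub>F t in nhds 0. u (z + t *s g) P \<psi> = u (z + t *s g) one (\<lambda>\<xi>. Q (z + t *s g) \<xi> * \<psi> \<xi>)"
      using D_near[OF z, of g] by (rule eventually_mono) (rule eq[OF _ \<psi>])
    ultimately have "((\<lambda>t. u (z + t *s g) one (\<lambda>\<xi>. Q (z + t *s g) \<xi> * \<psi> \<xi>)) has_field_derivative ?\<tau> * u z (\<lambda>\<xi>. lin g \<xi> * P \<xi>) \<psi>) (at 0)"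
      by (simp add: DERIV_cong_ev[OF refl _ refl])
    from DERIV_unique[OF this Q'(2)[OF \<psi> z]]
    have e: "?\<tau> * u z (\<lambda>\<xi>. lin g \<xi> * P \<xi>) \<psi> = ?\<tau> * u z one (\<lambda>\<xi>. lin (jac z *v g) \<xi> * (Q z \<xi> * \<psi> \<xi>)) + u z one (\<lambda>\<xi>. Q' z \<xi> * \<psi> \<xi>)" .
    have t0: "?\<tau> \<noteq> 0" by simp
    have Q'\<psi>: "(\<lambda>\<xi>. Q' z \<xi> * \<psi> \<xi>) \<in> exp_type" by (intro exp_type_mult cpoly_exp_type[OF Q'(1)] \<psi>)
    have lQ: "(\<lambda>\<xi>. lin (jac z *v g) \<xi> * Q z \<xi>) \<in> exp_type" by (intro exp_type_mult exp_type_lin cpoly_exp_type[OF Q])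
    have "u z one (\<lambda>\<xi>. (1 * (lin (jac z *v g) \<xi> * Q z \<xi>) + R z \<xi>) * \<psi> \<xi>) = 1 * u z one (\<lambda>\<xi>. (lin (jac z *v g) \<xi> * Q z \<xi>) * \<psi> \<xi>) + u z one (\<lambda>\<xi>. R z \<xi> * \<psi> \<xi>)"
      by (rule u_combine[OF R lQ \<psi>])
    moreover have "u z one (\<lambda>\<xi>. R z \<xi> * \<psi> \<xi>) = inverse ?\<tau> * u z one (\<lambda>\<xi>. Q' z \<xi> * \<psi> \<xi>)"
      unfolding R_def mult.assoc using bf_scale[OF u_bf_right[OF exp_type_const] Q'\<psi>] by (simp only: mult.assoc)
    ultimately have "?\<tau> * u z one (\<lambda>\<xi>. (lin (jac z *v g) \<xi> * Q z \<xi> + R z \<xi>) * \<psi> \<xi>)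
       = ?\<tau> * u z one (\<lambda>\<xi>. lin (jac z *v g) \<xi> * (Q z \<xi> * \<psi> \<xi>)) + ?\<tau> * (inverse ?\<tau> * u z one (\<lambda>\<xi>. Q' z \<xi> * \<psi> \<xi>))"
      by (simp only: mult.assoc mult_1_left distrib_left)
    also have "?\<tau> * (inverse ?\<tau> * u z one (\<lambda>\<xi>. Q' z \<xi> * \<psi> \<xi>)) = u z one (\<lambda>\<xi>. Q' z \<xi> * \<psi> \<xi>)"
    proof -
      have "t * (inverse t * x) = x" if "t \<noteq> 0" for t x :: complex using that by simp
      then show ?thesis using t0 by blast
    qed
    finally have "?\<tau> * u z (\<lambda>\<xi>. lin g \<xi> * P \<xi>) \<psi> = ?\<tau> * u z one (\<lambda>\<xi>. (lin (jac z *v g) \<xi> * Q z \<xi> + R z \<xi>) * \<psi> \<xi>)"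
      using e by simp
    then show ?thesis using t0 by (simp only: mult_cancel_left) blast
  qed
  with R show ?thesis by (intro exI[of _ R] conjI allI impI)
qed

text \<open>The operator behind \<open>\<Phi>\<close> maps \<open>e\<^sub>z P\<close> to the image of \<open>e\<^sub>z\<close> times a polynomial of no larger degree.\<close>

lemma transport_polynomial:
  assumes "polyd n P"
  shows "\<exists>Q. cpoly n Q \<and> (\<forall>z \<psi>. D z \<noteq> 0 \<longrightarrow> \<psi> \<in> exp_type \<longrightarrow> u z P \<psi> = u z one (\<lambda>\<xi>. Q z \<xi> * \<psi> \<xi>))"
  using assms
proof (induction rule: polyd.induct)
  case (zero n)
  have "u z one (\<lambda>\<xi>. 0) = 0" for z by (rule bf_zero[OF u_bf_right[OF exp_type_const]])
  moreover have "u z (\<lambda>\<xi>. 0) \<psi> = 0" if "\<psi> \<in> exp_type" for z \<psi>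
    using bf_zero[OF bf_left[OF that]] by (simp add: u_def)
  ultimately have "u z (\<lambda>\<xi>. 0) \<psi> = 0" "u z one (\<lambda>\<xi>. 0) = 0" if "\<psi> \<in> exp_type" for z \<psi>
    using that by blast+
  then show ?case by (intro exI[of _ "\<lambda>z \<xi>. 0"]) (simp add: cpoly.zero)
next
  case (const n c)
  have "u z (\<lambda>\<xi>. c) \<psi> = u z one (\<lambda>\<xi>. c * \<psi> \<xi>)" if "\<psi> \<in> exp_type" for z \<psi>
    using u_scale_left[OF exp_type_const that, of z c 1] bf_scale[OF u_bf_right[OF exp_type_const] that] by simp
  then show ?case by (intro exI[of _ "\<lambda>z \<xi>. c"]) (simp add: cpoly_one)
next
  case (add n P R)
  then obtain Q S where Q: "cpoly n Q" "\<And>z \<psi>. D z \<noteq> 0 \<Longrightarrow> \<psi> \<in> exp_type \<Longrightarrow> u z P \<psi> = u z one (\<lambda>\<xi>. Q z \<xi> * \<psi> \<xi>)"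
    and S: "cpoly n S" "\<And>z \<psi>. D z \<noteq> 0 \<Longrightarrow> \<psi> \<in> exp_type \<Longrightarrow> u z R \<psi> = u z one (\<lambda>\<xi>. S z \<xi> * \<psi> \<xi>)" by auto
  have "u z (\<lambda>\<xi>. P \<xi> + R \<xi>) \<psi> = u z one (\<lambda>\<xi>. (Q z \<xi> + S z \<xi>) * \<psi> \<xi>)" if "D z \<noteq> 0" and \<psi>: "\<psi> \<in> exp_type" for z \<psi>
    unfolding u_add_left[OF polyd_exp_type[OF add(1)] polyd_exp_type[OF add(2)] \<psi>]
    using u_combine[OF S(1) cpoly_exp_type[OF Q(1), of z] \<psi>, of z 1 z] Q(2) S(2) that by simp
  with cpoly_add[OF Q(1) S(1)] show ?case
    by (intro exI[of _ "\<lambda>z \<xi>. Q z \<xi> + S z \<xi>"] conjI allI impI)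
next
  case (mult n P g)
  then obtain Q where Q: "cpoly n Q" "\<And>z \<psi>. D z \<noteq> 0 \<Longrightarrow> \<psi> \<in> exp_type \<Longrightarrow> u z P \<psi> = u z one (\<lambda>\<xi>. Q z \<xi> * \<psi> \<xi>)" by auto
  obtain Q' where Q': "cpoly n Q'" "\<And>z \<psi>. D z \<noteq> 0 \<Longrightarrow> \<psi> \<in> exp_type \<Longrightarrow>
     u z (\<lambda>\<xi>. lin g \<xi> * P \<xi>) \<psi> = u z one (\<lambda>\<xi>. (lin (jac z *v g) \<xi> * Q z \<xi> + Q' z \<xi>) * \<psi> \<xi>)"
    using transport_step[OF Q(1) polyd_exp_type[OF mult(1)] Q(2), of g] by auto
  show ?case
    by (intro exI[of _ "\<lambda>z \<xi>. lin (jac z *v g) \<xi> * Q z \<xi> + Q' z \<xi>"] conjI allI impI Q'(2) cpoly_add cpoly_jac Q cpoly_Suc Q'(1))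
qed

text \<open>On leading terms the transport of polynomials is composition with the derivative.\<close>

lemma transport_power:
  "\<exists>R. cpoly n R \<and> (\<forall>z \<psi>. D z \<noteq> 0 \<longrightarrow> \<psi> \<in> exp_type \<longrightarrow>
     u z (\<lambda>\<xi>. lin g \<xi> ^ n) \<psi> = u z one (\<lambda>\<xi>. (lin (jac z *v g) \<xi> ^ n + R z \<xi>) * \<psi> \<xi>))"
proof (induction n)
  case 0
  show ?case by (intro exI[of _ "\<lambda>z \<xi>. 0"]) (simp add: cpoly.zero)
next
  case (Suc n)
  then obtain R where R: "cpoly n R" "\<And>z \<psi>. D z \<noteq> 0 \<Longrightarrow> \<psi> \<in> exp_type \<Longrightarrow>
     u z (\<lambda>\<xi>. lin g \<xi> ^ n) \<psi> = u z one (\<lambda>\<xi>. (lin (jac z *v g) \<xi> ^ n + R z \<xi>) * \<psi> \<xi>)" by auto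
  have Q: "cpoly (Suc n) (\<lambda>z \<xi>. lin (jac z *v g) \<xi> ^ n + R z \<xi>)" by (intro cpoly_add cpoly_power cpoly_Suc R(1))
  have P: "(\<lambda>\<xi>. lin g \<xi> ^ n) \<in> exp_type" by (intro exp_type_intros)
  obtain Q' where Q': "cpoly (Suc n) Q'" "\<And>z \<psi>. D z \<noteq> 0 \<Longrightarrow> \<psi> \<in> exp_type \<Longrightarrow>
     u z (\<lambda>\<xi>. lin g \<xi> * lin g \<xi> ^ n) \<psi> = u z one (\<lambda>\<xi>. (lin (jac z *v g) \<xi> * (lin (jac z *v g) \<xi> ^ n + R z \<xi>) + Q' z \<xi>) * \<psi> \<xi>)"
    using transport_step[OF Q P R(2), of g] by auto
  have "cpoly (Suc n) (\<lambda>z \<xi>. lin (jac z *v g) \<xi> * R z \<xi> + Q' z \<xi>)" by (intro cpoly_add cpoly_jac R(1) Q'(1))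
  then show ?case using Q'(2)
    by (intro exI[of _ "\<lambda>z \<xi>. lin (jac z *v g) \<xi> * R z \<xi> + Q' z \<xi>"]) (simp add: distrib_left add.assoc)
qed

section \<open>Continuation along complex lines\<close>

text \<open>Along a line both \<open>u\<close> and the pairing with \<open>e\<^sub>F\<^sub>(\<^sub>s\<^sub>)\<close> solve the same linear system with one unknown for every \<open>\<psi>\<close>.\<close>

lemma flow_unique:
  assumes S: "open S" "connected S" "s1 \<in> S"
    and \<alpha>: "\<And>l. (\<lambda>s. \<alpha> s $ l) holomorphic_on S"
    and F: "\<And>l s. s \<in> S \<Longrightarrow> ((\<lambda>s. F s $ l) has_field_derivative \<alpha> s $ l) (at s)"
    and rel: "\<And>s \<psi>. s \<in> S \<Longrightarrow> \<psi> \<in> exp_type \<Longrightarrow> u (z0 + s *s v) (lin v) \<psi> = u (z0 + s *s v) one (\<lambda>\<xi>. lin (\<alpha> s) \<xi> * \<psi> \<xi>)"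
    and init: "\<And>\<psi>. \<psi> \<in> exp_type \<Longrightarrow> u (z0 + s1 *s v) one \<psi> = bil (ch (F s1)) \<psi>"
    and s: "s \<in> S" and \<psi>: "\<psi> \<in> exp_type"
  shows "u (z0 + s *s v) one \<psi> = bil (ch (F s)) \<psi>"
proof -
  let ?\<tau> = "2 * of_real pi * \<i> :: complex"
  define Y where "Y s \<psi> = u (z0 + s *s v) one \<psi> - bil (ch (F s)) \<psi>" for s \<psi>
  have lin_Y: "Y s (\<lambda>\<xi>. lin w \<xi> * \<psi> \<xi>) = (\<Sum>l\<in>UNIV. w $ l * Y s (\<lambda>\<xi>. coord l \<xi> * \<psi> \<xi>))" if \<psi>: "\<psi> \<in> exp_type" for s w \<psi>
  proof -
    have "bounded_functional (\<lambda>\<psi>. bil (ch (F s)) \<psi>)"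
      unfolding bil_commute[of "ch (F s)"] by (rule bounded_functional_bil[OF exp_type_ch])
    then show ?thesis unfolding Y_def u_lin_right[OF exp_type_const \<psi>] using bf_lin_sum[OF _ \<psi>]
      by (simp add: sum_subtractf right_diff_distrib)
  qed
  define Y' where "Y' \<psi> s = ?\<tau> * Y s (\<lambda>\<xi>. lin (\<alpha> s) \<xi> * \<psi> \<xi>)" for \<psi> s
  have "Y s \<psi> = 0"
  proof (rule linear_system_zero[OF S _ _ _ \<psi> s, of Y Y'])
    fix \<psi> :: "real ^ 'a \<Rightarrow> complex" assume \<psi>: "\<psi> \<in> exp_type"
    show "Y s1 \<psi> = 0" unfolding Y_def using init[OF \<psi>] by simp
    have "jets S Y exp_type (\<lambda>s. ?\<tau> * (\<Sum>l\<in>UNIV. \<alpha> s $ l * Y s (\<lambda>\<xi>. coord l \<xi> * \<psi> \<xi>)))"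
    proof (rule jets_scale[OF jets_sum[OF finite] holomorphic_on_const])
      fix l
      have "jets S Y exp_type (\<lambda>s. \<alpha> s $ l * Y s (\<lambda>\<xi>. coord l \<xi> * \<psi> \<xi>) + 0)"
        by (intro jets.step jets.zero \<alpha> exp_type_intros \<psi>)
      then show "jets S Y exp_type (\<lambda>s. \<alpha> s $ l * Y s (\<lambda>\<xi>. coord l \<xi> * \<psi> \<xi>))" by simp
    qed
    then show "jets S Y exp_type (Y' \<psi>)" unfolding Y'_def lin_Y[OF \<psi>] .
    fix s assume s: "s \<in> S"
    have 1: "((\<lambda>s. u (z0 + s *s v) one \<psi>) has_field_derivative ?\<tau> * u (z0 + s *s v) one (\<lambda>\<xi>. lin (\<alpha> s) \<xi> * \<psi> \<xi>)) (at s)"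
      using u_line[OF exp_type_const[of 1] \<psi>, of z0 v s] rel[OF s \<psi>] by simp
    have 2: "((\<lambda>s. bil (ch (F s)) \<psi>) has_field_derivative ?\<tau> * bil (ch (F s)) (\<lambda>\<xi>. lin (\<alpha> s) \<xi> * \<psi> \<xi>)) (at s)"
    proof -
      have "bil (\<lambda>\<xi>. lin (\<alpha> s) \<xi> * ch (F s) \<xi>) \<psi> = bil (ch (F s)) (\<lambda>\<xi>. lin (\<alpha> s) \<xi> * \<psi> \<xi>)"
        unfolding bil_def by (simp only: mult_ac)
      then show ?thesis
        using bf_curve[OF bounded_functional_bil[OF \<psi>] exp_type_const[of 1] F[OF s]] by simp
    qed
    show "((\<lambda>s. Y s \<psi>) has_field_derivative Y' \<psi> s) (at s)"
      unfolding Y_def Y'_def right_diff_distrib by (rule DERIV_diff[OF 1 2])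
  qed
  then show ?thesis unfolding Y_def by simp
qed

definition regular :: "complex ^ 'a \<Rightarrow> complex set" where
  "regular v = {s. D (cx p + s *s v) \<noteq> 0}"

lemma D_line: "(\<lambda>s. D (cx p + s *s v)) holomorphic_on UNIV"
  using D_line_holo unfolding line_holo_def by auto

lemma regular_open: "open (regular v)"
  unfolding regular_def using holomorphic_on_imp_continuous_on[OF D_line] by (intro open_Collect_neq continuous_intros)

lemma regular_0: "0 \<in> regular v" using Gram_nonsingular by (simp add: regular_def)

text \<open>A nonzero entire function has countably many zeros, and these do not disconnect the plane.\<close>

lemma regular_connected: "connected (regular v)"
proof -
  let ?h = "\<lambda>s. D (cx p + s *s v)"
  have c: "countable {s \<in> UNIV. ?h s = 0}"
  proof (cases "?h constant_on UNIV")
    case True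
    then obtain a where a: "\<And>s. ?h s = a" unfolding constant_on_def by auto
    then have "a \<noteq> 0" using a[of 0] Gram_nonsingular by simp
    then show ?thesis using a by simp
  next
    case False
    show ?thesis using False by (intro holomorphic_countable_zeros D_line) auto
  qed
  have "connected (UNIV - {s \<in> UNIV. ?h s = 0})"
    using c by (intro connected_open_diff_countable) auto
  moreover have "UNIV - {s \<in> UNIV. ?h s = 0} = regular v" unfolding regular_def by auto
  ultimately show ?thesis by simp
qed

lemma jac_line_holo: "(\<lambda>s. jac (cx p + s *s v) $ l $ k) holomorphic_on regular v"
proof -
  have "(\<lambda>s. cof (cx p + s *s v) l k) holomorphic_on UNIV" using cof_line_holo unfolding line_holo_def by auto
  then have "(\<lambda>s. cof (cx p + s *s v) l k / D (cx p + s *s v)) holomorphic_on regular v"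
    by (rule holomorphic_on_divide[OF holomorphic_on_subset[OF _ subset_UNIV] holomorphic_on_subset[OF D_line subset_UNIV]])
      (simp add: regular_def)
  then show ?thesis unfolding jac_def by simp
qed

text \<open>The operator behind \<open>\<Phi>\<close> maps \<open>e\<^sub>z\<close> to some character \<open>e\<^sub>\<zeta>\<close> at every regular point of a line through \<open>p\<close>. On a disc
  of regular points a primitive of \<open>jac z v\<close> provides the exponent, by \<open>flow_unique\<close>, once it exists at one point of
  the disc; so the property is invariant along the connected set of regular points.\<close>

lemma exponent_exists:
  assumes s: "s \<in> regular v"
  shows "\<exists>\<zeta>. \<forall>\<psi>\<in>exp_type. u (cx p + s *s v) one \<psi> = bil (ch \<zeta>) \<psi>"
proof -
  define T where "T s \<longleftrightarrow> (\<exists>\<zeta>. \<forall>\<psi>\<in>exp_type. u (cx p + s *s v) one \<psi> = bil (ch \<zeta>) \<psi>)" for s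
  have ball: "T b" if r: "ball a r \<subseteq> regular v" and c: "c \<in> ball a r" "T c" and b: "b \<in> ball a r" for a r b c
  proof -
    define \<alpha> where "\<alpha> s = jac (cx p + s *s v) *v v" for s
    have \<alpha>: "(\<lambda>s. \<alpha> s $ l) holomorphic_on ball a r" for l
      unfolding \<alpha>_def matrix_vector_mult_def
      by (simp, intro holomorphic_on_sum holomorphic_on_mult holomorphic_on_const holomorphic_on_subset[OF jac_line_holo r])
    have "\<exists>g. \<forall>x\<in>ball a r. (g has_field_derivative \<alpha> x $ l) (at x)" for l
    proof (rule holomorphic_convex_primitive'[OF convex_ball open_ball \<alpha>])
      fix g assume g: "\<And>x. x \<in> ball a r \<Longrightarrow> (g has_field_derivative \<alpha> x $ l) (at x within ball a r)"
      show ?thesis using g at_within_open[OF _ open_ball] by (intro exI[of _ g] ballI) force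
    qed
    then obtain g where g: "\<And>l x. x \<in> ball a r \<Longrightarrow> (g l has_field_derivative \<alpha> x $ l) (at x)" by metis
    obtain \<zeta> where \<zeta>: "\<And>\<psi>. \<psi> \<in> exp_type \<Longrightarrow> u (cx p + c *s v) one \<psi> = bil (ch \<zeta>) \<psi>"
      using c(2) unfolding T_def by auto
    define F where "F s = (\<chi> l. g l s - g l c + \<zeta> $ l)" for s
    have Fc: "F c = \<zeta>" unfolding F_def by (simp add: vec_eq_iff)
    have "u (cx p + b *s v) one \<psi> = bil (ch (F b)) \<psi>" if \<psi>: "\<psi> \<in> exp_type" for \<psi>
    proof (rule flow_unique[where F = F and \<alpha> = \<alpha>, OF open_ball connected_ball c(1) \<alpha> _ _ _ b \<psi>])
      show "((\<lambda>s. F s $ l) has_field_derivative \<alpha> s $ l) (at s)" if "s \<in> ball a r" for l s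
        unfolding F_def using g[OF that, of l] by (auto intro!: derivative_eq_intros)
      show "u (cx p + s *s v) (lin v) \<psi> = u (cx p + s *s v) one (\<lambda>\<xi>. lin (\<alpha> s) \<xi> * \<psi> \<xi>)"
        if "s \<in> ball a r" "\<psi> \<in> exp_type" for s \<psi>
        unfolding \<alpha>_def using that r by (intro jac_relation) (auto simp: regular_def)
      show "u (cx p + c *s v) one \<psi> = bil (ch (F c)) \<psi>" if "\<psi> \<in> exp_type" for \<psi>
        unfolding Fc by (rule \<zeta>[OF that])
    qed
    then show ?thesis unfolding T_def by (intro exI[of _ "F b"] ballI)
  qed
  have T0: "T 0" unfolding T_def using u_real[OF p] by (intro exI[of _ "cx (f p)"]) simp
  have "T 0 \<longleftrightarrow> T s"
  proof (rule connected_equivalence_relation[OF regular_connected[of v] regular_0 s, of "\<lambda>a b. T a \<longleftrightarrow> T b"])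
    fix a assume "a \<in> regular v"
    then obtain r where r: "r > 0" "ball a r \<subseteq> regular v" using openE[OF regular_open] by metis
    then have "openin (top_of_set (regular v)) (ball a r)" by (simp add: openin_open_eq[OF regular_open])
    moreover have "T a \<longleftrightarrow> T x" if "x \<in> ball a r" for x
      using ball[OF r(2) _ _ that, of a] ball[OF r(2) that, of a] r(1) by auto
    ultimately show "\<exists>V. openin (top_of_set (regular v)) V \<and> a \<in> V \<and> (\<forall>x\<in>V. T a \<longleftrightarrow> T x)"
      using r(1) by (intro exI[of _ "ball a r"]) auto
  qed auto
  then show ?thesis using T0 unfolding T_def by simp
qed

end

section \<open>Quotients of entire functions\<close>

text \<open>The singularities of the quotient are removable because it is bounded, and Liouville's theorem applies.\<close>

lemma entire_dominated:
  fixes N E :: "complex \<Rightarrow> complex"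
  assumes N: "N holomorphic_on UNIV" and E: "E holomorphic_on UNIV" and E0: "E b \<noteq> 0"
    and dom: "\<And>s. E s \<noteq> 0 \<Longrightarrow> cmod (N s / E s) \<le> c"
  shows "\<exists>k. \<forall>s. E s \<noteq> 0 \<longrightarrow> N s / E s = k"
proof -
  have sub: "N holomorphic_on X" "E holomorphic_on X" for X
    using holomorphic_on_subset[OF N subset_UNIV] holomorphic_on_subset[OF E subset_UNIV] by auto
  have "\<exists>r g. r > 0 \<and> g holomorphic_on ball a r \<and> (\<forall>s\<in>ball a r. s \<noteq> a \<or> E a \<noteq> 0 \<longrightarrow> E s \<noteq> 0 \<and> g s = N s / E s)" for a
  proof (cases "E a = 0")
    case False
    have "open {s. E s \<noteq> 0}" using holomorphic_on_imp_continuous_on[OF E] by (intro open_Collect_neq continuous_intros)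
    moreover have "a \<in> {s. E s \<noteq> 0}" using False by simp
    ultimately obtain r where r: "r > 0" "ball a r \<subseteq> {s. E s \<noteq> 0}" by (rule openE)
    have "(\<lambda>s. N s / E s) holomorphic_on ball a r" using r(2) by (intro holomorphic_on_divide sub) auto
    then show ?thesis using r by (intro exI[of _ r] exI[of _ "\<lambda>s. N s / E s"]) auto
  next
    case True
    obtain r where r: "r > 0" "\<And>z. z \<in> ball a r - {a} \<Longrightarrow> E z \<noteq> 0"
      using isolated_zeros[OF E open_UNIV connected_UNIV UNIV_I True UNIV_I E0] by auto
    have h: "(\<lambda>s. N s / E s) holomorphic_on (ball a r - {a})" using r(2) by (intro holomorphic_on_divide sub)
    have "\<forall>\<^sub>F z in at a. norm (N z / E z) \<le> c"
      unfolding eventually_at using r by (intro exI[of _ r]) (auto simp: dist_commute intro!: dom)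
    then obtain g where "g holomorphic_on ball a r" "\<And>z. z \<in> ball a r - {a} \<Longrightarrow> g z = N z / E z"
      using holomorphic_on_extend_bounded[OF h] r(1) by auto
    then show ?thesis using r True by (intro exI[of _ r] exI[of _ g]) auto
  qed
  then obtain r g where rg: "\<And>a. r a > 0" "\<And>a. g a holomorphic_on ball a (r a)"
    "\<And>a s. s \<in> ball a (r a) \<Longrightarrow> s \<noteq> a \<or> E a \<noteq> 0 \<Longrightarrow> E s \<noteq> 0 \<and> g a s = N s / E s" by metis
  define G where "G a = g a a" for a
  have Gq: "G s = N s / E s" if "E s \<noteq> 0" for s
    unfolding G_def using rg(3)[of s s] rg(1)[of s] that by simp
  have Gg: "G s = g a s" if "s \<in> ball a (r a)" for a s
    using rg(3)[OF that] Gq[of s] by (cases "s = a") (auto simp: G_def)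
  have "G holomorphic_on UNIV"
  proof (rule holomorphic_onI)
    fix a
    have "G holomorphic_on ball a (r a)" using rg(2)[of a] Gg holomorphic_cong by metis
    then have "G field_differentiable at a" using rg(1)[of a] by (simp add: holomorphic_on_imp_differentiable_at)
    then show "G field_differentiable at a within UNIV" by simp
  qed
  moreover have "cmod (G a) \<le> c" for a
  proof (cases "E a = 0")
    case False then show ?thesis using Gq dom by simp
  next
    case True
    have "continuous_on (ball a (r a)) (g a)" using rg(2) by (rule holomorphic_on_imp_continuous_on)
    then have "isCont (g a) a" using rg(1)[of a] by (simp add: continuous_on_eq_continuous_at)
    then have lim: "(g a \<longlongrightarrow> G a) (at a)" unfolding G_def isCont_def .
    show ?thesis
    proof (rule Lim_norm_ubound[OF _ lim])
      show "\<forall>\<^sub>F x in at a. norm (g a x) \<le> c"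
        unfolding eventually_at
      proof (intro exI[of _ "r a"] conjI ballI impI rg(1))
        fix x assume x: "x \<noteq> a \<and> dist x a < r a"
        then have "x \<in> ball a (r a)" by (simp add: dist_commute)
        then have "E x \<noteq> 0 \<and> g a x = N x / E x" using rg(3)[of x a] x by blast
        then show "norm (g a x) \<le> c" using dom[of x] by simp
      qed
    qed simp
  qed
  then have "bounded (range G)" unfolding bounded_iff by auto
  ultimately have "G constant_on UNIV" by (rule Liouville_theorem)
  then obtain k where "\<And>s. G s = k" unfolding constant_on_def by auto
  then show ?thesis using Gq by (intro exI[of _ k]) auto
qed

section \<open>Growth on polynomials forces the map to be affine\<close>

definition cxm :: "real ^ 'd ^ 'd \<Rightarrow> complex ^ 'd ^ 'd" where
  "cxm A = (\<chi> i j. of_real (A $ i $ j))"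

lemma cxm_mult: "cxm A *v cx x = cx (A *v x)"
  by (simp add: cxm_def cx_def matrix_vector_mult_def vec_eq_iff)

lemma trace_cxm: "trace (cxm X ** M) = (\<Sum>i\<in>UNIV. \<Sum>j\<in>UNIV. of_real (X $ i $ j) * M $ j $ i)"
  by (simp add: trace_def matrix_matrix_mult_def cxm_def)

text \<open>The extremal growth bound \<open>B\<close> and the set of admissible matrices enter only through these three properties.\<close>

locale growth_form = based_form +
  fixes B :: real and \<G> :: "(real ^ 'a ^ 'a) set"
  assumes B: "B > 0"
    and growth: "\<And>y. \<exists>N. \<forall>n\<ge>N. \<forall>P. polyd (Suc n) P \<longrightarrow>
        nr (\<lambda>\<xi>. of_real (exp (y \<bullet> \<xi>)) * P \<xi>) \<le> B ^ n * nr P \<and> nr P \<le> B ^ n * nr (\<lambda>\<xi>. of_real (exp (y \<bullet> \<xi>)) * P \<xi>)"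
    and comp: "\<And>A. A \<in> \<G> \<Longrightarrow> \<exists>c. \<forall>P\<in>exp_type. continuous_on UNIV P \<longrightarrow> nr (\<lambda>\<xi>. P (transpose A *v \<xi>)) \<le> c * nr P"
    and span: "span \<G> = UNIV"
begin

text \<open>The modulus of \<open>e\<^sub>z\<close> is the exponential of a real linear form.\<close>

lemma growth_ch:
  "\<exists>N. \<forall>n\<ge>N. \<forall>P. polyd (Suc n) P \<longrightarrow> nr (\<lambda>\<xi>. ch z \<xi> * P \<xi>) \<le> B ^ n * nr P \<and> nr P \<le> B ^ n * nr (\<lambda>\<xi>. ch z \<xi> * P \<xi>)"
proof -
  have "nr (\<lambda>\<xi>. ch z \<xi> * P \<xi>) = nr (\<lambda>\<xi>. of_real (exp ((\<chi> i. - (2 * pi * Im (z $ i))) \<bullet> \<xi>)) * P \<xi>)" for P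
    by (rule nr_cong_norm) (simp only: norm_mult norm_ch norm_of_real abs_exp_cancel)
  then show ?thesis using growth[of "\<chi> i. - (2 * pi * Im (z $ i))"] by simp
qed

text \<open>Apply in turn: multiplication by \<open>e\<^sub>z\<close>, the operator behind \<open>\<Phi>\<close>, division by \<open>e\<^sub>\<zeta>\<close>, substitution of \<open>A\<^sup>T\<close>. The first and
  third cost \<open>B\<^sup>n\<close>, the others a constant, and the leading term \<open>\<langle>g,\<xi>\<rangle>\<^sup>n\<close> of an eigenvector is multiplied by \<open>c\<^sup>n\<close>.\<close>

lemma leading_power_step:
  assumes s: "D z \<noteq> 0" and \<zeta>: "\<And>\<psi>. \<psi> \<in> exp_type \<Longrightarrow> u z one \<psi> = bil (ch \<zeta>) \<psi>"
    and A: "A \<in> \<G>" and ev: "(cxm A ** jac z) *v g = c *s g"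
  shows "\<exists>K>0. \<exists>N. \<forall>n\<ge>N. \<forall>q. polyd n q \<longrightarrow> (\<exists>r. polyd n r \<and>
    nr (\<lambda>\<xi>. c ^ n * lin g \<xi> ^ n + r \<xi>) \<le> K * (B\<^sup>2) ^ n * nr (\<lambda>\<xi>. lin g \<xi> ^ n + q \<xi>))"
proof -
  obtain N1 where N1: "\<And>n P. n \<ge> N1 \<Longrightarrow> polyd (Suc n) P \<Longrightarrow> nr (\<lambda>\<xi>. ch z \<xi> * P \<xi>) \<le> B ^ n * nr P"
    using growth_ch[of z] by auto
  obtain N2 where N2: "\<And>n P. n \<ge> N2 \<Longrightarrow> polyd (Suc n) P \<Longrightarrow> nr P \<le> B ^ n * nr (\<lambda>\<xi>. ch \<zeta> \<xi> * P \<xi>)"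
    using growth_ch[of \<zeta>] by auto
  obtain a where a: "\<And>P. P \<in> exp_type \<Longrightarrow> continuous_on UNIV P \<Longrightarrow> nr (\<lambda>\<xi>. P (transpose A *v \<xi>)) \<le> a * nr P" using comp[OF A] by auto
  define K where "K = \<bar>a\<bar> * C\<^sub>0 + 1"
  have K: "K > 0" unfolding K_def using C0 by (simp add: add_nonneg_pos)
  have "\<exists>r. polyd n r \<and> nr (\<lambda>\<xi>. c ^ n * lin g \<xi> ^ n + r \<xi>) \<le> K * (B\<^sup>2) ^ n * nr (\<lambda>\<xi>. lin g \<xi> ^ n + q \<xi>)"
    if n: "n \<ge> max N1 N2" and q: "polyd n q" for n q
  proof -
    define P where "P = (\<lambda>\<xi>. lin g \<xi> ^ n + q \<xi>)"
    have P: "polyd (Suc n) P" unfolding P_def by (intro polyd.add polyd_power polyd_Suc q)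
    obtain R where R: "cpoly n R" "\<And>z \<psi>. D z \<noteq> 0 \<Longrightarrow> \<psi> \<in> exp_type \<Longrightarrow>
       u z (\<lambda>\<xi>. lin g \<xi> ^ n) \<psi> = u z one (\<lambda>\<xi>. (lin (jac z *v g) \<xi> ^ n + R z \<xi>) * \<psi> \<xi>)"
      using transport_power[of n g] by auto
    obtain Q where Q: "cpoly n Q" "\<And>z \<psi>. D z \<noteq> 0 \<Longrightarrow> \<psi> \<in> exp_type \<Longrightarrow> u z q \<psi> = u z one (\<lambda>\<xi>. Q z \<xi> * \<psi> \<xi>)"
      using transport_polynomial[OF q] by auto
    define r where "r \<xi> = R z \<xi> + Q z \<xi>" for \<xi>
    have r: "polyd n r" unfolding r_def by (intro polyd.add cpoly_polyd R Q)
    define W where "W \<xi> = lin (jac z *v g) \<xi> ^ n + r \<xi>" for \<xi>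
    have W: "polyd (Suc n) W" unfolding W_def by (intro polyd.add polyd_power polyd_Suc r)
    have We: "W \<in> exp_type" using W by (rule polyd_exp_type)
    have "\<Phi> (\<lambda>\<xi>. ch z \<xi> * P \<xi>) \<psi> = bil (\<lambda>\<xi>. ch \<zeta> \<xi> * W \<xi>) \<psi>" if \<psi>: "\<psi> \<in> exp_type" for \<psi>
    proof -
      have pw: "(\<lambda>\<xi>. lin g \<xi> ^ n) \<in> exp_type" by (intro exp_type_intros)
      have pR: "(\<lambda>\<xi>. lin (jac z *v g) \<xi> ^ n + R z \<xi>) \<in> exp_type" by (intro exp_type_intros cpoly_exp_type[OF R(1)])
      have "u z P \<psi> = u z (\<lambda>\<xi>. lin g \<xi> ^ n) \<psi> + u z q \<psi>"
        unfolding P_def by (rule u_add_left[OF pw polyd_exp_type[OF q] \<psi>])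
      also have "\<dots> = u z one (\<lambda>\<xi>. (lin (jac z *v g) \<xi> ^ n + R z \<xi>) * \<psi> \<xi>) + u z one (\<lambda>\<xi>. Q z \<xi> * \<psi> \<xi>)"
        using R(2)[OF s \<psi>] Q(2)[OF s \<psi>] by simp
      also have "\<dots> = u z one (\<lambda>\<xi>. W \<xi> * \<psi> \<xi>)"
        using u_combine[OF Q(1) pR \<psi>, of z 1 z] unfolding W_def r_def by (simp add: add.assoc)
      also have "\<dots> = bil (ch \<zeta>) (\<lambda>\<xi>. W \<xi> * \<psi> \<xi>)" by (rule \<zeta>[OF exp_type_mult[OF We \<psi>]])
      also have "\<dots> = bil (\<lambda>\<xi>. ch \<zeta> \<xi> * W \<xi>) \<psi>" unfolding bil_def by (simp only: mult.assoc)
      finally show ?thesis unfolding u_def .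
    qed
    then have dual: "nr (\<lambda>\<xi>. ch \<zeta> \<xi> * W \<xi>) \<le> C\<^sub>0 * nr (\<lambda>\<xi>. ch z \<xi> * P \<xi>)"
      by (intro norm_le_of_dual exp_type_mult exp_type_ch We polyd_exp_type[OF P])
    define r' where "r' \<xi> = r (transpose A *v \<xi>)" for \<xi>
    have r': "polyd n r'" unfolding r'_def by (rule polyd_transpose[OF r])
    have "W (transpose A *v \<xi>) = c ^ n * lin g \<xi> ^ n + r' \<xi>" for \<xi>
    proof -
      have "lin (jac z *v g) (transpose A *v \<xi>) = lin (cxm A *v (jac z *v g)) \<xi>"
        unfolding lin_transpose cxm_def ..
      also have "\<dots> = c * lin g \<xi>" unfolding matrix_vector_mul_assoc ev lin_scale ..
      finally show ?thesis unfolding W_def r'_def by (simp only: power_mult_distrib)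
    qed
    then have "nr (\<lambda>\<xi>. c ^ n * lin g \<xi> ^ n + r' \<xi>) = nr (\<lambda>\<xi>. W (transpose A *v \<xi>))" by simp
    also have "\<dots> \<le> a * nr W" by (rule a[OF We polyd_continuous[OF W]])
    also have "\<dots> \<le> \<bar>a\<bar> * nr W" using nr_nonneg by (intro mult_right_mono) auto
    also have "nr W \<le> B ^ n * nr (\<lambda>\<xi>. ch \<zeta> \<xi> * W \<xi>)" using N2[OF _ W] n by simp
    also have "nr (\<lambda>\<xi>. ch \<zeta> \<xi> * W \<xi>) \<le> C\<^sub>0 * nr (\<lambda>\<xi>. ch z \<xi> * P \<xi>)" by (rule dual)
    also have "nr (\<lambda>\<xi>. ch z \<xi> * P \<xi>) \<le> B ^ n * nr P" using N1[OF _ P] n by simp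
    finally have "nr (\<lambda>\<xi>. c ^ n * lin g \<xi> ^ n + r' \<xi>) \<le> \<bar>a\<bar> * (B ^ n * (C\<^sub>0 * (B ^ n * nr P)))"
      using B C0 by (simp add: mult_left_mono)
    also have "\<dots> = (\<bar>a\<bar> * C\<^sub>0) * (B\<^sup>2) ^ n * nr P" by (simp add: power2_eq_square power_mult_distrib)
    also have "\<dots> \<le> K * (B\<^sup>2) ^ n * nr P" unfolding K_def using B nr_nonneg by (intro mult_right_mono) auto
    finally show ?thesis using r' unfolding P_def by (intro exI[of _ r'] conjI)
  qed
  then show ?thesis using K by (intro exI[of _ K] conjI exI[of _ "max N1 N2"] allI impI)
qed

text \<open>Take the infimum over the lower order terms: in the quotient by lower degree the leading power has a positive
  norm and is an eigenvector for \<open>c\<^sup>n\<close>, so \<open>|c|\<^sup>n \<le> K B\<^sup>2\<^sup>n\<close> for all large \<open>n\<close>; take \<open>n\<close>-th roots.\<close>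

lemma eigenvalue_bound:
  assumes s: "D z \<noteq> 0" and \<zeta>: "\<And>\<psi>. \<psi> \<in> exp_type \<Longrightarrow> u z one \<psi> = bil (ch \<zeta>) \<psi>"
    and A: "A \<in> \<G>" and g: "g \<noteq> 0" and ev: "(cxm A ** jac z) *v g = c *s g"
  shows "cmod c \<le> B\<^sup>2"
proof (cases "c = 0")
  case True then show ?thesis by simp
next
  case c: False
  obtain K N where K: "K > 0" and KN: "\<forall>n\<ge>N. \<forall>q. polyd n q \<longrightarrow> (\<exists>r. polyd n r \<and>
    nr (\<lambda>\<xi>. c ^ n * lin g \<xi> ^ n + r \<xi>) \<le> K * (B\<^sup>2) ^ n * nr (\<lambda>\<xi>. lin g \<xi> ^ n + q \<xi>))"
  proof -
    have "\<exists>K>0. \<exists>N. \<forall>n\<ge>N. \<forall>q. polyd n q \<longrightarrow> (\<exists>r. polyd n r \<and>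
      nr (\<lambda>\<xi>. c ^ n * lin g \<xi> ^ n + r \<xi>) \<le> K * (B\<^sup>2) ^ n * nr (\<lambda>\<xi>. lin g \<xi> ^ n + q \<xi>))"
      by (rule leading_power_step[OF s \<zeta> A ev])
    then show thesis by (elim exE conjE) (rule that)
  qed
  have step: "\<exists>r. polyd n r \<and>
    nr (\<lambda>\<xi>. c ^ n * lin g \<xi> ^ n + r \<xi>) \<le> K * (B\<^sup>2) ^ n * nr (\<lambda>\<xi>. lin g \<xi> ^ n + q \<xi>)" if "n \<ge> N" "polyd n q" for n q
    using KN[rule_format, OF that] .
  have bound: "cmod c ^ n \<le> K * (B\<^sup>2) ^ n" if n: "n \<ge> N" for n
  proof -
    \<comment> \<open>The values whose infimum is the norm of the leading power in the quotient by lower degree.\<close>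
    define S where "S = (\<lambda>q. nr (\<lambda>\<xi>. lin g \<xi> ^ n + q \<xi>)) ` {q. polyd n q}"
    obtain e where e: "e > 0" "\<And>q. polyd n q \<Longrightarrow> nr (\<lambda>\<xi>. lin g \<xi> ^ n + q \<xi>) \<ge> e"
      using leading_power_bounded_below[OF g, of n] by auto
    have ne: "S \<noteq> {}" unfolding S_def using polyd.zero by auto
    have bdd: "bdd_below S" unfolding S_def using e(2) by (intro bdd_belowI[of _ e]) auto
    have m: "Inf S \<ge> e" using ne e(2) unfolding S_def by (intro cInf_greatest) auto
    have KB: "K * (B\<^sup>2) ^ n > 0" using K B by simp
    have "cmod c ^ n * Inf S / (K * (B\<^sup>2) ^ n) \<le> Inf S"
    proof (rule cInf_greatest[OF ne])
      fix x assume "x \<in> S"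
      then obtain q where q: "polyd n q" "x = nr (\<lambda>\<xi>. lin g \<xi> ^ n + q \<xi>)" unfolding S_def by auto
      obtain r where r: "polyd n r" "nr (\<lambda>\<xi>. c ^ n * lin g \<xi> ^ n + r \<xi>) \<le> K * (B\<^sup>2) ^ n * x"
        using step[OF n q(1)] q(2) by auto
      have "c ^ n * (lin g \<xi> ^ n + inverse (c ^ n) * r \<xi>) = c ^ n * lin g \<xi> ^ n + r \<xi>" for \<xi>
        using c by (simp add: distrib_left)
      then have "nr (\<lambda>\<xi>. c ^ n * lin g \<xi> ^ n + r \<xi>) = cmod c ^ n * nr (\<lambda>\<xi>. lin g \<xi> ^ n + inverse (c ^ n) * r \<xi>)"
        using nr_scale[of "c ^ n" "\<lambda>\<xi>. lin g \<xi> ^ n + inverse (c ^ n) * r \<xi>"] by (simp add: norm_power)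
      moreover have "Inf S \<le> nr (\<lambda>\<xi>. lin g \<xi> ^ n + inverse (c ^ n) * r \<xi>)"
        unfolding S_def using bdd unfolding S_def by (intro cInf_lower image_eqI[OF refl]) (auto intro: polyd_scale[OF r(1)])
      ultimately have "cmod c ^ n * Inf S \<le> K * (B\<^sup>2) ^ n * x"
        using r(2) order_trans[OF mult_left_mono, of "Inf S" _ "cmod c ^ n"] by simp
      then show "cmod c ^ n * Inf S / (K * (B\<^sup>2) ^ n) \<le> x" using KB by (simp add: divide_le_eq mult.commute)
    qed
    then have "cmod c ^ n * Inf S \<le> (K * (B\<^sup>2) ^ n) * Inf S" using KB by (simp add: divide_le_eq mult.commute)
    then show ?thesis using m e(1) by simp
  qed
  show ?thesis
  proof (rule ccontr)
    assume "\<not> ?thesis"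
    then have r: "cmod c / B\<^sup>2 > 1" using B by simp
    obtain n where n: "K < (cmod c / B\<^sup>2) ^ n" using real_arch_pow[OF r] by auto
    have "(cmod c / B\<^sup>2) ^ n \<le> (cmod c / B\<^sup>2) ^ max n N" using r by (intro power_increasing) auto
    also have "\<dots> = cmod c ^ max n N / (B\<^sup>2) ^ max n N" by (rule power_divide)
    also have "\<dots> \<le> K" using bound[of "max n N"] B by (simp add: divide_le_eq)
    finally show False using n by simp
  qed
qed

text \<open>For \<open>X \<in> \<G>\<close> this is the eigenvalue bound; the trace is linear in \<open>X\<close>, and \<open>\<G>\<close> spans.\<close>

lemma trace_bounded: "\<exists>c. \<forall>s\<in>regular v. cmod (trace (cxm X ** jac (cx p + s *s v))) \<le> c"
proof -
  have "X \<in> span \<G>" using span by simp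
  then show ?thesis
  proof (induction rule: span_induct_alt)
    case base
    show ?case by (intro exI[of _ 0]) (simp add: trace_cxm)
  next
    case (step r A Y)
    then obtain c where c: "\<And>s. s \<in> regular v \<Longrightarrow> cmod (trace (cxm Y ** jac (cx p + s *s v))) \<le> c" by auto
    have "cmod (trace (cxm (r *\<^sub>R A + Y) ** jac (cx p + s *s v))) \<le> \<bar>r\<bar> * (real CARD('a) * B\<^sup>2) + c" if s: "s \<in> regular v" for s
    proof -
      let ?J = "jac (cx p + s *s v)"
      have "trace (cxm (r *\<^sub>R A + Y) ** ?J) = of_real r * trace (cxm A ** ?J) + trace (cxm Y ** ?J)"
        unfolding trace_cxm by (simp add: distrib_right sum.distrib sum_distrib_left mult.assoc)
      then have "cmod (trace (cxm (r *\<^sub>R A + Y) ** ?J)) \<le> \<bar>r\<bar> * cmod (trace (cxm A ** ?J)) + cmod (trace (cxm Y ** ?J))"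
        using norm_triangle_ineq[of "of_real r * trace (cxm A ** ?J)" "trace (cxm Y ** ?J)"] by (simp add: norm_mult)
      moreover have "cmod (trace (cxm A ** ?J)) \<le> real CARD('a) * B\<^sup>2"
      proof (rule trace_le_eigenvalue_bound)
        show "B\<^sup>2 > 0" using B by simp
        fix c g assume g: "g \<noteq> 0" and ev: "(cxm A ** ?J) *v g = c *s g"
        obtain \<zeta> where \<zeta>: "\<And>\<psi>. \<psi> \<in> exp_type \<Longrightarrow> u (cx p + s *s v) one \<psi> = bil (ch \<zeta>) \<psi>"
          using exponent_exists[OF s] by auto
        show "cmod c \<le> B\<^sup>2"
          by (rule eigenvalue_bound[OF _ \<zeta> step(1) g ev]) (use s in \<open>simp_all add: regular_def\<close>)
      qed
      then have "\<bar>r\<bar> * cmod (trace (cxm A ** ?J)) \<le> \<bar>r\<bar> * (real CARD('a) * B\<^sup>2)" by (rule mult_left_mono) simp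
      ultimately show ?thesis using c[OF s] by linarith
    qed
    then show ?case by blast
  qed
qed

text \<open>The entries of \<open>jac\<close> are traces of its products with matrix units, hence bounded quotients of entire functions.\<close>

lemma jac_constant: assumes s: "s \<in> regular v" shows "jac (cx p + s *s v) = jac (cx p)"
proof -
  have "jac (cx p + s *s v) $ l $ k = jac (cx p) $ l $ k" for l k
  proof -
    define X :: "real ^ 'a ^ 'a" where "X = (\<chi> i j. if i = k \<and> j = l then 1 else 0)"
    have tr: "trace (cxm X ** M) = M $ l $ k" for M
    proof -
      have "trace (cxm X ** M) = (\<Sum>i\<in>UNIV. \<Sum>j\<in>UNIV. if i = k then if j = l then M $ j $ i else 0 else 0)"
        unfolding trace_cxm X_def by (intro sum.cong refl) auto
      also have "\<dots> = (\<Sum>i\<in>UNIV. if i = k then M $ l $ i else 0)"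
        by (intro sum.cong refl) simp
      also have "\<dots> = M $ l $ k" by simp
      finally show ?thesis .
    qed
    obtain c where c: "\<And>s. s \<in> regular v \<Longrightarrow> cmod (jac (cx p + s *s v) $ l $ k) \<le> c"
      using trace_bounded[of v X] unfolding tr by auto
    define n where "n s = cof (cx p + s *s v) l k" for s
    define e where "e s = D (cx p + s *s v)" for s
    have j: "jac (cx p + s *s v) $ l $ k = n s / e s" for s by (simp add: jac_def n_def e_def)
    have "\<exists>a. \<forall>s. e s \<noteq> 0 \<longrightarrow> n s / e s = a"
    proof (rule entire_dominated)
      show "n holomorphic_on UNIV" unfolding n_def[abs_def] using cof_line_holo unfolding line_holo_def by auto
      show "e holomorphic_on UNIV" unfolding e_def[abs_def] by (rule D_line)
      show "e 0 \<noteq> 0" unfolding e_def using Gram_nonsingular by simp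
      show "cmod (n s / e s) \<le> c" if "e s \<noteq> 0" for s using c[of s] that unfolding j by (simp add: regular_def e_def)
    qed
    then obtain a where a: "\<And>s. e s \<noteq> 0 \<Longrightarrow> n s / e s = a" by auto
    have "e s \<noteq> 0" "e 0 \<noteq> 0" using s regular_0[of v] by (simp_all add: regular_def e_def)
    then have "n s / e s = a" "n 0 / e 0 = a" using a by blast+
    then show ?thesis using j[of s] j[of 0] by simp
  qed
  then show ?thesis by (simp add: vec_eq_iff)
qed

text \<open>With a constant derivative the exponent in \<open>flow_unique\<close> is an affine function. Its values are real at real points
  because \<open>jac p\<close> is the weak derivative of \<open>f\<close> at \<open>p\<close>, and on \<open>U\<close> separation of characters identifies it with \<open>f\<close>.\<close>

theorem affine:
  "\<exists>A b. (\<forall>x\<in>U. f x = A *v x + b) \<and> (\<forall>x. \<forall>\<psi>\<in>exp_type. \<Phi> (ch (cx x)) \<psi> = bil (ch (cx (A *v x + b))) \<psi>)"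
proof -
  have "\<exists>c. \<forall>l. jac (cx p) $ l $ k = of_real (c $ l)" for k
  proof (rule cof_real[OF p, of k])
    fix c assume c: "\<And>l. cof (cx p) l k = of_real (c $ l) * D (cx p)"
    show ?thesis using Gram_nonsingular by (intro exI[of _ c]) (simp add: jac_def c)
  qed
  then obtain c :: "'a \<Rightarrow> real ^ 'a" where c: "\<And>k l. jac (cx p) $ l $ k = of_real (c k $ l)" by metis
  define A where "A = (\<chi> l k. c k $ l)"
  have JA: "jac (cx p) = cxm A" by (simp add: vec_eq_iff cxm_def A_def c)
  define b where "b = f p - A *v p"
  have main: "u (cx p + 1 *s cx v) one \<psi> = bil (ch (cx (A *v (p + v) + b))) \<psi>" if \<psi>: "\<psi> \<in> exp_type" for v \<psi>
  proof -
    define w where "w = cx (A *v v)"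
    \<comment> \<open>Near s = 0 this is \<open>jac_relation\<close> with the constant matrix; the identity theorem covers the zeros of D.\<close>
    have rel: "u (cx p + s *s cx v) (lin (cx v)) \<psi> = u (cx p + s *s cx v) one (\<lambda>\<xi>. lin w \<xi> * \<psi> \<xi>)" if \<psi>: "\<psi> \<in> exp_type" for s \<psi>
    proof -
      define h where "h s = u (cx p + s *s cx v) (lin (cx v)) \<psi> - u (cx p + s *s cx v) one (\<lambda>\<xi>. lin w \<xi> * \<psi> \<xi>)" for s
      have hol: "h holomorphic_on UNIV"
      proof -
        have "line_holo (\<lambda>z. u z (lin (cx v)) \<psi> - u z one (\<lambda>\<xi>. lin w \<xi> * \<psi> \<xi>))"
          by (intro line_holo_diff u_line_holo exp_type_intros \<psi>)
        then show ?thesis unfolding line_holo_def h_def[abs_def] by auto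
      qed
      have h0: "h s = 0" if s: "s \<in> regular (cx v)" for s
        unfolding h_def using jac_relation[OF _ \<psi>, of "cx p + s *s cx v" "cx v"] s
        unfolding jac_constant[OF s] JA cxm_mult w_def by (simp add: regular_def)
      obtain e where e: "e > 0" "ball 0 e \<subseteq> regular (cx v)" using openE[OF regular_open regular_0] by metis
      have "h s = 0"
        by (rule entire_real_zero[OF hol e(1)]) (use e(2) in \<open>auto intro!: h0 simp: subset_iff\<close>)
      then show ?thesis unfolding h_def by simp
    qed
    define F where "F s = cx (f p) + s *s w" for s
    have "u (cx p + 1 *s cx v) one \<psi> = bil (ch (F 1)) \<psi>"
    proof (rule flow_unique[where F = F and \<alpha> = "\<lambda>s. w" and ?s1.0 = 0, OF open_UNIV connected_UNIV UNIV_I _ _ rel _ UNIV_I \<psi>])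
      show "((\<lambda>s. F s $ l) has_field_derivative w $ l) (at s)" for l s
        unfolding F_def by (auto intro!: derivative_eq_intros)
      show "u (cx p + 0 *s cx v) one \<psi> = bil (ch (F 0)) \<psi>" if "\<psi> \<in> exp_type" for \<psi>
        using u_real[OF p that] by (simp add: F_def)
    qed simp
    moreover have "F 1 = cx (A *v (p + v) + b)"
      by (simp add: F_def w_def b_def cx_add cx_diff matrix_vector_right_distrib)
    ultimately show ?thesis by simp
  qed
  have all: "\<Phi> (ch (cx x)) \<psi> = bil (ch (cx (A *v x + b))) \<psi>" if "\<psi> \<in> exp_type" for x \<psi>
    using main[OF that, of "x - p"] unfolding u_def by (simp add: cx_diff)
  have "f x = A *v x + b" if x: "x \<in> U" for x
  proof -
    define y where "y = f x - (A *v x + b)"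
    obtain C \<epsilon> where sep: "C > 0" "\<epsilon> > 0" "\<And>y. nr (\<lambda>\<xi>. ch (cx y) \<xi> - 1) < \<epsilon> \<Longrightarrow> norm y \<le> C * nr (\<lambda>\<xi>. ch (cx y) \<xi> - 1)"
      using character_separation by blast
    define \<theta> where "\<theta> = (\<lambda>\<xi>. ch (cx (f x)) \<xi> - ch (cx (A *v x + b)) \<xi>)"
    have \<theta>: "\<theta> \<in> exp_type" unfolding \<theta>_def by (intro exp_type_intros)
    have "bil \<theta> \<psi> = 0" if \<psi>: "\<psi> \<in> exp_type" for \<psi>
      unfolding \<theta>_def using bf_diff[OF bounded_functional_bil[OF \<psi>] exp_type_ch exp_type_ch] Phi_ch[OF x \<psi>] all[OF \<psi>, of x] by simp
    then have "nr \<theta> = 0" using bil_cnj[OF \<theta>] exp_type_cnj[OF \<theta>] by simp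
    moreover have "nr (\<lambda>\<xi>. ch (cx y) \<xi> - 1) = nr \<theta>"
    proof (rule nr_cong_norm)
      fix \<xi>
      have "\<theta> \<xi> = ch (cx (A *v x + b)) \<xi> * (ch (cx y) \<xi> - 1)"
        unfolding \<theta>_def y_def cx_diff[of "f x"] ch_diff using ch_nz[of "cx (A *v x + b)" \<xi>] by (simp add: right_diff_distrib)
      then show "cmod (ch (cx y) \<xi> - 1) = cmod (\<theta> \<xi>)" by (simp only: norm_mult norm_ch_cx mult_1_left)
    qed
    ultimately have "norm y \<le> 0" using sep(2) sep(3)[of y] by simp
    then show ?thesis unfolding y_def by simp
  qed
  with all show ?thesis by (intro exI[of _ A] exI[of _ b] conjI ballI allI)
qed

end

section \<open>Lebesgue measure: exponential moments and linear maps\<close>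

lemma exp_abs_finite: "(\<integral>\<^sup>+x. ennreal (exp (- \<bar>x\<bar>)) \<partial>(lborel :: real measure)) < \<infinity>"
proof -
  have lim: "((\<lambda>x. - exp (- x)) \<longlongrightarrow> (0 :: real)) at_top"
    using tendsto_minus[OF filterlim_compose[OF exp_at_bot filterlim_uminus_at_bot_at_top]] by simp
  have half: "(\<integral>\<^sup>+x. ennreal (exp (- x)) * indicator {0..} x \<partial>(lborel :: real measure)) = ennreal (0 - (- exp (- 0)))"
    by (rule nn_integral_FTC_atLeast[OF _ _ _ lim]) (auto intro!: derivative_eq_intros)
  have "(\<integral>\<^sup>+x. ennreal (exp (- \<bar>x\<bar>)) \<partial>(lborel :: real measure))
     \<le> (\<integral>\<^sup>+x. ennreal (exp (- x)) * indicator {0..} x + ennreal (exp x) * indicator {..0} x \<partial>lborel)"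
    by (intro nn_integral_mono) (auto simp: indicator_def abs_if)
  also have "\<dots> = (\<integral>\<^sup>+x. ennreal (exp (- x)) * indicator {0..} x \<partial>lborel) + (\<integral>\<^sup>+x. ennreal (exp x) * indicator {..0} x \<partial>(lborel :: real measure))"
    by (intro nn_integral_add) auto
  also have "(\<integral>\<^sup>+x. ennreal (exp x) * indicator {..0} x \<partial>(lborel :: real measure)) = (\<integral>\<^sup>+x. ennreal (exp (- x)) * indicator {..0} (- x) \<partial>lborel)"
    by (subst nn_integral_real_affine[of _ "-1" 0]) auto
  also have "\<dots> = (\<integral>\<^sup>+x. ennreal (exp (- x)) * indicator {0..} x \<partial>lborel)"
    by (intro nn_integral_cong) (auto simp: indicator_def)
  finally show ?thesis unfolding half by (simp add: order.strict_trans1)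
qed

lemma exp_norm_finite: "(\<integral>\<^sup>+\<xi>. ennreal (exp (- (real DIM(real ^ 'd) * norm \<xi>))) \<partial>(lborel :: (real ^ 'd) measure)) < \<infinity>"
proof -
  have "(\<integral>\<^sup>+\<xi>. ennreal (exp (- (real DIM(real ^ 'd) * norm \<xi>))) \<partial>(lborel :: (real ^ 'd) measure))
     \<le> (\<integral>\<^sup>+\<xi>. ennreal (\<Prod>b\<in>Basis. exp (- \<bar>\<xi> \<bullet> b\<bar>)) \<partial>(lborel :: (real ^ 'd) measure))"
  proof (intro nn_integral_mono ennreal_leI)
    fix \<xi> :: "real ^ 'd"
    have "(\<Sum>b\<in>Basis. \<bar>\<xi> \<bullet> b\<bar>) \<le> (\<Sum>b\<in>(Basis :: (real ^ 'd) set). norm \<xi>)" by (intro sum_mono Basis_le_norm)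
    then have "- (real DIM(real ^ 'd) * norm \<xi>) \<le> (\<Sum>b\<in>Basis. - \<bar>\<xi> \<bullet> b\<bar>)" by (simp add: sum_negf)
    then show "exp (- (real DIM(real ^ 'd) * norm \<xi>)) \<le> (\<Prod>b\<in>Basis. exp (- \<bar>\<xi> \<bullet> b\<bar>))"
      by (subst exp_sum[symmetric]) simp_all
  qed
  also have "\<dots> = (\<integral>\<^sup>+\<xi>. (\<Prod>b\<in>Basis. ennreal (exp (- \<bar>\<xi> \<bullet> b\<bar>))) \<partial>(lborel :: (real ^ 'd) measure))"
    by (simp add: prod_ennreal)
  also have "\<dots> = (\<Prod>b\<in>(Basis :: (real ^ 'd) set). (\<integral>\<^sup>+x. ennreal (exp (- \<bar>x\<bar>)) \<partial>(lborel :: real measure)))"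
    by (rule nn_integral_lborel_prod) auto
  also have "\<dots> < \<infinity>" using exp_abs_finite by (simp add: power_less_top_ennreal)
  finally show ?thesis .
qed

text \<open>Translation invariance determines Lebesgue measure up to a factor, by an exchange of integrals; so invertible linear
  maps only rescale it.\<close>

lemma linear_image_scaling:
  fixes A :: "real ^ 'd ^ 'd"
  assumes A: "invertible A"
  shows "\<exists>k>0. \<forall>g\<in>borel_measurable borel. (\<integral>\<^sup>+\<xi>. g (A *v \<xi>) \<partial>lborel) = ennreal k * (\<integral>\<^sup>+\<xi>. g \<xi> \<partial>lborel)"
proof -
  obtain A' where A': "A ** A' = mat 1" "A' ** A = mat 1" using A unfolding invertible_def by auto
  have AA: "A *v (A' *v x) = x" "A' *v (A *v x) = x" for x by (auto simp: matrix_vector_mul_assoc A')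
  have cont: "continuous_on UNIV ((*v) A)" by (rule linear_continuous_on) (simp add: linear_linear[symmetric] matrix_vector_mul_linear)
  have cont': "continuous_on UNIV ((*v) A')" by (rule linear_continuous_on) (simp add: linear_linear[symmetric] matrix_vector_mul_linear)
  have mA[measurable]: "(*v) A \<in> borel_measurable borel" using cont by (rule borel_measurable_continuous_onI)
  have trans: "(\<integral>\<^sup>+\<xi>. h (a + \<xi>) \<partial>lborel) = (\<integral>\<^sup>+\<xi>. h \<xi> \<partial>(lborel :: (real ^ 'd) measure))" if [measurable]: "h \<in> borel_measurable borel" for h :: "real ^ 'd \<Rightarrow> ennreal" and a
  proof -
    have "(\<integral>\<^sup>+\<xi>. h \<xi> \<partial>lborel) = (\<integral>\<^sup>+\<xi>. h \<xi> \<partial>distr lborel borel ((+) a))" unfolding lborel_distr_plus ..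
    also have "\<dots> = (\<integral>\<^sup>+\<xi>. h (a + \<xi>) \<partial>lborel)" by (rule nn_integral_distr) measurable
    finally show ?thesis by simp
  qed
  define b :: "real ^ 'd \<Rightarrow> ennreal" where "b = indicator (ball 0 1)"
  have [measurable]: "b \<in> borel_measurable borel" unfolding b_def by (rule borel_measurable_indicator) simp
  define v where "v = emeasure lborel (ball (0 :: real ^ 'd) 1)"
  have v: "(\<integral>\<^sup>+\<xi>. b \<xi> \<partial>lborel) = v" unfolding b_def v_def by simp
  have pos: "emeasure lborel Y \<noteq> 0" if "open Y" "y \<in> Y" for Y and y :: "real ^ 'd"
  proof
    assume "emeasure lborel Y = 0"
    then have "Y \<in> null_sets lborel" using that(1) by auto
    then have "negligible Y" by (simp add: negligible_iff_null_sets null_sets_completionI)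
    then show False using open_not_negligible[OF that(1)] that(2) by auto
  qed
  have v0: "v \<noteq> 0" "v \<noteq> \<infinity>"
    unfolding v_def using pos[OF open_ball, of "0 :: real ^ 'd" 0 1] emeasure_bounded_finite[OF bounded_ball, of "0 :: real ^ 'd" 1] by auto
  define c where "c = (\<integral>\<^sup>+\<xi>. b (- (A *v \<xi>)) \<partial>lborel)"
  \<comment> \<open>Insert a translate of the unit ball, exchange the integrals, and move the translation to the other factor.\<close>
  have ex: "v * (\<integral>\<^sup>+y. g (A *v y) \<partial>lborel) = c * (\<integral>\<^sup>+y. g y \<partial>lborel)" if [measurable]: "g \<in> borel_measurable borel" for g :: "real ^ 'd \<Rightarrow> ennreal"
  proof -
    have pair: "pair_sigma_finite (lborel :: (real ^ 'd) measure) (lborel :: (real ^ 'd) measure)" by unfold_locales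
    have "v * (\<integral>\<^sup>+y. g (A *v y) \<partial>lborel) = (\<integral>\<^sup>+x. b x * (\<integral>\<^sup>+y. g (A *v y) \<partial>lborel) \<partial>lborel)"
      unfolding v[symmetric] by (rule nn_integral_multc[symmetric]) measurable
    also have "\<dots> = (\<integral>\<^sup>+x. b x * (\<integral>\<^sup>+y. g (x + A *v y) \<partial>lborel) \<partial>lborel)"
    proof (rule nn_integral_cong)
      fix x
      have "(\<integral>\<^sup>+y. g (A *v y) \<partial>lborel) = (\<integral>\<^sup>+y. g (A *v (A' *v x + y)) \<partial>lborel)"
        by (rule trans[symmetric]) measurable
      then show "b x * (\<integral>\<^sup>+y. g (A *v y) \<partial>lborel) = b x * (\<integral>\<^sup>+y. g (x + A *v y) \<partial>lborel)"
        by (simp add: matrix_vector_right_distrib AA)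
    qed
    also have "\<dots> = (\<integral>\<^sup>+x. (\<integral>\<^sup>+y. b x * g (x + A *v y) \<partial>lborel) \<partial>lborel)"
      by (intro nn_integral_cong nn_integral_cmult[symmetric]) measurable
    also have "\<dots> = (\<integral>\<^sup>+y. (\<integral>\<^sup>+x. b x * g (x + A *v y) \<partial>lborel) \<partial>lborel)"
      by (rule pair_sigma_finite.Fubini'[OF pair, symmetric]) measurable
    also have "\<dots> = (\<integral>\<^sup>+y. (\<integral>\<^sup>+x. b (x - A *v y) * g x \<partial>lborel) \<partial>lborel)"
    proof (rule nn_integral_cong)
      fix y
      have "(\<integral>\<^sup>+x. b (x - A *v y) * g x \<partial>lborel) = (\<integral>\<^sup>+x. b ((A *v y + x) - A *v y) * g (A *v y + x) \<partial>lborel)"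
        by (rule trans[symmetric]) measurable
      then show "(\<integral>\<^sup>+x. b x * g (x + A *v y) \<partial>lborel) = (\<integral>\<^sup>+x. b (x - A *v y) * g x \<partial>lborel)"
        by (simp add: add.commute)
    qed
    also have "\<dots> = (\<integral>\<^sup>+x. (\<integral>\<^sup>+y. b (x - A *v y) * g x \<partial>lborel) \<partial>lborel)"
      by (rule pair_sigma_finite.Fubini'[OF pair]) measurable
    also have "\<dots> = (\<integral>\<^sup>+x. c * g x \<partial>lborel)"
    proof (rule nn_integral_cong)
      fix x
      have "(\<integral>\<^sup>+y. b (x - A *v y) * g x \<partial>lborel) = (\<integral>\<^sup>+y. b (x - A *v y) \<partial>lborel) * g x"
        by (rule nn_integral_multc) measurable
      also have "(\<integral>\<^sup>+y. b (x - A *v y) \<partial>lborel) = (\<integral>\<^sup>+y. b (x - A *v (A' *v x + y)) \<partial>lborel)"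
        by (rule trans[symmetric]) measurable
      also have "\<dots> = c" unfolding c_def by (simp add: matrix_vector_right_distrib AA)
      finally show "(\<integral>\<^sup>+y. b (x - A *v y) * g x \<partial>lborel) = c * g x" .
    qed
    also have "\<dots> = c * (\<integral>\<^sup>+y. g y \<partial>lborel)" by (rule nn_integral_cmult) measurable
    finally show ?thesis .
  qed
  define X where "X = {\<xi>. - (A *v \<xi>) \<in> ball 0 1}"
  have oX: "open X" unfolding X_def
    using open_vimage[OF open_ball, of "\<lambda>\<xi>. - (A *v \<xi>)" 0 1] cont by (simp add: vimage_def continuous_on_minus)
  have cX: "c = emeasure lborel X"
  proof -
    have "X \<in> sets borel" using oX by simp
    moreover have "c = (\<integral>\<^sup>+\<xi>. indicator X \<xi> \<partial>lborel)" unfolding c_def b_def X_def by (intro nn_integral_cong) (simp add: indicator_def)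
    ultimately show ?thesis by simp
  qed
  have "0 \<in> X" unfolding X_def by simp
  have "X \<subseteq> (\<lambda>x. A' *v (- x)) ` ball 0 1"
  proof
    fix \<xi> assume "\<xi> \<in> X"
    then show "\<xi> \<in> (\<lambda>x. A' *v (- x)) ` ball 0 1"
      unfolding X_def using AA by (intro image_eqI[of _ _ "- (A *v \<xi>)"]) auto
  qed
  moreover have "bounded ((\<lambda>x. A' *v (- x)) ` cball 0 1)"
    using cont' by (intro compact_imp_bounded compact_continuous_image compact_cball)
      (auto intro!: continuous_on_compose2[of UNIV "(*v) A'"] continuous_intros)
  ultimately have bX: "bounded X" by (meson ball_subset_cball bounded_subset image_mono)
  have c1: "c \<noteq> \<infinity>" unfolding cX using emeasure_bounded_finite[OF bX] by simp
  have c0: "c \<noteq> 0" unfolding cX by (rule pos[OF oX \<open>0 \<in> X\<close>])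
  obtain v' c' where vc: "v = ennreal v'" "c = ennreal c'" "v' > 0" "c' > 0"
    using v0 c0 c1 by (cases v; cases c) (auto simp: less_le)
  have "(\<integral>\<^sup>+\<xi>. g (A *v \<xi>) \<partial>lborel) = ennreal (c' / v') * (\<integral>\<^sup>+\<xi>. g \<xi> \<partial>lborel)" if "g \<in> borel_measurable borel" for g :: "real ^ 'd \<Rightarrow> ennreal"
  proof -
    have "ennreal (1 / v') * (v * (\<integral>\<^sup>+\<xi>. g (A *v \<xi>) \<partial>lborel)) = ennreal (1 / v') * (c * (\<integral>\<^sup>+\<xi>. g \<xi> \<partial>lborel))"
      using ex[OF that] by simp
    moreover have "ennreal (1 / v') * v = 1" "ennreal (1 / v') * c = ennreal (c' / v')"
      unfolding vc using vc(3,4) by (simp_all add: ennreal_mult[symmetric])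
    ultimately show ?thesis by (simp add: mult.assoc[symmetric])
  qed
  then show ?thesis using vc(3,4) by (intro exI[of _ "c' / v'"]) auto
qed

section \<open>The measure with density \<open>w\<close>\<close>

locale weight =
  fixes w :: "real ^ 'd \<Rightarrow> real"
  assumes w_L1: "integrable lebesgue w"
    and w_nonzero: "\<not> (AE \<xi> in lebesgue. w \<xi> = 0)"
    and w_nonneg: "AE \<xi> in lebesgue. w \<xi> \<ge> 0"
    and w_decay: "\<And>a::real. a > 0 \<Longrightarrow> \<exists>c>0. AE \<xi> in lebesgue. w \<xi> \<le> c * exp (- a * norm \<xi>)"
begin

definition \<mu> :: "(real ^ 'd) measure" where "\<mu> = density lebesgue (\<lambda>\<xi>. ennreal (w \<xi>))"

lemma w_measurable: "w \<in> borel_measurable lebesgue" using w_L1 by simp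

text \<open>A nonnegative Borel version of \<open>w\<close>, so that substitutions preserve measurability.\<close>

definition w0 :: "real ^ 'd \<Rightarrow> real" where
  "w0 = (SOME g. g \<in> borel_measurable borel \<and> (\<forall>\<xi>. g \<xi> \<ge> 0) \<and> (AE \<xi> in lebesgue. w \<xi> = g \<xi>))"

lemma w0: "w0 \<in> borel_measurable borel" "\<And>\<xi>. w0 \<xi> \<ge> 0" "AE \<xi> in lebesgue. w \<xi> = w0 \<xi>"
proof -
  obtain g where g: "g \<in> borel_measurable lborel" "AE \<xi> in lborel. w \<xi> = g \<xi>"
    using completion_ex_borel_measurable_real[OF w_measurable] by auto
  have "AE \<xi> in lebesgue. w \<xi> = max 0 (g \<xi>)"
    using w_nonneg AE_completion[OF g(2)] by eventually_elim auto
  then have "\<exists>g. g \<in> borel_measurable borel \<and> (\<forall>\<xi>. g \<xi> \<ge> 0) \<and> (AE \<xi> in lebesgue. w \<xi> = g \<xi>)"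
    using g(1) by (intro exI[of _ "\<lambda>\<xi>. max 0 (g \<xi>)"]) auto
  from someI_ex[OF this] show "w0 \<in> borel_measurable borel" "\<And>\<xi>. w0 \<xi> \<ge> 0" "AE \<xi> in lebesgue. w \<xi> = w0 \<xi>"
    unfolding w0_def by auto
qed

lemmas w0_measurable [measurable] = w0(1)

lemma \<mu>_w0: "\<mu> = density lebesgue (\<lambda>\<xi>. ennreal (w0 \<xi>))"
  unfolding \<mu>_def
proof (rule density_cong)
  show "AE \<xi> in lebesgue. ennreal (w \<xi>) = ennreal (w0 \<xi>)" using w0(3) by eventually_elim simp
qed (use w_measurable w0 in \<open>auto intro!: borel_measurable_lebesgueI\<close>)

lemma nn_integral_\<mu>: assumes [measurable]: "g \<in> borel_measurable borel"
  shows "(\<integral>\<^sup>+\<xi>. g \<xi> \<partial>\<mu>) = (\<integral>\<^sup>+\<xi>. ennreal (w0 \<xi>) * g \<xi> \<partial>lborel)"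
proof -
  have "(\<integral>\<^sup>+\<xi>. g \<xi> \<partial>\<mu>) = (\<integral>\<^sup>+\<xi>. ennreal (w0 \<xi>) * g \<xi> \<partial>lebesgue)"
    unfolding \<mu>_w0 by (rule nn_integral_density) (auto intro!: borel_measurable_lebesgueI)
  then show ?thesis by (simp add: nn_integral_completion)
qed

text \<open>The decay of \<open>w\<close> beats \<open>exp (a |\<xi>|)\<close> with an integrable factor to spare.\<close>

lemma exp_int: "integrable \<mu> (\<lambda>\<xi>. exp (a * norm \<xi>))"
proof -
  define a' where "a' = \<bar>a\<bar> + real DIM(real ^ 'd)"
  have "a' > 0" unfolding a'_def by (simp add: add_nonneg_pos)
  from w_decay[OF this] obtain c where c: "c > 0" "AE \<xi> in lebesgue. w \<xi> \<le> c * exp (- a' * norm \<xi>)" by auto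
  have "integrable lborel (\<lambda>\<xi> :: real ^ 'd. exp (- (real DIM(real ^ 'd) * norm \<xi>)))"
    using exp_norm_finite[where 'd = 'd] by (intro integrableI_nonneg) auto
  then have i: "integrable lebesgue (\<lambda>\<xi> :: real ^ 'd. c * exp (- (real DIM(real ^ 'd) * norm \<xi>)))"
    by (intro integrable_mult_right integrable_completion[THEN iffD2]) auto
  have "integrable lebesgue (\<lambda>\<xi>. w \<xi> *\<^sub>R exp (a * norm \<xi>))"
  proof (rule Bochner_Integration.integrable_bound[OF i])
    show "(\<lambda>\<xi>. w \<xi> *\<^sub>R exp (a * norm \<xi>)) \<in> borel_measurable lebesgue"
      by (rule borel_measurable_scaleR[OF w_measurable borel_measurable_lebesgueI]) measurable
    show "AE \<xi> in lebesgue. norm (w \<xi> *\<^sub>R exp (a * norm \<xi>)) \<le> norm (c * exp (- (real DIM(real ^ 'd) * norm \<xi>)))"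
      using w_nonneg c(2)
    proof eventually_elim
      fix \<xi> assume w: "0 \<le> w \<xi>" "w \<xi> \<le> c * exp (- a' * norm \<xi>)"
      have "w \<xi> * exp (a * norm \<xi>) \<le> (c * exp (- a' * norm \<xi>)) * exp (\<bar>a\<bar> * norm \<xi>)"
        using w c(1) by (intro mult_mono) (auto intro!: mult_right_mono)
      also have "\<dots> = c * exp (- (real DIM(real ^ 'd) * norm \<xi>))"
        unfolding a'_def mult.assoc exp_add[symmetric] by (simp add: algebra_simps)
      finally show "norm (w \<xi> *\<^sub>R exp (a * norm \<xi>)) \<le> norm (c * exp (- (real DIM(real ^ 'd) * norm \<xi>)))"
        using w(1) c(1) by (simp add: abs_mult)
    qed
  qed
  moreover have "(\<lambda>\<xi> :: real ^ 'd. exp (a * norm \<xi>)) \<in> borel_measurable lebesgue"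
    by (rule borel_measurable_lebesgueI) measurable
  ultimately show ?thesis unfolding \<mu>_def using integrable_density[OF _ w_measurable w_nonneg] by blast
qed

text \<open>The sets \<open>{w \<ge> 1 / (n + 1)}\<close> within balls exhaust the support of \<open>w\<close>, so one of them has positive measure, and inner
  regularity provides a compact part.\<close>

lemma ac_lower: "\<exists>K \<delta>. compact K \<and> measure lebesgue K > 0 \<and> \<delta> > 0 \<and>
     (\<forall>g\<in>borel_measurable borel. ennreal \<delta> * (\<integral>\<^sup>+\<xi>. g \<xi> * indicator K \<xi> \<partial>lborel) \<le> (\<integral>\<^sup>+\<xi>. g \<xi> \<partial>\<mu>))"
proof -
  define S where "S n = {\<xi>. w0 \<xi> \<ge> 1 / real (Suc n)} \<inter> cball 0 (real n)" for n :: nat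
  have Sb [measurable]: "S n \<in> sets borel" for n unfolding S_def by measurable
  have "\<exists>n. emeasure lborel (S n) \<noteq> 0"
  proof (rule ccontr)
    assume "\<not> ?thesis"
    then have "(\<Union>n. S n) \<in> null_sets lborel" using Sb by (intro null_sets_UN) auto
    then have "AE \<xi> in lborel. \<xi> \<notin> (\<Union>n. S n)" by (rule AE_not_in)
    then have "AE \<xi> in lebesgue. \<xi> \<notin> (\<Union>n. S n)" by (rule AE_completion)
    then have "AE \<xi> in lebesgue. w \<xi> = 0"
      using w0(3)
    proof eventually_elim
      fix \<xi> assume n: "\<xi> \<notin> (\<Union>n. S n)" and e: "w \<xi> = w0 \<xi>"
      have "\<not> w0 \<xi> > 0"
      proof
        assume "w0 \<xi> > 0"
        then obtain m where m: "1 / real (Suc m) < w0 \<xi>" using nat_approx_posE by blast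
        obtain k where k: "norm \<xi> \<le> real k" using real_arch_simple by blast
        have "1 / real (Suc (max m k)) \<le> 1 / real (Suc m)" by (simp add: frac_le)
        then have "\<xi> \<in> S (max m k)" unfolding S_def using m k by (simp add: le_max_iff_disj)
        then show False using n by blast
      qed
      then show "w \<xi> = 0" using e w0(2)[of \<xi>] by simp
    qed
    then show False using w_nonzero by simp
  qed
  then obtain n where n: "emeasure lborel (S n) \<noteq> 0" by auto
  have fin: "emeasure lborel (S n) < \<infinity>" by (rule emeasure_bounded_finite) (auto simp: S_def)
  have Sl: "S n \<in> lmeasurable" using fin Sb[of n] by (intro fmeasurableI) auto
  define m where "m = measure lebesgue (S n)"
  have m: "m > 0"
  proof -
    have "emeasure lebesgue (S n) \<noteq> 0" using n Sb[of n] by simp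
    then show ?thesis unfolding m_def using emeasure_eq_measure2[OF Sl] by (auto simp: less_le)
  qed
  obtain K where K: "closed K" "K \<subseteq> S n" "S n - K \<in> lmeasurable" "emeasure lebesgue (S n - K) < ennreal m"
    using sets_lebesgue_inner_closed[OF fmeasurableD[OF Sl] m] by blast
  have cK: "compact K"
    using K(1,2) unfolding S_def compact_eq_bounded_closed by (auto intro: bounded_subset[OF bounded_cball])
  have mK: "measure lebesgue K > 0"
  proof -
    have "measure lebesgue (S n - K) = m - measure lebesgue K"
      unfolding m_def using measurable_measure_Diff[OF Sl fmeasurableD[OF lmeasurable_compact[OF cK]] K(2)] .
    moreover have "measure lebesgue (S n - K) < m"
      using K(4) m emeasure_eq_measure2[OF K(3)] by (simp add: ennreal_less_iff)
    ultimately show ?thesis by simp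
  qed
  define \<delta> where "\<delta> = 1 / real (Suc n)"
  have "ennreal \<delta> * (\<integral>\<^sup>+\<xi>. g \<xi> * indicator K \<xi> \<partial>lborel) \<le> (\<integral>\<^sup>+\<xi>. g \<xi> \<partial>\<mu>)" if [measurable]: "g \<in> borel_measurable borel" for g
  proof -
    have [measurable]: "K \<in> sets borel" using K(1) by simp
    have "ennreal \<delta> * (\<integral>\<^sup>+\<xi>. g \<xi> * indicator K \<xi> \<partial>lborel) = (\<integral>\<^sup>+\<xi>. ennreal \<delta> * (g \<xi> * indicator K \<xi>) \<partial>lborel)"
      by (rule nn_integral_cmult[symmetric]) measurable
    also have "\<dots> \<le> (\<integral>\<^sup>+\<xi>. ennreal (w0 \<xi>) * g \<xi> \<partial>lborel)"
    proof (rule nn_integral_mono)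
      fix \<xi> show "ennreal \<delta> * (g \<xi> * indicator K \<xi>) \<le> ennreal (w0 \<xi>) * g \<xi>"
      proof (cases "\<xi> \<in> K")
        case True
        then have "\<delta> \<le> w0 \<xi>" using K(2) unfolding S_def \<delta>_def by auto
        then show ?thesis using True by (auto intro!: mult_right_mono ennreal_leI)
      qed simp
    qed
    also have "\<dots> = (\<integral>\<^sup>+\<xi>. g \<xi> \<partial>\<mu>)" by (rule nn_integral_\<mu>[symmetric]) measurable
    finally show ?thesis .
  qed
  moreover have "\<delta> > 0" unfolding \<delta>_def by simp
  ultimately show ?thesis using cK mK by (intro exI[of _ K] exI[of _ \<delta>] conjI ballI)
qed

sublocale ac_measure \<mu>
proof
  show "sets \<mu> = sets lebesgue" by (simp add: \<mu>_def)
qed (rule exp_int ac_lower)+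

lemma nn_integral_nr: "\<phi> \<in> exp_type \<Longrightarrow> (\<integral>\<^sup>+\<xi>. ennreal ((cmod (\<phi> \<xi>))\<^sup>2) \<partial>\<mu>) = ennreal ((nr \<phi>)\<^sup>2)"
  unfolding nr_sq by (rule nn_integral_eq_integral) (auto intro: integrable_norm_sq)

lemma L2_weight_norm_eq: "\<phi> \<in> exp_type \<Longrightarrow> L2_weight_norm w \<phi> = ennreal (nr \<phi>)"
  unfolding L2_weight_norm_def \<mu>_def[symmetric] nn_integral_nr ennroot_def
  using nr_nonneg by (simp add: sqrt_def[symmetric])

text \<open>In \<open>[0, \<infinity>]\<close> a positive number divided by zero is infinite, so finiteness of the supremum forces \<open>a = 0\<close> when \<open>b = 0\<close>.\<close>

lemma ratio_bound:
  assumes n: "n > 0" and B: "B > 0" and P: "P \<in> S" and a: "a \<ge> 0" and b: "b \<ge> 0"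
    and q: "q P = ennreal a / ennreal b" and root: "ennroot n (SUP P\<in>S. q P) < ennreal B"
  shows "a \<le> B ^ n * b"
proof -
  define s where "s = (SUP P\<in>S. q P)"
  have fin: "s \<noteq> \<infinity>" using root unfolding ennroot_def s_def[symmetric] by (auto split: if_splits)
  then obtain r where r: "s = ennreal r" "r \<ge> 0" by (cases s) auto
  have "root n r < B" using root fin r B real_root_ge_zero[OF r(2), of n] unfolding ennroot_def s_def[symmetric] by (simp add: ennreal_less_iff)
  then have "root n r ^ n \<le> B ^ n" using real_root_ge_zero[OF r(2), of n] by (intro power_mono) auto
  then have rB: "r \<le> B ^ n" using n r(2) by simp
  have le: "ennreal a / ennreal b \<le> ennreal r" using SUP_upper[OF P, of q] unfolding q r(1)[symmetric] s_def .
  show ?thesis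
  proof (cases "b = 0")
    case True
    then have "a = 0"
    proof (rule_tac ccontr)
      assume "a \<noteq> 0"
      then have "ennreal a / ennreal b = \<infinity>" using a True by (simp add: ennreal_divide_zero)
      then show False using le top_le[of "ennreal r"] by simp
    qed
    then show ?thesis using True by simp
  next
    case False
    then have "ennreal (a / b) \<le> ennreal r" using le a b by (simp add: divide_ennreal)
    then have "a / b \<le> r" using r(2) by (simp add: ennreal_le_iff)
    then have "a \<le> r * b" using b False by (simp add: field_simps)
    also have "\<dots> \<le> B ^ n * b" using rB b by (rule mult_right_mono)
    finally show ?thesis .
  qed
qed

text \<open>A bound on the limit superior of the \<open>n\<close>-th roots is a bound by \<open>B\<^sup>n\<close> for all large \<open>n\<close>.\<close>

lemma growth_from_extremal:
  assumes B: "B > 0" and lim: "limsup (\<lambda>n. E_minus n y w) < ennreal B" "limsup (\<lambda>n. E_plus n y w) < ennreal B"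
  shows "\<exists>N. \<forall>n\<ge>N. \<forall>P. polyd (Suc n) P \<longrightarrow>
        nr (\<lambda>\<xi>. of_real (exp (y \<bullet> \<xi>)) * P \<xi>) \<le> B ^ n * nr P \<and> nr P \<le> B ^ n * nr (\<lambda>\<xi>. of_real (exp (y \<bullet> \<xi>)) * P \<xi>)"
proof -
  have "\<forall>\<^sub>F n in sequentially. n > 0 \<and> E_minus n y w < ennreal B \<and> E_plus n y w < ennreal B"
    using eventually_gt_at_top[of 0] Limsup_lessD[OF lim(1)] Limsup_lessD[OF lim(2)] by eventually_elim auto
  then obtain N where N: "\<And>n. n \<ge> N \<Longrightarrow> n > 0 \<and> E_minus n y w < ennreal B \<and> E_plus n y w < ennreal B"
    unfolding eventually_sequentially by auto
  have "nr (\<lambda>\<xi>. of_real (exp (y \<bullet> \<xi>)) * P \<xi>) \<le> B ^ n * nr P \<and> nr P \<le> B ^ n * nr (\<lambda>\<xi>. of_real (exp (y \<bullet> \<xi>)) * P \<xi>)"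
    if n: "n \<ge> N" and P: "polyd (Suc n) P" for n P
  proof (cases "P = (\<lambda>\<xi>. 0)")
    case True then show ?thesis by (simp add: nr_def)
  next
    case False
    have Pm: "P \<in> poly_le n - {\<lambda>\<xi>. 0}" using polyd_imp_poly_le[OF P refl] False by simp
    have Pe: "P \<in> exp_type" using P by (rule polyd_exp_type)
    have m: "mult_exp y P = (\<lambda>\<xi>. of_real (exp (y \<bullet> \<xi>)) * P \<xi>)" by (simp add: mult_exp_def)
    have "(\<lambda>\<xi>. complex_of_real (exp (y \<bullet> \<xi>))) \<in> exp_type"
    proof (rule exp_typeI[of _ 1 "norm y"])
      show "cmod (of_real (exp (y \<bullet> \<xi>))) \<le> 1 * exp (norm y * norm \<xi>)" for \<xi>
        using norm_cauchy_schwarz[of y \<xi>] by simp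
    qed (intro borel_measurable_lebesgueI, measurable)
    then have me: "mult_exp y P \<in> exp_type" unfolding m using Pe by (rule exp_type_mult)
    have n0: "n > 0" using N[OF n] by simp
    have "nr (mult_exp y P) \<le> B ^ n * nr P"
      by (rule ratio_bound[OF n0 B Pm nr_nonneg nr_nonneg, of "\<lambda>P. L2_weight_norm w (mult_exp y P) / L2_weight_norm w P"])
        (use N[OF n] in \<open>simp_all add: L2_weight_norm_eq Pe me E_plus_def\<close>)
    moreover have "nr P \<le> B ^ n * nr (mult_exp y P)"
      by (rule ratio_bound[OF n0 B Pm nr_nonneg nr_nonneg, of "\<lambda>P. L2_weight_norm w P / L2_weight_norm w (mult_exp y P)"])
        (use N[OF n] in \<open>simp_all add: L2_weight_norm_eq Pe me E_minus_def\<close>)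
    ultimately show ?thesis unfolding m by simp
  qed
  then show ?thesis by (intro exI[of _ N]) blast
qed

lemma AE_linear_image:
  fixes A :: "real ^ 'd ^ 'd"
  assumes A: "invertible A" and Q: "AE \<xi> in lebesgue. Q \<xi>"
  shows "AE \<xi> in lebesgue. Q (A *v \<xi>)"
proof -
  obtain k where k: "\<And>g. g \<in> borel_measurable borel \<Longrightarrow> (\<integral>\<^sup>+\<xi>. g (A *v \<xi>) \<partial>lborel) = ennreal k * (\<integral>\<^sup>+\<xi>. g \<xi> \<partial>lborel)"
    using linear_image_scaling[OF A] by auto
  have "continuous_on UNIV ((*v) A)" by (rule linear_continuous_on) (simp add: linear_linear[symmetric] matrix_vector_mul_linear)
  then have [measurable]: "(*v) A \<in> borel_measurable borel" by (rule borel_measurable_continuous_onI)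
  have "AE \<xi> in lborel. Q \<xi>" using Q by (simp add: AE_completion_iff)
  then obtain N where N: "{\<xi>. \<not> Q \<xi>} \<subseteq> N" "N \<in> null_sets lborel" unfolding eventually_ae_filter by auto
  have [measurable]: "N \<in> sets borel" using N(2) by auto
  have "(\<integral>\<^sup>+\<xi>. indicator N (A *v \<xi>) \<partial>lborel) = ennreal k * (\<integral>\<^sup>+\<xi>. indicator N \<xi> \<partial>lborel)" by (rule k) measurable
  also have "\<dots> = 0" using N(2) by (simp add: null_setsD1)
  finally have "AE \<xi> in lborel. indicator N (A *v \<xi>) = (0 :: ennreal)" by (subst (asm) nn_integral_0_iff_AE) auto
  then have "AE \<xi> in lborel. Q (A *v \<xi>)" by eventually_elim (use N(1) in \<open>auto simp: indicator_def split: if_splits\<close>)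
  then show ?thesis by (rule AE_completion)
qed

text \<open>Change variables after replacing \<open>w(\<xi>)\<close> by \<open>w(A\<^sup>T \<xi>) / l\<close>.\<close>

lemma G_set_comp:
  assumes A: "A \<in> G_set w"
  shows "\<exists>c\<ge>0. \<forall>P\<in>exp_type. continuous_on UNIV P \<longrightarrow> (\<lambda>\<xi>. P (transpose A *v \<xi>)) \<in> exp_type \<longrightarrow> nr (\<lambda>\<xi>. P (transpose A *v \<xi>)) \<le> c * nr P"
proof -
  define T where "T = transpose A"
  obtain l where l: "l > 0" "AE \<xi> in lebesgue. w (transpose A *v \<xi>) \<ge> l * w \<xi>" and inv: "invertible A"
    using A unfolding G_set_def by blast
  note l = l(1) l(2)[folded T_def]
  have inv': "invertible T" unfolding T_def using inv by (rule transpose_invertible)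
  obtain k where k: "k > 0" "\<And>g. g \<in> borel_measurable borel \<Longrightarrow> (\<integral>\<^sup>+\<xi>. g (T *v \<xi>) \<partial>lborel) = ennreal k * (\<integral>\<^sup>+\<xi>. g \<xi> \<partial>lborel)"
    using linear_image_scaling[OF inv'] by (elim exE conjE) (rule that, assumption, erule bspec)
  have "AE \<xi> in lebesgue. w0 \<xi> \<le> 1 / l * w0 (T *v \<xi>)"
    using l(2) w0(3) AE_linear_image[OF inv' w0(3)]
    by eventually_elim (use l(1) in \<open>simp add: field_simps\<close>)
  then have ae: "AE \<xi> in lborel. w0 \<xi> \<le> 1 / l * w0 (T *v \<xi>)" by (simp add: AE_completion_iff)
  have "nr (\<lambda>\<xi>. P (T *v \<xi>)) \<le> sqrt (k / l) * nr P"
    if P: "P \<in> exp_type" "continuous_on UNIV P" and PA: "(\<lambda>\<xi>. P (T *v \<xi>)) \<in> exp_type" for P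
  proof -
    have [measurable]: "P \<in> borel_measurable borel" using P(2) by (rule borel_measurable_continuous_onI)
    have "continuous_on UNIV ((*v) T)" by (rule linear_continuous_on) (simp add: linear_linear[symmetric] matrix_vector_mul_linear)
    then have [measurable]: "(*v) T \<in> borel_measurable borel" by (rule borel_measurable_continuous_onI)
    have "ennreal ((nr (\<lambda>\<xi>. P (T *v \<xi>)))\<^sup>2) = (\<integral>\<^sup>+\<xi>. ennreal (w0 \<xi>) * ennreal ((cmod (P (T *v \<xi>)))\<^sup>2) \<partial>lborel)"
      unfolding nn_integral_nr[OF PA, symmetric] by (rule nn_integral_\<mu>) measurable
    also have "\<dots> \<le> (\<integral>\<^sup>+\<xi>. ennreal (1 / l) * (ennreal (w0 (T *v \<xi>)) * ennreal ((cmod (P (T *v \<xi>)))\<^sup>2)) \<partial>lborel)"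
    proof (rule nn_integral_mono_AE)
      show "AE \<xi> in lborel. ennreal (w0 \<xi>) * ennreal ((cmod (P (T *v \<xi>)))\<^sup>2) \<le> ennreal (1 / l) * (ennreal (w0 (T *v \<xi>)) * ennreal ((cmod (P (T *v \<xi>)))\<^sup>2))"
        using ae
      proof eventually_elim
        fix \<xi> assume "w0 \<xi> \<le> 1 / l * w0 (T *v \<xi>)"
        then have "ennreal (w0 \<xi>) \<le> ennreal (1 / l * w0 (T *v \<xi>))" by (rule ennreal_leI)
        also have "\<dots> = ennreal (1 / l) * ennreal (w0 (T *v \<xi>))" using l(1) w0(2) by (intro ennreal_mult) auto
        finally have "ennreal (w0 \<xi>) \<le> ennreal (1 / l) * ennreal (w0 (T *v \<xi>))" .
        then show "ennreal (w0 \<xi>) * ennreal ((cmod (P (T *v \<xi>)))\<^sup>2) \<le> ennreal (1 / l) * (ennreal (w0 (T *v \<xi>)) * ennreal ((cmod (P (T *v \<xi>)))\<^sup>2))"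
          unfolding mult.assoc[symmetric] by (rule mult_right_mono) simp
      qed
    qed
    also have "\<dots> = ennreal (1 / l) * (\<integral>\<^sup>+\<xi>. ennreal (w0 (T *v \<xi>)) * ennreal ((cmod (P (T *v \<xi>)))\<^sup>2) \<partial>lborel)"
      by (rule nn_integral_cmult) measurable
    also have "(\<integral>\<^sup>+\<xi>. ennreal (w0 (T *v \<xi>)) * ennreal ((cmod (P (T *v \<xi>)))\<^sup>2) \<partial>lborel)
       = ennreal k * (\<integral>\<^sup>+\<xi>. ennreal (w0 \<xi>) * ennreal ((cmod (P \<xi>))\<^sup>2) \<partial>lborel)" by (rule k(2)) measurable
    also have "(\<integral>\<^sup>+\<xi>. ennreal (w0 \<xi>) * ennreal ((cmod (P \<xi>))\<^sup>2) \<partial>lborel) = ennreal ((nr P)\<^sup>2)"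
      unfolding nn_integral_nr[OF P(1), symmetric] by (rule nn_integral_\<mu>[symmetric]) measurable
    also have "ennreal (1 / l) * (ennreal k * ennreal ((nr P)\<^sup>2)) = ennreal (k / l * (nr P)\<^sup>2)"
      using l(1) k(1) by (simp add: ennreal_mult[symmetric])
    finally have "(nr (\<lambda>\<xi>. P (T *v \<xi>)))\<^sup>2 \<le> k / l * (nr P)\<^sup>2"
      using l(1) k(1) by (subst (asm) ennreal_le_iff) auto
    also have "\<dots> = (sqrt (k / l) * nr P)\<^sup>2" using l(1) k(1) by (simp add: power_mult_distrib)
    finally show ?thesis using l(1) k(1) nr_nonneg[of P] power2_le_imp_le by fastforce
  qed
  moreover have "sqrt (k / l) \<ge> 0" using k l by simp
  ultimately show ?thesis unfolding T_def[symmetric] by (intro exI[of _ "sqrt (k / l)"] conjI ballI impI)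
qed

lemma exp_type_linear: assumes P: "P \<in> exp_type" "continuous_on UNIV P" shows "(\<lambda>\<xi>. P (A *v \<xi>)) \<in> exp_type"
proof -
  obtain c a where ca: "c \<ge> 0" "a \<ge> 0" "\<And>\<xi>. cmod (P \<xi>) \<le> c * exp (a * norm \<xi>)" using exp_typeE[OF P(1)] by metis
  have bl: "bounded_linear ((*v) A)" by (simp add: linear_linear[symmetric] matrix_vector_mul_linear)
  then obtain K where K: "\<And>\<xi>. norm (A *v \<xi>) \<le> norm \<xi> * K" using bounded_linear.bounded by blast
  have "continuous_on UNIV (\<lambda>\<xi>. P (A *v \<xi>))"
    by (rule continuous_on_compose2[OF P(2) linear_continuous_on[OF bl]]) simp
  then have "(\<lambda>\<xi>. P (A *v \<xi>)) \<in> borel_measurable lebesgue" by (intro borel_measurable_lebesgueI borel_measurable_continuous_onI)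
  moreover have "cmod (P (A *v \<xi>)) \<le> c * exp ((a * K) * norm \<xi>)" for \<xi>
  proof -
    have "a * norm (A *v \<xi>) \<le> a * (norm \<xi> * K)" using K ca(2) by (rule mult_left_mono)
    then have "c * exp (a * norm (A *v \<xi>)) \<le> c * exp ((a * K) * norm \<xi>)" using ca(1) by (intro mult_left_mono) (auto simp: mult_ac)
    then show ?thesis using ca(3)[of "A *v \<xi>"] by linarith
  qed
  ultimately show ?thesis by (rule exp_typeI)
qed

end

section \<open>Kernels and trigonometric sums\<close>

context weight begin

text \<open>The function represented by \<open>\<phi>\<close>: the inverse Fourier transform of \<open>\<phi> w\<close>. Under this map the kernel function at \<open>x\<close> comes
  from the character of \<open>- x\<close>.\<close>

definition \<kappa> :: "(real ^ 'd \<Rightarrow> complex) \<Rightarrow> real ^ 'd \<Rightarrow> complex" where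
  "\<kappa> \<phi> y = bil \<phi> (ch (cx y))"

text \<open>The signs make \<open>trigsum xs\<close> represent the kernel combination with the same coefficients and points.\<close>

fun trigsum :: "(complex \<times> (real ^ 'd)) list \<Rightarrow> real ^ 'd \<Rightarrow> complex" where
  "trigsum [] = (\<lambda>\<xi>. 0)"
| "trigsum ((c, x) # xs) = (\<lambda>\<xi>. c * ch (cx (- x)) \<xi> + trigsum xs \<xi>)"

lemma trigsum_exp_type: "trigsum xs \<in> exp_type"
  by (induction xs rule: trigsum.induct) (auto intro!: exp_type_intros)

lemma weight_kernel_eq: "weight_kernel w x y = \<kappa> (ch (cx (- x))) y"
proof -
  have m: "(\<lambda>\<xi>. ch (cx (- x)) \<xi> * ch (cx y) \<xi>) \<in> borel_measurable lebesgue"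
    by (intro borel_measurable_lebesgueI) measurable
  have "\<kappa> (ch (cx (- x))) y = (LINT \<xi>|lebesgue. w \<xi> *\<^sub>R (ch (cx (- x)) \<xi> * ch (cx y) \<xi>))"
    unfolding \<kappa>_def bil_def unfolding \<mu>_def by (rule integral_density[OF m w_measurable w_nonneg])
  also have "\<dots> = weight_kernel w x y"
    unfolding weight_kernel_def fourier_def
  proof (rule Bochner_Integration.integral_cong[OF refl])
    fix \<xi> :: "real ^ 'd"
    have "ch (cx (- x)) \<xi> * ch (cx y) \<xi> = exp (- 2 * complex_of_real pi * \<i> * complex_of_real (\<xi> \<bullet> (x - y)))"
      unfolding ch_add[symmetric] cx_add[symmetric] unfolding ch_cx
      by (simp add: inner_diff_right inner_diff_left inner_add_left inner_commute algebra_simps)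
    then show "w \<xi> *\<^sub>R (ch (cx (- x)) \<xi> * ch (cx y) \<xi>) = of_real (w \<xi>) * exp (- 2 * complex_of_real pi * \<i> * complex_of_real (\<xi> \<bullet> (x - y)))"
      by (simp add: scaleR_conv_of_real)
  qed
  finally show ?thesis ..
qed

lemma comb_kappa: "y \<in> E \<Longrightarrow> comb E (weight_kernel w) xs y = \<kappa> (trigsum xs) y"
proof (induction xs rule: trigsum.induct)
  case 1 then show ?case by (simp add: comb_def \<kappa>_def bil_def)
next
  case (2 c x xs)
  have "\<kappa> (trigsum ((c, x) # xs)) y = bil (\<lambda>\<xi>. c * ch (cx (- x)) \<xi>) (ch (cx y)) + bil (trigsum xs) (ch (cx y))"
    unfolding \<kappa>_def trigsum.simps by (rule bil_add_left) (intro exp_type_intros trigsum_exp_type)+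
  moreover have k: "zero_ext E (weight_kernel w x) y = \<kappa> (ch (cx (- x))) y"
    using 2(2) unfolding zero_ext_def weight_kernel_eq by simp
  ultimately show ?case using 2 unfolding comb_Cons k by (simp add: bil_scale_left \<kappa>_def)
qed

lemma antilin_kappa: "\<phi> \<in> exp_type \<Longrightarrow> antilin (\<kappa> \<phi>) xs = bil \<phi> (\<lambda>\<xi>. cnj (trigsum xs \<xi>))"
proof (induction xs rule: trigsum.induct)
  case 1 then show ?case by (simp add: antilin_def bil_def)
next
  case (2 c x xs)
  have "bil \<phi> (\<lambda>\<xi>. cnj (trigsum ((c, x) # xs) \<xi>)) = bil (\<lambda>\<xi>. cnj c * ch (cx x) \<xi> + cnj (trigsum xs \<xi>)) \<phi>"
    unfolding bil_commute[of \<phi>] by (simp add: cnj_ch_cx)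
  also have "\<dots> = bil (\<lambda>\<xi>. cnj c * ch (cx x) \<xi>) \<phi> + bil (\<lambda>\<xi>. cnj (trigsum xs \<xi>)) \<phi>"
    by (rule bil_add_left) (intro exp_type_intros trigsum_exp_type 2(2))+
  also have "\<dots> = antilin (\<kappa> \<phi>) ((c, x) # xs)"
    unfolding antilin_Cons 2(1)[OF 2(2)] by (simp add: bil_scale_left \<kappa>_def bil_commute)
  finally show ?case ..
qed

lemma kernel_norm:
  assumes H: "is_rkhs E (weight_kernel w) H ip" and xs: "snd ` set xs \<subseteq> E"
  shows "ip_norm ip (comb E (weight_kernel w) xs) = nr (trigsum xs)"
proof -
  interpret rkhs E "weight_kernel w" H ip using H by unfold_locales
  let ?c = "comb E (weight_kernel w) xs"
  have cH: "?c \<in> H" using xs by (rule comb_in)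
  have "of_real ((ip_norm ip ?c)\<^sup>2) = ip ?c ?c" by (rule ip_self[OF cH, symmetric])
  also have "\<dots> = antilin ?c xs" by (rule ip_comb[OF cH xs])
  also have "\<dots> = antilin (\<kappa> (trigsum xs)) xs"
    unfolding antilin_def using xs comb_kappa[of _ E xs] by (intro arg_cong[of _ _ sum_list] map_cong) auto
  also have "\<dots> = of_real ((nr (trigsum xs))\<^sup>2)"
    unfolding antilin_kappa[OF trigsum_exp_type] by (rule bil_cnj[OF trigsum_exp_type])
  finally have "(ip_norm ip ?c)\<^sup>2 = (nr (trigsum xs))\<^sup>2" by (simp only: of_real_eq_iff)
  then show ?thesis using nrm_nonneg[OF cH] nr_nonneg by (simp add: power2_eq_iff_nonneg)
qed

text \<open>By Cauchy-Schwarz the pairing of \<open>\<kappa> \<phi>\<close> with kernel combinations is bounded by the norm of \<open>\<phi>\<close>.\<close>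

lemma kappa_in:
  assumes H: "is_rkhs E (weight_kernel w) H ip" and \<phi>: "\<phi> \<in> exp_type"
  shows "zero_ext E (\<kappa> \<phi>) \<in> H" "ip_norm ip (zero_ext E (\<kappa> \<phi>)) \<le> nr \<phi>"
proof -
  interpret rkhs E "weight_kernel w" H ip using H by unfold_locales
  have "cmod (antilin (\<kappa> \<phi>) xs) \<le> nr \<phi> * nrm (comb E (weight_kernel w) xs)" if xs: "snd ` set xs \<subseteq> E" for xs
  proof -
    have "cmod (antilin (\<kappa> \<phi>) xs) \<le> nr \<phi> * nr (\<lambda>\<xi>. cnj (trigsum xs \<xi>))"
      unfolding antilin_kappa[OF \<phi>] by (intro bil_Cauchy_Schwarz \<phi> exp_type_cnj trigsum_exp_type)
    also have "nr (\<lambda>\<xi>. cnj (trigsum xs \<xi>)) = nr (trigsum xs)" by (rule nr_cong_norm) simp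
    finally show ?thesis unfolding kernel_norm[OF H xs] .
  qed
  from membership_criterion[OF nr_nonneg this]
  show "zero_ext E (\<kappa> \<phi>) \<in> H" "ip_norm ip (zero_ext E (\<kappa> \<phi>)) \<le> nr \<phi>" by auto
qed

lemma kappa_add: "\<phi> \<in> exp_type \<Longrightarrow> \<psi> \<in> exp_type \<Longrightarrow> \<kappa> (\<lambda>\<xi>. \<phi> \<xi> + \<psi> \<xi>) y = \<kappa> \<phi> y + \<kappa> \<psi> y"
  unfolding \<kappa>_def by (rule bil_add_left[OF _ _ exp_type_ch])
lemma kappa_scale: "\<kappa> (\<lambda>\<xi>. c * \<phi> \<xi>) y = c * \<kappa> \<phi> y"
  unfolding \<kappa>_def by (rule bil_scale_left)

text \<open>Pair \<open>(\<kappa> \<psi>) \<circ> f\<close> with the restriction of \<open>\<kappa> (cnj \<phi>)\<close> to \<open>U\<close>: the inner product is antilinear in its second argument, so the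
  result is bilinear, and for \<open>\<phi> = e\<^sub>x\<close> the second function is the kernel function at \<open>x\<close>.\<close>

lemma bounded_form_of_composition:
  assumes Hk: "is_rkhs UNIV (weight_kernel w) H ipH" and HU: "is_rkhs U (weight_kernel w) HU ipU"
    and U: "open U" and C: "C \<ge> 0"
    and dom: "\<And>h. h \<in> H \<Longrightarrow> comp_op U f h \<in> HU"
    and bound: "\<And>h. h \<in> H \<Longrightarrow> ip_norm ipU (comp_op U f h) \<le> C * ip_norm ipH h"
  shows "\<exists>\<Phi>. bounded_form \<mu> \<Phi> C U f"
proof -
  interpret K: rkhs UNIV "weight_kernel w" H ipH using Hk by unfold_locales
  interpret V: rkhs U "weight_kernel w" HU ipU using HU by unfold_locales
  have zU: "zero_ext UNIV h = h" for h :: "real ^ 'd \<Rightarrow> complex" by (simp add: zero_ext_def)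
  define T where "T \<psi> = comp_op U f (\<kappa> \<psi>)" for \<psi>
  define R where "R \<phi> = zero_ext U (\<kappa> (\<lambda>\<xi>. cnj (\<phi> \<xi>)))" for \<phi>
  define \<Phi> where "\<Phi> \<phi> \<psi> = ipU (T \<psi>) (R \<phi>)" for \<phi> \<psi>
  have kH: "\<kappa> \<psi> \<in> H" "K.nrm (\<kappa> \<psi>) \<le> nr \<psi>" if "\<psi> \<in> exp_type" for \<psi>
    using kappa_in[OF Hk that] unfolding zU by auto
  have TH: "T \<psi> \<in> HU" if "\<psi> \<in> exp_type" for \<psi> unfolding T_def by (rule dom[OF kH(1)[OF that]])
  have Tn: "V.nrm (T \<psi>) \<le> C * nr \<psi>" if \<psi>: "\<psi> \<in> exp_type" for \<psi>
    unfolding T_def using bound[OF kH(1)[OF \<psi>]] mult_left_mono[OF kH(2)[OF \<psi>] C] by linarith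
  have RH: "R \<phi> \<in> HU" if "\<phi> \<in> exp_type" for \<phi> unfolding R_def by (rule kappa_in(1)[OF HU exp_type_cnj[OF that]])
  have Rn: "V.nrm (R \<phi>) \<le> nr \<phi>" if "\<phi> \<in> exp_type" for \<phi>
  proof -
    have "nr (\<lambda>\<xi>. cnj (\<phi> \<xi>)) = nr \<phi>" by (rule nr_cong_norm) simp
    then show ?thesis unfolding R_def using kappa_in(2)[OF HU exp_type_cnj[OF that]] by simp
  qed
  have Tadd: "T (\<lambda>\<xi>. \<psi> \<xi> + \<theta> \<xi>) = (\<lambda>x. T \<psi> x + T \<theta> x)" if "\<psi> \<in> exp_type" "\<theta> \<in> exp_type" for \<psi> \<theta>
    unfolding T_def comp_op_def zero_ext_def by (auto simp: kappa_add[OF that])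
  have Tscale: "T (\<lambda>\<xi>. c * \<psi> \<xi>) = (\<lambda>x. c * T \<psi> x)" for c \<psi>
    unfolding T_def comp_op_def zero_ext_def by (auto simp: kappa_scale)
  have Radd: "R (\<lambda>\<xi>. \<psi> \<xi> + \<theta> \<xi>) = (\<lambda>x. R \<psi> x + R \<theta> x)" if "\<psi> \<in> exp_type" "\<theta> \<in> exp_type" for \<psi> \<theta>
    unfolding R_def zero_ext_def by (auto simp: kappa_add[OF exp_type_cnj[OF that(1)] exp_type_cnj[OF that(2)]])
  have Rscale: "R (\<lambda>\<xi>. c * \<psi> \<xi>) = (\<lambda>x. cnj c * R \<psi> x)" for c \<psi>
    unfolding R_def zero_ext_def by (auto simp: kappa_scale)
  have bnd: "cmod (\<Phi> \<phi> \<psi>) \<le> C * nr \<phi> * nr \<psi>" if "\<phi> \<in> exp_type" "\<psi> \<in> exp_type" for \<phi> \<psi>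
  proof -
    have "cmod (\<Phi> \<phi> \<psi>) \<le> V.nrm (T \<psi>) * V.nrm (R \<phi>)" unfolding \<Phi>_def by (rule V.Cauchy_Schwarz[OF TH[OF that(2)] RH[OF that(1)]])
    also have "\<dots> \<le> (C * nr \<psi>) * nr \<phi>"
      using C by (intro mult_mono Tn Rn that V.nrm_nonneg RH mult_nonneg_nonneg nr_nonneg)
    finally show ?thesis by (simp add: mult_ac)
  qed
  have "bounded_form \<mu> \<Phi> C U f"
  proof
    fix \<psi> :: "real ^ 'd \<Rightarrow> complex" assume \<psi>: "\<psi> \<in> exp_type"
    show "bounded_functional (\<lambda>\<phi>. \<Phi> \<phi> \<psi>)"
      unfolding bounded_functional_def
    proof (intro conjI ballI allI)
      fix \<phi> \<theta> :: "real ^ 'd \<Rightarrow> complex" assume "\<phi> \<in> exp_type" "\<theta> \<in> exp_type"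
      then show "\<Phi> (\<lambda>\<xi>. \<phi> \<xi> + \<theta> \<xi>) \<psi> = \<Phi> \<phi> \<psi> + \<Phi> \<theta> \<psi>"
        unfolding \<Phi>_def by (simp add: Radd V.ip_add_right[OF RH RH TH[OF \<psi>]])
    next
      fix \<phi> :: "real ^ 'd \<Rightarrow> complex" and c assume "\<phi> \<in> exp_type"
      then show "\<Phi> (\<lambda>\<xi>. c * \<phi> \<xi>) \<psi> = c * \<Phi> \<phi> \<psi>"
        unfolding \<Phi>_def by (simp add: Rscale V.ip_scale_right[OF RH TH[OF \<psi>]])
    next
      show "\<exists>K\<ge>0. \<forall>\<phi>\<in>exp_type. cmod (\<Phi> \<phi> \<psi>) \<le> K * nr \<phi>"
        using bnd[OF _ \<psi>] C nr_nonneg[of \<psi>] by (intro exI[of _ "C * nr \<psi>"] conjI ballI) (auto simp: mult_ac)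
    qed
  next
    fix \<phi> :: "real ^ 'd \<Rightarrow> complex" assume \<phi>: "\<phi> \<in> exp_type"
    show "bounded_functional (\<lambda>\<psi>. \<Phi> \<phi> \<psi>)"
      unfolding bounded_functional_def
    proof (intro conjI ballI allI)
      fix \<psi> \<theta> :: "real ^ 'd \<Rightarrow> complex" assume "\<psi> \<in> exp_type" "\<theta> \<in> exp_type"
      then show "\<Phi> \<phi> (\<lambda>\<xi>. \<psi> \<xi> + \<theta> \<xi>) = \<Phi> \<phi> \<psi> + \<Phi> \<phi> \<theta>"
        unfolding \<Phi>_def by (simp add: Tadd V.ip_add[OF TH TH RH[OF \<phi>]])
    next
      fix \<psi> :: "real ^ 'd \<Rightarrow> complex" and c assume "\<psi> \<in> exp_type"
      then show "\<Phi> \<phi> (\<lambda>\<xi>. c * \<psi> \<xi>) = c * \<Phi> \<phi> \<psi>"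
        unfolding \<Phi>_def by (simp add: Tscale V.ip_scale[OF TH RH[OF \<phi>]])
    next
      show "\<exists>K\<ge>0. \<forall>\<psi>\<in>exp_type. cmod (\<Phi> \<phi> \<psi>) \<le> K * nr \<psi>"
        using bnd[OF \<phi>] C nr_nonneg[of \<phi>] by (intro exI[of _ "C * nr \<phi>"] conjI ballI) auto
    qed
  next
    fix x and \<psi> :: "real ^ 'd \<Rightarrow> complex" assume x: "x \<in> U" and \<psi>: "\<psi> \<in> exp_type"
    have "(\<lambda>\<xi>. cnj (ch (cx x) \<xi>)) = ch (cx (- x))" by (rule ext) (rule cnj_ch_cx)
    then have "R (ch (cx x)) = zero_ext U (\<kappa> (ch (cx (- x))))" unfolding R_def by (simp only:)
    also have "\<dots> = zero_ext U (weight_kernel w x)" unfolding zero_ext_def weight_kernel_eq ..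
    finally have "R (ch (cx x)) = zero_ext U (weight_kernel w x)" .
    then have "\<Phi> (ch (cx x)) \<psi> = T \<psi> x" unfolding \<Phi>_def by (simp add: V.reproducing[OF x TH[OF \<psi>]])
    also have "\<dots> = bil \<psi> (ch (cx (f x)))" unfolding T_def comp_op_def zero_ext_def \<kappa>_def using x by simp
    finally show "\<Phi> (ch (cx x)) \<psi> = bil (ch (cx (f x))) \<psi>" by (simp add: bil_commute)
  qed (use bnd U C in auto)
  then show ?thesis by blast
qed

lemma trigsum_continuous: "continuous_on UNIV (trigsum xs)"
  by (induction xs rule: trigsum.induct) (auto simp: ch_cx intro!: continuous_intros)

text \<open>Composing the points with \<open>x \<mapsto> A x + b\<close> composes the trigonometric sum with \<open>A\<^sup>T\<close>, up to a factor of modulus one.\<close>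

lemma affine_composition_bounded:
  assumes A: "A \<in> G_set w" and Hk: "is_rkhs UNIV (weight_kernel w) H ipH" and HU: "is_rkhs U (weight_kernel w) HU ipU"
    and f: "\<And>x. x \<in> U \<Longrightarrow> f x = A *v x + b"
  shows "\<exists>C\<ge>0. \<forall>h\<in>H. comp_op U f h \<in> HU \<and> ip_norm ipU (comp_op U f h) \<le> C * ip_norm ipH h"
proof -
  obtain C where C: "C \<ge> 0" and CP: "\<forall>P\<in>exp_type. continuous_on UNIV P \<longrightarrow> (\<lambda>\<xi>. P (transpose A *v \<xi>)) \<in> exp_type \<longrightarrow> nr (\<lambda>\<xi>. P (transpose A *v \<xi>)) \<le> C * nr P"
    using G_set_comp[OF A] by (elim exE conjE) (rule that)
  have push: "trigsum (map (\<lambda>(c, x). (c, f x)) xs) \<xi> = ch (cx (- b)) \<xi> * trigsum xs (transpose A *v \<xi>)" if "snd ` set xs \<subseteq> U" for xs \<xi>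
    using that
  proof (induction xs rule: trigsum.induct)
    case (2 c x xs)
    then have x: "x \<in> U" by simp
    have "(A *v x) \<bullet> \<xi> = x \<bullet> (transpose A *v \<xi>)"
      using dot_lmul_matrix[of \<xi> A x] by (simp add: inner_commute)
    then have "ch (cx (- f x)) \<xi> = ch (cx (- b)) \<xi> * ch (cx (- x)) (transpose A *v \<xi>)"
      unfolding f[OF x] ch_cx exp_add[symmetric] by (simp add: inner_add_left inner_diff_left algebra_simps del: transpose_matrix_vector)
    then show ?case using 2 by (simp add: algebra_simps del: transpose_matrix_vector)
  qed simp
  have bd: "ip_norm ipH (comb UNIV (weight_kernel w) (map (\<lambda>(c, x). (c, f x)) xs)) \<le> C * ip_norm ipU (comb U (weight_kernel w) xs)"
    if xs: "snd ` set xs \<subseteq> U" for xs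
  proof -
    have "ip_norm ipH (comb UNIV (weight_kernel w) (map (\<lambda>(c, x). (c, f x)) xs)) = nr (trigsum (map (\<lambda>(c, x). (c, f x)) xs))"
      by (rule kernel_norm[OF Hk]) simp
    also have "\<dots> = nr (\<lambda>\<xi>. trigsum xs (transpose A *v \<xi>))"
      by (rule nr_cong_norm) (simp only: push[OF xs] norm_mult norm_ch_cx mult_1_left)
    also have "\<dots> \<le> C * nr (trigsum xs)"
      using CP[rule_format, OF trigsum_exp_type trigsum_continuous exp_type_linear[OF trigsum_exp_type trigsum_continuous]] .
    also have "nr (trigsum xs) = ip_norm ipU (comb U (weight_kernel w) xs)" by (rule kernel_norm[OF HU xs, symmetric])
    finally show ?thesis .
  qed
  have "comp_op U f h \<in> HU \<and> ip_norm ipU (comp_op U f h) \<le> C * ip_norm ipH h" if h: "h \<in> H" for h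
    using composition_of_bounded_on_kernels[where k = "weight_kernel w" and k' = "weight_kernel w" and f = f, OF Hk HU C bd h] by blast
  then show ?thesis using C by (intro exI[of _ C] conjI ballI) blast+
qed

end

section \<open>Trigonometric polynomials and comparison of measures\<close>

context weight begin

definition trig_poly :: "(real ^ 'd \<Rightarrow> complex) \<Rightarrow> bool" where
  "trig_poly T \<longleftrightarrow> (\<exists>xs. T = trigsum xs)"

lemma trigsum_append: "trigsum (xs @ ys) \<xi> = trigsum xs \<xi> + trigsum ys \<xi>"
  by (induction xs rule: trigsum.induct) auto

lemma trig_poly_add: "trig_poly S \<Longrightarrow> trig_poly T \<Longrightarrow> trig_poly (\<lambda>\<xi>. S \<xi> + T \<xi>)"
  unfolding trig_poly_def
proof (elim exE)
  fix xs ys assume "S = trigsum xs" "T = trigsum ys"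
  then show "\<exists>zs. (\<lambda>\<xi>. S \<xi> + T \<xi>) = trigsum zs" by (intro exI[of _ "xs @ ys"]) (simp add: fun_eq_iff trigsum_append)
qed

lemma trigsum_shift: "c * ch (cx (- x)) \<xi> * trigsum ys \<xi> = trigsum (map (\<lambda>(d, y). (c * d, x + y)) ys) \<xi>"
proof (induction ys rule: trigsum.induct)
  case (2 d y ys)
  have "ch (cx (- (x + y))) \<xi> = ch (cx (- x)) \<xi> * ch (cx (- y)) \<xi>" unfolding ch_add[symmetric] cx_add[symmetric] by simp
  then show ?case using 2 by (simp add: algebra_simps)
qed simp

lemma trig_poly_mult: assumes "trig_poly S" "trig_poly T" shows "trig_poly (\<lambda>\<xi>. S \<xi> * T \<xi>)"
proof -
  obtain xs ys where S: "S = trigsum xs" and T: "T = trigsum ys" using assms unfolding trig_poly_def by auto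
  have "trig_poly (\<lambda>\<xi>. trigsum xs \<xi> * trigsum ys \<xi>)"
  proof (induction xs rule: trigsum.induct)
    case 1
    have "(\<lambda>\<xi>. 0) = trigsum []" by simp
    then show ?case unfolding trig_poly_def by (intro exI[of _ "[]"]) simp
  next
    case (2 c x xs)
    have "trig_poly (trigsum (map (\<lambda>(d, y). (c * d, x + y)) ys))" unfolding trig_poly_def by blast
    from trig_poly_add[OF this 2] show ?case unfolding trigsum_shift[symmetric] by (simp add: algebra_simps)
  qed
  then show ?thesis unfolding S T .
qed

lemma trig_poly_ch: "trig_poly (\<lambda>\<xi>. c * ch (cx x) \<xi>)"
  unfolding trig_poly_def by (intro exI[of _ "[(c, - x)]"]) (simp add: fun_eq_iff)
lemma trig_poly_const: "trig_poly (\<lambda>\<xi>. c)"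
proof -
  have "cx (0 :: real ^ 'd) = 0" by (simp add: cx_def vec_eq_iff)
  then show ?thesis using trig_poly_ch[of c 0] by (simp add: ch_0)
qed
lemma trig_poly_sum: "(\<And>i. i \<in> I \<Longrightarrow> trig_poly (F i)) \<Longrightarrow> trig_poly (\<lambda>\<xi>. \<Sum>i\<in>I. F i \<xi>)"
  by (induction I rule: infinite_finite_induct) (auto intro: trig_poly_add trig_poly_const)

text \<open>The map onto the torus \<open>\<real>\<^sup>d / (L \<int>)\<^sup>d\<close>, embedded in \<open>\<complex>\<^sup>d\<close>.\<close>

definition tor :: "real \<Rightarrow> real ^ 'd \<Rightarrow> complex ^ 'd" where
  "tor L \<xi> = (\<chi> i. ch (cx (axis i (1 / L))) \<xi>)"

lemma tor_nth: "tor L \<xi> $ i = exp (\<i> * of_real (2 * pi * (\<xi> $ i / L)))"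
  unfolding tor_def by (simp add: ch_cx inner_axis' mult_ac)

lemma tor_continuous: "continuous_on X (tor L)"
  unfolding tor_def ch_cx by (intro continuous_on_vec_lambda continuous_intros)

lemma tor_bounded: "tor L \<xi> \<in> cball 0 (real CARD('d))"
proof -
  have "norm (tor L \<xi>) \<le> (\<Sum>i\<in>UNIV. norm (tor L \<xi> $ i))" unfolding norm_vec_def by (rule L2_set_le_sum) simp
  also have "\<dots> = real CARD('d)" unfolding tor_def by (simp add: norm_ch_cx)
  finally show ?thesis by simp
qed

lemma tor_inj:
  assumes L: "L > 0" and eq: "tor L \<xi> = tor L \<eta>" and a: "\<And>i. \<bar>\<xi> $ i\<bar> < L / 2" and b: "\<And>i. \<bar>\<eta> $ i\<bar> \<le> L / 2"
  shows "\<xi> = \<eta>"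
proof -
  have "\<xi> $ i = \<eta> $ i" for i
  proof -
    have "exp (\<i> * of_real (2 * pi * (\<xi> $ i / L))) = exp (\<i> * of_real (2 * pi * (\<eta> $ i / L)))"
      using eq unfolding tor_nth[symmetric] by simp
    then obtain n :: int where n: "\<i> * of_real (2 * pi * (\<xi> $ i / L)) = \<i> * of_real (2 * pi * (\<eta> $ i / L)) + (of_int (2 * n) * pi) * \<i>"
      unfolding exp_eq by blast
    have "Im (\<i> * of_real (2 * pi * (\<xi> $ i / L))) = Im (\<i> * of_real (2 * pi * (\<eta> $ i / L)) + (of_int (2 * n) * pi) * \<i>)" using n by simp
    then have "2 * pi * (\<xi> $ i / L) = 2 * pi * (\<eta> $ i / L) + 2 * pi * of_int n" by simp
    then have "2 * pi * (\<xi> $ i / L) = 2 * pi * (\<eta> $ i / L + of_int n)" by (simp add: distrib_left)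
    then have "\<xi> $ i / L = \<eta> $ i / L + of_int n" by (simp only: mult_cancel_left) simp
    then have e: "\<xi> $ i = \<eta> $ i + L * of_int n" using L by (simp add: field_simps)
    have "\<bar>L * of_int n\<bar> < L * 1" using a[of i] b[of i] e by argo
    then have "\<bar>of_int n :: real\<bar> < 1" using L by (simp add: abs_mult)
    then have "n = 0" by linarith
    then show ?thesis using e by simp
  qed
  then show ?thesis by (simp add: vec_eq_iff)
qed

lemma trig_poly_tor:
  assumes "real_polynomial_function (g :: complex ^ 'd \<Rightarrow> real)"
  shows "trig_poly (\<lambda>\<xi>. of_real (g (tor L \<xi>)))"
  using assms
proof (induction rule: real_polynomial_function.induct)
  case (linear g)
  have basis: "trig_poly (\<lambda>\<xi>. of_real (tor L \<xi> \<bullet> b))" if b: "b \<in> Basis" for b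
  proof -
    obtain i e where b: "b = axis i e" "e \<in> Basis" using b unfolding Basis_vec_def by auto
    have t: "trig_poly (\<lambda>\<xi>. c * ch (cx (axis i (1 / L))) \<xi> + d * ch (cx (- axis i (1 / L))) \<xi>)" for c d
      by (intro trig_poly_add trig_poly_ch)
    have re: "of_real (Re z) = 1/2 * z + 1/2 * cnj z" and im: "of_real (Im z) = - (\<i>/2) * z + (\<i>/2) * cnj z" for z
      by (auto simp: complex_eq_iff)
    have "e = 1 \<or> e = \<i>" using b(2) unfolding Basis_complex_def by auto
    then show ?thesis
    proof
      assume "e = 1"
      then have "(\<lambda>\<xi>. complex_of_real (tor L \<xi> \<bullet> b)) = (\<lambda>\<xi>. of_real (Re (ch (cx (axis i (1 / L))) \<xi>)))"
        by (simp add: b(1) inner_axis tor_def inner_complex_def)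
      then show ?thesis unfolding re cnj_ch_cx using t[of "1/2" "1/2"] by simp
    next
      assume "e = \<i>"
      then have "(\<lambda>\<xi>. complex_of_real (tor L \<xi> \<bullet> b)) = (\<lambda>\<xi>. of_real (Im (ch (cx (axis i (1 / L))) \<xi>)))"
        by (simp add: b(1) inner_axis tor_def inner_complex_def)
      then show ?thesis unfolding im cnj_ch_cx using t[of "- (\<i>/2)" "\<i>/2"] by simp
    qed
  qed
  have gx: "g x = (\<Sum>b\<in>Basis. (x \<bullet> b) * g b)" for x
  proof -
    have "g x = g (\<Sum>b\<in>Basis. (x \<bullet> b) *\<^sub>R b)" by (simp add: euclidean_representation)
    also have "\<dots> = (\<Sum>b\<in>Basis. (x \<bullet> b) * g b)" using linear by (simp add: linear_sum linear_scale bounded_linear.linear)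
    finally show ?thesis .
  qed
  have "(\<lambda>\<xi>. complex_of_real (g (tor L \<xi>))) = (\<lambda>\<xi>. \<Sum>b\<in>Basis. of_real (tor L \<xi> \<bullet> b) * of_real (g b))"
  proof (rule ext)
    fix \<xi> show "complex_of_real (g (tor L \<xi>)) = (\<Sum>b\<in>Basis. of_real (tor L \<xi> \<bullet> b) * of_real (g b))"
      by (subst gx) (simp only: of_real_sum of_real_mult)
  qed
  then show ?case by (simp only:) (intro trig_poly_sum trig_poly_mult trig_poly_const basis)
next
  case (const c) then show ?case by (rule trig_poly_const)
next
  case (add f g) then show ?case using trig_poly_add by simp
next
  case (mult f g) then show ?case using trig_poly_mult by simp
qed

text \<open>Trigonometric polynomials with a large period imitate indicator functions: the images of \<open>K\<close> and of the ball without \<open>V\<close>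
  on the torus are disjoint and compact, so Urysohn's lemma separates them, and the separating function is approximated
  by a polynomial in the coordinates of the torus and their conjugates.\<close>

lemma trig_poly_separation:
  assumes K: "compact K" and V: "open V" "K \<subseteq> V" and r: "r > 0" "K \<subseteq> cball 0 r" and e: "e > 0"
  obtains T where "trig_poly T" "\<And>\<xi>. cmod (T \<xi>) \<le> 1 + e" "\<And>\<xi>. \<xi> \<in> K \<Longrightarrow> cmod (T \<xi>) \<ge> 1 - e"
    "\<And>\<xi>. norm \<xi> \<le> r \<Longrightarrow> \<xi> \<notin> V \<Longrightarrow> cmod (T \<xi>) \<le> e"
proof -
  \<comment> \<open>With this period the ball of radius r embeds into the torus.\<close>
  define L where "L = 4 * r"
  have L: "L > 0" unfolding L_def using r by simp
  have small: "\<bar>\<xi> $ i\<bar> < L / 2" if "norm \<xi> \<le> r" for \<xi> i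
    using component_le_norm_cart[of \<xi> i] that r(1) unfolding L_def by linarith
  define C1 where "C1 = tor L ` K"
  define C2 where "C2 = tor L ` (cball 0 r - V)"
  have "compact C1" unfolding C1_def by (intro compact_continuous_image tor_continuous K)
  moreover have "compact C2" unfolding C2_def by (intro compact_continuous_image tor_continuous compact_diff compact_cball V)
  ultimately have cl: "closed C1" "closed C2" by (auto simp: compact_imp_closed)
  have "C1 \<inter> C2 = {}"
  proof (rule ccontr)
    assume "C1 \<inter> C2 \<noteq> {}"
    then obtain z where z: "z \<in> C1" "z \<in> C2" by blast
    obtain \<xi> where x1: "\<xi> \<in> K" "z = tor L \<xi>" using z(1) unfolding C1_def by blast
    obtain \<eta> where x2: "\<eta> \<in> cball 0 r - V" "z = tor L \<eta>" using z(2) unfolding C2_def by blast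
    have x: "\<xi> \<in> K" "\<eta> \<in> cball 0 r - V" "tor L \<xi> = tor L \<eta>" using x1 x2 by simp_all
    have "norm \<xi> \<le> r" "norm \<eta> \<le> r" using x r(2) by auto
    then have "\<xi> = \<eta>" using tor_inj[OF L x(3)] small less_imp_le by blast
    then show False using x V(2) by auto
  qed
  then obtain h :: "complex ^ 'd \<Rightarrow> real" where h: "continuous_on UNIV h" "\<And>x. h x \<in> closed_segment 1 0" "\<And>x. x \<in> C1 \<Longrightarrow> h x = 1" "\<And>x. x \<in> C2 \<Longrightarrow> h x = 0"
    using Urysohn[OF cl, of 1 0] by metis
  have h01: "0 \<le> h x" "h x \<le> 1" for x using h(2)[of x] by (auto simp: closed_segment_eq_real_ivl split: if_splits)
  obtain g where g: "polynomial_function g" "\<And>x. x \<in> cball 0 (real CARD('d)) \<Longrightarrow> norm (h x - g x) < e"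
    using Stone_Weierstrass_polynomial_function[OF compact_cball continuous_on_subset[OF h(1) subset_UNIV] e, of 0 "real CARD('d)"] by blast
  define T where "T \<xi> = complex_of_real (g (tor L \<xi>))" for \<xi>
  have near: "\<bar>h (tor L \<xi>) - g (tor L \<xi>)\<bar> < e" for \<xi> using g(2)[OF tor_bounded] by simp
  have nT: "cmod (T \<xi>) = \<bar>g (tor L \<xi>)\<bar>" for \<xi> by (simp add: T_def)
  show thesis
  proof (rule that)
    show "trig_poly T" unfolding T_def using g(1) by (intro trig_poly_tor) (simp add: real_polynomial_function_eq)
    show "cmod (T \<xi>) \<le> 1 + e" for \<xi> unfolding nT using near[of \<xi>] h01[of "tor L \<xi>"] by linarith
    show "cmod (T \<xi>) \<ge> 1 - e" if "\<xi> \<in> K" for \<xi>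
      unfolding nT using near[of \<xi>] h(3)[of "tor L \<xi>"] that unfolding C1_def by force
    show "cmod (T \<xi>) \<le> e" if "norm \<xi> \<le> r" "\<xi> \<notin> V" for \<xi>
      unfolding nT using near[of \<xi>] h(4)[of "tor L \<xi>"] that unfolding C2_def by force
  qed
qed

text \<open>The Borel measure with the same density, for which regularity holds and images are formed.\<close>

definition M :: "(real ^ 'd) measure" where "M = density lborel (\<lambda>\<xi>. ennreal (w0 \<xi>))"

lemma M_sets [simp, measurable_cong]: "sets M = sets borel" by (simp add: M_def)
lemma M_space [simp]: "space M = UNIV" by (simp add: M_def)

lemma nn_integral_M: "g \<in> borel_measurable borel \<Longrightarrow> (\<integral>\<^sup>+\<xi>. g \<xi> \<partial>M) = (\<integral>\<^sup>+\<xi>. ennreal (w0 \<xi>) * g \<xi> \<partial>lborel)"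
  unfolding M_def by (rule nn_integral_density) auto

lemma nn_integral_M_nr: "\<phi> \<in> exp_type \<Longrightarrow> \<phi> \<in> borel_measurable borel \<Longrightarrow> (\<integral>\<^sup>+\<xi>. ennreal ((cmod (\<phi> \<xi>))\<^sup>2) \<partial>M) = ennreal ((nr \<phi>)\<^sup>2)"
proof -
  assume e: "\<phi> \<in> exp_type" and [measurable]: "\<phi> \<in> borel_measurable borel"
  have "(\<integral>\<^sup>+\<xi>. ennreal ((cmod (\<phi> \<xi>))\<^sup>2) \<partial>M) = (\<integral>\<^sup>+\<xi>. ennreal (w0 \<xi>) * ennreal ((cmod (\<phi> \<xi>))\<^sup>2) \<partial>lborel)"
    by (rule nn_integral_M) measurable
  also have "\<dots> = (\<integral>\<^sup>+\<xi>. ennreal ((cmod (\<phi> \<xi>))\<^sup>2) \<partial>\<mu>)" by (rule nn_integral_\<mu>[symmetric]) measurable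
  also have "\<dots> = ennreal ((nr \<phi>)\<^sup>2)" by (rule nn_integral_nr[OF e])
  finally show ?thesis .
qed

lemma M_finite: "finite_measure M"
proof
  have "emeasure M UNIV = (\<integral>\<^sup>+\<xi>. ennreal ((cmod (1 :: complex))\<^sup>2) \<partial>M)" using emeasure_eq_sum_singleton nn_integral_const[of M 1] by simp
  also have "\<dots> = ennreal ((nr (\<lambda>\<xi>. 1))\<^sup>2)" by (rule nn_integral_M_nr) auto
  finally show "emeasure M (space M) \<noteq> \<infinity>" by simp
qed

lemma M_nonzero: "emeasure M UNIV \<noteq> 0"
proof
  assume "emeasure M UNIV = 0"
  then have "(\<integral>\<^sup>+\<xi>. ennreal (w0 \<xi>) * 1 \<partial>lborel) = 0" using nn_integral_M[of "\<lambda>\<xi>. 1"] nn_integral_const[of M 1] by simp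
  then have "AE \<xi> in lborel. ennreal (w0 \<xi>) = 0" by (subst (asm) nn_integral_0_iff_AE) auto
  then have "AE \<xi> in lebesgue. ennreal (w0 \<xi>) = 0" by (rule AE_completion)
  then have "AE \<xi> in lebesgue. w \<xi> = 0" using w0(3) by eventually_elim (use w0(2) in \<open>simp add: ennreal_eq_0_iff antisym\<close>)
  then show False using w_nonzero by simp
qed

text \<open>Apply the inequality to a trigonometric polynomial close to one on \<open>K\<close> and close to zero off \<open>V\<close> within a large ball.
  Beyond the ball it is only bounded, and the finite measure \<open>M\<close> has little mass there.\<close>

lemma compact_open_comparison:
  fixes T :: "real ^ 'd ^ 'd"
  assumes C: "C \<ge> 0" and bound: "\<And>xs. nr (\<lambda>\<xi>. trigsum xs (T *v \<xi>)) \<le> C * nr (trigsum xs)"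
    and K: "compact K" and V: "open V" "K \<subseteq> V"
  shows "measure (distr M borel ((*v) T)) K \<le> C\<^sup>2 * measure M V"
proof -
  interpret M: finite_measure M by (rule M_finite)
  define N where "N = distr M borel ((*v) T)"
  have "continuous_on UNIV ((*v) T)" by (rule linear_continuous_on) (simp add: linear_linear[symmetric] matrix_vector_mul_linear)
  then have T [measurable]: "(*v) T \<in> borel_measurable borel" by (rule borel_measurable_continuous_onI)
  have TM: "(*v) T \<in> measurable M borel" using T by (simp add: measurable_cong_sets[OF M_sets refl])
  interpret N: finite_measure N unfolding N_def by (rule M.finite_measure_distr[OF TM])
  have Ns: "sets N = sets borel" unfolding N_def by simp
  have [measurable]: "K \<in> sets borel" "V \<in> sets borel" using K V by (auto simp: compact_imp_closed)
  have step: "(1 - e)\<^sup>2 * measure N K \<le> C\<^sup>2 * ((1 + e)\<^sup>2 * (measure M V + measure M {\<xi>. norm \<xi> > r}) + e\<^sup>2 * measure M UNIV)"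
    if e: "e > 0" "e < 1" and r: "r > 0" "K \<subseteq> cball 0 r" for e r
  proof -
    obtain S where S: "trig_poly S" "\<And>\<xi>. cmod (S \<xi>) \<le> 1 + e" "\<And>\<xi>. \<xi> \<in> K \<Longrightarrow> cmod (S \<xi>) \<ge> 1 - e"
      "\<And>\<xi>. norm \<xi> \<le> r \<Longrightarrow> \<xi> \<notin> V \<Longrightarrow> cmod (S \<xi>) \<le> e" using trig_poly_separation[OF K V r e(1)] by metis
    obtain xs where xs: "S = trigsum xs" using S(1) unfolding trig_poly_def by auto
    have Se: "S \<in> exp_type" "continuous_on UNIV S" unfolding xs by (auto intro: trigsum_exp_type trigsum_continuous)
    have [measurable]: "S \<in> borel_measurable borel" using Se(2) by (rule borel_measurable_continuous_onI)
    have out: "{\<xi> :: real ^ 'd. norm \<xi> > r} \<in> sets borel" by measurable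
    have "ennreal ((1 - e)\<^sup>2 * measure N K) = (\<integral>\<^sup>+\<xi>. ennreal ((1 - e)\<^sup>2) * indicator K \<xi> \<partial>N)"
      by (subst nn_integral_cmult_indicator) (auto simp: Ns N.emeasure_eq_measure ennreal_mult)
    also have "\<dots> \<le> (\<integral>\<^sup>+\<xi>. ennreal ((cmod (S \<xi>))\<^sup>2) \<partial>N)"
      by (intro nn_integral_mono) (use S(3) e in \<open>auto simp: indicator_def intro!: ennreal_leI power_mono\<close>)
    also have "\<dots> = (\<integral>\<^sup>+\<xi>. ennreal ((cmod (S (T *v \<xi>)))\<^sup>2) \<partial>M)"
      unfolding N_def by (rule nn_integral_distr[OF TM]) measurable
    also have "\<dots> = ennreal ((nr (\<lambda>\<xi>. S (T *v \<xi>)))\<^sup>2)"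
      by (rule nn_integral_M_nr[OF exp_type_linear[OF Se]]) measurable
    also have "\<dots> \<le> ennreal ((C * nr S)\<^sup>2)"
      unfolding xs using bound nr_nonneg by (intro ennreal_leI power_mono) auto
    also have "\<dots> = ennreal (C\<^sup>2) * (\<integral>\<^sup>+\<xi>. ennreal ((cmod (S \<xi>))\<^sup>2) \<partial>M)"
      unfolding nn_integral_M_nr[OF Se(1) \<open>S \<in> borel_measurable borel\<close>] by (simp add: power_mult_distrib ennreal_mult)
    also have "(\<integral>\<^sup>+\<xi>. ennreal ((cmod (S \<xi>))\<^sup>2) \<partial>M)
       \<le> (\<integral>\<^sup>+\<xi>. ennreal ((1 + e)\<^sup>2) * indicator V \<xi> + (ennreal ((1 + e)\<^sup>2) * indicator {\<xi>. norm \<xi> > r} \<xi> + ennreal (e\<^sup>2) * indicator UNIV \<xi>) \<partial>M)"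
    proof (rule nn_integral_mono)
      fix \<xi>
      have a: "ennreal ((cmod (S \<xi>))\<^sup>2) \<le> ennreal ((1 + e)\<^sup>2)" using S(2) by (intro ennreal_leI power_mono) auto
      have b: "ennreal ((cmod (S \<xi>))\<^sup>2) \<le> ennreal (e\<^sup>2)" if "norm \<xi> \<le> r" "\<xi> \<notin> V" using S(4)[OF that] by (intro ennreal_leI power_mono) auto
      show "ennreal ((cmod (S \<xi>))\<^sup>2) \<le> ennreal ((1 + e)\<^sup>2) * indicator V \<xi> + (ennreal ((1 + e)\<^sup>2) * indicator {\<xi>. norm \<xi> > r} \<xi> + ennreal (e\<^sup>2) * indicator UNIV \<xi>)"
      proof (cases "\<xi> \<in> V")
        case True then show ?thesis using a by (simp add: add_increasing2)
      next
        case False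
        then show ?thesis using a b by (cases "norm \<xi> \<le> r") (auto simp: add_increasing2)
      qed
    qed
    also have "\<dots> = ennreal ((1 + e)\<^sup>2) * emeasure M V + (ennreal ((1 + e)\<^sup>2) * emeasure M {\<xi>. norm \<xi> > r} + ennreal (e\<^sup>2) * emeasure M UNIV)"
      using out by (simp add: nn_integral_add nn_integral_cmult_indicator)
    also have "\<dots> = ennreal ((1 + e)\<^sup>2 * (measure M V + measure M {\<xi>. norm \<xi> > r}) + e\<^sup>2 * measure M UNIV)"
      unfolding M.emeasure_eq_measure by (simp add: ennreal_mult[symmetric] ennreal_plus[symmetric] distrib_left add.assoc del: ennreal_plus)
    finally have "ennreal ((1 - e)\<^sup>2 * measure N K) \<le> ennreal (C\<^sup>2) * ennreal ((1 + e)\<^sup>2 * (measure M V + measure M {\<xi>. norm \<xi> > r}) + e\<^sup>2 * measure M UNIV)"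
      by (simp add: mult_left_mono)
    moreover have "x \<le> c * y" if "ennreal x \<le> ennreal c * ennreal y" "0 \<le> c" "0 \<le> y" for x c y
      using that by (simp add: ennreal_mult[symmetric] ennreal_le_iff)
    ultimately show ?thesis by (simp only: zero_le_power2 measure_nonneg add_nonneg_nonneg mult_nonneg_nonneg)
  qed
  obtain r0 where r0: "r0 > 0" "K \<subseteq> cball 0 r0"
    using bounded_pos[THEN iffD1, OF compact_imp_bounded[OF K]] by (auto simp: subset_iff)
  have lim_e: "measure N K \<le> C\<^sup>2 * (measure M V + measure M {\<xi>. norm \<xi> > r})" if r: "r > 0" "K \<subseteq> cball 0 r" for r
  proof (rule LIMSEQ_le)
    let ?e = "\<lambda>n :: nat. 1 / real (Suc (Suc n))"
    have e0: "?e \<longlonglongrightarrow> 0" by (rule LIMSEQ_Suc[OF LIMSEQ_Suc[OF lim_1_over_n]])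
    have "(\<lambda>n. (1 - ?e n)\<^sup>2 * measure N K) \<longlonglongrightarrow> (1 - 0)\<^sup>2 * measure N K" by (intro tendsto_intros e0)
    then show "(\<lambda>n. (1 - ?e n)\<^sup>2 * measure N K) \<longlonglongrightarrow> measure N K" by simp
    have "(\<lambda>n. C\<^sup>2 * ((1 + ?e n)\<^sup>2 * (measure M V + measure M {\<xi>. norm \<xi> > r}) + (?e n)\<^sup>2 * measure M UNIV)) \<longlonglongrightarrow>
       C\<^sup>2 * ((1 + 0)\<^sup>2 * (measure M V + measure M {\<xi>. norm \<xi> > r}) + 0\<^sup>2 * measure M UNIV)" by (intro tendsto_intros e0)
    then show "(\<lambda>n. C\<^sup>2 * ((1 + ?e n)\<^sup>2 * (measure M V + measure M {\<xi>. norm \<xi> > r}) + (?e n)\<^sup>2 * measure M UNIV)) \<longlonglongrightarrow>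
       C\<^sup>2 * (measure M V + measure M {\<xi>. norm \<xi> > r})" by simp
    have "(1 - ?e n)\<^sup>2 * measure N K \<le> C\<^sup>2 * ((1 + ?e n)\<^sup>2 * (measure M V + measure M {\<xi>. norm \<xi> > r}) + (?e n)\<^sup>2 * measure M UNIV)" for n
      by (rule step[OF _ _ r]) (auto simp: divide_less_eq)
    then show "\<exists>k. \<forall>n\<ge>k. (1 - ?e n)\<^sup>2 * measure N K \<le> C\<^sup>2 * ((1 + ?e n)\<^sup>2 * (measure M V + measure M {\<xi>. norm \<xi> > r}) + (?e n)\<^sup>2 * measure M UNIV)"
      by (intro exI[of _ 0] allI impI)
  qed
  have tail: "(\<lambda>n. measure M {\<xi>. norm \<xi> > real n}) \<longlonglongrightarrow> measure M (\<Inter>n. {\<xi>. norm \<xi> > real n})"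
    by (rule M.finite_Lim_measure_decseq) (auto simp: decseq_def)
  have "(\<Inter>n. {\<xi> :: real ^ 'd. norm \<xi> > real n}) = {}"
  proof (rule equals0I)
    fix \<xi> :: "real ^ 'd" assume \<xi>: "\<xi> \<in> (\<Inter>n. {\<xi>. norm \<xi> > real n})"
    obtain n where "norm \<xi> \<le> real n" using real_arch_simple by blast
    moreover have "norm \<xi> > real n" using \<xi> by blast
    ultimately show False by simp
  qed
  then have tail0: "(\<lambda>n. measure M {\<xi>. norm \<xi> > real n}) \<longlonglongrightarrow> 0" using tail by simp
  have "measure N K \<le> C\<^sup>2 * (measure M V + 0)"
  proof (rule LIMSEQ_le_const)
    show "(\<lambda>n. C\<^sup>2 * (measure M V + measure M {\<xi>. norm \<xi> > real n})) \<longlonglongrightarrow> C\<^sup>2 * (measure M V + 0)"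
      by (intro tendsto_intros tail0)
    obtain n0 :: nat where n0: "r0 \<le> real n0" using real_arch_simple by blast
    have "measure N K \<le> C\<^sup>2 * (measure M V + measure M {\<xi>. norm \<xi> > real n})" if "n \<ge> n0" for n
    proof (rule lim_e)
      have "r0 \<le> real n" using that n0 by linarith
      then show "real n > 0" "K \<subseteq> cball 0 (real n)" using r0 by auto
    qed
    then show "\<exists>n0. \<forall>n\<ge>n0. measure N K \<le> C\<^sup>2 * (measure M V + measure M {\<xi>. norm \<xi> > real n})" by blast
  qed
  then show ?thesis unfolding N_def by simp
qed

text \<open>Outer regularity on compact sets and inner regularity on Borel sets remove the gap between \<open>K\<close> and \<open>V\<close>.\<close>

lemma borel_comparison:
  fixes T :: "real ^ 'd ^ 'd"
  assumes C: "C \<ge> 0" and bound: "\<And>xs. nr (\<lambda>\<xi>. trigsum xs (T *v \<xi>)) \<le> C * nr (trigsum xs)"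
    and X: "X \<in> sets borel"
  shows "emeasure (distr M borel ((*v) T)) X \<le> ennreal (C\<^sup>2) * emeasure M X"
proof -
  interpret M: finite_measure M by (rule M_finite)
  define N where "N = distr M borel ((*v) T)"
  have "continuous_on UNIV ((*v) T)" by (rule linear_continuous_on) (simp add: linear_linear[symmetric] matrix_vector_mul_linear)
  then have T: "(*v) T \<in> borel_measurable borel" by (rule borel_measurable_continuous_onI)
  have TM: "(*v) T \<in> measurable M borel" using T by (simp add: measurable_cong_sets[OF M_sets refl])
  interpret N: finite_measure N unfolding N_def by (rule M.finite_measure_distr[OF TM])
  have Ns: "sets N = sets borel" unfolding N_def by simp
  have Kc: "measure N K \<le> C\<^sup>2 * measure M K" if K: "compact K" for K
  proof (rule field_le_epsilon)
    fix e :: real assume e: "e > 0"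
    define d where "d = e / (C\<^sup>2 + 1)"
    have d: "d > 0" unfolding d_def using e by (simp add: add_nonneg_pos)
    have Kb: "K \<in> sets borel" using K by (simp add: compact_imp_closed)
    have "emeasure M K = (INF V\<in>{V. K \<subseteq> V \<and> open V}. emeasure M V)"
      by (rule outer_regular[OF M_sets _ Kb]) (simp add: M.emeasure_finite)
    moreover have "emeasure M K < emeasure M K + ennreal d"
      using d by (simp add: M.emeasure_eq_measure ennreal_plus[symmetric] ennreal_less_iff del: ennreal_plus)
    ultimately have "(INF V\<in>{V. K \<subseteq> V \<and> open V}. emeasure M V) < emeasure M K + ennreal d" by simp
    then obtain V where V: "open V" "K \<subseteq> V" "emeasure M V < emeasure M K + ennreal d" unfolding INF_less_iff by auto
    have MV: "measure M V \<le> measure M K + d"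
      using V(3) d by (simp add: M.emeasure_eq_measure ennreal_plus[symmetric] ennreal_less_iff del: ennreal_plus)
    have "measure N K \<le> C\<^sup>2 * measure M V" unfolding N_def by (rule compact_open_comparison[OF C bound K V(1,2)])
    also have "\<dots> \<le> C\<^sup>2 * (measure M K + d)" using MV by (intro mult_left_mono) auto
    also have "\<dots> \<le> C\<^sup>2 * measure M K + e"
    proof -
      have "C\<^sup>2 * d = C\<^sup>2 / (C\<^sup>2 + 1) * e" unfolding d_def by simp
      also have "\<dots> \<le> 1 * e" using e by (intro mult_right_mono) (auto simp: add_nonneg_pos divide_le_eq)
      finally show ?thesis by (simp add: distrib_left)
    qed
    finally show "measure N K \<le> C\<^sup>2 * measure M K + e" .
  qed
  have "emeasure N X = (SUP K\<in>{K. K \<subseteq> X \<and> compact K}. emeasure N K)"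
    by (rule inner_regular[OF Ns _ X]) (simp add: N.emeasure_finite)
  also have "\<dots> \<le> ennreal (C\<^sup>2) * emeasure M X"
  proof (rule SUP_least)
    fix K assume K: "K \<in> {K. K \<subseteq> X \<and> compact K}"
    have "emeasure N K \<le> ennreal (C\<^sup>2 * measure M K)"
      unfolding N.emeasure_eq_measure using Kc K by (intro ennreal_leI) auto
    also have "\<dots> = ennreal (C\<^sup>2) * emeasure M K" by (simp add: M.emeasure_eq_measure ennreal_mult)
    also have "\<dots> \<le> ennreal (C\<^sup>2) * emeasure M X" using K X by (intro mult_left_mono emeasure_mono) auto
    finally show "emeasure N K \<le> ennreal (C\<^sup>2) * emeasure M X" .
  qed
  finally show ?thesis unfolding N_def .
qed

text \<open>The inequality for trigonometric sums says that the image of \<open>M\<close> under \<open>A\<^sup>T\<close> is at most \<open>C\<^sup>2 M\<close>. If \<open>A\<close> were singular the image would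
  live on a null set; otherwise a change of variables compares the densities.\<close>

lemma membership_from_trigsum_bound:
  assumes C: "C \<ge> 0" and bound': "\<And>xs. nr (\<lambda>\<xi>. trigsum xs (transpose A *v \<xi>)) \<le> C * nr (trigsum xs)"
  shows "A \<in> G_set w"
proof -
  interpret M: finite_measure M by (rule M_finite)
  define T where "T = transpose A"
  have bound: "\<And>xs. nr (\<lambda>\<xi>. trigsum xs (T *v \<xi>)) \<le> C * nr (trigsum xs)" unfolding T_def by (rule bound')
  have lin: "linear ((*v) T)" by (rule matrix_vector_mul_linear)
  have "continuous_on UNIV ((*v) T)" by (rule linear_continuous_on) (simp add: linear_linear[symmetric] lin)
  then have Tm [measurable]: "(*v) T \<in> borel_measurable borel" by (rule borel_measurable_continuous_onI)
  have TM: "(*v) T \<in> measurable M borel" using Tm by (simp add: measurable_cong_sets[OF M_sets refl])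
  have cmp: "emeasure M {\<xi>. T *v \<xi> \<in> X} \<le> ennreal (C\<^sup>2) * emeasure M X" if X: "X \<in> sets borel" for X
    using borel_comparison[OF C bound X] unfolding emeasure_distr[OF TM X] by (simp add: vimage_def)
  \<comment> \<open>Otherwise the comparison on the range of T, a null set, would make M vanish.\<close>
  have inv: "invertible T"
  proof (rule ccontr)
    assume "\<not> invertible T"
    then have "\<not> inj ((*v) T)" by (simp add: invertible_left_inverse matrix_left_invertible_injective)
    then have neg: "negligible (range ((*v) T))" using lin by (intro negligible_linear_singular_image)
    have "closed (range ((*v) T))" by (intro closed_subspace linear_subspace_image lin subspace_UNIV)
    then have rb: "range ((*v) T) \<in> sets borel" by simp
    have "emeasure lborel (range ((*v) T)) = 0" using neg rb by (simp add: negligible_iff_null_sets null_sets_def)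
    then have "range ((*v) T) \<in> null_sets lborel" using rb by auto
    then have ae: "AE \<xi> in lborel. \<xi> \<notin> range ((*v) T)" by (rule AE_not_in)
    have "emeasure M (range ((*v) T)) = (\<integral>\<^sup>+\<xi>. ennreal (w0 \<xi>) * indicator (range ((*v) T)) \<xi> \<partial>lborel)"
      unfolding M_def using rb by (subst emeasure_density) auto
    also have "\<dots> = (\<integral>\<^sup>+(\<xi> :: real ^ 'd). 0 \<partial>lborel)"
      by (rule nn_integral_cong_AE) (use ae in \<open>eventually_elim, simp\<close>)
    finally have "emeasure M (range ((*v) T)) = 0" by simp
    then have "emeasure M {\<xi>. T *v \<xi> \<in> range ((*v) T)} = 0" using cmp[OF rb] by simp
    then show False using M_nonzero by simp
  qed
  then obtain T' where T': "T ** T' = mat 1" "T' ** T = mat 1" unfolding invertible_def by auto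
  have TT: "T *v (T' *v x) = x" "T' *v (T *v x) = x" for x by (auto simp: matrix_vector_mul_assoc T')
  have inv': "invertible T'" using T' unfolding invertible_def by auto
  obtain k where k: "k > 0" "\<And>g. g \<in> borel_measurable borel \<Longrightarrow> (\<integral>\<^sup>+\<xi>. g (T' *v \<xi>) \<partial>lborel) = ennreal k * (\<integral>\<^sup>+\<xi>. g \<xi> \<partial>lborel)"
    using linear_image_scaling[OF inv'] by (elim exE conjE) (rule that, assumption, erule bspec)
  \<comment> \<open>Chosen so that the set where the density inequality fails has at most half of its own measure.\<close>
  define l where "l = 1 / (2 * (C\<^sup>2 * k + 1))"
  have Ck: "C\<^sup>2 * k + 1 > 0" using k(1) by (simp add: add_nonneg_pos)
  have l: "l > 0" unfolding l_def using Ck by simp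
  define E where "E = {\<xi>. w0 (T *v \<xi>) < l * w0 \<xi>}"
  have E [measurable]: "E \<in> sets borel" unfolding E_def by measurable
  have "continuous_on UNIV ((*v) T')" by (rule linear_continuous_on) (simp add: linear_linear[symmetric] matrix_vector_mul_linear)
  then have T'm [measurable]: "(*v) T' \<in> borel_measurable borel" by (rule borel_measurable_continuous_onI)
  define X where "X = {\<eta>. T' *v \<eta> \<in> E}"
  have X: "X \<in> sets borel" using measurable_sets[OF T'm E] unfolding X_def by (simp add: vimage_def)
  have ME: "emeasure M E = (\<integral>\<^sup>+\<xi>. ennreal (w0 \<xi>) * indicator E \<xi> \<partial>lborel)"
    unfolding M_def by (subst emeasure_density) auto
  have "emeasure M X = (\<integral>\<^sup>+\<eta>. ennreal (w0 \<eta>) * indicator X \<eta> \<partial>lborel)"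
    unfolding M_def using X by (subst emeasure_density) auto
  also have "\<dots> = (\<integral>\<^sup>+\<eta>. ennreal (w0 (T *v (T' *v \<eta>))) * indicator E (T' *v \<eta>) \<partial>lborel)"
    unfolding TT X_def by (intro nn_integral_cong) (simp add: indicator_def)
  also have "\<dots> = ennreal k * (\<integral>\<^sup>+\<xi>. ennreal (w0 (T *v \<xi>)) * indicator E \<xi> \<partial>lborel)"
    by (rule k(2)) measurable
  also have "(\<integral>\<^sup>+\<xi>. ennreal (w0 (T *v \<xi>)) * indicator E \<xi> \<partial>lborel) \<le> (\<integral>\<^sup>+\<xi>. ennreal l * (ennreal (w0 \<xi>) * indicator E \<xi>) \<partial>lborel)"
  proof (rule nn_integral_mono)
    fix \<xi>
    show "ennreal (w0 (T *v \<xi>)) * indicator E \<xi> \<le> ennreal l * (ennreal (w0 \<xi>) * indicator E \<xi>)"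
    proof (cases "\<xi> \<in> E")
      case True
      then have "ennreal (w0 (T *v \<xi>)) \<le> ennreal (l * w0 \<xi>)" unfolding E_def by (intro ennreal_leI) simp
      also have "\<dots> = ennreal l * ennreal (w0 \<xi>)" using l w0(2) by (intro ennreal_mult) auto
      finally show ?thesis using True by simp
    qed simp
  qed
  also have "\<dots> = ennreal l * emeasure M E" unfolding ME by (rule nn_integral_cmult) measurable
  finally have MX: "emeasure M X \<le> ennreal k * (ennreal l * emeasure M E)" by (simp add: mult_left_mono)
  have "E = {\<xi>. T *v \<xi> \<in> X}" unfolding X_def by (simp add: TT)
  then have "emeasure M E \<le> ennreal (C\<^sup>2) * emeasure M X" using cmp[OF X] by simp
  also have "\<dots> \<le> ennreal (C\<^sup>2) * (ennreal k * (ennreal l * emeasure M E))" using MX by (rule mult_left_mono) simp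
  also have "\<dots> = ennreal (C\<^sup>2 * (k * (l * measure M E)))" using k(1) l by (simp add: M.emeasure_eq_measure ennreal_mult)
  finally have "measure M E \<le> C\<^sup>2 * (k * (l * measure M E))" using k(1) l by (simp add: M.emeasure_eq_measure ennreal_le_iff)
  also have "\<dots> = C\<^sup>2 * k / (2 * (C\<^sup>2 * k + 1)) * measure M E" unfolding l_def by simp
  also have "\<dots> \<le> 1 / 2 * measure M E" using Ck k(1) by (intro mult_right_mono) (auto simp: field_simps)
  finally have "measure M E = 0" using measure_nonneg[of M E] by simp
  then have "(\<integral>\<^sup>+\<xi>. ennreal (w0 \<xi>) * indicator E \<xi> \<partial>lborel) = 0" unfolding ME[symmetric] by (simp add: M.emeasure_eq_measure)
  then have "AE \<xi> in lborel. ennreal (w0 \<xi>) * indicator E \<xi> = 0" by (subst (asm) nn_integral_0_iff_AE) auto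
  then have "AE \<xi> in lborel. w0 (T *v \<xi>) \<ge> l * w0 \<xi>"
  proof eventually_elim
    fix \<xi> assume z: "ennreal (w0 \<xi>) * indicator E \<xi> = 0"
    show "w0 (T *v \<xi>) \<ge> l * w0 \<xi>"
    proof (rule ccontr)
      assume c: "\<not> ?thesis"
      then have "\<xi> \<in> E" unfolding E_def by simp
      then have "w0 \<xi> = 0" using z w0(2)[of \<xi>] by (simp add: ennreal_eq_0_iff antisym)
      then show False using c w0(2)[of "T *v \<xi>"] by simp
    qed
  qed
  then have "AE \<xi> in lebesgue. w0 (T *v \<xi>) \<ge> l * w0 \<xi>" by (rule AE_completion)
  then have "AE \<xi> in lebesgue. w (T *v \<xi>) \<ge> l * w \<xi>"
    using w0(3) AE_linear_image[OF inv w0(3)] by eventually_elim simp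
  moreover have "invertible A" using transpose_invertible[OF inv] unfolding T_def by simp
  ultimately show ?thesis unfolding G_set_def T_def using l by blast
qed

end

section \<open>The equivalence\<close>

context weight begin

text \<open>Since the form maps all real characters to characters of the affine map, it maps \<open>T\<close> to the composite of \<open>T\<close> with \<open>A\<^sup>T\<close> up to
  a factor of modulus one, and its boundedness is the inequality that characterises \<open>\<G>(w)\<close>.\<close>

lemma affine_of_bounded_composition:
  assumes Hk: "is_rkhs UNIV (weight_kernel w) H ipH" and HU: "is_rkhs U (weight_kernel w) HU ipU"
    and U: "open U" and p: "p \<in> U" and C: "C \<ge> 0"
    and dom: "\<And>h. h \<in> H \<Longrightarrow> comp_op U f h \<in> HU"
    and bound: "\<And>h. h \<in> H \<Longrightarrow> ip_norm ipU (comp_op U f h) \<le> C * ip_norm ipH h"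
    and B: "B > 0" "\<And>y. limsup (\<lambda>n. E_minus n y w) < ennreal B" "\<And>y. limsup (\<lambda>n. E_plus n y w) < ennreal B"
    and span: "span (G_set w) = UNIV"
  shows "\<exists>A\<in>G_set w. \<exists>b. \<forall>x\<in>U. f x = A *v x + b"
proof -
  obtain \<Phi> where "bounded_form \<mu> \<Phi> C U f" using bounded_form_of_composition[OF Hk HU U C dom bound] by auto
  then interpret F: bounded_form \<mu> \<Phi> C U f .
  interpret F: growth_form \<mu> \<Phi> C U f p B "G_set w"
  proof
    show "p \<in> U" "0 < B" "span (G_set w) = UNIV" by (rule p B(1) span)+
    show "\<exists>N. \<forall>n\<ge>N. \<forall>P. polyd (Suc n) P \<longrightarrow>
        nr (\<lambda>\<xi>. of_real (exp (y \<bullet> \<xi>)) * P \<xi>) \<le> B ^ n * nr P \<and> nr P \<le> B ^ n * nr (\<lambda>\<xi>. of_real (exp (y \<bullet> \<xi>)) * P \<xi>)" for y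
      by (rule growth_from_extremal[OF B(1) B(2) B(3)])
    fix A assume A: "A \<in> G_set w"
    obtain c where c: "\<forall>P\<in>exp_type. continuous_on UNIV P \<longrightarrow> (\<lambda>\<xi>. P (transpose A *v \<xi>)) \<in> exp_type \<longrightarrow> nr (\<lambda>\<xi>. P (transpose A *v \<xi>)) \<le> c * nr P"
      using G_set_comp[OF A] by (elim exE conjE) (rule that)
    show "\<exists>c. \<forall>P\<in>exp_type. continuous_on UNIV P \<longrightarrow> nr (\<lambda>\<xi>. P (transpose A *v \<xi>)) \<le> c * nr P"
    proof (intro exI[of _ c] ballI impI)
      fix P :: "real ^ 'd \<Rightarrow> complex" assume P: "P \<in> exp_type" "continuous_on UNIV P"
      show "nr (\<lambda>\<xi>. P (transpose A *v \<xi>)) \<le> c * nr P"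
        using c[rule_format, OF P exp_type_linear[OF P]] .
    qed
  qed
  obtain A b where fx: "\<forall>x\<in>U. f x = A *v x + b"
    and Ab: "\<forall>x. \<forall>\<psi>\<in>exp_type. \<Phi> (ch (cx x)) \<psi> = bil (ch (cx (A *v x + b))) \<psi>"
    using F.affine by (elim exE conjE) (rule that)
  have "nr (\<lambda>\<xi>. trigsum xs (transpose A *v \<xi>)) \<le> C * nr (trigsum xs)" for xs
  proof -
    define \<theta> where "\<theta> xs = (\<lambda>\<xi>. ch (cx b) \<xi> * trigsum xs (transpose A *v \<xi>))" for xs
    have \<theta>: "\<theta> xs \<in> exp_type" for xs
      unfolding \<theta>_def by (intro exp_type_mult exp_type_ch exp_type_linear trigsum_exp_type trigsum_continuous)
    have "\<Phi> (trigsum xs) \<psi> = bil (\<theta> xs) \<psi>" if \<psi>: "\<psi> \<in> exp_type" for \<psi>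
    proof (induction xs rule: trigsum.induct)
      case 1
      have "\<Phi> (\<lambda>\<xi>. 0) \<psi> = 0" by (rule bf_zero[OF F.bf_left[OF \<psi>]])
      then show ?case by (simp add: \<theta>_def bil_def)
    next
      case (2 c x xs)
      have "(A *v (- x)) \<bullet> \<xi> = (- x) \<bullet> (transpose A *v \<xi>)" for \<xi>
        using dot_lmul_matrix[of \<xi> A "- x"] by (simp add: inner_commute)
      then have e: "ch (cx (A *v (- x) + b)) \<xi> = ch (cx b) \<xi> * ch (cx (- x)) (transpose A *v \<xi>)" for \<xi>
        unfolding ch_cx exp_add[symmetric] by (simp only: inner_add_left of_real_add) (simp only: algebra_simps)
      have "\<theta> ((c, x) # xs) = (\<lambda>\<xi>. c * ch (cx (A *v (- x) + b)) \<xi> + \<theta> xs \<xi>)"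
        unfolding \<theta>_def e by (simp add: algebra_simps del: transpose_matrix_vector)
      then have "bil (\<theta> ((c, x) # xs)) \<psi> = c * bil (ch (cx (A *v (- x) + b))) \<psi> + bil (\<theta> xs) \<psi>"
        using bil_add_left[OF exp_type_scale[OF exp_type_ch] \<theta> \<psi>] by (simp only: bil_scale_left)
      moreover have "\<Phi> (trigsum ((c, x) # xs)) \<psi> = c * \<Phi> (ch (cx (- x))) \<psi> + \<Phi> (trigsum xs) \<psi>"
        unfolding trigsum.simps using bf_add[OF F.bf_left[OF \<psi>] exp_type_scale[OF exp_type_ch] trigsum_exp_type]
          bf_scale[OF F.bf_left[OF \<psi>] exp_type_ch] by simp
      moreover have "\<Phi> (ch (cx (- x))) \<psi> = bil (ch (cx (A *v (- x) + b))) \<psi>" using Ab \<psi> by blast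
      ultimately show ?case using 2 by simp
    qed
    then have "nr (\<theta> xs) \<le> C * nr (trigsum xs)" by (intro F.norm_le_of_dual trigsum_exp_type \<theta>)
    moreover have "nr (\<theta> xs) = nr (\<lambda>\<xi>. trigsum xs (transpose A *v \<xi>))"
      unfolding \<theta>_def by (rule nr_cong_norm) (simp only: norm_mult norm_ch_cx mult_1_left)
    ultimately show ?thesis by simp
  qed
  then have "A \<in> G_set w" by (rule membership_from_trigsum_bound[OF C])
  with fx show ?thesis by blast
qed

end

text \<open>A witness for the matrix in the degenerate case of an empty set \<open>U\<close>.\<close>

lemma mat_1_in_G_set: "mat 1 \<in> G_set w"
proof -
  have "invertible (mat 1 :: real ^ 'd ^ 'd)" unfolding invertible_def by (intro exI[of _ "mat 1"]) simp
  moreover have "AE \<xi> in lebesgue. w (transpose (mat 1) *v \<xi>) \<ge> 1 * w \<xi>" for w :: "real ^ 'd \<Rightarrow> real"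
    by (simp add: transpose_mat)
  ultimately show ?thesis unfolding G_set_def by (intro CollectI conjI exI[of _ 1]) auto
qed

theorem theorem1:
  fixes w :: "real ^ 'd \<Rightarrow> real"
    and U :: "(real ^ 'd) set"
    and f :: "real ^ 'd \<Rightarrow> real ^ 'd"
    and H\<^sub>k :: "(real ^ 'd \<Rightarrow> complex) set"
    and ip\<^sub>k :: "(real ^ 'd \<Rightarrow> complex) \<Rightarrow> (real ^ 'd \<Rightarrow> complex) \<Rightarrow> complex"
    and H\<^sub>U :: "(real ^ 'd \<Rightarrow> complex) set"
    and ip\<^sub>U :: "(real ^ 'd \<Rightarrow> complex) \<Rightarrow> (real ^ 'd \<Rightarrow> complex) \<Rightarrow> complex"
  assumes w_L1: "integrable lebesgue w"
    and w_Linf: "\<exists>C. AE \<xi> in lebesgue. \<bar>w \<xi>\<bar> \<le> C"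
    and w_nonzero: "\<not> (AE \<xi> in lebesgue. w \<xi> = 0)"
    and w_nonneg: "AE \<xi> in lebesgue. w \<xi> \<ge> 0"
    and A: "\<And>a::real. a > 0 \<Longrightarrow> \<exists>c>0. AE \<xi> in lebesgue. w \<xi> \<le> c * exp (- a * norm \<xi>)"
    and B: "\<exists>B::real. B > 0 \<and>
              (\<forall>y. limsup (\<lambda>n. E_minus n y w) < ennreal B \<and> limsup (\<lambda>n. E_plus n y w) < ennreal B)"
    and C: "span (G_set w) = UNIV"
    and rkhs_k: "is_rkhs UNIV (weight_kernel w) H\<^sub>k ip\<^sub>k"
    and rkhs_U: "is_rkhs U (weight_kernel w) H\<^sub>U ip\<^sub>U"
    and U: "open U"
  shows "((\<exists>A\<in>G_set w. \<exists>b. \<forall>x\<in>U. f x = A *v x + b)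
            \<longleftrightarrow> comp_op_domain H\<^sub>k U H\<^sub>U f = H\<^sub>k)
         \<and> (comp_op_domain H\<^sub>k U H\<^sub>U f = H\<^sub>k \<longrightarrow>
              (\<exists>C. \<forall>h\<in>H\<^sub>k. ip_norm ip\<^sub>U (comp_op U f h) \<le> C * ip_norm ip\<^sub>k h))"
proof -
  interpret weight w by unfold_locales (rule w_L1 w_nonzero w_nonneg A; assumption?)+
  have dom_iff: "comp_op_domain H\<^sub>k U H\<^sub>U f = H\<^sub>k \<longleftrightarrow> (\<forall>h\<in>H\<^sub>k. comp_op U f h \<in> H\<^sub>U)"
    unfolding comp_op_domain_def by blast
  have bounded: "\<exists>K\<ge>0. \<forall>h\<in>H\<^sub>k. ip_norm ip\<^sub>U (comp_op U f h) \<le> K * ip_norm ip\<^sub>k h"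
    if dom: "\<And>h. h \<in> H\<^sub>k \<Longrightarrow> comp_op U f h \<in> H\<^sub>U"
  proof -
    obtain K where K: "K \<ge> 0" and KK: "\<forall>xs. snd ` set xs \<subseteq> U \<longrightarrow>
      ip_norm ip\<^sub>k (comb UNIV (weight_kernel w) (map (\<lambda>(c, x). (c, f x)) xs)) \<le> K * ip_norm ip\<^sub>U (comb U (weight_kernel w) xs)"
    proof -
      have "\<exists>K\<ge>0. \<forall>xs. snd ` set xs \<subseteq> U \<longrightarrow>
        ip_norm ip\<^sub>k (comb UNIV (weight_kernel w) (map (\<lambda>(c, x). (c, f x)) xs)) \<le> K * ip_norm ip\<^sub>U (comb U (weight_kernel w) xs)"
        by (rule composition_bounded_on_kernels[OF rkhs_k rkhs_U dom])
      then show thesis by (elim exE conjE) (rule that)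
    qed
    show ?thesis
      by (intro exI[of _ K] conjI ballI K composition_of_bounded_on_kernels(2)[OF rkhs_k rkhs_U K KK[rule_format]])
  qed
  have forward: "comp_op_domain H\<^sub>k U H\<^sub>U f = H\<^sub>k" if i: "\<exists>A\<in>G_set w. \<exists>b. \<forall>x\<in>U. f x = A *v x + b"
  proof -
    obtain A b where A: "A \<in> G_set w" and f: "\<And>x. x \<in> U \<Longrightarrow> f x = A *v x + b" using i by blast
    show ?thesis unfolding dom_iff using affine_composition_bounded[OF A rkhs_k rkhs_U f] by blast
  qed
  have backward: "\<exists>A\<in>G_set w. \<exists>b. \<forall>x\<in>U. f x = A *v x + b" if ii: "comp_op_domain H\<^sub>k U H\<^sub>U f = H\<^sub>k"
  proof (cases "U = {}")
    case True
    then show ?thesis using mat_1_in_G_set by blast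
  next
    case False
    then obtain p where p: "p \<in> U" by blast
    have dom: "comp_op U f h \<in> H\<^sub>U" if "h \<in> H\<^sub>k" for h using ii that unfolding dom_iff by blast
    obtain K where K: "K \<ge> 0" "\<And>h. h \<in> H\<^sub>k \<Longrightarrow> ip_norm ip\<^sub>U (comp_op U f h) \<le> K * ip_norm ip\<^sub>k h"
      using bounded[OF dom] by blast
    obtain R where R: "R > 0" "\<And>y. limsup (\<lambda>n. E_minus n y w) < ennreal R" "\<And>y. limsup (\<lambda>n. E_plus n y w) < ennreal R"
      using B by blast
    show ?thesis by (rule affine_of_bounded_composition[OF rkhs_k rkhs_U U p K(1) dom K(2) R C])
  qed
  show ?thesis
  proof (intro conjI iffI impI)
    assume ii: "comp_op_domain H\<^sub>k U H\<^sub>U f = H\<^sub>k"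
    then have "\<And>h. h \<in> H\<^sub>k \<Longrightarrow> comp_op U f h \<in> H\<^sub>U" unfolding dom_iff by blast
    from bounded[OF this] show "\<exists>C. \<forall>h\<in>H\<^sub>k. ip_norm ip\<^sub>U (comp_op U f h) \<le> C * ip_norm ip\<^sub>k h" by blast
  qed (fact forward backward)+
qed

end
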